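(* Suppose that $p\in(1,+\infty)$, let $V:[0,T]\times\mathcal{P}_p(\mathbb{R}^d)\rightrightarrows C^0(\mathbb{R}^d,\mathbb{R}^d)$ be a set-valued map with convex images satisfying Hypotheses (CI) (listed in the context), and let $\mathcal{Q}\subset\mathcal{P}_p(\mathbb{R}^d)$ be a proper set. If $\mathcal{Q}$ is viable for the continuity inclusion $$\partial_t\mu(t)\in-\mathrm{div}_x\big(V(t,\mu(t))\mu(t)\big),\qquad\mu(\tau)=\mu_\tau,$$ then necessarily $$V(t,\nu)\cap T_{\mathcal{Q}}(\nu)\neq\emptyset$$ for $\mathcal{L}^1$-almost every $t\in[0,T]$ and each $\nu\in\mathcal{Q}$.
   Context: $\mathcal{P}_p(\mathbb{R}^d)$ is the set of Borel probability measures on $\mathbb{R}^d$ with finite moment $\mathcal{M}_p(\mu)=(\int|x|^p\,d\mu(x))^{1/p}$, endowed with the Wasserstein distance $W_p$ of order $p$; $f_\sharp\mu$ is the image measure of $\mu$ through $f$. $\mathcal{L}^p(\mathbb{R}^d,\mathbb{R}^d;\mu)$ is the seminormed space of Borel maps $\mathbb{R}^d\to\mathbb{R}^d$ that are $p$-integrable with respect to $\mu$. $T>0$ is fixed. $C^0(\mathbb{R}^d,\mathbb{R}^d)$ is endowed with the separable Fréchet topology of locally uniform convergence, induced by $d_{cc}(v,w)=\sum_{k\ge1}2^{-k}\min\{1,\|v-w\|_{C^0(B(0,k),\mathbb{R}^d)}\}$. We write $d_{\sup}(v,w)=\sup_{x\in\mathbb{R}^d}|v(x)-w(x)|\in[0,+\infty]$,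 and $\mathrm{Lip}(v;\mathbb{R}^d)$ for the Lipschitz constant of $v$. A set-valued map $F:I\rightrightarrows X$ is $\mathcal{L}^1$-measurable if $\{t\in I: F(t)\cap O\neq\emptyset\}$ is $\mathcal{L}^1$-measurable for every open $O\subset X$. Hypotheses (CI): (i) for any $\mu\in\mathcal{P}_p(\mathbb{R}^d)$, the map $t\in[0,T]\rightrightarrows V(t,\mu)\subset C^0(\mathbb{R}^d,\mathbb{R}^d)$ is $\mathcal{L}^1$-measurable with closed nonempty images; (ii) there is $m(\cdot)\in L^1([0,T],\mathbb{R}_+)$ such that for $\mathcal{L}^1$-a.e. $t\in[0,T]$, any $\mu\in\mathcal{P}_p(\mathbb{R}^d)$, every $v\in V(t,\mu)$ and all $x\in\mathbb{R}^d$, $|v(x)|\le m(t)(1+|x|+\mathcal{M}_p(\mu))$; (iii) there is $l(\cdot)\in L^1([0,T],\mathbb{R}_+)$ such that for $\mathcal{L}^1$-a.e. $t\in[0,T]$, any $\mu\in\mathcal{P}_p(\mathbb{R}^d)$ and every $v\in V(t,\mu)$, $\mathrm{Lip}(v;\mathbb{R}^d)\le l(t)$; (iv) there is $L(\cdot)\in L^1([0,T],\mathbb{R}_+)$ such that for $\mathcal{L}^1$-a.e. $t\in[0,T]$, any $\mu,\nu\in\mathcal{P}_p(\mathbb{R}^d)$ and each $v\in V(t,\mu)$, there is $w\in V(t,\nu)$ with $d_{\sup}(v,w)\le L(t)W_p(\mu,\nu)$. Solutions: $\mathcal{S}_{[\tau,T]}(\tau,\mu_\tau)$ is the set of all absolutely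 continuous curves $\mu(\cdot)\in AC([\tau,T],\mathcal{P}_p(\mathbb{R}^d))$ with $\mu(\tau)=\mu_\tau$ for which there is an $\mathcal{L}^1$-measurable selection $t\in[\tau,T]\mapsto v(t)\in V(t,\mu(t))$ such that $\partial_t\mu(t)+\mathrm{div}_x(v(t)\mu(t))=0$ holds in the sense of distributions on $(\tau,T)\times\mathbb{R}^d$. A closed subset $\mathcal{Q}$ of a metric space is proper if its intersection with every closed ball is compact. $\mathcal{Q}$ is viable if for every $\tau\in[0,T]$ and any $\mu_\tau\in\mathcal{Q}$ there is $\mu(\cdot)\in\mathcal{S}_{[\tau,T]}(\tau,\mu_\tau)$ with $\mu(t)\in\mathcal{Q}$ for all $t\in[\tau,T]$. Contingent cone: for $\nu\in\mathcal{Q}$, $$T_{\mathcal{Q}}(\nu)=\Big\{\xi\in\mathcal{L}^p(\mathbb{R}^d,\mathbb{R}^d;\nu):\ \liminf_{h\to0^+}\tfrac1h\,\mathrm{dist}_{\mathcal{P}_p(\mathbb{R}^d)}\big((\mathrm{Id}+h\xi)_\sharp\nu;\mathcal{Q}\big)=0\Big\},$$ with $\mathrm{dist}_{\mathcal{P}_p(\mathbb{R}^d)}(\sigma;\mathcal{Q})=\inf_{\sigma'\in\mathcal{Q}}W_p(\sigma,\sigma')$. *)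

theory Defs
  imports "HOL-Probability.Probability"
begin

section \<open>The Wasserstein space\<close>

definition prob_moment :: "real \<Rightarrow> 'a::euclidean_space measure set" where
  "prob_moment p =
     {\<mu>. prob_space \<mu> \<and> sets \<mu> = sets borel \<and> integrable \<mu> (\<lambda>x. norm x powr p)}"

definition moment :: "real \<Rightarrow> 'a::euclidean_space measure \<Rightarrow> real" where
  "moment p \<mu> = (\<integral>x. norm x powr p \<partial>\<mu>) powr (1 / p)"

definition couplings ::
    "'a::euclidean_space measure \<Rightarrow> 'a measure \<Rightarrow> ('a \<times> 'a) measure set" where
  "couplings \<mu> \<nu> =
     {\<gamma>. sets \<gamma> = sets borel \<and> distr \<gamma> borel fst = \<mu> \<and> distr \<gamma> borel snd = \<nu>}"

text \<open>The transport cost is an \<^typ>\<open>ennreal\<close>, so that no coupling can have a spuriously zero cost;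
  on \<^const>\<open>prob_moment\<close> the infimum is finite, and the conversion to a real number is
  harmless.\<close>

definition wasserstein ::
    "real \<Rightarrow> 'a::euclidean_space measure \<Rightarrow> 'a measure \<Rightarrow> real" where
  "wasserstein p \<mu> \<nu> =
     enn2real (INF \<gamma>\<in>couplings \<mu> \<nu>. \<integral>\<^sup>+z. ennreal (norm (fst z - snd z) powr p) \<partial>\<gamma>) powr (1 / p)"

definition wasserstein_dist_to ::
    "real \<Rightarrow> 'a::euclidean_space measure \<Rightarrow> 'a measure set \<Rightarrow> real" where
  "wasserstein_dist_to p \<sigma> Q = (INF \<sigma>'\<in>Q. wasserstein p \<sigma> \<sigma>')"

definition proper_set :: "real \<Rightarrow> 'a::euclidean_space measure set \<Rightarrow> bool" where
  "proper_set p Q \<longleftrightarrow>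
     closedin (Metric_space.mtopology (prob_moment p) (wasserstein p)) Q \<and>
     (\<forall>\<mu>\<in>prob_moment p. \<forall>r.
        compactin (Metric_space.mtopology (prob_moment p) (wasserstein p))
          (Q \<inter> Metric_space.mcball (prob_moment p) (wasserstein p) \<mu> r))"

text \<open>Absolute continuity in the metric sense: the increments are controlled by the integral of an
  integrable function.\<close>

definition abs_cont_curve ::
    "real \<Rightarrow> real \<Rightarrow> real \<Rightarrow> (real \<Rightarrow> 'a::euclidean_space measure) \<Rightarrow> bool" where
  "abs_cont_curve p a b \<mu> \<longleftrightarrow>
     (\<forall>t\<in>{a..b}. \<mu> t \<in> prob_moment p) \<and>
     (\<exists>g. set_integrable lebesgue {a..b} g \<and> (\<forall>t\<in>{a..b}. 0 \<le> g t) \<and>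
          (\<forall>s t. a \<le> s \<and> s \<le> t \<and> t \<le> b \<longrightarrow>
             wasserstein p (\<mu> s) (\<mu> t) \<le> (LINT r:{s..t}|lebesgue. g r)))"

section \<open>Continuous maps with locally uniform convergence\<close>

definition C0 :: "('a::euclidean_space \<Rightarrow> 'a) set" where
  "C0 = {v. continuous_on UNIV v}"

definition sup_on ::
    "'a::euclidean_space set \<Rightarrow> ('a \<Rightarrow> 'a) \<Rightarrow> ('a \<Rightarrow> 'a) \<Rightarrow> ennreal" where
  "sup_on A v w = (SUP x\<in>A. ennreal (norm (v x - w x)))"

abbreviation d_sup :: "('a::euclidean_space \<Rightarrow> 'a) \<Rightarrow> ('a \<Rightarrow> 'a) \<Rightarrow> ennreal" where
  "d_sup \<equiv> sup_on UNIV"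

text \<open>The index is shifted by one: the sum runs over the balls of radius \<open>k + 1\<close>, \<open>k \<ge> 0\<close>.\<close>

definition d_cc :: "('a::euclidean_space \<Rightarrow> 'a) \<Rightarrow> ('a \<Rightarrow> 'a) \<Rightarrow> real" where
  "d_cc v w = (\<Sum>k. (1/2) ^ Suc k * enn2real (min 1 (sup_on (cball 0 (real (Suc k))) v w)))"

abbreviation C0_topology :: "('a::euclidean_space \<Rightarrow> 'a) topology" where
  "C0_topology \<equiv> Metric_space.mtopology C0 d_cc"

lemma sup_on_commute: "sup_on A v w = sup_on A w v"
  unfolding sup_on_def by (simp add: norm_minus_commute)

lemma sup_on_triangle: "sup_on A u w \<le> sup_on A u v + sup_on A v w"
  unfolding sup_on_def
proof (rule SUP_least)
  fix x assume x: "x \<in> A"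
  have "ennreal (norm (u x - w x)) \<le> ennreal (norm (u x - v x) + norm (v x - w x))"
    by (intro ennreal_leI) (metis diff_add_cancel add_diff_eq norm_triangle_ineq)
  also have "\<dots> = ennreal (norm (u x - v x)) + ennreal (norm (v x - w x))"
    by simp
  also have "\<dots> \<le> (SUP x\<in>A. ennreal (norm (u x - v x))) + (SUP x\<in>A. ennreal (norm (v x - w x)))"
    by (intro add_mono SUP_upper x)
  finally show "ennreal (norm (u x - w x)) \<le> \<dots>" .
qed

lemma d_cc_term_le_1: "enn2real (min 1 (e::ennreal)) \<le> 1"
  using enn2real_mono[of "min 1 e" 1] by simp

lemma d_cc_summable:
  "summable (\<lambda>k. (1/2) ^ Suc k * enn2real (min 1 (sup_on (cball 0 (real (Suc k))) v w)))"
proof (rule summable_comparison_test[OF _ summable_geometric[of "1/2::real"]])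
  show "\<exists>N. \<forall>n\<ge>N. norm ((1/2) ^ Suc n *
          enn2real (min 1 (sup_on (cball 0 (real (Suc n))) v w))) \<le> (1/2::real) ^ n"
  proof (intro exI allI impI)
    fix n :: nat
    have "(1/2) ^ Suc n * enn2real (min 1 (sup_on (cball 0 (real (Suc n))) v w))
            \<le> (1/2::real) ^ Suc n * 1"
      by (intro mult_left_mono d_cc_term_le_1) simp
    then show "norm ((1/2) ^ Suc n *
          enn2real (min 1 (sup_on (cball 0 (real (Suc n))) v w))) \<le> (1/2::real) ^ n"
      by (simp add: abs_mult)
  qed
qed simp

lemma enn2real_min_triangle:
  assumes "(a::ennreal) \<le> b + c"
  shows "enn2real (min 1 a) \<le> enn2real (min 1 b) + enn2real (min 1 c)"
proof -
  have fin: "min 1 b < top" "min 1 c < top"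
    by (auto simp: min_less_iff_disj)
  have "min 1 a \<le> min 1 b + min 1 c"
  proof (cases "1 \<le> b \<or> 1 \<le> c")
    case True
    then show ?thesis
      by (metis add_increasing add_increasing2 min.absorb1 min.cobounded1 order_trans zero_le)
  next
    case False
    then have "min 1 b = b" "min 1 c = c" by (auto simp: min_def)
    then show ?thesis using assms by (metis min.coboundedI2)
  qed
  then have "enn2real (min 1 a) \<le> enn2real (min 1 b + min 1 c)"
    by (intro enn2real_mono) (auto simp: fin)
  also have "\<dots> = enn2real (min 1 b) + enn2real (min 1 c)"
    by (rule enn2real_plus[OF fin])
  finally show ?thesis .
qed

lemma d_cc_eq_0_iff:
  fixes v w :: "'a::euclidean_space \<Rightarrow> 'a"
  shows "d_cc v w = 0 \<longleftrightarrow> v = w"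
proof
  assume "d_cc v w = 0"
  then have zero: "\<And>k. (1/2::real) ^ Suc k *
      enn2real (min 1 (sup_on (cball 0 (real (Suc k))) v w)) = 0"
    unfolding d_cc_def
    using suminf_eq_zero_iff[OF d_cc_summable[of v w]] by simp
  show "v = w"
  proof
    fix x :: 'a
    obtain k :: nat where "norm x \<le> real k"
      using real_arch_simple by blast
    then have x: "x \<in> cball 0 (real (Suc k))" by simp
    have fin: "min 1 (sup_on (cball 0 (real (Suc k))) v w) < top"
      by (auto simp: min_less_iff_disj)
    have "enn2real (min 1 (sup_on (cball 0 (real (Suc k))) v w)) = 0"
      using zero[of k] by simp
    then have "min 1 (sup_on (cball 0 (real (Suc k))) v w) = 0"
      using fin by (auto simp: enn2real_eq_0_iff)
    then have "sup_on (cball 0 (real (Suc k))) v w = 0"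
      by (auto simp: min_def split: if_splits)
    moreover have "ennreal (norm (v x - w x)) \<le> sup_on (cball 0 (real (Suc k))) v w"
      unfolding sup_on_def by (rule SUP_upper[OF x])
    ultimately show "v x = w x" by simp
  qed
next
  assume "v = w"
  then have "sup_on A v w = 0" for A :: "'a set"
    unfolding sup_on_def by (cases "A = {}") (auto simp: bot_ennreal)
  then show "d_cc v w = 0" by (simp add: d_cc_def)
qed

lemma Metric_space_C0: "Metric_space C0 d_cc"
proof
  fix u v w :: "'a \<Rightarrow> 'a"
  show "0 \<le> d_cc v w"
    unfolding d_cc_def by (intro suminf_nonneg d_cc_summable) simp
  show "d_cc v w = d_cc w v"
    unfolding d_cc_def by (simp add: sup_on_commute)
  show "d_cc v w = 0 \<longleftrightarrow> v = w"
    by (rule d_cc_eq_0_iff)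
  show "d_cc u w \<le> d_cc u v + d_cc v w"
    unfolding d_cc_def suminf_add[OF d_cc_summable d_cc_summable]
    by (intro suminf_le summable_add d_cc_summable)
      (auto simp flip: distrib_left
        intro!: mult_left_mono enn2real_min_triangle sup_on_triangle)
qed

definition measurable_multimap ::
    "real set \<Rightarrow> (real \<Rightarrow> ('a::euclidean_space \<Rightarrow> 'a) set) \<Rightarrow> bool" where
  "measurable_multimap I F \<longleftrightarrow>
     (\<forall>U. openin C0_topology U \<longrightarrow> {t \<in> I. F t \<inter> U \<noteq> {}} \<in> sets lebesgue)"

definition measurable_map ::
    "real set \<Rightarrow> (real \<Rightarrow> 'a::euclidean_space \<Rightarrow> 'a) \<Rightarrow> bool" where
  "measurable_map I v \<longleftrightarrow>
     (\<forall>t\<in>I. v t \<in> C0) \<and> (\<forall>U. openin C0_topology U \<longrightarrow> {t \<in> I. v t \<in> U} \<in> sets lebesgue)"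

section \<open>The continuity inclusion\<close>

text \<open>The null sets in the growth, Lipschitz and Wasserstein-continuity conditions are uniform in the
  measures; the measurability condition holds for every time and measure. The bound on the Lipschitz
  constant of \<open>v\<close> by \<open>l t\<close> is \<open>(l t)-lipschitz_on UNIV v\<close>.\<close>

definition hypotheses_CI ::
    "real \<Rightarrow> real \<Rightarrow> (real \<Rightarrow> 'a::euclidean_space measure \<Rightarrow> ('a \<Rightarrow> 'a) set) \<Rightarrow> bool" where
  "hypotheses_CI p T V \<longleftrightarrow>
     (\<forall>\<mu>\<in>prob_moment p.
        measurable_multimap {0..T} (\<lambda>t. V t \<mu>) \<and>
        (\<forall>t\<in>{0..T}. closedin C0_topology (V t \<mu>) \<and> V t \<mu> \<noteq> {})) \<and>
     (\<exists>m. set_integrable lebesgue {0..T} m \<and> (\<forall>t\<in>{0..T}. 0 \<le> m t) \<and>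
        (AE t\<in>{0..T} in lebesgue. \<forall>\<mu>\<in>prob_moment p. \<forall>v\<in>V t \<mu>. \<forall>x.
           norm (v x) \<le> m t * (1 + norm x + moment p \<mu>))) \<and>
     (\<exists>l. set_integrable lebesgue {0..T} l \<and> (\<forall>t\<in>{0..T}. 0 \<le> l t) \<and>
        (AE t\<in>{0..T} in lebesgue. \<forall>\<mu>\<in>prob_moment p. \<forall>v\<in>V t \<mu>. (l t)-lipschitz_on UNIV v)) \<and>
     (\<exists>L. set_integrable lebesgue {0..T} L \<and> (\<forall>t\<in>{0..T}. 0 \<le> L t) \<and>
        (AE t\<in>{0..T} in lebesgue. \<forall>\<mu>\<in>prob_moment p. \<forall>\<nu>\<in>prob_moment p. \<forall>v\<in>V t \<mu>.
           \<exists>w\<in>V t \<nu>. d_sup v w \<le> ennreal (L t * wasserstein p \<mu> \<nu>)))"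

text \<open>Function spaces do not carry a \<open>real_vector\<close> instance, so convexity of a set of maps is
  spelled out with the pointwise operations.\<close>

definition convex_maps :: "('a::euclidean_space \<Rightarrow> 'a) set \<Rightarrow> bool" where
  "convex_maps S \<longleftrightarrow>
     (\<forall>v\<in>S. \<forall>w\<in>S. \<forall>c\<in>{0..1::real}. (\<lambda>x. (1 - c) *\<^sub>R v x + c *\<^sub>R w x) \<in> S)"

primrec Ck :: "nat \<Rightarrow> ('b::real_normed_vector \<Rightarrow> real) \<Rightarrow> bool" where
  "Ck 0 f \<longleftrightarrow> continuous_on UNIV f"
| "Ck (Suc k) f \<longleftrightarrow>
     f differentiable_on UNIV \<and> (\<forall>u. Ck k (\<lambda>z. frechet_derivative f (at z) u))"

definition test_function :: "real \<Rightarrow> real \<Rightarrow> (real \<times> 'a::euclidean_space \<Rightarrow> real) \<Rightarrow> bool" where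
  "test_function a b \<phi> \<longleftrightarrow>
     (\<forall>k. Ck k \<phi>) \<and>
     (\<exists>K. compact K \<and> K \<subseteq> {a<..<b} \<times> UNIV \<and> (\<forall>z. z \<notin> K \<longrightarrow> \<phi> z = 0))"

text \<open>The derivatives of \<open>\<phi>\<close> in the directions \<open>(1, 0)\<close> and \<open>(0, v t x)\<close> are its time derivative and
  the inner product of its space gradient with \<open>v t x\<close>. Integrability in time is required explicitly
  because a non-integrable function has Bochner integral zero.\<close>

definition continuity_equation ::
    "real \<Rightarrow> real \<Rightarrow> (real \<Rightarrow> 'a::euclidean_space \<Rightarrow> 'a) \<Rightarrow> (real \<Rightarrow> 'a measure) \<Rightarrow> bool" where
  "continuity_equation a b v \<mu> \<longleftrightarrow>
     (\<forall>\<phi>. test_function a b \<phi> \<longrightarrow>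
        (let I = (\<lambda>t. \<integral>x. frechet_derivative \<phi> (at (t, x)) (1, 0) +
                          frechet_derivative \<phi> (at (t, x)) (0, v t x) \<partial>\<mu> t)
         in set_integrable lebesgue {a<..<b} I \<and> (LINT t:{a<..<b}|lebesgue. I t) = 0))"

definition solutions ::
    "real \<Rightarrow> real \<Rightarrow> (real \<Rightarrow> 'a::euclidean_space measure \<Rightarrow> ('a \<Rightarrow> 'a) set) \<Rightarrow>
     real \<Rightarrow> 'a measure \<Rightarrow> (real \<Rightarrow> 'a measure) set" where
  "solutions p T V \<tau> \<mu>\<^sub>\<tau> =
     {\<mu>. abs_cont_curve p \<tau> T \<mu> \<and> \<mu> \<tau> = \<mu>\<^sub>\<tau> \<and>
         (\<exists>v. measurable_map {\<tau>..T} v \<and> (\<forall>t\<in>{\<tau>..T}. v t \<in> V t (\<mu> t)) \<and>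
              continuity_equation \<tau> T v \<mu>)}"

definition viable ::
    "real \<Rightarrow> real \<Rightarrow> (real \<Rightarrow> 'a::euclidean_space measure \<Rightarrow> ('a \<Rightarrow> 'a) set) \<Rightarrow>
     'a measure set \<Rightarrow> bool" where
  "viable p T V Q \<longleftrightarrow>
     (\<forall>\<tau>\<in>{0..T}. \<forall>\<mu>\<^sub>\<tau>\<in>Q. \<exists>\<mu>\<in>solutions p T V \<tau> \<mu>\<^sub>\<tau>. \<forall>t\<in>{\<tau>..T}. \<mu> t \<in> Q)"

definition contingent_cone ::
    "real \<Rightarrow> 'a::euclidean_space measure set \<Rightarrow> 'a measure \<Rightarrow> ('a \<Rightarrow> 'a) set" where
  "contingent_cone p Q \<nu> =
     {\<xi>. \<xi> \<in> borel_measurable borel \<and> integrable \<nu> (\<lambda>x. norm (\<xi> x) powr p) \<and>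
         Liminf (at_right 0)
           (\<lambda>h. ereal (1 / h * wasserstein_dist_to p (distr \<nu> borel (\<lambda>x. x + h *\<^sub>R \<xi> x)) Q)) = 0}"

end

theory Submission
  imports Defs "HOL-Real_Asymp.Real_Asymp" "HOL-Complex_Analysis.Great_Picard"
begin

text \<open>
  At almost every time \<open>\<tau>\<close> a single sequence \<open>h n \<longlonglongrightarrow> 0\<close> can be used for everything: the averages over
  \<open>{\<tau>..\<tau> + h n}\<close> of \<open>m\<close>, \<open>l\<close>, \<open>L\<close> and of countably many further integrable functions converge to the
  values at \<open>\<tau>\<close> (\<open>common_averaging_sequence\<close>). Fix such a \<open>\<tau>\<close> and let \<open>\<nu> \<in> Q\<close>. Viability yields a curve
  \<open>\<mu>\<close> in \<open>Q\<close> that starts from \<open>\<nu>\<close> at time \<open>\<tau>\<close> and is driven by velocities \<open>v t \<in> V t (\<mu> t)\<close>. The averages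
  \<open>\<xi>\<^sub>n\<close> of \<open>v\<close> over \<open>{\<tau>..\<tau> + h n}\<close> have bounded Lipschitz constants and uniform linear growth, so a
  subsequence converges pointwise to a Lipschitz map \<open>\<xi>\<close>. This \<open>\<xi>\<close> lies both in
  \<open>V \<tau> \<nu>\<close> and in the contingent cone.

  \<^bold>\<open>Membership in\<close> \<open>V \<tau> \<nu>\<close>. For points \<open>x\<^sub>i\<close> and vectors \<open>c\<^sub>i\<close> consider the functional
  \<open>w \<mapsto> \<Sum>\<^sub>i c\<^sub>i \<bullet> w x\<^sub>i\<close>. As \<open>v t\<close> is uniformly close to \<open>V t \<nu>\<close>, its value at \<open>v t\<close> exceeds the supremum over
  \<open>V t \<nu>\<close> by a multiple of \<open>L t * W\<^sub>p (\<mu> t, \<nu>)\<close> at most; averaging over \<open>{\<tau>..\<tau> + h n}\<close> bounds the value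
  at \<open>\<xi>\<close> by the supremum over \<open>V \<tau> \<nu>\<close>. The exceptional null set may depend neither on \<open>\<nu>\<close> nor on
  the functional. Therefore only \<open>c\<^sub>i\<close> and \<open>x\<^sub>i\<close> from a countable dense set are used, and \<open>\<nu>\<close> is
  replaced by nearby measures from a countable dense set (\<open>countable_dense_measures\<close>), at the price of
  another error \<open>L \<tau> * W\<^sub>p (\<nu>, \<nu>')\<close>. A closed convex set of equi-Lipschitz maps contains every
  Lipschitz map that satisfies these inequalities (\<open>closed_convex_mem_of_support\<close>).

  \<^bold>\<open>Tangency.\<close> Over a short interval \<open>{\<tau>..\<tau> + h}\<close> the solution is transported by a map: \<open>\<mu> (\<tau> + h)\<close> is
  the image of \<open>\<nu>\<close> under some \<open>\<Phi>\<close> with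
  \<open>\<bar>\<Phi> x - x - \<integral> v r x dr\<bar> \<le> a (exp a - 1) (1 + \<bar>x\<bar>)\<close>, where \<open>a\<close> is the integral over the interval
  of the growth and Lipschitz bounds (\<open>flow_map\<close>). Along \<open>h n\<close> one has \<open>a = O(h n)\<close>, hence \<open>\<Phi>\<close> and
  \<open>x \<mapsto> x + h n * \<xi> x\<close> differ by \<open>o(h n)\<close> in \<open>L\<^sup>p(\<nu>)\<close>. The image of \<open>\<nu>\<close> under the pair of these two
  maps is a coupling, so the Wasserstein distance is \<open>o(h n)\<close> as well, while \<open>\<mu> (\<tau> + h n) \<in> Q\<close>.

  The map \<open>\<Phi>\<close> is a limit of Euler polygons with exact time integrals of the velocity, and
  \<open>\<mu> (\<tau> + h) = \<Phi>\<^sub>#\<nu>\<close> is proved by duality. If \<open>f\<close> is a Lipschitz function and \<open>f\<^sub>\<epsilon>\<close> its mollification, the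
  continuity equation shows that \<open>\<integral> f\<^sub>\<epsilon> d\<mu> t\<close> differs from the integral with respect to \<open>\<mu> s\<close> of the mollified
  composition of \<open>f\<close> with one Euler step by \<open>A s t\<close>, the integral of the growth and Lipschitz bounds over the
  step, times \<open>O(\<epsilon>) + C\<^sub>\<epsilon> o(1)\<close>, where \<open>o(1)\<close> refers to the mesh (\<open>one_step_estimate\<close>). As \<open>f\<close> is mollified
  afresh in each step, only its Lipschitz constant and its support matter, and both stay bounded along the
  Euler steps (\<open>telescope\<close>). Since \<open>A\<close> is additive, the errors add up to something that
  vanishes with the mesh and then with \<open>\<epsilon>\<close>.
\<close>

section \<open>Averages along a common sequence of steps\<close>

lemma average_eq_unit_interval:
  fixes f :: "real \<Rightarrow> real"
  assumes "0 < h"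
  shows "(1 / h) * (LINT r:{t..t+h}|lborel. f r) = (LINT s:{0..1}|lborel. f (t + h * s))"
proof -
  have "(LINT r:{t..t+h}|lborel. f r) = h * integral\<^sup>L lborel (\<lambda>s. indicator {t..t+h} (t + h * s) *\<^sub>R f (t + h * s))"
    unfolding set_lebesgue_integral_def
    using lborel_integral_real_affine[of h "\<lambda>r. indicator {t..t+h} r *\<^sub>R f r" t] assms by simp
  also have "(\<lambda>s. indicator {t..t+h} (t + h * s) *\<^sub>R f (t + h * s)) = (\<lambda>s. indicator {0..1} s *\<^sub>R f (t + h * s))"
    using assms by (auto simp: indicator_def fun_eq_iff zero_le_mult_iff)
  finally show ?thesis using assms by (simp add: set_lebesgue_integral_def)
qed

lemma nn_integral_translate:
  fixes g :: "real \<Rightarrow> ennreal"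
  assumes [measurable]: "g \<in> borel_measurable borel"
  shows "(\<integral>\<^sup>+t. g (t + c) \<partial>lborel) = (\<integral>\<^sup>+t. g t \<partial>lborel)"
  using nn_integral_real_affine[of g 1 c] by (simp add: add.commute)

text \<open>Translation invariance of Lebesgue measure: averaging over the translates \<open>t + h * s\<close> preserves
  the integral for every \<open>h\<close>, so averaging is an \<open>L\<^sup>1\<close>-contraction uniformly in
  \<open>h\<close>.\<close>
lemma nn_integral_average:
  fixes g :: "real \<Rightarrow> ennreal"
  assumes [measurable]: "g \<in> borel_measurable borel"
  shows "(\<integral>\<^sup>+t. (\<integral>\<^sup>+s. g (t + h * s) * indicator {0..1} s \<partial>lborel) \<partial>lborel) = (\<integral>\<^sup>+t. g t \<partial>lborel)"
proof -
  have "(\<integral>\<^sup>+t. (\<integral>\<^sup>+s. g (t + h * s) * indicator {0..1} s \<partial>lborel) \<partial>lborel)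
      = (\<integral>\<^sup>+s. (\<integral>\<^sup>+t. g (t + h * s) * indicator {0..1} s \<partial>lborel) \<partial>lborel)"
    by (rule lborel_pair.Fubini') measurable
  also have "\<dots> = (\<integral>\<^sup>+(s::real). (\<integral>\<^sup>+t. g t \<partial>lborel) * indicator {0..1} s \<partial>lborel)"
    by (simp add: nn_integral_multc nn_integral_translate)
  also have "\<dots> = (\<integral>\<^sup>+t. g t \<partial>lborel)"
    by (simp add: nn_integral_cmult)
  finally show ?thesis .
qed

text \<open>The \<open>L\<^sup>1\<close> modulus of continuity of \<open>f\<close> under translation, averaged over the
  shifts between \<open>0\<close> and \<open>h\<close>. It bounds the \<open>L\<^sup>1\<close> distance between
  \<open>f\<close> and its averages over \<open>{t..t + h}\<close>.\<close>
definition avg_err :: "(real \<Rightarrow> real) \<Rightarrow> real \<Rightarrow> ennreal" where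
  "avg_err f h = (\<integral>\<^sup>+t. (\<integral>\<^sup>+s. ennreal \<bar>f (t + h * s) - f t\<bar> * indicator {0..1} s \<partial>lborel) \<partial>lborel)"

text \<open>\<open>avg_err\<close> is stable under \<open>L\<^sup>1\<close> approximation, uniformly in
  \<open>h\<close>; this makes a density argument possible.\<close>
lemma avg_err_split:
  assumes [measurable]: "f \<in> borel_measurable borel" "g \<in> borel_measurable borel"
  shows "avg_err f h \<le> avg_err g h + 2 * (\<integral>\<^sup>+t. ennreal \<bar>f t - g t\<bar> \<partial>lborel)"
proof -
  have "ennreal \<bar>f (t + h * s) - f t\<bar> * indicator {0..1} s \<le> ennreal \<bar>g (t + h * s) - g t\<bar> * indicator {0..1} s
     + (ennreal \<bar>f (t + h * s) - g (t + h * s)\<bar> * indicator {0..1} s + ennreal \<bar>f t - g t\<bar> * indicator {0..1} s)" for t s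
    by (auto simp: indicator_def simp flip: ennreal_plus intro!: ennreal_leI)
  then have "avg_err f h \<le> (\<integral>\<^sup>+t. (\<integral>\<^sup>+s. ennreal \<bar>g (t + h * s) - g t\<bar> * indicator {0..1} s
     + (ennreal \<bar>f (t + h * s) - g (t + h * s)\<bar> * indicator {0..1} s + ennreal \<bar>f t - g t\<bar> * indicator {0..1} s) \<partial>lborel) \<partial>lborel)"
    unfolding avg_err_def by (intro nn_integral_mono)
  also have "\<dots> = (\<integral>\<^sup>+t. (\<integral>\<^sup>+s. ennreal \<bar>g (t + h * s) - g t\<bar> * indicator {0..1} s \<partial>lborel)
     + ((\<integral>\<^sup>+s. ennreal \<bar>f (t + h * s) - g (t + h * s)\<bar> * indicator {0..1} s \<partial>lborel) + ennreal \<bar>f t - g t\<bar>) \<partial>lborel)"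
    by (intro nn_integral_cong) (simp add: nn_integral_add nn_integral_cmult)
  also have "\<dots> = avg_err g h + ((\<integral>\<^sup>+t. (\<integral>\<^sup>+s. ennreal \<bar>f (t + h * s) - g (t + h * s)\<bar> * indicator {0..1} s \<partial>lborel) \<partial>lborel)
      + (\<integral>\<^sup>+t. ennreal \<bar>f t - g t\<bar> \<partial>lborel))"
    unfolding avg_err_def by (simp add: nn_integral_add)
  also have "(\<integral>\<^sup>+t. (\<integral>\<^sup>+s. ennreal \<bar>f (t + h * s) - g (t + h * s)\<bar> * indicator {0..1} s \<partial>lborel) \<partial>lborel)
      = (\<integral>\<^sup>+t. ennreal \<bar>f t - g t\<bar> \<partial>lborel)"
    using nn_integral_average[of "\<lambda>t. ennreal \<bar>f t - g t\<bar>" h] by simp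
  finally show ?thesis by (simp add: mult_2)
qed

lemma nn_integral_dominated_to_0:
  fixes u :: "nat \<Rightarrow> 'b \<Rightarrow> ennreal"
  assumes "\<And>n. u n \<in> borel_measurable M" "w \<in> borel_measurable M" "\<And>n x. u n x \<le> w x"
    "(\<integral>\<^sup>+x. w x \<partial>M) < \<infinity>" "\<And>x. (\<lambda>n. u n x) \<longlonglongrightarrow> 0"
  shows "(\<lambda>n. \<integral>\<^sup>+x. u n x \<partial>M) \<longlonglongrightarrow> 0"
  using nn_integral_dominated_convergence[of u M "\<lambda>_. 0" w] assms by simp

text \<open>A translation leaves the measure of \<open>U\<close> unchanged, so the mass that leaves \<open>U\<close>
  equals the mass that enters it. Only the part that leaves has to be estimated, and it tends to zero pointwise on
  \<open>U\<close> because \<open>U\<close> is open.\<close>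
lemma avg_err_indicator_open:
  assumes U: "open U" "emeasure lborel U < \<infinity>" and h: "h \<longlonglongrightarrow> 0"
  shows "(\<lambda>n. avg_err (indicator U) (h n)) \<longlonglongrightarrow> 0"
proof -
  have [measurable]: "U \<in> sets borel" using U by simp
  \<comment> \<open>\<open>P\<close> is the mass leaving \<open>U\<close>, \<open>N\<close> the mass entering
    it.\<close>
  define P where "P n t s = (ennreal (indicator U t * (1 - indicator U (t + h n * s)))) * indicator {0..1} s" for n and t s :: real
  define N where "N n t s = (ennreal (indicator U (t + h n * s) * (1 - indicator U t))) * indicator {0..1} s" for n and t s :: real
  have [measurable]: "(\<lambda>(t,s). P n t s) \<in> borel_measurable (lborel \<Otimes>\<^sub>M lborel)"
    "(\<lambda>(t,s). N n t s) \<in> borel_measurable (lborel \<Otimes>\<^sub>M lborel)" for n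
    unfolding P_def N_def by measurable
  have Pt: "(\<lambda>n. (\<integral>\<^sup>+s. P n t s \<partial>lborel)) \<longlonglongrightarrow> 0" for t
  proof (rule nn_integral_dominated_to_0[where w="indicator {0..1}"])
    fix s :: real
    have "eventually (\<lambda>n. t + h n * s \<in> U) sequentially" if "t \<in> U"
    proof -
      have "(\<lambda>n. t + h n * s) \<longlonglongrightarrow> t + 0 * s" by (intro tendsto_intros h)
      then show ?thesis using U(1) that by (simp add: topological_tendstoD)
    qed
    then have "eventually (\<lambda>n. P n t s = 0) sequentially"
      by (cases "t \<in> U") (auto simp: P_def elim!: eventually_mono)
    then show "(\<lambda>n. P n t s) \<longlonglongrightarrow> 0" by (rule tendsto_eventually)
  next
    show "P n t s \<le> indicator {0..1} s" for n s by (auto simp: P_def indicator_def)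
  qed (auto simp: P_def)
  have P0: "(\<lambda>n. \<integral>\<^sup>+t. (\<integral>\<^sup>+s. P n t s \<partial>lborel) \<partial>lborel) \<longlonglongrightarrow> 0"
  proof (rule nn_integral_dominated_to_0[where w="indicator U"])
    fix n t
    have "(\<integral>\<^sup>+s. P n t s \<partial>lborel) \<le> (\<integral>\<^sup>+(s::real). indicator U t * indicator {0..1} s \<partial>lborel)"
      by (intro nn_integral_mono) (auto simp: P_def indicator_def)
    then show "(\<integral>\<^sup>+s. P n t s \<partial>lborel) \<le> indicator U t" by (simp add: nn_integral_cmult)
  qed (use U Pt in auto)
  have eq: "(\<integral>\<^sup>+t. (\<integral>\<^sup>+s. P n t s \<partial>lborel) \<partial>lborel) = (\<integral>\<^sup>+t. (\<integral>\<^sup>+s. N n t s \<partial>lborel) \<partial>lborel)" for n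
  proof -
    define B where "B t s = ennreal (indicator U t * indicator U (t + h n * s)) * indicator {0..1} s" for t s :: real
    have [measurable]: "(\<lambda>(t,s). B t s) \<in> borel_measurable (lborel \<Otimes>\<^sub>M lborel)"
      unfolding B_def by measurable
    have "(\<integral>\<^sup>+t. (\<integral>\<^sup>+s. P n t s \<partial>lborel) \<partial>lborel) + (\<integral>\<^sup>+t. (\<integral>\<^sup>+s. B t s \<partial>lborel) \<partial>lborel) 
       = (\<integral>\<^sup>+t. (\<integral>\<^sup>+s. P n t s + B t s \<partial>lborel) \<partial>lborel)" 
      by (simp add: nn_integral_add)
    also have "\<dots> = (\<integral>\<^sup>+t. (\<integral>\<^sup>+(s::real). indicator U t * indicator {0..1} s \<partial>lborel) \<partial>lborel)"
      by (intro nn_integral_cong) (auto simp: P_def B_def indicator_def)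
    also have "\<dots> = emeasure lborel U" by (simp add: nn_integral_cmult)
    finally have 1: "(\<integral>\<^sup>+t. (\<integral>\<^sup>+s. P n t s \<partial>lborel) \<partial>lborel) + (\<integral>\<^sup>+t. (\<integral>\<^sup>+s. B t s \<partial>lborel) \<partial>lborel) = emeasure lborel U" .
    have "(\<integral>\<^sup>+t. (\<integral>\<^sup>+s. N n t s \<partial>lborel) \<partial>lborel) + (\<integral>\<^sup>+t. (\<integral>\<^sup>+s. B t s \<partial>lborel) \<partial>lborel) 
       = (\<integral>\<^sup>+t. (\<integral>\<^sup>+s. N n t s + B t s \<partial>lborel) \<partial>lborel)" 
      by (simp add: nn_integral_add)
    also have "\<dots> = (\<integral>\<^sup>+t. (\<integral>\<^sup>+s. indicator U (t + h n * s) * indicator {0..1} s \<partial>lborel) \<partial>lborel)"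
      by (intro nn_integral_cong) (auto simp: N_def B_def indicator_def)
    also have "\<dots> = emeasure lborel U" by (simp add: nn_integral_average)
    finally have 2: "(\<integral>\<^sup>+t. (\<integral>\<^sup>+s. N n t s \<partial>lborel) \<partial>lborel) + (\<integral>\<^sup>+t. (\<integral>\<^sup>+s. B t s \<partial>lborel) \<partial>lborel) = emeasure lborel U" .
    have "(\<integral>\<^sup>+t. (\<integral>\<^sup>+s. B t s \<partial>lborel) \<partial>lborel) \<le> emeasure lborel U"
      unfolding 1[symmetric] by simp
    then have "(\<integral>\<^sup>+t. (\<integral>\<^sup>+s. B t s \<partial>lborel) \<partial>lborel) \<noteq> \<top>" using U(2) by (auto simp: top_unique)
    moreover have "(\<integral>\<^sup>+t. (\<integral>\<^sup>+s. B t s \<partial>lborel) \<partial>lborel) + (\<integral>\<^sup>+t. (\<integral>\<^sup>+s. P n t s \<partial>lborel) \<partial>lborel)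
        = (\<integral>\<^sup>+t. (\<integral>\<^sup>+s. B t s \<partial>lborel) \<partial>lborel) + (\<integral>\<^sup>+t. (\<integral>\<^sup>+s. N n t s \<partial>lborel) \<partial>lborel)"
      using 1 2 by (simp add: add.commute)
    ultimately show ?thesis unfolding ennreal_add_left_cancel by simp
  qed
  have "avg_err (indicator U) (h n) = (\<integral>\<^sup>+t. (\<integral>\<^sup>+s. P n t s + N n t s \<partial>lborel) \<partial>lborel)" for n
    unfolding avg_err_def by (intro nn_integral_cong) (auto simp: P_def N_def indicator_def)
  then have "avg_err (indicator U) (h n) = (\<integral>\<^sup>+t. (\<integral>\<^sup>+s. P n t s \<partial>lborel) \<partial>lborel) + (\<integral>\<^sup>+t. (\<integral>\<^sup>+s. P n t s \<partial>lborel) \<partial>lborel)" for n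
    by (simp add: nn_integral_add eq)
  then show ?thesis using tendsto_add[OF P0 P0] by simp
qed

lemma avg_err_limitI:
  assumes "f \<in> borel_measurable borel"
    and "\<And>e::real. e > 0 \<Longrightarrow> \<exists>g\<in>borel_measurable borel. (\<integral>\<^sup>+t. ennreal \<bar>f t - g t\<bar> \<partial>lborel) \<le> ennreal e \<and>
           (\<lambda>n. avg_err g (h n)) \<longlonglongrightarrow> 0"
  shows "(\<lambda>n. avg_err f (h n)) \<longlonglongrightarrow> 0"
proof (rule order_tendstoI)
  fix a :: ennreal assume "0 < a"
  then obtain e where e: "0 < e" "ennreal (3 * e) < a"
  proof -
    obtain b where b: "0 < b" "b < a" using \<open>0 < a\<close> dense by blast
    then have bf: "b < \<top>" using order_less_le_trans[OF _ top_greatest] by blast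
    show ?thesis
      using b bf by (intro that[of "enn2real b / 3"]) (auto simp: enn2real_positive_iff)
  qed
  obtain g where g: "g \<in> borel_measurable borel" "(\<integral>\<^sup>+t. ennreal \<bar>f t - g t\<bar> \<partial>lborel) \<le> ennreal e"
     "(\<lambda>n. avg_err g (h n)) \<longlonglongrightarrow> 0" using assms(2)[OF e(1)] by blast
  have "eventually (\<lambda>n. avg_err g (h n) < ennreal e) sequentially"
    using g(3) e(1) by (intro order_tendstoD) auto
  then show "eventually (\<lambda>n. avg_err f (h n) < a) sequentially"
  proof eventually_elim
    case (elim n)
    have "avg_err f (h n) \<le> avg_err g (h n) + 2 * (\<integral>\<^sup>+t. ennreal \<bar>f t - g t\<bar> \<partial>lborel)"
      by (rule avg_err_split) (use assms g in auto)
    also have "\<dots> \<le> ennreal e + 2 * ennreal e" using elim g by (intro add_mono mult_left_mono) auto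
    also have "\<dots> = ennreal (3 * e)" 
      using e(1) by (subst ennreal_numeral[symmetric], subst ennreal_mult[symmetric]) (simp_all flip: ennreal_plus)
    finally show ?case using e(2) by (rule le_less_trans)
  qed
qed auto

text \<open>Continuity of translations in \<open>L\<^sup>1\<close>, by induction on integrable functions; indicators of
  Borel sets are approximated from outside by open sets.\<close>
lemma avg_err_tendsto_0:
  assumes "integrable lborel f" and h: "h \<longlonglongrightarrow> 0"
  shows "(\<lambda>n. avg_err f (h n)) \<longlonglongrightarrow> 0"
  using assms(1)
proof (induct rule: integrable_induct)
  case (base A c)
  have ind: "(\<lambda>n. avg_err (indicator A) (h n)) \<longlonglongrightarrow> 0"
  proof (rule avg_err_limitI)
    show "indicator A \<in> borel_measurable borel" using base by auto
    fix e :: real assume "0 < e"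
    have "A \<in> sets lebesgue" using base by simp
    then obtain U where U: "open U" "A \<subseteq> U" "U - A \<in> lmeasurable" "emeasure lebesgue (U - A) < ennreal e"
      using sets_lebesgue_outer_open[OF _ \<open>0 < e\<close>, of A] by blast
    have [measurable]: "U \<in> sets borel" "A \<in> sets borel" using U base by auto
    have UA: "emeasure lborel (U - A) \<le> ennreal e" using U(4) by (simp add: less_imp_le)
    have "emeasure lborel U \<le> emeasure lborel A + emeasure lborel (U - A)"
      using emeasure_subadditive[of A lborel "U - A"] U(2) by (simp add: Un_absorb1)
    also have "\<dots> < \<infinity>" using le_less_trans[OF UA ennreal_less_top] base by (auto simp: ennreal_add_less_top)
    finally have fin: "emeasure lborel U < \<infinity>" .
    have "(\<integral>\<^sup>+t. ennreal \<bar>indicator A t - indicator U t\<bar> \<partial>lborel) = (\<integral>\<^sup>+t. indicator (U - A) t \<partial>lborel)"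
      using U(2) by (intro nn_integral_cong) (auto simp: indicator_def)
    also have "\<dots> \<le> ennreal e" using UA by simp
    finally show "\<exists>g\<in>borel_measurable borel. (\<integral>\<^sup>+t. ennreal \<bar>indicator A t - g t\<bar> \<partial>lborel) \<le> ennreal e \<and>
           (\<lambda>n. avg_err g (h n)) \<longlonglongrightarrow> 0"
      using avg_err_indicator_open[OF U(1) fin h] by (intro bexI[of _ "indicator U"]) auto
  qed
  have [measurable]: "A \<in> sets borel" using base by simp
  have "ennreal \<bar>indicator A x *\<^sub>R c - indicator A y *\<^sub>R c\<bar> = ennreal \<bar>c\<bar> * ennreal \<bar>indicator A x - indicator A y\<bar>" for x y
    by (auto simp: indicator_def)
  then have "avg_err (\<lambda>x. indicator A x *\<^sub>R c) (h n) = ennreal \<bar>c\<bar> * avg_err (indicator A) (h n)" for n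
    unfolding avg_err_def by (simp add: nn_integral_cmult mult.assoc)
  then show ?case using ennreal_tendsto_cmult[OF _ ind, of "ennreal \<bar>c\<bar>"] by simp
next
  case (add f g)
  have [measurable]: "f \<in> borel_measurable borel" "g \<in> borel_measurable borel"
    using add by auto
  have "avg_err (\<lambda>x. f x + g x) (h n) \<le> avg_err f (h n) + avg_err g (h n)" for n
  proof -
    have "ennreal \<bar>(f (t + h n * s) + g (t + h n * s)) - (f t + g t)\<bar> * indicator {0..1} s \<le>
      ennreal \<bar>f (t + h n * s) - f t\<bar> * indicator {0..1} s + ennreal \<bar>g (t + h n * s) - g t\<bar> * indicator {0..1} s" for t s
      by (auto simp: indicator_def simp flip: ennreal_plus intro!: ennreal_leI)
    then have "avg_err (\<lambda>x. f x + g x) (h n) \<le> (\<integral>\<^sup>+t. (\<integral>\<^sup>+s. ennreal \<bar>f (t + h n * s) - f t\<bar> * indicator {0..1} s + ennreal \<bar>g (t + h n * s) - g t\<bar> * indicator {0..1} s \<partial>lborel) \<partial>lborel)"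
      unfolding avg_err_def by (intro nn_integral_mono)
    also have "\<dots> = avg_err f (h n) + avg_err g (h n)" unfolding avg_err_def by (simp add: nn_integral_add)
    finally show ?thesis .
  qed
  moreover have "(\<lambda>n. avg_err f (h n) + avg_err g (h n)) \<longlonglongrightarrow> 0" using tendsto_add[OF add(2) add(4)] by simp
  ultimately show ?case
    by (rule_tac tendsto_sandwich[where f="\<lambda>_. 0" and h="\<lambda>n. avg_err f (h n) + avg_err g (h n)"]) simp_all
next
  case (lim f s)
  have [measurable]: "f \<in> borel_measurable borel" "\<And>i. s i \<in> borel_measurable borel"
    using borel_measurable_integrable[OF lim(1)] borel_measurable_integrable[OF lim(5)] by simp_all
  show ?case
  proof (rule avg_err_limitI)
    fix e :: real assume "0 < e"
    have "(\<lambda>i. \<integral>\<^sup>+t. ennreal \<bar>f t - s i t\<bar> \<partial>lborel) \<longlonglongrightarrow> 0"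
    proof (rule nn_integral_dominated_to_0[where w="\<lambda>t. ennreal (3 * \<bar>f t\<bar>)"])
      fix i t
      have "\<bar>s i t\<bar> \<le> 2 * \<bar>f t\<bar>" using lim(4)[of t i] by simp
      then show "ennreal \<bar>f t - s i t\<bar> \<le> ennreal (3 * \<bar>f t\<bar>)" by (intro ennreal_leI) linarith
      have "(\<lambda>i. \<bar>f t - s i t\<bar>) \<longlonglongrightarrow> \<bar>f t - f t\<bar>" using lim(3)[of t] by (intro tendsto_intros) auto
      then show "(\<lambda>i. ennreal \<bar>f t - s i t\<bar>) \<longlonglongrightarrow> 0" using tendsto_ennrealI by fastforce
    next
      have "integrable lborel (\<lambda>t. 3 * \<bar>f t\<bar>)" using lim(5) by simp
      then show "(\<integral>\<^sup>+t. ennreal (3 * \<bar>f t\<bar>) \<partial>lborel) < \<infinity>"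
        unfolding integrable_iff_bounded by simp
    qed simp_all
    then have "eventually (\<lambda>i. (\<integral>\<^sup>+t. ennreal \<bar>f t - s i t\<bar> \<partial>lborel) < ennreal e) sequentially"
      using \<open>0 < e\<close> by (intro order_tendstoD) auto
    then obtain i where "(\<integral>\<^sup>+t. ennreal \<bar>f t - s i t\<bar> \<partial>lborel) < ennreal e" by (auto simp: eventually_sequentially)
    then show "\<exists>g\<in>borel_measurable borel. (\<integral>\<^sup>+t. ennreal \<bar>f t - g t\<bar> \<partial>lborel) \<le> ennreal e \<and>
           (\<lambda>n. avg_err g (h n)) \<longlonglongrightarrow> 0"
      using lim(2) less_imp_le by (intro bexI[of _ "s i"] conjI) simp_all
  qed simp
qed

lemma average_minus_value_le:
  assumes f: "integrable lborel f" and "0 < h"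
  shows "ennreal \<bar>(1 / h) * (LINT r:{t..t+h}|lborel. f r) - f t\<bar>
     \<le> (\<integral>\<^sup>+s. ennreal \<bar>f (t + h * s) - f t\<bar> * indicator {0..1} s \<partial>lborel)"
proof -
  have i: "integrable lborel (\<lambda>s. indicator {0..1} s *\<^sub>R f (t + h * s))"
    using lborel_integrable_real_affine[OF f, of h t] \<open>0 < h\<close> by (intro integrable_mult_indicator) auto
  have "(1 / h) * (LINT r:{t..t+h}|lborel. f r) - f t
     = (\<integral>s. indicator {0..1} s *\<^sub>R f (t + h * s) \<partial>lborel) - (\<integral>(s::real). indicator {0..1} s *\<^sub>R f t \<partial>lborel)"
    unfolding average_eq_unit_interval[OF \<open>0 < h\<close>] by (simp add: set_lebesgue_integral_def content_real)
  also have "\<dots> = (\<integral>s. indicator {0..1} s *\<^sub>R (f (t + h * s) - f t) \<partial>lborel)"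
    by (subst Bochner_Integration.integral_diff[symmetric]) (use i in \<open>auto simp: algebra_simps\<close>)
  finally have "ennreal \<bar>(1 / h) * (LINT r:{t..t+h}|lborel. f r) - f t\<bar>
     = ennreal (norm (\<integral>s. indicator {0..1} s *\<^sub>R (f (t + h * s) - f t) \<partial>lborel))" by simp
  also have "\<dots> \<le> (\<integral>\<^sup>+s. ennreal (norm (indicator {0..1} s *\<^sub>R (f (t + h * s) - f t))) \<partial>lborel)"
    by (rule integral_norm_bound_ennreal) (use i in \<open>auto simp: algebra_simps\<close>)
  also have "\<dots> = (\<integral>\<^sup>+s. ennreal \<bar>f (t + h * s) - f t\<bar> * indicator {0..1} s \<partial>lborel)"
    by (intro nn_integral_cong) (auto simp: indicator_def)
  finally show ?thesis .
qed

text \<open>The averages converge in \<open>L\<^sup>1\<close>. Choosing \<open>h n\<close> so small that the functions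
  of index up to \<open>n\<close> have error at most \<open>2\<^sup>-\<^sup>n\<close> makes the errors summable, which
  forces convergence almost everywhere for each function along the same sequence.\<close>
lemma common_averaging_sequence_lborel:
  fixes f :: "nat \<Rightarrow> real \<Rightarrow> real"
  assumes f: "\<And>i. integrable lborel (f i)"
  obtains h where "\<And>n. 0 < h n" "h \<longlonglongrightarrow> 0"
    "AE t in lborel. \<forall>i. (\<lambda>n. (1 / h n) * (LINT r:{t..t+h n}|lborel. f i r)) \<longlonglongrightarrow> f i t"
proof -
  have [measurable]: "f i \<in> borel_measurable borel" for i using f[of i] by simp
  have "\<exists>k\<ge>n. \<forall>i\<le>n. avg_err (f i) (inverse (real (Suc k))) \<le> ennreal ((1/2)^n)" for n :: nat
  proof -
    have "eventually (\<lambda>k. \<forall>i\<in>{..n}. avg_err (f i) (inverse (real (Suc k))) < ennreal ((1/2)^n)) sequentially"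
      by (intro eventually_ball_finite ballI order_tendstoD(2)[OF avg_err_tendsto_0[OF f LIMSEQ_inverse_real_of_nat]]) auto
    then have "eventually (\<lambda>k. k \<ge> n \<and> (\<forall>i\<in>{..n}. avg_err (f i) (inverse (real (Suc k))) < ennreal ((1/2)^n))) sequentially"
      by (intro eventually_conj eventually_ge_at_top)
    then show ?thesis by (auto simp: eventually_sequentially intro: less_imp_le)
  qed
  then obtain k where k: "\<And>n. k n \<ge> n" "\<And>n i. i \<le> n \<Longrightarrow> avg_err (f i) (inverse (real (Suc (k n)))) \<le> ennreal ((1/2)^n)"
    by metis
  define h where "h n = inverse (real (Suc (k n)))" for n
  have h0: "0 < h n" for n by (simp add: h_def)
  have hl: "h \<longlonglongrightarrow> 0"
  proof (rule tendsto_sandwich[OF _ _ tendsto_const LIMSEQ_inverse_real_of_nat])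
    show "\<forall>\<^sub>F n in sequentially. h n \<le> inverse (real (Suc n))"
      unfolding h_def using k(1) by (intro always_eventually allI) (auto intro!: le_imp_inverse_le)
  qed (use h0 less_imp_le in \<open>auto intro!: always_eventually\<close>)
  define E where "E i n t = (\<integral>\<^sup>+s. ennreal \<bar>f i (t + h n * s) - f i t\<bar> * indicator {0..1} s \<partial>lborel)" for i n t
  have [measurable]: "E i n \<in> borel_measurable lborel" for i n unfolding E_def by measurable
  have "AE t in lborel. (\<lambda>n. (1 / h n) * (LINT r:{t..t+h n}|lborel. f i r)) \<longlonglongrightarrow> f i t" for i
  proof -
    \<comment> \<open>The error of \<open>f i\<close> is controlled only from index \<open>i\<close> on.\<close>
    have "(\<integral>\<^sup>+t. (\<Sum>n. E i (n + i) t) \<partial>lborel) = (\<Sum>n. avg_err (f i) (h (n + i)))"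
      by (simp add: nn_integral_suminf avg_err_def E_def)
    also have "\<dots> \<le> (\<Sum>n. ennreal ((1/2)^n))"
    proof (rule suminf_le)
      fix n :: nat
      have "avg_err (f i) (h (n + i)) \<le> ennreal ((1/2)^(n+i))" using k(2)[of i "n+i"] by (simp add: h_def)
      also have "\<dots> \<le> ennreal ((1/2)^n)" by (intro ennreal_leI power_decreasing) auto
      finally show "avg_err (f i) (h (n + i)) \<le> ennreal ((1/2)^n)" .
    qed auto
    also have "\<dots> = ennreal (\<Sum>n. (1/2)^n)"
      by (intro suminf_ennreal2) auto
    also have "\<dots> < \<infinity>" by simp
    finally have "AE t in lborel. (\<Sum>n. E i (n + i) t) \<noteq> \<infinity>"
      by (intro nn_integral_PInf_AE) auto
    then show ?thesis
    proof eventually_elim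
      case (elim t)
      have fin: "E i (n + i) t \<noteq> \<infinity>" for n
        using elim sum_le_suminf[of "\<lambda>n. E i (n + i) t" "{n}"] by (auto simp: top_unique)
      define e where "e n = enn2real (E i (n + i) t)" for n
      have eE: "E i (n + i) t = ennreal (e n)" for n using fin[of n] by (simp add: e_def less_top)
      have e0: "0 \<le> e n" for n by (simp add: e_def)
      have "summable e" using elim unfolding eE by (intro summable_suminf_not_top) (auto simp: e0)
      then have e: "e \<longlonglongrightarrow> 0" by (rule summable_LIMSEQ_zero)
      have "\<bar>(1 / h (n + i)) * (LINT r:{t..t+h (n + i)}|lborel. f i r) - f i t\<bar> \<le> e n" for n
        using average_minus_value_le[OF f[of i] h0[of "n + i"], of t] eE[of n] e0 by (simp add: E_def)
      then have "(\<lambda>n. (1 / h (n + i)) * (LINT r:{t..t+h (n + i)}|lborel. f i r) - f i t) \<longlonglongrightarrow> 0"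
        by (intro Lim_null_comparison[OF _ e]) (auto intro!: always_eventually)
      then have "(\<lambda>n. (1 / h (n + i)) * (LINT r:{t..t+h (n + i)}|lborel. f i r)) \<longlonglongrightarrow> f i t"
        by (simp add: LIM_zero_iff)
      then show ?case by (rule LIMSEQ_offset)
    qed
  qed
  then have "AE t in lborel. \<forall>i. (\<lambda>n. (1 / h n) * (LINT r:{t..t+h n}|lborel. f i r)) \<longlonglongrightarrow> f i t"
    by (subst AE_all_countable) blast
  with h0 hl that show ?thesis by blast
qed

lemma common_averaging_sequence:
  fixes f :: "nat \<Rightarrow> real \<Rightarrow> real"
  assumes f: "\<And>i. integrable lebesgue (f i)"
  obtains h where "\<And>n. 0 < h n" "h \<longlonglongrightarrow> 0"
    "AE t in lebesgue. \<forall>i. (\<lambda>n. (1 / h n) * (LINT r:{t..t+h n}|lebesgue. f i r)) \<longlonglongrightarrow> f i t"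
proof -
  have "\<exists>g. g \<in> borel_measurable lborel \<and> (AE x in lborel. f i x = g x)" for i
    using completion_ex_borel_measurable_real[of "f i" lborel] f[of i] by (auto dest: borel_measurable_integrable)
  then obtain g where g: "\<And>i. g i \<in> borel_measurable lborel" "\<And>i. AE x in lborel. f i x = g i x" by metis
  have ae: "AE x in lebesgue. f i x = g i x" for i using g(2)[of i] by (rule AE_completion)
  have gl: "g i \<in> borel_measurable lebesgue" for i using g(1)[of i] by (simp add: measurable_completion)
  have gi: "integrable lborel (g i)" for i
    using f[of i] integrable_cong_AE[OF _ gl[of i] ae] g(1)[of i] by (simp add: integrable_completion borel_measurable_integrable)
  have int: "(LINT r:{a..b}|lebesgue. f i r) = (LINT r:{a..b}|lborel. g i r)" for a b i
  proof -
    have "(LINT r:{a..b}|lebesgue. f i r) = (LINT r:{a..b}|lebesgue. g i r)"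
      unfolding set_lebesgue_integral_def
    proof (rule integral_cong_AE)
      have [measurable]: "f i \<in> borel_measurable lebesgue" "g i \<in> borel_measurable lebesgue" "{a..b} \<in> sets lebesgue"
        using f[of i] gl[of i] by (auto dest: borel_measurable_integrable)
      show "(\<lambda>x. indicat_real {a..b} x *\<^sub>R f i x) \<in> borel_measurable lebesgue"
        "(\<lambda>x. indicat_real {a..b} x *\<^sub>R g i x) \<in> borel_measurable lebesgue" by measurable
    qed (use ae[of i] in \<open>auto elim!: eventually_mono\<close>)
    also have "\<dots> = (LINT r:{a..b}|lborel. g i r)" 
      unfolding set_lebesgue_integral_def by (rule integral_completion) (use g(1)[of i] in simp)
    finally show ?thesis .
  qed
  obtain h where h: "\<And>n. 0 < h n" "h \<longlonglongrightarrow> 0"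
    "AE t in lborel. \<forall>i. (\<lambda>n. (1 / h n) * (LINT r:{t..t+h n}|lborel. g i r)) \<longlonglongrightarrow> g i t"
    by (rule common_averaging_sequence_lborel[of g, OF gi]) (rule that)
  have "AE t in lebesgue. \<forall>i. f i t = g i t" using ae by (simp add: AE_all_countable)
  with AE_completion[OF h(3)] have "AE t in lebesgue. \<forall>i. (\<lambda>n. (1 / h n) * (LINT r:{t..t+h n}|lebesgue. f i r)) \<longlonglongrightarrow> f i t"
    unfolding int by eventually_elim auto
  then show ?thesis by (rule that[OF h(1,2)])
qed


section \<open>Smooth functions\<close>

text \<open>The iterated derivative in \<open>Ck\<close> is taken direction by direction, so it suffices to know some
  derivative \<open>D\<close> and the regularity of \<open>\<lambda>z. D z u\<close> for each direction
  \<open>u\<close>.\<close>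
lemma Ck_SucI:
  assumes "\<And>z. (f has_derivative D z) (at z)" "\<And>u. Ck k (\<lambda>z. D z u)"
  shows "Ck (Suc k) f"
proof -
  have "frechet_derivative f (at z) = D z" for z
    using frechet_derivative_at[OF assms(1)[of z]] by simp
  moreover have "f differentiable_on UNIV"
    using assms(1) by (auto simp: differentiable_on_def differentiable_def)
  ultimately show ?thesis using assms(2) by simp
qed

lemma Ck_has_derivative:
  assumes "Ck (Suc k) f"
  shows "(f has_derivative frechet_derivative f (at z)) (at z)"
  using assms by (auto simp: differentiable_on_def frechet_derivative_works)

lemma Ck_continuous: "Ck k f \<Longrightarrow> continuous_on UNIV f"
  by (cases k) (auto intro: differentiable_imp_continuous_on)

lemma Ck_Suc_imp: "Ck (Suc k) f \<Longrightarrow> Ck k f"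
proof (induction k arbitrary: f)
  case 0
  then show ?case by (auto intro: differentiable_imp_continuous_on)
next
  case (Suc k)
  then show ?case by simp
qed

lemma Ck_const: "Ck k (\<lambda>z. c)"
proof (induction k arbitrary: c)
  case (Suc k)
  show ?case by (rule Ck_SucI[where D="\<lambda>_ _. 0"]) (auto intro: Suc)
qed simp

lemma Ck_bounded_linear: "bounded_linear f \<Longrightarrow> Ck k f"
proof (cases k)
  case 0
  then show "bounded_linear f \<Longrightarrow> Ck k f" by (simp add: linear_continuous_on)
next
  case (Suc n)
  then show "bounded_linear f \<Longrightarrow> Ck k f"
    using Ck_SucI[of f "\<lambda>_. f" n] by (auto intro: Ck_const bounded_linear_imp_has_derivative)
qed

lemma Ck_add: "Ck k f \<Longrightarrow> Ck k g \<Longrightarrow> Ck k (\<lambda>z. f z + g z)"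
proof (induction k arbitrary: f g)
  case 0
  then show ?case by (auto intro: continuous_intros)
next
  case (Suc k)
  show ?case
  proof (rule Ck_SucI)
    show "((\<lambda>z. f z + g z) has_derivative (\<lambda>u. frechet_derivative f (at z) u + frechet_derivative g (at z) u)) (at z)" for z
      using Suc.prems by (intro has_derivative_add Ck_has_derivative)
  qed (use Suc in auto)
qed

lemma Ck_mult: "Ck k f \<Longrightarrow> Ck k g \<Longrightarrow> Ck k (\<lambda>z. f z * g z)"
proof (induction k arbitrary: f g)
  case 0
  then show ?case by (auto intro: continuous_intros)
next
  case (Suc k)
  show ?case
  proof (rule Ck_SucI)
    show "((\<lambda>z. f z * g z) has_derivative (\<lambda>u. f z * frechet_derivative g (at z) u + frechet_derivative f (at z) u * g z)) (at z)" for z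
      using Suc.prems by (intro has_derivative_mult Ck_has_derivative)
    show "Ck k (\<lambda>z. f z * frechet_derivative g (at z) u + frechet_derivative f (at z) u * g z)" for u
      using Suc.prems by (intro Ck_add Suc.IH Ck_Suc_imp[OF Suc.prems(1)] Ck_Suc_imp[OF Suc.prems(2)]) auto
  qed
qed

lemma Ck_sum: "finite I \<Longrightarrow> (\<And>i. i \<in> I \<Longrightarrow> Ck k (f i)) \<Longrightarrow> Ck k (\<lambda>z. \<Sum>i\<in>I. f i z)"
  by (induction I rule: finite_induct) (auto intro: Ck_const Ck_add)

lemma Ck_affine: "bounded_linear L \<Longrightarrow> Ck k f \<Longrightarrow> Ck k (\<lambda>z. f (c + L z))"
proof (induction k arbitrary: f)
  case 0
  then have "continuous_on UNIV (\<lambda>z. c + L z)" by (intro continuous_intros linear_continuous_on)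
  then show ?case using 0 by (auto intro: continuous_on_compose2[of UNIV f])
next
  case (Suc k)
  show ?case
  proof (rule Ck_SucI)
    fix z
    have "((\<lambda>z. c + L z) has_derivative L) (at z)"
      using Suc.prems(1) has_derivative_add[OF has_derivative_const[of c] bounded_linear_imp_has_derivative] by fastforce
    then show "((\<lambda>z. f (c + L z)) has_derivative (\<lambda>u. frechet_derivative f (at (c + L z)) (L u))) (at z)"
      using has_derivative_compose[OF _ Ck_has_derivative[OF Suc.prems(2)]] by blast
  next
    show "Ck k (\<lambda>z. frechet_derivative f (at (c + L z)) (L u))" for u
      using Suc.IH[OF Suc.prems(1), of "\<lambda>z. frechet_derivative f (at z) (L u)"] Suc.prems(2) by simp
  qed
qed

lemma Ck_inner_self: "Ck k (\<lambda>z::'a::euclidean_space. z \<bullet> z)"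
proof -
  have "(\<lambda>z::'a. z \<bullet> z) = (\<lambda>z. \<Sum>i\<in>Basis. (z \<bullet> i) * (z \<bullet> i))"
    by (rule ext) (rule euclidean_inner)
  then show ?thesis
    by (simp only:) (intro Ck_sum Ck_mult Ck_bounded_linear bounded_linear_inner_left finite_Basis)
qed

text \<open>The functions \<open>P (1 / s) * exp (- 1 / s)\<close>, extended by zero to \<open>s \<le> 0\<close>.
  Allowing every polynomial \<open>P\<close> makes the family closed under differentiation, which gives smoothness by
  induction.\<close>
definition flat :: "real poly \<Rightarrow> real \<Rightarrow> real" where
  "flat P s = (if 0 < s then poly P (1 / s) * exp (- (1 / s)) else 0)"

lemma poly_times_exp_neg_tendsto_0:
  "((\<lambda>x::real. poly P x * exp (- x)) \<longlongrightarrow> 0) at_top"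
proof -
  have eq: "poly P x * exp (- x) = (\<Sum>i\<le>degree P. coeff P i * (x ^ i / exp x))" for x :: real
    by (simp add: poly_altdef sum_distrib_right exp_minus divide_inverse mult.assoc)
  have "((\<lambda>x. \<Sum>i\<le>degree P. coeff P i * (x ^ i / exp x)) \<longlongrightarrow> (\<Sum>i\<le>degree P. coeff P i * 0)) at_top"
    by (intro tendsto_intros tendsto_power_div_exp_0)
  then show ?thesis unfolding eq by simp
qed

lemma flat_has_derivative:
  "(flat P has_real_derivative flat ([:0,0,1:] * (P - pderiv P)) s) (at s)"
proof (cases s "0::real" rule: linorder_cases)
  case less
  have "((\<lambda>_. 0) has_real_derivative 0) (at s)" by simp
  then have "(flat P has_real_derivative 0) (at s)"
    by (rule has_field_derivative_transform_within_open[where S="{..<0}"]) (use less in \<open>auto simp: flat_def\<close>)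
  then show ?thesis using less by (simp add: flat_def)
next
  case greater
  have "((\<lambda>s. poly P (1 / s) * exp (- (1 / s))) has_real_derivative
     poly P (1 / s) * (exp (- (1 / s)) * (1 / s\<^sup>2)) + poly (pderiv P) (1 / s) * (- (1 / s\<^sup>2)) * exp (- (1 / s))) (at s)"
    using greater by (auto intro!: derivative_eq_intros DERIV_chain2[OF poly_DERIV] simp: power2_eq_square)
  then have "(flat P has_real_derivative
     poly P (1 / s) * (exp (- (1 / s)) * (1 / s\<^sup>2)) + poly (pderiv P) (1 / s) * (- (1 / s\<^sup>2)) * exp (- (1 / s))) (at s)"
    by (rule has_field_derivative_transform_within_open[where S="{0<..}"]) (use greater in \<open>auto simp: flat_def\<close>)
  then show ?thesis using greater by (simp add: flat_def algebra_simps power2_eq_square)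
next
  case equal
  have "((\<lambda>h. poly ([:0,1:] * P) (inverse h) * exp (- inverse h)) \<longlongrightarrow> 0) (at_right 0)"
    using filterlim_compose[OF poly_times_exp_neg_tendsto_0 filterlim_inverse_at_top_right] by blast
  then have r: "((\<lambda>h. flat P h / h) \<longlongrightarrow> 0) (at_right 0)"
    by (rule Lim_transform_eventually)
      (auto simp: flat_def eventually_at_right_less divide_inverse eventually_at intro!: exI[of _ 1])
  have l: "((\<lambda>h. flat P h / h) \<longlongrightarrow> 0) (at_left 0)"
    by (rule tendsto_eventually) (auto simp: flat_def eventually_at intro!: exI[of _ 1])
  have "((\<lambda>h. (flat P (0 + h) - flat P 0) / h) \<longlongrightarrow> 0) (at 0)"
    using filterlim_split_at[OF l r] by (simp add: flat_def)
  then show ?thesis using equal by (simp add: DERIV_def flat_def)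
qed

lemma Ck_flat_comp:
  assumes q: "\<And>k. Ck k q"
  shows "Ck k (\<lambda>z. flat P (q z))"
proof (induction k arbitrary: P)
  case 0
  have "continuous_on UNIV (flat P)"
    using flat_has_derivative by (meson DERIV_isCont continuous_at_imp_continuous_on)
  then show ?case using Ck_continuous[OF q] by (auto intro: continuous_on_compose2)
next
  case (Suc k)
  show ?case
  proof (rule Ck_SucI)
    show "((\<lambda>z. flat P (q z)) has_derivative
        (\<lambda>u. flat ([:0,0,1:] * (P - pderiv P)) (q z) * frechet_derivative q (at z) u)) (at z)" for z
      using has_derivative_compose[OF Ck_has_derivative[OF q] has_field_derivative_imp_has_derivative[OF flat_has_derivative]]
      by auto
    show "Ck k (\<lambda>z. flat ([:0,0,1:] * (P - pderiv P)) (q z) * frechet_derivative q (at z) u)" for u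
      using q[of "Suc k"] by (intro Ck_mult Suc) auto
  qed
qed

definition bump :: "'a::euclidean_space \<Rightarrow> real" where
  "bump z = flat 1 (1 - z \<bullet> z)"

lemma Ck_bump: "Ck k (bump :: 'a::euclidean_space \<Rightarrow> real)"
proof -
  have "Ck k (\<lambda>z::'a. 1 + (-1) * (z \<bullet> z))" for k by (intro Ck_add Ck_mult Ck_const Ck_inner_self)
  then have "Ck k (\<lambda>z::'a. 1 - z \<bullet> z)" for k by simp
  then show ?thesis unfolding bump_def[abs_def] by (rule Ck_flat_comp)
qed

lemma bump_nonneg: "0 \<le> bump z"
  by (auto simp: bump_def flat_def)

lemma bump_eq_0: "1 \<le> norm z \<Longrightarrow> bump z = 0"
  by (auto simp: bump_def flat_def dot_square_norm) (smt (verit) one_le_power)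

text \<open>The normalised primitive of a bump supported in \<open>{0..1}\<close>. Its rescalings, cutting off smoothly
  in time, turn the weak formulation on the open time interval into an identity between two times.\<close>
lemma smooth_step:
  obtains S b :: "real \<Rightarrow> real" where
    "\<And>k. Ck k S" "\<And>s. (S has_real_derivative b s) (at s)" "\<And>s. 0 \<le> b s"
    "\<And>s. s \<le> 0 \<Longrightarrow> S s = 0" "\<And>s. 1 \<le> s \<Longrightarrow> S s = 1" "continuous_on UNIV b"
    "\<And>s. s \<le> 0 \<or> 1 \<le> s \<Longrightarrow> b s = 0"
proof -
  define c where "c = (\<lambda>s::real. flat 1 (s * (1 + (-1) * s)))"
  have cCk: "Ck k c" for k
    unfolding c_def by (intro Ck_flat_comp Ck_mult Ck_add Ck_const Ck_bounded_linear bounded_linear_ident)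
  have cc: "continuous_on UNIV c" using Ck_continuous[OF cCk[of 0]] .
  have c0: "0 \<le> c s" for s by (auto simp: c_def flat_def)
  have cz: "c s = 0" if "s \<le> 0 \<or> 1 \<le> s" for s
    using that by (auto simp: c_def flat_def zero_less_mult_iff)
  have cp: "0 < c s" if "0 < s" "s < 1" for s
    using that by (auto simp: c_def flat_def zero_less_mult_iff)
  obtain F where F: "\<And>s. (F has_real_derivative c s) (at s)"
    using einterval_antiderivative[of "-\<infinity>" "\<infinity>" c] cc
    by (auto simp: continuous_on_eq_continuous_at has_real_derivative_iff_has_vector_derivative)
  have lt: "F 0 < F 1"
  proof -
    have "\<exists>z>0. z < 1 \<and> F 1 - F 0 = (1 - 0) * c z"
      by (rule MVT2) (use F in auto)
    then show ?thesis using cp by fastforce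
  qed
  have F0: "F s = F 0" if "s \<le> 0" for s
  proof (cases "s = 0")
    case False
    then have "\<exists>z>s. z < 0 \<and> F 0 - F s = (0 - s) * c z"
      by (intro MVT2) (use F that in auto)
    then show ?thesis using cz by fastforce
  qed simp
  have F1: "F s = F 1" if "1 \<le> s" for s
  proof (cases "s = 1")
    case False
    then have "\<exists>z>1. z < s \<and> F s - F 1 = (s - 1) * c z"
      by (intro MVT2) (use F that in auto)
    then show ?thesis using cz by fastforce
  qed simp
  define S where "S s = (F s - F 0) / (F 1 - F 0)" for s
  define b where "b s = c s / (F 1 - F 0)" for s
  have Sd: "(S has_real_derivative b s) (at s)" for s
    unfolding S_def b_def using lt by (auto intro!: derivative_eq_intros F)
  show ?thesis
  proof (rule that[of S b])
    show "Ck k S" for k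
    proof (cases k)
      case 0
      then show ?thesis using Sd by (auto intro!: continuous_at_imp_continuous_on DERIV_isCont)
    next
      case (Suc n)
      have "Ck n (\<lambda>s. (inverse (F 1 - F 0) * u) * c s)" for u by (intro Ck_mult Ck_const cCk)
      then have "Ck n (\<lambda>s. b s * u)" for u by (simp add: b_def field_simps)
      then show ?thesis unfolding Suc
        by (intro Ck_SucI[where D="\<lambda>s u. b s * u"]) (use Sd in \<open>auto simp: has_field_derivative_def mult_commute_abs\<close>)
    qed
    show "continuous_on UNIV b" unfolding b_def using lt by (intro continuous_intros cc) auto
    show "S s = 0" if "s \<le> 0" for s by (simp add: S_def F0[OF that])
    show "S s = 1" if "1 \<le> s" for s using lt by (simp add: S_def F1[OF that])
    show "0 \<le> b s" for s using lt c0[of s] by (simp add: b_def)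
    show "b s = 0" if "s \<le> 0 \<or> 1 \<le> s" for s by (simp add: b_def cz[OF that])
  qed (rule Sd)
qed


section \<open>Mollification\<close>

lemma Ck_derivative_vanishes:
  assumes f: "Ck (Suc k) f" and z: "\<And>z. R < norm z \<Longrightarrow> f z = 0" and w: "R < norm w"
  shows "frechet_derivative f (at w) u = 0"
proof -
  have "((\<lambda>_. 0) has_derivative frechet_derivative f (at w)) (at w)"
  proof (rule has_derivative_transform_within_open[OF Ck_has_derivative[OF f]])
    show "open {z. R < norm z}" by (intro open_Collect_less continuous_intros)
  qed (use w z in auto)
  then have "frechet_derivative f (at w) = (\<lambda>_. 0)"
    using has_derivative_unique has_derivative_const by blast
  then show ?thesis by simp
qed

lemma derivative_basis_sum:
  fixes f :: "'a::euclidean_space \<Rightarrow> real"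
  assumes "Ck (Suc k) f"
  shows "frechet_derivative f (at z) u = (\<Sum>i\<in>Basis. (u \<bullet> i) * frechet_derivative f (at z) i)"
proof -
  have "linear (frechet_derivative f (at z))"
    using Ck_has_derivative[OF assms] has_derivative_linear by blast
  then have "frechet_derivative f (at z) (\<Sum>i\<in>Basis. (u \<bullet> i) *\<^sub>R i) = (\<Sum>i\<in>Basis. (u \<bullet> i) * frechet_derivative f (at z) i)"
    by (simp add: linear_sum linear_cmul)
  then show ?thesis by (simp add: euclidean_representation)
qed

lemma compact_support_derivative_bounded:
  fixes f :: "'a::euclidean_space \<Rightarrow> real"
  assumes f: "Ck (Suc 0) f" and z: "\<And>z. R < norm z \<Longrightarrow> f z = 0"
  shows "\<exists>C\<ge>0. \<forall>z u. \<bar>frechet_derivative f (at z) u\<bar> \<le> C * norm u"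
proof -
  have "\<exists>c\<ge>0. \<forall>z. \<bar>frechet_derivative f (at z) i\<bar> \<le> c" for i
  proof -
    have "continuous_on UNIV (\<lambda>z. frechet_derivative f (at z) i)" using f by simp
    then have "compact ((\<lambda>z. frechet_derivative f (at z) i) ` cball 0 R)"
      by (intro compact_continuous_image) (auto intro: continuous_on_subset)
    then obtain c where c: "\<And>z. z \<in> cball 0 R \<Longrightarrow> \<bar>frechet_derivative f (at z) i\<bar> \<le> c"
      by (fastforce dest: compact_imp_bounded simp: bounded_iff)
    have "\<bar>frechet_derivative f (at z) i\<bar> \<le> max 0 c" for z
      using c[of z] Ck_derivative_vanishes[OF f z, where w=z and u=i] by (cases "norm z \<le> R") auto
    then show ?thesis by (intro exI[of _ "max 0 c"]) auto
  qed
  then obtain c where c: "\<And>i. 0 \<le> c i" "\<And>i z. \<bar>frechet_derivative f (at z) i\<bar> \<le> c i" by metis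
  show ?thesis
  proof (intro exI[of _ "\<Sum>i\<in>Basis. c i"] conjI allI)
    fix z u :: 'a
    have "\<bar>\<Sum>i\<in>Basis. (u \<bullet> i) * frechet_derivative f (at z) i\<bar> \<le> (\<Sum>i\<in>Basis. \<bar>(u \<bullet> i) * frechet_derivative f (at z) i\<bar>)"
      by (rule sum_abs)
    also have "\<dots> \<le> (\<Sum>i\<in>Basis. norm u * c i)"
      unfolding abs_mult using c by (intro sum_mono mult_mono) (auto simp: Basis_le_norm)
    finally show "\<bar>frechet_derivative f (at z) u\<bar> \<le> (\<Sum>i\<in>Basis. c i) * norm u"
      unfolding derivative_basis_sum[OF f, of z u] by (simp add: sum_distrib_left mult.commute)
  qed (use c in \<open>auto intro: sum_nonneg\<close>)
qed

lemma lipschitz_from_derivative: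
  fixes f :: "'a::euclidean_space \<Rightarrow> real"
  assumes f: "Ck (Suc 0) f" and C: "0 \<le> C" "\<And>z u. \<bar>frechet_derivative f (at z) u\<bar> \<le> C * norm u"
  shows "\<bar>f x - f y\<bar> \<le> C * norm (x - y)"
proof -
  have "onorm (frechet_derivative f (at z)) \<le> C" for z
    by (rule onorm_le) (use C in simp)
  then show ?thesis
    using differentiable_bound[of UNIV f "\<lambda>z. frechet_derivative f (at z)" C x y] Ck_has_derivative[OF f] by simp
qed

text \<open>Apply the boundedness of the derivative to \<open>f\<close> and, direction by direction over the basis, to
  its partial derivatives.\<close>
lemma compact_support_derivative_lipschitz:
  fixes f :: "'a::euclidean_space \<Rightarrow> real"
  assumes f: "\<And>k. Ck k f" and z: "\<And>z. R < norm z \<Longrightarrow> f z = 0"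
  shows "\<exists>C\<ge>0. (\<forall>z u. \<bar>frechet_derivative f (at z) u\<bar> \<le> C * norm u) \<and>
    (\<forall>z w u. \<bar>frechet_derivative f (at z) u - frechet_derivative f (at w) u\<bar> \<le> C * norm (z - w) * norm u)"
proof -
  obtain C0 where C0: "0 \<le> C0" "\<And>z u. \<bar>frechet_derivative f (at z) u\<bar> \<le> C0 * norm u"
    using compact_support_derivative_bounded[OF f z, of R] by auto
  have "\<exists>c\<ge>0. \<forall>z w. \<bar>frechet_derivative f (at z) i - frechet_derivative f (at w) i\<bar> \<le> c * norm (z - w)" for i
  proof -
    have 1: "Ck (Suc 0) (\<lambda>z. frechet_derivative f (at z) i)" using f[of "Suc (Suc 0)"] by simp
    have z': "frechet_derivative f (at w) i = 0" if "R < norm w" for w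
      by (rule Ck_derivative_vanishes[OF f[of "Suc 0"], where R=R]) (use z that in auto)
    obtain c where c: "0 \<le> c" "\<And>z u. \<bar>frechet_derivative (\<lambda>z. frechet_derivative f (at z) i) (at z) u\<bar> \<le> c * norm u"
      using compact_support_derivative_bounded[OF 1 z', of R] by auto
    show ?thesis using lipschitz_from_derivative[OF 1 c] c(1) by auto
  qed
  then obtain c where c: "\<And>i. 0 \<le> c i" "\<And>i z w. \<bar>frechet_derivative f (at z) i - frechet_derivative f (at w) i\<bar> \<le> c i * norm (z - w)"
    by metis
  define C where "C = C0 + (\<Sum>i\<in>Basis. c i)"
  have s: "0 \<le> (\<Sum>i\<in>(Basis::'a set). c i)" using c by (auto intro: sum_nonneg)
  show ?thesis
  proof (intro exI[of _ C] conjI allI)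
    show "0 \<le> C" using C0 s by (simp add: C_def)
    show "\<bar>frechet_derivative f (at z) u\<bar> \<le> C * norm u" for z u
      using C0(2)[of z u] s by (simp add: C_def distrib_right add_increasing2)
    fix z w u :: 'a
    have "\<bar>(\<Sum>i\<in>Basis. (u \<bullet> i) * (frechet_derivative f (at z) i - frechet_derivative f (at w) i))\<bar>
       \<le> (\<Sum>i\<in>Basis. \<bar>(u \<bullet> i) * (frechet_derivative f (at z) i - frechet_derivative f (at w) i)\<bar>)"
      by (rule sum_abs)
    also have "\<dots> \<le> (\<Sum>i\<in>Basis. norm u * (c i * norm (z - w)))"
      unfolding abs_mult using c by (intro sum_mono mult_mono) (auto simp: Basis_le_norm)
    also have "\<dots> = (\<Sum>i\<in>Basis. c i) * norm (z - w) * norm u"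
      by (simp add: sum_distrib_left sum_distrib_right mult_ac)
    also have "\<dots> \<le> C * norm (z - w) * norm u"
      using C0 by (intro mult_right_mono) (auto simp: C_def)
    finally show "\<bar>frechet_derivative f (at z) u - frechet_derivative f (at w) u\<bar> \<le> C * norm (z - w) * norm u"
      unfolding derivative_basis_sum[OF f[of "Suc 0"], of _ u] by (simp add: algebra_simps sum_subtractf)
  qed
qed

text \<open>Differentiation under the integral sign. The convolution is taken over a box, which is no restriction for
  compactly supported \<open>f\<close>, so that the Leibniz rule for compact domains applies.\<close>
lemma convolution_has_derivative:
  fixes f \<rho> :: "'a::euclidean_space \<Rightarrow> real"
  assumes f: "continuous_on UNIV f" and \<rho>: "\<And>k. Ck k \<rho>"
  shows "((\<lambda>x. integral (cbox a b) (\<lambda>y. f y * \<rho> (x - y))) has_derivative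
     (\<lambda>u. integral (cbox a b) (\<lambda>y. f y * frechet_derivative \<rho> (at (x - y)) u))) (at x)"
proof -
  define D where "D x y = f y *\<^sub>R Blinfun (frechet_derivative \<rho> (at (x - y)))" for x y
  have bl: "bounded_linear (frechet_derivative \<rho> (at z))" for z
    using Ck_has_derivative[OF \<rho>] has_derivative_bounded_linear by blast
  have D: "blinfun_apply (D x y) u = f y * frechet_derivative \<rho> (at (x - y)) u" for x y u
    by (simp add: D_def blinfun.scaleR_left bounded_linear_Blinfun_apply[OF bl])
  have c: "continuous_on (S \<times> T) (\<lambda>(x, y). D x y)" for S T
  proof (rule continuous_on_blinfun_componentwise)
    fix i :: 'a
    have "continuous_on UNIV (\<lambda>z. frechet_derivative \<rho> (at z) i)" using \<rho>[of "Suc 0"] by simp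
    then have "continuous_on (S \<times> T) (\<lambda>z. frechet_derivative \<rho> (at (fst z - snd z)) i)"
      by (rule continuous_on_compose2) (auto intro!: continuous_intros)
    moreover have "continuous_on (S \<times> T) (\<lambda>z. f (snd z))"
      by (rule continuous_on_compose2[OF f]) (auto intro!: continuous_intros)
    ultimately show "continuous_on (S \<times> T) (\<lambda>z. blinfun_apply (case z of (x, y) \<Rightarrow> D x y) i)"
      by (simp add: case_prod_unfold D continuous_on_mult)
  qed
  have "((\<lambda>x. integral (cbox a b) (\<lambda>y. f y * \<rho> (x - y))) has_derivative integral (cbox a b) (D x)) (at x within UNIV)"
  proof (rule leibniz_rule)
    fix x y :: 'a
    have "((\<lambda>x. x - y) has_derivative (\<lambda>u. u)) (at x)" by (auto intro!: derivative_eq_intros)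
    from has_derivative_compose[OF this Ck_has_derivative[OF \<rho>]]
    have "((\<lambda>x. f y * \<rho> (x - y)) has_derivative (\<lambda>u. f y * frechet_derivative \<rho> (at (x - y)) u)) (at x)"
      by (intro has_derivative_mult_right)
    then show "((\<lambda>x. f y * \<rho> (x - y)) has_derivative blinfun_apply (D x y)) (at x within UNIV)"
      by (simp add: D[abs_def])
    have "continuous_on (cbox a b) (\<lambda>y. \<rho> (x - y))"
      by (rule continuous_on_compose2[OF Ck_continuous[OF \<rho>[of 0]]]) (auto intro!: continuous_intros)
    then have "continuous_on (cbox a b) (\<lambda>y. f y * \<rho> (x - y))"
      using continuous_on_subset[OF f, of "cbox a b"] by (intro continuous_on_mult) auto
    then show "(\<lambda>y. f y * \<rho> (x - y)) integrable_on cbox a b" by (rule integrable_continuous)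
  qed (use c in auto)
  moreover have "blinfun_apply (integral (cbox a b) (D x)) u = integral (cbox a b) (\<lambda>y. f y * frechet_derivative \<rho> (at (x - y)) u)" for u
  proof -
    have "continuous_on (cbox a b) (\<lambda>y. (\<lambda>(x, y). D x y) (x, y))"
      by (rule continuous_on_compose2[OF c[of UNIV UNIV]]) (auto intro!: continuous_on_Pair continuous_intros)
    then have "continuous_on (cbox a b) (D x)" by simp
    then show ?thesis by (subst blinfun_apply_integral) (auto intro!: integrable_continuous simp: D)
  qed
  then have "blinfun_apply (integral (cbox a b) (D x)) = (\<lambda>u. integral (cbox a b) (\<lambda>y. f y * frechet_derivative \<rho> (at (x - y)) u))"
    by (rule ext)
  ultimately show ?thesis by simp
qed

lemma Ck_convolution:
  fixes f \<rho> :: "'a::euclidean_space \<Rightarrow> real"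
  assumes f: "continuous_on UNIV f"
  shows "(\<And>k. Ck k \<rho>) \<Longrightarrow> Ck k (\<lambda>x. integral (cbox a b) (\<lambda>y. f y * \<rho> (x - y)))"
proof (induction k arbitrary: \<rho>)
  case 0
  have "continuous_on UNIV (\<lambda>x. integral (cbox a b) (\<lambda>y. f y * \<rho> (x - y)))"
    using convolution_has_derivative[OF f 0] has_derivative_continuous
    by (blast intro: continuous_at_imp_continuous_on)
  then show ?case by simp
next
  case (Suc k)
  show ?case
  proof (rule Ck_SucI[OF convolution_has_derivative[OF f Suc.prems]])
    show "Ck k (\<lambda>x. integral (cbox a b) (\<lambda>y. f y * frechet_derivative \<rho> (at (x - y)) u))" for u
    proof (rule Suc.IH)
      show "Ck k (\<lambda>z. frechet_derivative \<rho> (at z) u)" for k using Suc.prems[of "Suc k"] by simp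
    qed
  qed
qed

lemma integrable_lborel_compact_support:
  fixes g :: "'a::euclidean_space \<Rightarrow> real"
  assumes g: "continuous_on UNIV g" and z: "\<And>y. y \<notin> S \<Longrightarrow> g y = 0" and S: "compact S"
  shows "integrable lborel g"
proof -
  have "(\<lambda>x. indicator S x *\<^sub>R g x) = g" using z by (auto simp: indicator_def fun_eq_iff)
  then show ?thesis using borel_integrable_compact[OF S continuous_on_subset[OF g subset_UNIV]] by simp
qed

lemma lborel_integral_cbox:
  fixes g :: "'a::euclidean_space \<Rightarrow> real"
  assumes g: "continuous_on UNIV g" and z: "\<And>y. y \<notin> cbox a b \<Longrightarrow> g y = 0"
  shows "(\<integral>y. g y \<partial>lborel) = integral (cbox a b) g"
proof -
  have "(\<lambda>x. indicator (cbox a b) x *\<^sub>R g x) = g" using z by (auto simp: indicator_def fun_eq_iff)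
  moreover have "set_integrable lborel (cbox a b) g"
    using borel_integrable_compact[OF compact_cbox continuous_on_subset[OF g subset_UNIV], of a b] by (simp add: set_integrable_def)
  ultimately show ?thesis using set_borel_integral_eq_integral(2)[of "cbox a b" g] by (simp add: set_lebesgue_integral_def)
qed

text \<open>Holds for every \<open>g\<close>: if \<open>g\<close> is not Borel measurable, neither is its reflection,
  and both integrals are zero by convention.\<close>
lemma lborel_integral_reflect:
  fixes g :: "'a::euclidean_space \<Rightarrow> real"
  shows "(\<integral>y. g (x - y) \<partial>lborel) = (\<integral>y. g y \<partial>lborel)"
proof (cases "g \<in> borel_measurable borel")
  case [measurable]: True
  have "(lborel :: 'a measure) = distr lborel borel (\<lambda>y. x - y)"
    using lborel_affine[of "-1" x] by (simp add: density_1 one_ennreal_def[symmetric])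
  then have "(\<integral>y. g y \<partial>lborel) = (\<integral>y. g y \<partial>distr lborel borel (\<lambda>y. x - y))" by simp
  also have "\<dots> = (\<integral>y. g (x - y) \<partial>lborel)" by (rule integral_distr) auto
  finally show ?thesis by simp
next
  case False
  have "(\<lambda>y. g (x - y)) \<notin> borel_measurable borel"
  proof
    assume "(\<lambda>y. g (x - y)) \<in> borel_measurable borel"
    then have "(\<lambda>y. g (x - y)) \<circ> (\<lambda>y. x - y) \<in> borel_measurable borel"
      by (intro measurable_comp[where N=borel]) auto
    then show False using False by (simp add: o_def)
  qed
  then have "\<not> integrable lborel (\<lambda>y. g (x - y))" "\<not> integrable lborel g"
    using False by (auto dest: borel_measurable_integrable)
  then show ?thesis by (simp add: not_integrable_integral_eq)
qed

definition mollifier :: "real \<Rightarrow> 'a::euclidean_space \<Rightarrow> real" where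
  "mollifier \<epsilon> z = bump (z /\<^sub>R \<epsilon>) / (\<integral>y. bump (y /\<^sub>R \<epsilon>) \<partial>(lborel :: 'a measure))"

lemma mollifier_props:
  fixes z :: "'a::euclidean_space"
  assumes "0 < \<epsilon>"
  shows "0 \<le> mollifier \<epsilon> z" "\<epsilon> < norm z \<Longrightarrow> mollifier \<epsilon> z = 0" "Ck k (mollifier \<epsilon> :: 'a \<Rightarrow> real)"
    "integrable lborel (mollifier \<epsilon> :: 'a \<Rightarrow> real)" "(\<integral>z. mollifier \<epsilon> z \<partial>(lborel :: 'a measure)) = 1"
proof -
  define J where "J = (\<integral>y. bump (y /\<^sub>R \<epsilon>) \<partial>(lborel :: 'a measure))"
  have b: "Ck k (\<lambda>z::'a. bump (z /\<^sub>R \<epsilon>))" for k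
    using Ck_affine[OF bounded_linear_scaleR_right Ck_bump, of k 0] by simp
  have z: "bump (z /\<^sub>R \<epsilon>) = 0" if "\<epsilon> < norm z" for z :: 'a
    using that assms by (intro bump_eq_0) (simp add: field_simps)
  have i: "integrable lborel (\<lambda>y::'a. bump (y /\<^sub>R \<epsilon>))"
    by (rule integrable_lborel_compact_support[where S="cball 0 \<epsilon>"]) (use Ck_continuous[OF b[of 0]] z in auto)
  have J: "0 < J"
  proof -
    \<comment> \<open>On the ball of radius \<open>\<epsilon> / 2\<close> one has \<open>1 - \<bar>z\<bar>\<^sup>2 \<ge>
      3/4\<close>, which keeps the bump away from zero.\<close>
    have lb: "exp (- (4/3)) \<le> bump (y /\<^sub>R \<epsilon>)" if "y \<in> cball 0 (\<epsilon>/2)" for y :: 'a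
    proof -
      have "norm (y /\<^sub>R \<epsilon>) \<le> 1/2" using that assms by (simp add: field_simps)
      then have "(y /\<^sub>R \<epsilon>) \<bullet> (y /\<^sub>R \<epsilon>) \<le> (1/2)\<^sup>2" unfolding dot_square_norm by (intro power_mono) auto
      then have "3/4 \<le> 1 - (y /\<^sub>R \<epsilon>) \<bullet> (y /\<^sub>R \<epsilon>)" by (simp add: power2_eq_square)
      then have "1 / (1 - (y /\<^sub>R \<epsilon>) \<bullet> (y /\<^sub>R \<epsilon>)) \<le> 4/3" "0 < 1 - (y /\<^sub>R \<epsilon>) \<bullet> (y /\<^sub>R \<epsilon>)" by (auto simp: divide_le_eq)
      then show ?thesis by (simp add: bump_def flat_def)
    qed
    have "0 < exp (- (4/3)) * measure lborel (cball (0::'a) (\<epsilon>/2))"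
      using content_cball_pos[of "\<epsilon>/2" "0::'a"] assms by simp
    also have "\<dots> = (\<integral>y. exp (- (4/3)) * indicator (cball (0::'a) (\<epsilon>/2)) y \<partial>lborel)" by simp
    also have "\<dots> \<le> J" unfolding J_def
    proof (rule integral_mono)
      show "integrable lborel (\<lambda>y. exp (- (4/3)) * indicator (cball (0::'a) (\<epsilon>/2)) y :: real)"
        using emeasure_lborel_cball_finite[of "0::'a" "\<epsilon>/2"] by (intro integrable_mult_right integrable_real_indicator) auto
    qed (use i lb bump_nonneg in \<open>auto simp: indicator_def\<close>)
    finally show ?thesis .
  qed
  show "0 \<le> mollifier \<epsilon> z" using J by (simp add: mollifier_def bump_nonneg J_def)
  show "\<epsilon> < norm z \<Longrightarrow> mollifier \<epsilon> z = 0" by (simp add: mollifier_def z)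
  have m: "mollifier \<epsilon> = (\<lambda>z::'a. inverse J * bump (z /\<^sub>R \<epsilon>))" by (simp add: mollifier_def fun_eq_iff J_def field_simps)
  show "Ck k (mollifier \<epsilon> :: 'a \<Rightarrow> real)" unfolding m by (intro Ck_mult Ck_const b)
  show "integrable lborel (mollifier \<epsilon> :: 'a \<Rightarrow> real)" unfolding m using i by simp
  show "(\<integral>z. mollifier \<epsilon> z \<partial>(lborel :: 'a measure)) = 1" unfolding m using J i by (simp add: J_def)
qed

definition mollify :: "real \<Rightarrow> ('a::euclidean_space \<Rightarrow> real) \<Rightarrow> 'a \<Rightarrow> real" where
  "mollify \<epsilon> f x = (\<integral>y. f y * mollifier \<epsilon> (x - y) \<partial>lborel)"

lemma mollify_alt: "mollify \<epsilon> f x = (\<integral>y. f (x - y) * mollifier \<epsilon> y \<partial>lborel)"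
  unfolding mollify_def using lborel_integral_reflect[of "\<lambda>y. f y * mollifier \<epsilon> (x - y)" x] by simp

lemma mollify_integrable:
  fixes f :: "'a::euclidean_space \<Rightarrow> real"
  assumes "0 < \<epsilon>" "continuous_on UNIV f"
  shows "integrable lborel (\<lambda>y. f (x - y) * mollifier \<epsilon> y)"
  by (rule integrable_lborel_compact_support[where S="cball 0 \<epsilon>"])
     (use mollifier_props[OF assms(1)] Ck_continuous[OF mollifier_props(3)[OF assms(1), of 0]] in
       \<open>auto simp: not_le intro!: continuous_on_mult continuous_on_compose2[OF assms(2)] continuous_intros\<close>)

text \<open>The mollifier is a probability density on the ball of radius \<open>\<epsilon>\<close>, so only values at
  points shifted by at most \<open>\<epsilon>\<close> are compared. All bounds on mollifications below are
  instances.\<close>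
lemma mollify_diff_le:
  fixes f g :: "'a::euclidean_space \<Rightarrow> real"
  assumes e: "0 < \<epsilon>" and f: "continuous_on UNIV f" and g: "continuous_on UNIV g"
    and le: "\<And>y. norm y \<le> \<epsilon> \<Longrightarrow> \<bar>f (x - y) - g (x' - y)\<bar> \<le> c"
  shows "\<bar>mollify \<epsilon> f x - mollify \<epsilon> g x'\<bar> \<le> c"
proof -
  note m = mollifier_props[OF e, where 'a='a]
  have "mollify \<epsilon> f x - mollify \<epsilon> g x' = (\<integral>y. (f (x - y) - g (x' - y)) * mollifier \<epsilon> y \<partial>lborel)"
    unfolding mollify_alt using mollify_integrable[OF e f] mollify_integrable[OF e g]
    by (subst Bochner_Integration.integral_diff[symmetric]) (auto simp: algebra_simps)
  also have "\<bar>\<dots>\<bar> \<le> (\<integral>y. c * mollifier \<epsilon> y \<partial>(lborel :: 'a measure))"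
    unfolding real_norm_def[symmetric]
  proof (rule order_trans[OF integral_norm_bound integral_mono])
    have "integrable lborel (\<lambda>y. (f (x - y) - g (x' - y)) * mollifier \<epsilon> y)"
      using Bochner_Integration.integrable_diff[OF mollify_integrable[OF e f, of x] mollify_integrable[OF e g, of x']] by (simp add: algebra_simps)
    then show "integrable lborel (\<lambda>y. norm ((f (x - y) - g (x' - y)) * mollifier \<epsilon> y))" by simp
    show "integrable lborel (\<lambda>y::'a. c * mollifier \<epsilon> y)" using m(4) by simp
    show "norm ((f (x - y) - g (x' - y)) * mollifier \<epsilon> y) \<le> c * mollifier \<epsilon> y" for y
      using le[of y] m(1)[of y] m(2)[of y] by (cases "norm y \<le> \<epsilon>") (auto simp: abs_mult intro!: mult_right_mono)
  qed
  also have "\<dots> = c" using m(5) by simp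
  finally show ?thesis .
qed

lemma mollify_lipschitz:
  fixes f :: "'a::euclidean_space \<Rightarrow> real"
  assumes e: "0 < \<epsilon>" and f: "K-lipschitz_on UNIV f"
  shows "K-lipschitz_on UNIV (mollify \<epsilon> f)"
proof (rule lipschitz_onI[OF _ lipschitz_on_nonneg[OF f]])
  fix x y
  have "\<bar>mollify \<epsilon> f x - mollify \<epsilon> f y\<bar> \<le> K * dist x y"
  proof (rule mollify_diff_le[OF e])
    fix z show "\<bar>f (x - z) - f (y - z)\<bar> \<le> K * dist x y"
      using lipschitz_onD[OF f, of "x - z" "y - z"] by (simp add: dist_norm)
  qed (use lipschitz_on_continuous_on[OF f] in auto)
  then show "dist (mollify \<epsilon> f x) (mollify \<epsilon> f y) \<le> K * dist x y" by (simp add: dist_real_def)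
qed

lemma mollify_bounded:
  fixes f :: "'a::euclidean_space \<Rightarrow> real"
  assumes e: "0 < \<epsilon>" and f: "continuous_on UNIV f" "\<And>x. \<bar>f x\<bar> \<le> B"
  shows "\<bar>mollify \<epsilon> f x\<bar> \<le> B"
proof -
  have "\<bar>mollify \<epsilon> f x - mollify \<epsilon> (\<lambda>_. 0) x\<bar> \<le> B"
    by (rule mollify_diff_le[OF e f(1)]) (use f in auto)
  then show ?thesis by (simp add: mollify_def)
qed

lemma mollify_close:
  fixes f :: "'a::euclidean_space \<Rightarrow> real"
  assumes e: "0 < \<epsilon>" and f: "K-lipschitz_on UNIV f"
  shows "\<bar>mollify \<epsilon> f x - f x\<bar> \<le> K * \<epsilon>"
proof -
  have K: "0 \<le> K" using lipschitz_on_nonneg[OF f] .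
  have c: "mollify \<epsilon> (\<lambda>_. f x) x = f x"
    unfolding mollify_alt using mollifier_props(5)[OF e, where 'a='a] by simp
  have "\<bar>mollify \<epsilon> f x - mollify \<epsilon> (\<lambda>_. f x) x\<bar> \<le> K * \<epsilon>"
  proof (rule mollify_diff_le[OF e])
    fix y :: 'a assume "norm y \<le> \<epsilon>"
    then show "\<bar>f (x - y) - f x\<bar> \<le> K * \<epsilon>"
      using lipschitz_onD[OF f, of "x - y" x] K mult_left_mono[of "norm y" \<epsilon> K] by (simp add: dist_norm)
  qed (use lipschitz_on_continuous_on[OF f] in auto)
  then show ?thesis unfolding c .
qed

text \<open>Mollification commutes with translations. It commutes with \<open>x \<mapsto> x + W x\<close> up to the
  variation of \<open>W\<close> on balls of radius \<open>\<epsilon>\<close>; the resulting factor \<open>c\<close> is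
  what makes the error of an Euler step proportional to the length of the step.\<close>
lemma mollify_commutator:
  fixes g :: "'a::euclidean_space \<Rightarrow> real"
  assumes e: "0 < \<epsilon>" and g: "K-lipschitz_on UNIV g" and W: "c-lipschitz_on UNIV W"
  shows "\<bar>mollify \<epsilon> (\<lambda>z. g (z + W z)) x - mollify \<epsilon> g (x + W x)\<bar> \<le> K * c * \<epsilon>"
proof (rule mollify_diff_le[OF e])
  have K: "0 \<le> K" "0 \<le> c" using lipschitz_on_nonneg[OF g] lipschitz_on_nonneg[OF W] by auto
  have gc: "continuous_on UNIV g" "continuous_on UNIV W" using lipschitz_on_continuous_on[OF g] lipschitz_on_continuous_on[OF W] by auto
  show "continuous_on UNIV (\<lambda>z. g (z + W z))"
    by (rule continuous_on_compose2[OF gc(1)]) (auto intro!: continuous_intros gc)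
  fix y :: 'a assume y: "norm y \<le> \<epsilon>"
  have "\<bar>g (x - y + W (x - y)) - g (x + W x - y)\<bar> \<le> K * norm (W (x - y) - W x)"
    using lipschitz_onD[OF g, of "x - y + W (x - y)" "x + W x - y"] by (simp add: dist_norm)
  also have "\<dots> \<le> K * (c * norm y)"
    using lipschitz_onD[OF W, of "x - y" x] K by (intro mult_left_mono) (auto simp: dist_norm)
  also have "\<dots> \<le> K * (c * \<epsilon>)" using y K by (intro mult_left_mono) auto
  finally show "\<bar>g (x - y + W (x - y)) - g (x + W x - y)\<bar> \<le> K * c * \<epsilon>" by (simp add: mult.assoc)
qed (use lipschitz_on_continuous_on[OF g] in auto)

text \<open>The constant depends on \<open>\<epsilon>\<close>, on the bound and on the support of \<open>f\<close>, but
  not on \<open>f\<close> itself: all derivatives fall on the mollifier. This uniformity allows the same constant in all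
  the Euler steps.\<close>
lemma mollify_smooth:
  fixes M B :: real
  assumes e: "0 < \<epsilon>" and B: "0 \<le> B"
  shows "\<exists>C\<ge>0. \<forall>f :: 'a::euclidean_space \<Rightarrow> real. continuous_on UNIV f \<longrightarrow> (\<forall>x. \<bar>f x\<bar> \<le> B) \<longrightarrow> (\<forall>x. M < norm x \<longrightarrow> f x = 0) \<longrightarrow>
       (\<forall>k. Ck k (mollify \<epsilon> f)) \<and>
       (\<forall>x. M + \<epsilon> < norm x \<longrightarrow> mollify \<epsilon> f x = 0) \<and>
       (\<forall>x u. \<bar>frechet_derivative (mollify \<epsilon> f) (at x) u\<bar> \<le> C * norm u) \<and>
       (\<forall>x y u. \<bar>frechet_derivative (mollify \<epsilon> f) (at x) u - frechet_derivative (mollify \<epsilon> f) (at y) u\<bar> \<le> C * norm (x - y) * norm u)"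
proof -
  note m = mollifier_props[OF e, where 'a='a]
  obtain a where ab: "cball (0::'a) M \<subseteq> cbox (- a) a"
    by (rule bounded_subset_cbox_symmetric[OF bounded_cball])
  obtain c where c: "0 \<le> c" "\<And>(z::'a) u. \<bar>frechet_derivative (mollifier \<epsilon>) (at z) u\<bar> \<le> c * norm u"
    "\<And>(z::'a) w u. \<bar>frechet_derivative (mollifier \<epsilon>) (at z) u - frechet_derivative (mollifier \<epsilon>) (at w) u\<bar> \<le> c * norm (z - w) * norm u"
    using compact_support_derivative_lipschitz[of "mollifier \<epsilon>" \<epsilon>, OF m(3) m(2)] by auto
  define C where "C = B * c * Henstock_Kurzweil_Integration.content (cbox (- a) a)"
  have C0: "0 \<le> C" using B c by (simp add: C_def)
  show ?thesis
  proof (rule exI[of _ C], rule conjI[OF C0], intro allI impI)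
    fix f :: "'a \<Rightarrow> real"
    assume f0: "continuous_on UNIV f" "\<forall>x. \<bar>f x\<bar> \<le> B" "\<forall>x. M < norm x \<longrightarrow> f x = 0"
    have f: "continuous_on UNIV f" "\<And>x. \<bar>f x\<bar> \<le> B" and z: "\<And>x. M < norm x \<Longrightarrow> f x = 0"
      using f0 by auto
    define g where "g x = integral (cbox (- a) a) (\<lambda>y. f y * mollifier \<epsilon> (x - y))" for x
    have cm: "continuous_on UNIV (mollifier \<epsilon> :: 'a \<Rightarrow> real)" using Ck_continuous[OF m(3)[of 0]] .
    have mg: "mollify \<epsilon> f = g"
      unfolding mollify_def g_def
    proof (intro ext lborel_integral_cbox)
      show "continuous_on UNIV (\<lambda>y. f y * mollifier \<epsilon> (x - y))" for x
        by (intro continuous_on_mult f continuous_on_compose2[OF cm]) (auto intro!: continuous_intros)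
      show "f y * mollifier \<epsilon> (x - y) = 0" if "y \<notin> cbox (- a) a" for x y
      proof -
        have "y \<notin> cball 0 M" using that ab by blast
        then show ?thesis using z[of y] by simp
      qed
    qed
    have Dg: "frechet_derivative g (at x) = (\<lambda>u. integral (cbox (- a) a) (\<lambda>y. f y * frechet_derivative (mollifier \<epsilon>) (at (x - y)) u))" for x
      using frechet_derivative_at[OF convolution_has_derivative[OF f(1) m(3)]] by (simp add: g_def[abs_def])
    have cd: "continuous_on UNIV (\<lambda>y. f y * frechet_derivative (mollifier \<epsilon>) (at (x - y)) u)" for x u
    proof -
      have "continuous_on UNIV (\<lambda>z::'a. frechet_derivative (mollifier \<epsilon>) (at z) u)" using m(3)[of "Suc 0"] by simp
      then have "continuous_on UNIV (\<lambda>y. frechet_derivative (mollifier \<epsilon>) (at (x - y)) u)"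
        by (rule continuous_on_compose2) (auto intro!: continuous_intros)
      then show ?thesis by (intro continuous_on_mult f)
    qed
    have ib: "\<bar>integral (cbox (- a) a) h\<bar> \<le> k * Henstock_Kurzweil_Integration.content (cbox (- a) a)" if "continuous_on UNIV h" "\<And>y. \<bar>h y\<bar> \<le> k" "0 \<le> k" for h k
      using has_integral_bound[of k h "integral (cbox (- a) a) h" "- a" a] that integrable_continuous[OF continuous_on_subset[OF that(1) subset_UNIV]]
      by (auto simp: has_integral_integral)
    show "(\<forall>k. Ck k (mollify \<epsilon> f)) \<and> (\<forall>x. M + \<epsilon> < norm x \<longrightarrow> mollify \<epsilon> f x = 0) \<and>
       (\<forall>x u. \<bar>frechet_derivative (mollify \<epsilon> f) (at x) u\<bar> \<le> C * norm u) \<and>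
       (\<forall>x y u. \<bar>frechet_derivative (mollify \<epsilon> f) (at x) u - frechet_derivative (mollify \<epsilon> f) (at y) u\<bar> \<le> C * norm (x - y) * norm u)"
    proof (intro conjI allI impI)
      show "Ck k (mollify \<epsilon> f)" for k unfolding mg g_def using Ck_convolution[OF f(1) m(3)] by blast
    next
      fix x :: 'a assume x: "M + \<epsilon> < norm x"
      have "f y * mollifier \<epsilon> (x - y) = 0" for y
        using z[of y] m(2)[of "x - y"] x norm_triangle_ineq2[of x y] by (cases "M < norm y") auto
      then have "(\<lambda>y. f y * mollifier \<epsilon> (x - y)) = (\<lambda>_. 0)" by (rule ext)
      then show "mollify \<epsilon> f x = 0" by (simp add: mollify_def)
    next
      fix x u
      show "\<bar>frechet_derivative (mollify \<epsilon> f) (at x) u\<bar> \<le> C * norm u"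
      proof -
        have "\<bar>f y * frechet_derivative (mollifier \<epsilon>) (at (x - y)) u\<bar> \<le> B * (c * norm u)" for y
          unfolding abs_mult using f(2) c B by (intro mult_mono) auto
        from ib[OF cd this] show ?thesis using B c by (simp add: mg Dg C_def mult_ac)
      qed
    next
      fix x y u :: 'a
      have "\<bar>f z * frechet_derivative (mollifier \<epsilon>) (at (x - z)) u - f z * frechet_derivative (mollifier \<epsilon>) (at (y - z)) u\<bar> \<le> B * (c * norm (x - y) * norm u)" for z
        unfolding right_diff_distrib[symmetric] abs_mult using f(2) c(1) c(3)[of "x - z" u "y - z"] B by (intro mult_mono) auto
      from ib[OF continuous_on_diff[OF cd cd] this]
      have "\<bar>integral (cbox (- a) a) (\<lambda>z. f z * frechet_derivative (mollifier \<epsilon>) (at (x - z)) u - f z * frechet_derivative (mollifier \<epsilon>) (at (y - z)) u)\<bar>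
         \<le> C * norm (x - y) * norm u" using B c(1) by (simp add: C_def mult_ac)
      moreover have "integral (cbox (- a) a) (\<lambda>z. f z * frechet_derivative (mollifier \<epsilon>) (at (x - z)) u - f z * frechet_derivative (mollifier \<epsilon>) (at (y - z)) u)
        = frechet_derivative (mollify \<epsilon> f) (at x) u - frechet_derivative (mollify \<epsilon> f) (at y) u"
        unfolding mg Dg by (intro integral_diff integrable_continuous continuous_on_subset[OF cd subset_UNIV])
      ultimately show "\<bar>frechet_derivative (mollify \<epsilon> f) (at x) u - frechet_derivative (mollify \<epsilon> f) (at y) u\<bar> \<le> C * norm (x - y) * norm u"
        by simp
    qed
  qed
qed


lemma taylor_remainder:
  fixes \<phi> :: "'a::euclidean_space \<Rightarrow> real"
  assumes \<phi>: "\<And>k. Ck k \<phi>" and C: "0 \<le> C"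
    "\<And>x y u. \<bar>frechet_derivative \<phi> (at x) u - frechet_derivative \<phi> (at y) u\<bar> \<le> C * norm (x - y) * norm u"
  shows "\<bar>\<phi> (x + w) - \<phi> x - frechet_derivative \<phi> (at x) w\<bar> \<le> C * (norm w)\<^sup>2"
proof -
  have "norm (\<phi> (x + w) - \<phi> x - frechet_derivative \<phi> (at x) (x + w - x)) \<le> norm (x + w - x) * (C * norm w)"
  proof (rule differentiable_bound_linearization[where S="cball x (norm w)"])
    show "x + t *\<^sub>R (x + w - x) \<in> cball x (norm w)" if "t \<in> {0..1}" for t
      using that by (simp add: dist_norm mult_left_le_one_le)
    show "(\<phi> has_derivative frechet_derivative \<phi> (at y)) (at y within cball x (norm w))" for y
      using Ck_has_derivative[OF \<phi>] by (rule has_derivative_at_withinI)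
    show "onorm (frechet_derivative \<phi> (at y) - frechet_derivative \<phi> (at x)) \<le> C * norm w" if "y \<in> cball x (norm w)" for y
    proof (rule onorm_le)
      fix u
      have "\<bar>frechet_derivative \<phi> (at y) u - frechet_derivative \<phi> (at x) u\<bar> \<le> C * norm (y - x) * norm u" by (rule C)
      also have "\<dots> \<le> C * norm w * norm u"
        using that C(1) by (intro mult_right_mono mult_left_mono) (auto simp: dist_norm norm_minus_commute)
      finally show "norm ((frechet_derivative \<phi> (at y) - frechet_derivative \<phi> (at x)) u) \<le> C * norm w * norm u"
        by (simp add: fun_diff_def)
    qed
  qed auto
  then show ?thesis by (simp add: power2_eq_square mult_ac)
qed


section \<open>Elementary estimates for the Wasserstein distance\<close>

lemma prob_momentD:
  assumes "\<mu> \<in> prob_moment p"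
  shows "prob_space \<mu>" "sets \<mu> = sets borel" "space \<mu> = UNIV" "integrable \<mu> (\<lambda>x. norm x powr p)"
  using assms sets_eq_imp_space_eq[of \<mu> borel] by (auto simp: prob_moment_def)

abbreviation cost :: "real \<Rightarrow> ('a::euclidean_space \<times> 'a) measure \<Rightarrow> ennreal" where
  "cost p \<gamma> \<equiv> \<integral>\<^sup>+z. ennreal (norm (fst z - snd z) powr p) \<partial>\<gamma>"

lemma powr_sum_le:
  fixes a b p :: real
  assumes "0 \<le> a" "0 \<le> b" "0 < p"
  shows "(a + b) powr p \<le> 2 powr p * (a powr p + b powr p)"
proof -
  have "(a + b) powr p \<le> (2 * max a b) powr p" using assms by (intro powr_mono2) auto
  also have "\<dots> = 2 powr p * max a b powr p" using assms by (subst powr_mult) auto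
  also have "max a b powr p \<le> a powr p + b powr p" by (auto simp: max_def)
  finally show ?thesis by simp
qed

text \<open>This plays the part of the inequalities of Young and Jensen: it bounds a linear cost by the
  \<open>p\<close>-cost. With \<open>c\<^sup>p\<close> bounding the integral of \<open>a\<^sup>p\<close>, the integral
  of \<open>a\<close> is at most \<open>2 c\<close>.\<close>
lemma le_powr_split:
  fixes a c p :: real
  assumes "0 \<le> a" "0 < c" "1 \<le> p"
  shows "a \<le> c + c powr (1 - p) * a powr p"
proof (cases "a \<le> c")
  case True
  then show ?thesis using assms by (smt (verit) mult_nonneg_nonneg powr_ge_zero)
next
  case False
  then have "a = a powr (1 - p) * a powr p" using assms by (simp flip: powr_add)
  also have "\<dots> \<le> c powr (1 - p) * a powr p"
    using False assms by (intro mult_right_mono powr_mono2') auto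
  finally show ?thesis using assms by simp
qed

lemma couplingsD:
  assumes \<gamma>: "\<gamma> \<in> couplings \<mu> \<nu>"
  shows "sets \<gamma> = sets borel" "space \<gamma> = UNIV" "fst \<in> measurable \<gamma> borel" "snd \<in> measurable \<gamma> borel"
    "distr \<gamma> borel fst = \<mu>" "distr \<gamma> borel snd = \<nu>"
proof -
  show s: "sets \<gamma> = sets borel" "distr \<gamma> borel fst = \<mu>" "distr \<gamma> borel snd = \<nu>"
    using \<gamma> by (auto simp: couplings_def)
  then show "space \<gamma> = UNIV" using sets_eq_imp_space_eq[of \<gamma> borel] by simp
  show "fst \<in> measurable \<gamma> borel" "snd \<in> measurable \<gamma> borel"
    by (auto simp: measurable_cong_sets[OF s(1) refl] intro!: borel_measurable_continuous_onI continuous_intros)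
qed

lemma coupling_prob:
  assumes \<gamma>: "\<gamma> \<in> couplings \<mu> \<nu>" and "prob_space \<mu>"
  shows "prob_space \<gamma>"
  using prob_space_distrD[of fst \<gamma> borel] couplingsD[OF \<gamma>] assms(2) by simp

lemma wasserstein_le_cost:
  assumes \<gamma>: "\<gamma> \<in> couplings \<mu> \<nu>" and c: "cost p \<gamma> \<le> ennreal (c powr p)" and "0 \<le> c" "0 < p"
  shows "wasserstein p \<mu> \<nu> \<le> c"
proof -
  have "(INF \<gamma>\<in>couplings \<mu> \<nu>. cost p \<gamma>) \<le> ennreal (c powr p)"
    using c by (rule INF_lower2[OF \<gamma>])
  then have "enn2real (INF \<gamma>\<in>couplings \<mu> \<nu>. cost p \<gamma>) \<le> c powr p"
    using enn2real_mono[of _ "ennreal (c powr p)"] by simp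
  then have "wasserstein p \<mu> \<nu> \<le> (c powr p) powr (1 / p)"
    unfolding wasserstein_def using assms by (intro powr_mono2) auto
  then show ?thesis using assms by (simp add: powr_powr)
qed

lemma wasserstein_nonneg: "0 \<le> wasserstein p \<mu> \<nu>"
  by (simp add: wasserstein_def)

lemma wasserstein_commute: "wasserstein p \<mu> \<nu> = wasserstein p \<nu> (\<mu> :: 'a::euclidean_space measure)"
proof -
  have swap: "\<exists>\<gamma>'\<in>couplings \<nu> \<mu>. cost p \<gamma>' = cost p \<gamma>" if \<gamma>: "\<gamma> \<in> couplings \<mu> \<nu>" for \<gamma> and \<mu> \<nu> :: "'a measure"
  proof (intro bexI[of _ "distr \<gamma> borel prod.swap"])
    note c = couplingsD[OF \<gamma>]
    have sw: "(prod.swap :: 'a \<times> 'a \<Rightarrow> _) \<in> borel_measurable borel"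
      by (intro borel_measurable_continuous_onI) (auto simp: prod.swap_def intro!: continuous_intros)
    then have [measurable]: "prod.swap \<in> measurable \<gamma> borel" by (simp add: measurable_cong_sets[OF c(1) refl])
    have [measurable]: "fst \<in> borel_measurable (borel :: ('a \<times> 'a) measure)" "snd \<in> borel_measurable (borel :: ('a \<times> 'a) measure)"
      by (auto intro!: borel_measurable_continuous_onI continuous_intros)
    show "distr \<gamma> borel prod.swap \<in> couplings \<nu> \<mu>"
      using c by (auto simp: couplings_def distr_distr o_def)
    show "cost p (distr \<gamma> borel prod.swap) = cost p \<gamma>"
      by (subst nn_integral_distr) (auto simp: norm_minus_commute)
  qed
  have le: "(INF \<gamma>\<in>couplings \<nu> \<mu>. cost p \<gamma>) \<le> (INF \<gamma>\<in>couplings \<mu> \<nu>. cost p \<gamma>)" for \<mu> \<nu> :: "'a measure"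
  proof (rule INF_greatest)
    fix \<gamma> assume "\<gamma> \<in> couplings \<mu> \<nu>"
    then obtain \<gamma>' where "\<gamma>' \<in> couplings \<nu> \<mu>" "cost p \<gamma>' = cost p \<gamma>" using swap by blast
    then show "(INF \<gamma>\<in>couplings \<nu> \<mu>. cost p \<gamma>) \<le> cost p \<gamma>" using INF_lower[of \<gamma>' "couplings \<nu> \<mu>" "cost p"] by simp
  qed
  have "(INF \<gamma>\<in>couplings \<mu> \<nu>. cost p \<gamma>) = (INF \<gamma>\<in>couplings \<nu> \<mu>. cost p \<gamma>)"
    by (rule antisym[OF le le])
  then show ?thesis by (simp add: wasserstein_def)
qed

lemma moment_nn_integral:
  assumes "\<mu> \<in> prob_moment p"
  shows "(\<integral>\<^sup>+x. ennreal (norm x powr p) \<partial>\<mu>) = ennreal (\<integral>x. norm x powr p \<partial>\<mu>)"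
  using prob_momentD[OF assms] by (intro nn_integral_eq_integral) auto

lemma cost_le_moments:
  assumes \<gamma>: "\<gamma> \<in> couplings \<mu> \<nu>" and \<mu>: "\<mu> \<in> prob_moment p" and \<nu>: "\<nu> \<in> prob_moment p" and p: "0 < p"
  shows "cost p \<gamma> \<le> ennreal (2 powr p * ((\<integral>x. norm x powr p \<partial>\<mu>) + (\<integral>x. norm x powr p \<partial>\<nu>)))"
proof -
  note c [measurable] = couplingsD[OF \<gamma>]
  have "cost p \<gamma> \<le> (\<integral>\<^sup>+z. ennreal (2 powr p) * (ennreal (norm (fst z) powr p) + ennreal (norm (snd z) powr p)) \<partial>\<gamma>)"
  proof (intro nn_integral_mono)
    fix z :: "'a \<times> 'a"
    have "norm (fst z - snd z) powr p \<le> (norm (fst z) + norm (snd z)) powr p"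
      using p by (intro powr_mono2 norm_triangle_ineq4) auto
    also have "\<dots> \<le> 2 powr p * (norm (fst z) powr p + norm (snd z) powr p)"
      by (intro powr_sum_le p) auto
    finally show "ennreal (norm (fst z - snd z) powr p) \<le> ennreal (2 powr p) * (ennreal (norm (fst z) powr p) + ennreal (norm (snd z) powr p))"
      by (simp flip: ennreal_plus ennreal_mult add: ennreal_leI)
  qed
  also have "\<dots> = ennreal (2 powr p) * ((\<integral>\<^sup>+z. ennreal (norm (fst z) powr p) \<partial>\<gamma>) + (\<integral>\<^sup>+z. ennreal (norm (snd z) powr p) \<partial>\<gamma>))"
    by (simp add: nn_integral_cmult nn_integral_add)
  also have "(\<integral>\<^sup>+z. ennreal (norm (fst z) powr p) \<partial>\<gamma>) = (\<integral>\<^sup>+x. ennreal (norm x powr p) \<partial>\<mu>)"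
    unfolding c(5)[symmetric] by (subst nn_integral_distr) auto
  also have "(\<integral>\<^sup>+z. ennreal (norm (snd z) powr p) \<partial>\<gamma>) = (\<integral>\<^sup>+x. ennreal (norm x powr p) \<partial>\<nu>)"
    unfolding c(6)[symmetric] by (subst nn_integral_distr) auto
  finally show ?thesis
    by (simp add: moment_nn_integral[OF \<mu>] moment_nn_integral[OF \<nu>] flip: ennreal_plus ennreal_mult)
qed

lemma product_coupling:
  assumes "\<mu> \<in> prob_moment p" "\<nu> \<in> prob_moment p"
  shows "\<mu> \<Otimes>\<^sub>M \<nu> \<in> couplings \<mu> \<nu>"
proof -
  note m = prob_momentD[OF assms(1)] and n = prob_momentD[OF assms(2)]
  interpret M: prob_space \<mu> by (rule m(1))
  interpret N: prob_space \<nu> by (rule n(1))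
  have "sets (\<mu> \<Otimes>\<^sub>M \<nu>) = sets borel" using m n by (metis borel_prod sets_pair_measure_cong)
  moreover have "distr (\<mu> \<Otimes>\<^sub>M \<nu>) borel fst = \<mu>"
    using N.distr_pair_fst[of \<mu>] m(2) by (simp cong: distr_cong)
  moreover have "distr (\<mu> \<Otimes>\<^sub>M \<nu>) borel snd = \<nu>"
  proof (rule measure_eqI)
    fix A assume "A \<in> sets (distr (\<mu> \<Otimes>\<^sub>M \<nu>) borel snd)"
    then have A: "A \<in> sets \<nu>" "A \<in> sets borel" using n by auto
    have "emeasure (distr (\<mu> \<Otimes>\<^sub>M \<nu>) borel snd) A = emeasure (\<mu> \<Otimes>\<^sub>M \<nu>) (snd -` A \<inter> space (\<mu> \<Otimes>\<^sub>M \<nu>))"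
      using A n by (intro emeasure_distr) (auto simp: measurable_cong_sets[OF refl n(2)[symmetric]])
    also have "snd -` A \<inter> space (\<mu> \<Otimes>\<^sub>M \<nu>) = space \<mu> \<times> A"
      using m n by (auto simp: space_pair_measure)
    also have "emeasure (\<mu> \<Otimes>\<^sub>M \<nu>) (space \<mu> \<times> A) = emeasure \<nu> A"
      using A by (simp add: N.emeasure_pair_measure_Times M.emeasure_space_1)
    finally show "emeasure (distr (\<mu> \<Otimes>\<^sub>M \<nu>) borel snd) A = emeasure \<nu> A" .
  qed (use n in simp)
  ultimately show ?thesis by (simp add: couplings_def)
qed

text \<open>The cost of the product coupling is finite. Therefore the infimum is finite, the conversion to a real number
  is faithful, and near-optimal couplings exist.\<close>
lemma coupling_below:
  assumes \<mu>: "\<mu> \<in> prob_moment p" and \<nu>: "\<nu> \<in> prob_moment p" and p: "0 < p" and c: "wasserstein p \<mu> \<nu> < c"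
  obtains \<gamma> where "\<gamma> \<in> couplings \<mu> \<nu>" "cost p \<gamma> \<le> ennreal (c powr p)"
proof -
  define I where "I = (INF \<gamma>\<in>couplings \<mu> \<nu>. cost p \<gamma>)"
  have "I \<le> cost p (\<mu> \<Otimes>\<^sub>M \<nu>)" unfolding I_def using product_coupling[OF \<mu> \<nu>] by (rule INF_lower)
  also have "\<dots> < \<top>" using cost_le_moments[OF product_coupling[OF \<mu> \<nu>] \<mu> \<nu> p] ennreal_less_top le_less_trans by blast
  finally have fin: "I < \<top>" .
  have "enn2real I powr (1 / p) < c" using c by (simp add: wasserstein_def I_def)
  then have "(enn2real I powr (1 / p)) powr p < c powr p" using p by (intro powr_less_mono2) auto
  then have "enn2real I < c powr p" using p by (simp add: powr_powr)
  then have "I < ennreal (c powr p)"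
    using fin by (metis ennreal_enn2real ennreal_lessI enn2real_nonneg le_less_trans)
  then obtain \<gamma> where "\<gamma> \<in> couplings \<mu> \<nu>" "cost p \<gamma> < ennreal (c powr p)"
    unfolding I_def INF_less_iff by auto
  then show ?thesis using that by (simp add: less_imp_le)
qed

lemma coupling_integral_diff_le:
  fixes \<phi> :: "'a::euclidean_space \<Rightarrow> real"
  assumes \<gamma>: "\<gamma> \<in> couplings \<mu> \<nu>" and \<mu>: "prob_space \<mu>" and cost: "cost p \<gamma> \<le> ennreal (c powr p)"
    and c: "0 < c" and p: "1 \<le> p" and \<phi>: "K-lipschitz_on UNIV \<phi>" and b: "\<And>x. \<bar>\<phi> x\<bar> \<le> B"
  shows "\<bar>(\<integral>x. \<phi> x \<partial>\<mu>) - (\<integral>x. \<phi> x \<partial>\<nu>)\<bar> \<le> 2 * K * c"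
proof -
  note cp [measurable] = couplingsD[OF \<gamma>]
  interpret G: prob_space \<gamma> by (rule coupling_prob[OF \<gamma> \<mu>])
  have K: "0 \<le> K" using lipschitz_on_nonneg[OF \<phi>] .
  have [measurable]: "\<phi> \<in> borel_measurable borel"
    using lipschitz_on_continuous_on[OF \<phi>] by (rule borel_measurable_continuous_onI)
  have i: "integrable \<gamma> (\<lambda>z. \<phi> (fst z))" "integrable \<gamma> (\<lambda>z. \<phi> (snd z))"
    using b by (auto intro!: G.integrable_const_bound[where B=B])
  have d: "integrable \<gamma> (\<lambda>z. norm (fst z - snd z) powr p)" 
    using le_less_trans[OF cost ennreal_less_top] by (intro integrableI_nonneg) auto
  have "(\<integral>z. norm (fst z - snd z) powr p \<partial>\<gamma>) = enn2real (cost p \<gamma>)" by (intro integral_eq_nn_integral) auto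
  also have "\<dots> \<le> c powr p" using enn2real_mono[OF cost] by simp
  finally have di: "(\<integral>z. norm (fst z - snd z) powr p \<partial>\<gamma>) \<le> c powr p" .
  have "(\<integral>x. \<phi> x \<partial>\<mu>) - (\<integral>x. \<phi> x \<partial>\<nu>) = (\<integral>z. \<phi> (fst z) \<partial>\<gamma>) - (\<integral>z. \<phi> (snd z) \<partial>\<gamma>)"
    unfolding cp(5)[symmetric] cp(6)[symmetric] by (simp add: integral_distr)
  also have "\<dots> = (\<integral>z. \<phi> (fst z) - \<phi> (snd z) \<partial>\<gamma>)" using i by simp
  also have "\<bar>\<dots>\<bar> \<le> (\<integral>z. K * (c + c powr (1 - p) * norm (fst z - snd z) powr p) \<partial>\<gamma>)"
    unfolding real_norm_def[symmetric]
  proof (rule order_trans[OF integral_norm_bound integral_mono])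
    show "integrable \<gamma> (\<lambda>z. norm (\<phi> (fst z) - \<phi> (snd z)))" using i by auto
    show "integrable \<gamma> (\<lambda>z. K * (c + c powr (1 - p) * norm (fst z - snd z) powr p))" using d by auto
    fix z :: "'a \<times> 'a"
    have "norm (\<phi> (fst z) - \<phi> (snd z)) \<le> K * norm (fst z - snd z)"
      using lipschitz_onD[OF \<phi>, of "fst z" "snd z"] by (simp add: dist_norm)
    also have "\<dots> \<le> K * (c + c powr (1 - p) * norm (fst z - snd z) powr p)"
      using K c p by (intro mult_left_mono le_powr_split) auto
    finally show "norm (\<phi> (fst z) - \<phi> (snd z)) \<le> K * (c + c powr (1 - p) * norm (fst z - snd z) powr p)" .
  qed
  also have "\<dots> = K * (c + c powr (1 - p) * (\<integral>z. norm (fst z - snd z) powr p \<partial>\<gamma>))"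
    using d by (simp add: G.prob_space)
  also have "\<dots> \<le> K * (c + c powr (1 - p) * c powr p)" using K c di by (intro mult_left_mono add_left_mono) auto
  also have "\<dots> = 2 * K * c" using c by (simp flip: powr_add)
  finally show ?thesis .
qed

text \<open>Lipschitz functions are integrated along a nearly optimal coupling. The factor \<open>2\<close> comes from
  \<open>le_powr_split\<close>.\<close>
lemma integral_diff_le_wasserstein:
  fixes \<phi> :: "'a::euclidean_space \<Rightarrow> real"
  assumes \<mu>: "\<mu> \<in> prob_moment p" and \<nu>: "\<nu> \<in> prob_moment p" and p: "1 \<le> p"
    and \<phi>: "K-lipschitz_on UNIV \<phi>" and b: "\<And>x. \<bar>\<phi> x\<bar> \<le> B"
  shows "\<bar>(\<integral>x. \<phi> x \<partial>\<mu>) - (\<integral>x. \<phi> x \<partial>\<nu>)\<bar> \<le> 2 * K * wasserstein p \<mu> \<nu>"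
proof (rule field_le_epsilon)
  fix e :: real assume e: "0 < e"
  have K: "0 \<le> K" using lipschitz_on_nonneg[OF \<phi>] .
  define c where "c = wasserstein p \<mu> \<nu> + e / (2 * K + 1)"
  have "0 < e / (2 * K + 1)" using e K by simp
  then have c: "wasserstein p \<mu> \<nu> < c" "0 < c" using wasserstein_nonneg[of p \<mu> \<nu>] by (auto simp: c_def)
  obtain \<gamma> where "\<gamma> \<in> couplings \<mu> \<nu>" "cost p \<gamma> \<le> ennreal (c powr p)"
    by (rule coupling_below[OF \<mu> \<nu> _ c(1)]) (use p in auto)
  from coupling_integral_diff_le[OF this(1) prob_momentD(1)[OF \<mu>] this(2) c(2) p \<phi> b]
  have "\<bar>(\<integral>x. \<phi> x \<partial>\<mu>) - (\<integral>x. \<phi> x \<partial>\<nu>)\<bar> \<le> 2 * K * c" .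
  also have "\<dots> = 2 * K * wasserstein p \<mu> \<nu> + 2 * K * (e / (2 * K + 1))" by (simp add: c_def algebra_simps)
  also have "2 * K * (e / (2 * K + 1)) \<le> e" using e K by (simp add: divide_le_eq)
  finally show "\<bar>(\<integral>x. \<phi> x \<partial>\<mu>) - (\<integral>x. \<phi> x \<partial>\<nu>)\<bar> \<le> 2 * K * wasserstein p \<mu> \<nu> + e" by simp
qed

lemma moment_le_wasserstein:
  assumes \<mu>: "\<mu> \<in> prob_moment p" and \<nu>: "\<nu> \<in> prob_moment p" and p: "0 < p" and c: "wasserstein p \<mu> \<nu> < c"
  shows "(\<integral>x. norm x powr p \<partial>\<nu>) \<le> 2 powr p * ((\<integral>x. norm x powr p \<partial>\<mu>) + c powr p)"
proof -
  obtain \<gamma> where \<gamma>: "\<gamma> \<in> couplings \<mu> \<nu>" "cost p \<gamma> \<le> ennreal (c powr p)"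
    by (rule coupling_below[OF \<mu> \<nu> p c])
  note cp [measurable] = couplingsD[OF \<gamma>(1)]
  have "ennreal (\<integral>x. norm x powr p \<partial>\<nu>) = (\<integral>\<^sup>+z. ennreal (norm (snd z) powr p) \<partial>\<gamma>)"
    unfolding moment_nn_integral[OF \<nu>, symmetric] by (subst cp(6)[symmetric], subst nn_integral_distr) auto
  also have "\<dots> \<le> (\<integral>\<^sup>+z. ennreal (2 powr p) * (ennreal (norm (fst z) powr p) + ennreal (norm (fst z - snd z) powr p)) \<partial>\<gamma>)"
  proof (intro nn_integral_mono)
    fix z :: "'a \<times> 'a"
    have "norm (snd z) powr p \<le> (norm (fst z) + norm (fst z - snd z)) powr p"
      using p norm_triangle_sub[of "snd z" "fst z"] by (intro powr_mono2) (auto simp: norm_minus_commute)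
    also have "\<dots> \<le> 2 powr p * (norm (fst z) powr p + norm (fst z - snd z) powr p)"
      by (intro powr_sum_le p) auto
    finally show "ennreal (norm (snd z) powr p) \<le> ennreal (2 powr p) * (ennreal (norm (fst z) powr p) + ennreal (norm (fst z - snd z) powr p))"
      by (simp flip: ennreal_plus ennreal_mult add: ennreal_leI)
  qed
  also have "\<dots> = ennreal (2 powr p) * ((\<integral>\<^sup>+z. ennreal (norm (fst z) powr p) \<partial>\<gamma>) + cost p \<gamma>)"
    by (simp add: nn_integral_cmult nn_integral_add)
  also have "(\<integral>\<^sup>+z. ennreal (norm (fst z) powr p) \<partial>\<gamma>) = ennreal (\<integral>x. norm x powr p \<partial>\<mu>)"
    unfolding moment_nn_integral[OF \<mu>, symmetric] by (subst cp(5)[symmetric], subst nn_integral_distr) auto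
  also have "ennreal (2 powr p) * (ennreal (\<integral>x. norm x powr p \<partial>\<mu>) + cost p \<gamma>)
     \<le> ennreal (2 powr p) * (ennreal (\<integral>x. norm x powr p \<partial>\<mu>) + ennreal (c powr p))"
    using \<gamma>(2) by (intro mult_left_mono add_left_mono) auto
  also have "\<dots> = ennreal (2 powr p * ((\<integral>x. norm x powr p \<partial>\<mu>) + c powr p))"
    by (simp flip: ennreal_plus ennreal_mult)
  finally show ?thesis by (subst (asm) ennreal_le_iff) auto
qed

text \<open>The image of \<open>\<mu>\<close> under the pair of maps is a coupling.\<close>
lemma wasserstein_distr_le:
  fixes \<mu> :: "'a::euclidean_space measure" and f g :: "'a \<Rightarrow> 'a"
  assumes \<mu>: "sets \<mu> = sets borel" and fg: "f \<in> borel_measurable borel" "g \<in> borel_measurable borel"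
    and le: "(\<integral>\<^sup>+x. ennreal (norm (f x - g x) powr p) \<partial>\<mu>) \<le> ennreal (c powr p)" and "0 \<le> c" "0 < p"
  shows "wasserstein p (distr \<mu> borel f) (distr \<mu> borel g) \<le> c"
proof (rule wasserstein_le_cost)
  have [measurable]: "f \<in> borel_measurable \<mu>" "g \<in> borel_measurable \<mu>" using fg by (auto simp: measurable_cong_sets[OF \<mu> refl])
  have [measurable]: "fst \<in> borel_measurable (borel :: ('a \<times> 'a) measure)" "snd \<in> borel_measurable (borel :: ('a \<times> 'a) measure)"
    by (auto intro!: borel_measurable_continuous_onI continuous_intros)
  have [measurable]: "(\<lambda>x. (f x, g x)) \<in> borel_measurable \<mu>" by (rule borel_measurable_Pair) auto
  show "distr \<mu> borel (\<lambda>x. (f x, g x)) \<in> couplings (distr \<mu> borel f) (distr \<mu> borel g)"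
    by (simp add: couplings_def distr_distr o_def)
  show "cost p (distr \<mu> borel (\<lambda>x. (f x, g x))) \<le> ennreal (c powr p)"
    using le by (subst nn_integral_distr) auto
qed fact+


section \<open>Separability of the Wasserstein space\<close>

text \<open>Measures concentrated on a finite set are determined by the masses of its points, so those with rational
  masses on finite subsets of a countable set form a countable set.\<close>
lemma finite_support_measure_eqI:
  assumes M: "M \<in> prob_moment p" "measure M A = 1" and N: "N \<in> prob_moment p" "measure N A = 1"
    and A: "finite A" and eq: "\<And>x. x \<in> A \<Longrightarrow> measure M {x} = measure N {x}"
  shows "M = N"
proof -
  have *: "emeasure L B = ennreal (\<Sum>x\<in>A \<inter> B. measure L {x})" 
    if L: "L \<in> prob_moment p" "measure L A = 1" and B: "B \<in> sets borel" for L B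
  proof -
    note m = prob_momentD[OF L(1)]
    interpret prob_space L by (rule m(1))
    have fb: "F \<in> sets L" if "finite F" for F using that m(2) by (simp add: finite_imp_closed borel_closed)
    have "AE x in L. x \<in> A" using L(2) AE_in_set_eq_1[OF fb[OF A]] by simp
    then have "measure L B = measure L (A \<inter> B)"
      by (intro finite_measure_eq_AE) (use fb A B m(2) in auto)
    also have "\<dots> = (\<Sum>x\<in>A \<inter> B. measure L {x})"
      by (rule finite_measure_eq_sum_singleton) (use A fb in auto)
    finally show ?thesis by (simp add: emeasure_eq_measure)
  qed
  show ?thesis
  proof (rule measure_eqI)
    show "sets M = sets N" using prob_momentD(2)[OF M(1)] prob_momentD(2)[OF N(1)] by simp
    fix B assume "B \<in> sets M"
    then have B: "B \<in> sets borel" using prob_momentD(2)[OF M(1)] by simp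
    show "emeasure M B = emeasure N B" using *[OF M B] *[OF N B] eq by simp
  qed
qed

lemma countable_rational_finite_support:
  fixes C :: "'a::euclidean_space set"
  assumes C: "countable C"
  shows "countable {M \<in> prob_moment p. \<exists>A\<subseteq>C. finite A \<and> measure M A = 1 \<and> (\<forall>x\<in>A. measure M {x} \<in> \<rat>)}"
proof -
  define DA where "DA A = {M \<in> prob_moment p. measure M A = 1 \<and> (\<forall>x\<in>A. measure M {x} \<in> \<rat>)}" for A :: "'a set"
  have "countable (DA A)" if A: "finite A" for A
  proof -
    define h where "h M = restrict (\<lambda>x. measure M {x}) A" for M :: "'a measure"
    have "inj_on h (DA A)"
    proof (rule inj_onI)
      fix M N assume "M \<in> DA A" "N \<in> DA A" and h: "h M = h N"
      moreover have "measure M {x} = measure N {x}" if "x \<in> A" for x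
        using fun_cong[OF h, of x] that by (simp add: h_def)
      ultimately show "M = N" using A by (auto simp: DA_def intro: finite_support_measure_eqI)
    qed
    moreover have "h ` DA A \<subseteq> PiE A (\<lambda>_. \<rat>)" by (auto simp: h_def DA_def)
    then have "countable (h ` DA A)"
      using countable_PiE[OF A, of "\<lambda>_. \<rat>"] countable_rat countable_subset by blast
    ultimately show ?thesis using countable_image_inj_on by blast
  qed
  then have "countable (\<Union>A\<in>{A. A \<subseteq> C \<and> finite A}. DA A)"
    using countable_Collect_finite_subset[OF C] by (intro countable_UN) (auto simp: conj_commute)
  then show ?thesis by (rule countable_subset[rotated]) (auto simp: DA_def)
qed

lemma rational_fraction:
  fixes a \<eta> :: real
  assumes "0 \<le> a" "0 < \<eta>" "\<eta> \<le> 1"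
  shows "\<exists>\<theta>. 1 - \<eta> \<le> \<theta> \<and> \<theta> \<le> 1 \<and> a * \<theta> \<in> \<rat>"
proof (cases "a = 0")
  case True
  then show ?thesis using assms by (intro exI[of _ 1]) auto
next
  case False
  then have "(1 - \<eta>) * a < a" using assms by (simp add: algebra_simps)
  then obtain r where r: "r \<in> \<rat>" "(1 - \<eta>) * a < r" "r < a" using Rats_dense_in_real by blast
  then show ?thesis using False assms by (intro exI[of _ "r / a"]) (auto simp: field_simps)
qed

text \<open>Send \<open>x\<close> to \<open>q x\<close> with probability \<open>\<theta> (q x)\<close>, and to the
  origin otherwise, where \<open>\<theta>\<close> is close to one and chosen to make all masses outside the origin
  rational. The mass at the origin is then rational too. The law of the pair \<open>(x, rounded x)\<close> is a coupling
  with small cost.\<close>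
lemma rational_rounding:
  fixes \<nu> :: "'a::euclidean_space measure"
  assumes \<nu>: "\<nu> \<in> prob_moment p" and p: "0 < p" and q: "simple_function borel q"
    and \<eta>: "0 < \<eta>" "\<eta> \<le> 1" and c: "0 \<le> c"
    and le: "(\<integral>\<^sup>+x. ennreal (norm (x - q x) powr p) \<partial>\<nu>) + ennreal \<eta> * (\<integral>\<^sup>+x. ennreal (norm x powr p) \<partial>\<nu>) \<le> ennreal (c powr p)"
  shows "\<exists>N\<in>prob_moment p. \<exists>A\<subseteq>insert 0 (range q). finite A \<and> measure N A = 1 \<and> (\<forall>x\<in>A. measure N {x} \<in> \<rat>) \<and> wasserstein p \<nu> N \<le> c"
proof -
  note n = prob_momentD[OF \<nu>]
  interpret V: prob_space \<nu> by (rule n(1))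
  \<comment> \<open>An independent uniform variable performs the randomised choice between \<open>q x\<close> and the
    origin.\<close>
  define U where "U = uniform_measure lborel {0..1::real}"
  interpret U: prob_space U unfolding U_def by (rule prob_space_uniform_measure) auto
  interpret P: pair_prob_space \<nu> U ..
  have [measurable_cong]: "sets \<nu> = sets borel" "sets U = sets borel" by (auto simp: n U_def)
  define A where "A = insert 0 (range q)"
  have A: "finite A" using simple_functionD(1)[OF q] by (simp add: A_def)
  have [measurable]: "q \<in> borel_measurable borel" using borel_measurable_simple_function[OF q] .
  define a where "a y = measure \<nu> (q -` {y})" for y
  obtain \<theta> where \<theta>: "\<And>y. 1 - \<eta> \<le> \<theta> y" "\<And>y. \<theta> y \<le> 1" "\<And>y. a y * \<theta> y \<in> \<rat>"
    using rational_fraction[OF _ \<eta>, of "a _"] by (metis a_def measure_nonneg)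
  have \<theta>0: "0 \<le> \<theta> y" for y using \<theta>(1)[of y] \<eta> by simp
  have [measurable]: "(\<lambda>x. \<theta> (q x)) \<in> borel_measurable borel"
    using borel_measurable_simple_function[OF simple_function_compose[OF q, of \<theta>]] by (simp add: o_def)
  define G where "G z = (if snd z < \<theta> (q (fst z)) then q (fst z) else 0)" for z :: "'a \<times> real"
  have [measurable]: "G \<in> borel_measurable (\<nu> \<Otimes>\<^sub>M U)" unfolding G_def by measurable
  have GA: "G z \<in> A" for z by (auto simp: G_def A_def)
  define N where "N = distr (\<nu> \<Otimes>\<^sub>M U) borel G"
  interpret N: prob_space N unfolding N_def by (rule P.prob_space_distr) simp
  have Nsets [measurable_cong]: "sets N = sets borel" by (simp add: N_def)
  have Ulen: "measure U {..<t} = t" if "0 \<le> t" "t \<le> 1" for t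
  proof -
    have "measure U {..<t} = measure lborel ({0..1} \<inter> {..<t}) / measure lborel {0..1::real}"
      unfolding U_def by (rule measure_uniform_measure) auto
    also have "{0..1} \<inter> {..<t} = {0..<t}" using that by auto
    finally show ?thesis using that by simp
  qed
  have fb: "F \<in> sets borel" if "finite F" for F :: "'a set" using that by (simp add: finite_imp_closed borel_closed)
  have NA: "measure N A = 1"
  proof -
    have "AE z in \<nu> \<Otimes>\<^sub>M U. G z \<in> A" using GA by simp
    then have "AE x in N. x \<in> A" unfolding N_def using fb[OF A] by (subst AE_distr_iff) auto
    then show ?thesis using fb[OF A] by (subst N.prob_eq_1) auto
  qed
  have Ny: "measure N {y} \<in> \<rat>" if "y \<noteq> 0" for y
  proof -
    have "measure N {y} = measure (\<nu> \<Otimes>\<^sub>M U) (G -` {y} \<inter> space (\<nu> \<Otimes>\<^sub>M U))"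
      unfolding N_def by (rule measure_distr) auto
    also have "G -` {y} \<inter> space (\<nu> \<Otimes>\<^sub>M U) = (q -` {y}) \<times> {..<\<theta> y}"
      using that n(3) by (auto simp: G_def space_pair_measure U_def split: if_splits)
    also have "measure (\<nu> \<Otimes>\<^sub>M U) ((q -` {y}) \<times> {..<\<theta> y}) = measure \<nu> (q -` {y}) * measure U {..<\<theta> y}"
    proof -
      have "q -` {y} \<in> sets \<nu>" using measurable_sets[of q \<nu> borel "{y}"] n(3) by simp
      then show ?thesis by (simp add: measure_def U.emeasure_pair_measure_Times enn2real_mult)
    qed
    finally show ?thesis using \<theta> \<theta>0 Ulen[of "\<theta> y"] by (simp add: a_def)
  qed
  have N0: "measure N {x} \<in> \<rat>" if "x \<in> A" for x
  proof (cases "x = 0")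
    case True
    have "1 = (\<Sum>y\<in>A. measure N {y})"
      unfolding NA[symmetric] by (rule N.finite_measure_eq_sum_singleton) (use A fb in auto)
    also have "\<dots> = measure N {0} + (\<Sum>y\<in>A - {0}. measure N {y})"
      using A by (subst sum.remove[of A 0]) (auto simp: A_def)
    finally have "measure N {0} = 1 - (\<Sum>y\<in>A - {0}. measure N {y})" by simp
    moreover have "(\<Sum>y\<in>A - {0}. measure N {y}) \<in> \<rat>" using Ny by (intro Rats_sum) auto
    ultimately show ?thesis using True by simp
  qed (rule Ny)
  have NP: "N \<in> prob_moment p"
  proof -
    have "integrable (\<nu> \<Otimes>\<^sub>M U) (\<lambda>z. norm (G z) powr p)"
    proof (rule P.P.integrable_const_bound[where B="\<Sum>y\<in>A. norm y powr p"])
      show "AE z in \<nu> \<Otimes>\<^sub>M U. norm (norm (G z) powr p) \<le> (\<Sum>y\<in>A. norm y powr p)"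
        using A GA by (auto intro!: member_le_sum)
    qed simp
    then show ?thesis using N.prob_space_axioms by (simp add: prob_moment_def N_def integrable_distr_eq)
  qed
  have [measurable]: "fst \<in> borel_measurable (borel :: ('a \<times> 'a) measure)" "snd \<in> borel_measurable (borel :: ('a \<times> 'a) measure)"
    by (auto intro!: borel_measurable_continuous_onI continuous_intros)
  have [measurable]: "(\<lambda>z. (fst z, G z)) \<in> borel_measurable (\<nu> \<Otimes>\<^sub>M U)"
    by (rule borel_measurable_Pair) auto
  define \<gamma> where "\<gamma> = distr (\<nu> \<Otimes>\<^sub>M U) borel (\<lambda>z. (fst z, G z))"
  have f: "distr (\<nu> \<Otimes>\<^sub>M U) borel fst = \<nu>"
    using U.distr_pair_fst[of \<nu>] n(2) by (simp cong: distr_cong)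
  have \<gamma>: "\<gamma> \<in> couplings \<nu> N"
    using f by (simp add: couplings_def \<gamma>_def distr_distr o_def N_def)
  have "cost p \<gamma> = (\<integral>\<^sup>+z. ennreal (norm (fst z - G z) powr p) \<partial>(\<nu> \<Otimes>\<^sub>M U))"
    unfolding \<gamma>_def by (subst nn_integral_distr) auto
  also have "\<dots> \<le> (\<integral>\<^sup>+z. ennreal (norm (fst z - q (fst z)) powr p) + ennreal (norm (fst z) powr p) * indicator {\<theta> (q (fst z))..} (snd z) \<partial>(\<nu> \<Otimes>\<^sub>M U))"
    by (intro nn_integral_mono) (auto simp: G_def indicator_def)
  also have "\<dots> = (\<integral>\<^sup>+x. (\<integral>\<^sup>+u. ennreal (norm (x - q x) powr p) + ennreal (norm x powr p) * indicator {\<theta> (q x)..} u \<partial>U) \<partial>\<nu>)"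
  proof (subst U.nn_integral_fst[symmetric])
    have "(\<lambda>z. ennreal (norm (fst z) powr p) * indicator {w. \<theta> (q (fst w)) \<le> snd w} z) \<in> borel_measurable (\<nu> \<Otimes>\<^sub>M U)"
      by measurable
    moreover have "(\<lambda>z. ennreal (norm (fst z) powr p) * indicator {w. \<theta> (q (fst w)) \<le> snd w} z) = (\<lambda>z. ennreal (norm (fst z) powr p) * indicator {\<theta> (q (fst z))..} (snd z))"
      by (auto simp: indicator_def)
    ultimately show "(\<lambda>z. ennreal (norm (fst z - q (fst z)) powr p) + ennreal (norm (fst z) powr p) * indicator {\<theta> (q (fst z))..} (snd z)) \<in> borel_measurable (\<nu> \<Otimes>\<^sub>M U)"
      by simp
  qed simp
  also have "\<dots> \<le> (\<integral>\<^sup>+x. ennreal (norm (x - q x) powr p) + ennreal (norm x powr p) * ennreal \<eta> \<partial>\<nu>)"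
  proof (intro nn_integral_mono)
    fix x
    have "space U - {..<\<theta> (q x)} = {\<theta> (q x)..}" by (auto simp: U_def)
    then have "measure U {\<theta> (q x)..} = 1 - \<theta> (q x)"
      using U.prob_compl[of "{..<\<theta> (q x)}"] Ulen[OF \<theta>0 \<theta>(2), of "q x"] by simp
    then have "emeasure U {\<theta> (q x)..} \<le> ennreal \<eta>"
      using \<theta>(1)[of "q x"] by (simp add: U.emeasure_eq_measure ennreal_leI)
    then show "(\<integral>\<^sup>+u. ennreal (norm (x - q x) powr p) + ennreal (norm x powr p) * indicator {\<theta> (q x)..} u \<partial>U)
        \<le> ennreal (norm (x - q x) powr p) + ennreal (norm x powr p) * ennreal \<eta>"
      by (subst nn_integral_add) (auto simp: nn_integral_cmult U.emeasure_space_1 intro!: mult_left_mono add_left_mono)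
  qed
  also have "\<dots> = (\<integral>\<^sup>+x. ennreal (norm (x - q x) powr p) \<partial>\<nu>) + (\<integral>\<^sup>+x. ennreal (norm x powr p) \<partial>\<nu>) * ennreal \<eta>"
    by (subst nn_integral_add) (auto simp: nn_integral_multc)
  also have "\<dots> \<le> ennreal (c powr p)" using le by (simp add: mult.commute)
  finally have "wasserstein p \<nu> N \<le> c" by (intro wasserstein_le_cost[OF \<gamma>] c p)
  then show ?thesis using NP NA N0 A by (intro bexI[of _ N] exI[of _ A]) (auto simp: A_def)
qed

text \<open>Approximate the identity by simple functions \<open>F i\<close> with \<open>\<bar>F i x\<bar> \<le> 2
  \<bar>x\<bar>\<close>, push the measure forward, and round the masses to rational numbers.\<close>
lemma countable_dense_measures:
  fixes p :: real
  assumes p: "0 < p"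
  obtains D :: "'a::euclidean_space measure set"
  where "countable D" "D \<subseteq> prob_moment p" "\<And>\<nu> e. \<nu> \<in> prob_moment p \<Longrightarrow> 0 < e \<Longrightarrow> \<exists>\<nu>'\<in>D. wasserstein p \<nu> \<nu>' < e"
proof -
  obtain F :: "nat \<Rightarrow> 'a \<Rightarrow> 'a" where F: "\<And>i. simple_function borel (F i)" "\<And>x. (\<lambda>i. F i x) \<longlonglongrightarrow> x" "\<And>i x. norm (F i x) \<le> 2 * norm x"
    using borel_measurable_implies_sequence_metric[of "\<lambda>x::'a. x" borel 0] by (auto simp: dist_norm)
  have Fm: "F i \<in> borel_measurable borel" for i using borel_measurable_simple_function[OF F(1)] .
  define C where "C = insert 0 (\<Union>i. range (F i))"
  have "finite (range (F i))" for i using simple_functionD(1)[OF F(1)[of i]] by simp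
  then have C: "countable C" by (auto simp: C_def intro: countable_finite)
  define D where "D = {M \<in> prob_moment p. \<exists>A\<subseteq>C. finite A \<and> measure M A = 1 \<and> (\<forall>x\<in>A. measure M {x} \<in> \<rat>)}"
  have "\<exists>\<nu>'\<in>D. wasserstein p \<nu> \<nu>' < e" if \<nu>: "\<nu> \<in> prob_moment p" and e: "0 < e" for \<nu> e
  proof -
    note n = prob_momentD[OF \<nu>]
    have [measurable_cong]: "sets \<nu> = sets borel" by (rule n)
    define c where "c = e / 2"
    have c: "0 < c" "c < e" using e by (auto simp: c_def)
    have cp: "0 < c powr p / 2" using c by simp
    define m where "m = (\<integral>x. norm x powr p \<partial>\<nu>)"
    have m: "0 \<le> m" by (auto simp: m_def)
    have "(\<lambda>i. \<integral>x. norm (x - F i x) powr p \<partial>\<nu>) \<longlonglongrightarrow> (\<integral>x. 0 \<partial>\<nu>)"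
    proof (rule integral_dominated_convergence[where w="\<lambda>x. 3 powr p * norm x powr p"])
      show "AE x in \<nu>. (\<lambda>i. norm (x - F i x) powr p) \<longlonglongrightarrow> 0"
      proof (rule AE_I2)
        fix x
        have "(\<lambda>i. norm (x - F i x)) \<longlonglongrightarrow> norm (x - x)" by (intro tendsto_intros F)
        then have "(\<lambda>i. norm (x - F i x)) \<longlonglongrightarrow> 0" by simp
        then show "(\<lambda>i. norm (x - F i x) powr p) \<longlonglongrightarrow> 0"
          using tendsto_powr'[of "\<lambda>i. norm (x - F i x)" 0 sequentially "\<lambda>_. p" p] p by simp
      qed
      fix i
      show "AE x in \<nu>. norm (norm (x - F i x) powr p) \<le> 3 powr p * norm x powr p"
      proof (rule AE_I2)
        fix x
        have "norm (x - F i x) \<le> 3 * norm x" using norm_triangle_ineq4[of x "F i x"] F(3)[of i x] by simp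
        then have "norm (x - F i x) powr p \<le> (3 * norm x) powr p" using p by (intro powr_mono2) auto
        then show "norm (norm (x - F i x) powr p) \<le> 3 powr p * norm x powr p" by (simp add: powr_mult)
      qed
    qed (use n(4) Fm in auto)
    then have "eventually (\<lambda>i. (\<integral>x. norm (x - F i x) powr p \<partial>\<nu>) < c powr p / 2) sequentially"
      using cp by (intro order_tendstoD) auto
    then obtain i where i: "(\<integral>x. norm (x - F i x) powr p \<partial>\<nu>) < c powr p / 2" by (auto simp: eventually_sequentially)
    define \<eta> where "\<eta> = min 1 (c powr p / 2 / (m + 1))"
    have \<eta>: "0 < \<eta>" "\<eta> \<le> 1" using cp m by (auto simp: \<eta>_def)
    have "\<eta> * m \<le> c powr p / 2 / (m + 1) * m" using m by (intro mult_right_mono) (auto simp: \<eta>_def)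
    also have "\<dots> \<le> c powr p / 2" using cp m by (simp add: field_simps)
    finally have \<eta>m: "\<eta> * m \<le> c powr p / 2" .
    have int: "integrable \<nu> (\<lambda>x. norm (x - F i x) powr p)"
    proof (rule Bochner_Integration.integrable_bound[where f="\<lambda>x. 3 powr p * norm x powr p"])
      show "AE x in \<nu>. norm (norm (x - F i x) powr p) \<le> norm (3 powr p * norm x powr p)"
      proof (rule AE_I2)
        fix x
        have "norm (x - F i x) \<le> 3 * norm x" using norm_triangle_ineq4[of x "F i x"] F(3)[of i x] by simp
        then have "norm (x - F i x) powr p \<le> (3 * norm x) powr p" using p by (intro powr_mono2) auto
        then show "norm (norm (x - F i x) powr p) \<le> norm (3 powr p * norm x powr p)" by (simp add: powr_mult)
      qed
    qed (use n(4) Fm in auto)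
    have "(\<integral>\<^sup>+x. ennreal (norm (x - F i x) powr p) \<partial>\<nu>) + ennreal \<eta> * (\<integral>\<^sup>+x. ennreal (norm x powr p) \<partial>\<nu>)
       = ennreal ((\<integral>x. norm (x - F i x) powr p \<partial>\<nu>) + \<eta> * m)"
      using int \<eta> m by (simp add: nn_integral_eq_integral moment_nn_integral[OF \<nu>] m_def[symmetric] ennreal_plus ennreal_mult)
    also have "\<dots> \<le> ennreal (c powr p)" using i \<eta>m by (intro ennreal_leI) simp
    finally obtain N A where NA: "N \<in> prob_moment p" "A \<subseteq> insert 0 (range (F i))" "finite A" "measure N A = 1"
      "\<forall>x\<in>A. measure N {x} \<in> \<rat>" "wasserstein p \<nu> N \<le> c"
      using rational_rounding[OF \<nu> p F(1) \<eta>, of c i] c(1) by auto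
    moreover have "A \<subseteq> C" using NA(2) by (auto simp: C_def)
    ultimately have "N \<in> D" by (auto simp: D_def)
    then show ?thesis using NA(6) c(2) by (intro bexI[of _ N]) auto
  qed
  moreover have "countable D" unfolding D_def using countable_rational_finite_support[OF C] .
  moreover have "D \<subseteq> prob_moment p" by (auto simp: D_def)
  ultimately show ?thesis using that by blast
qed


section \<open>The continuity equation tested against functions of space\<close>

lemma set_integral_Icc_combine:
  fixes g :: "real \<Rightarrow> 'b::euclidean_space"
  assumes g: "set_integrable lebesgue {a..b} g" and st: "a \<le> s" "s \<le> t" "t \<le> b"
  shows "(LINT r:{a..s}|lebesgue. g r) + (LINT r:{s..t}|lebesgue. g r) = (LINT r:{a..t}|lebesgue. g r)"
proof -
  have i: "set_integrable lebesgue {a..s} g" "set_integrable lebesgue {s..t} g" "set_integrable lebesgue {a..t} g"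
    using st by (auto intro!: set_integrable_subset[OF g])
  have "integral {a..s} g + integral {s..t} g = integral {a..t} g"
    using Henstock_Kurzweil_Integration.integral_combine[OF st(1,2) set_lebesgue_integral_eq_integral(1)[OF i(3)]] .
  then show ?thesis using i by (simp add: set_lebesgue_integral_eq_integral)
qed

lemma continuous_on_set_integral_Icc:
  fixes g :: "real \<Rightarrow> 'b::euclidean_space"
  assumes g: "set_integrable lebesgue {a..b} g"
  shows "continuous_on {a..b} (\<lambda>t. LINT r:{a..t}|lebesgue. g r)"
proof -
  have eq: "(LINT r:{a..t}|lebesgue. g r) = integral {a..t} g" if "t \<in> {a..b}" for t
    using set_integrable_subset[OF g, of "{a..t}"] that by (intro set_lebesgue_integral_eq_integral(2)) auto
  from indefinite_integral_continuous_1[OF set_lebesgue_integral_eq_integral(1)[OF g]]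
  show ?thesis by (rule continuous_on_eq) (simp add: eq)
qed

text \<open>After the substitution \<open>r = s + \<delta> * y\<close> the kernel becomes the fixed density
  \<open>b\<close> of mass \<open>S 1 - S 0 = 1\<close>, and dominated convergence applies.\<close>
lemma time_kernel_limit:
  fixes G b S :: "real \<Rightarrow> real"
  assumes S: "\<And>s. (S has_real_derivative b s) (at s)" "S 0 = 0" "S 1 = 1" and b: "continuous_on UNIV b" "\<And>s. s \<le> 0 \<or> 1 \<le> s \<Longrightarrow> b s = 0"
    and G [measurable]: "G \<in> borel_measurable borel" and B: "\<And>r. \<bar>G r\<bar> \<le> B" and c: "isCont G s"
    and d: "\<And>n. 0 < \<delta> n" "\<delta> \<longlonglongrightarrow> 0"
  shows "(\<lambda>n. \<integral>r. b (- s / \<delta> n + r / \<delta> n) / \<delta> n * G r \<partial>lborel) \<longlonglongrightarrow> G s"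
proof -
  have [measurable]: "b \<in> borel_measurable borel" using b(1) by (rule borel_measurable_continuous_onI)
  have eq: "(\<integral>r. b (- s / \<delta> n + r / \<delta> n) / \<delta> n * G r \<partial>lborel) = (\<integral>y. b y * G (s + \<delta> n * y) \<partial>lborel)" for n
    using lborel_integral_real_affine[of "\<delta> n" "\<lambda>r. b (- s / \<delta> n + r / \<delta> n) / \<delta> n * G r" s] d(1)[of n]
    by (simp add: field_simps flip: Bochner_Integration.integral_mult_right_zero)
  have bi: "b y = indicator {0..1} y *\<^sub>R b y" for y using b(2)[of y] by (cases "y \<le> 0 \<or> 1 \<le> y") auto
  have i: "integrable lborel b"
    by (rule integrable_lborel_compact_support[where S="{0..1}"]) (use b in auto)
  have "(\<integral>y. indicator {0..1} y *\<^sub>R b y \<partial>lborel) = S 1 - S 0"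
    by (rule integral_FTC_atLeastAtMost)
       (use S(1) b(1) in \<open>auto simp: has_real_derivative_iff_has_vector_derivative[symmetric] intro: continuous_on_subset has_field_derivative_at_within\<close>)
  then have one: "(\<integral>y. b y \<partial>lborel) = 1" unfolding bi[symmetric] using S by simp
  have "(\<lambda>n. \<integral>y. b y * G (s + \<delta> n * y) \<partial>lborel) \<longlonglongrightarrow> (\<integral>y. b y * G s \<partial>lborel)"
  proof (rule integral_dominated_convergence[where w="\<lambda>y. \<bar>b y\<bar> * B"])
    show "AE y in lborel. (\<lambda>n. b y * G (s + \<delta> n * y)) \<longlonglongrightarrow> b y * G s"
    proof (rule AE_I2)
      fix y
      have "(\<lambda>n. s + \<delta> n * y) \<longlonglongrightarrow> s + 0 * y" by (intro tendsto_intros d)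
      then have "(\<lambda>n. G (s + \<delta> n * y)) \<longlonglongrightarrow> G s" using c isCont_tendsto_compose by fastforce
      then show "(\<lambda>n. b y * G (s + \<delta> n * y)) \<longlonglongrightarrow> b y * G s" by (intro tendsto_intros)
    qed
    show "AE y in lborel. norm (b y * G (s + \<delta> n * y)) \<le> \<bar>b y\<bar> * B" for n
      using B by (auto simp: abs_mult intro!: mult_left_mono)
  qed (use i in auto)
  then show ?thesis unfolding eq using i one by simp
qed

lemma product_test_function:
  fixes \<phi> :: "'a::euclidean_space \<Rightarrow> real"
  assumes \<eta>: "\<And>k. Ck k \<eta>" "\<And>r. r \<notin> {c..d} \<Longrightarrow> \<eta> r = 0" "a < c" "d < b"
    and \<phi>: "\<And>k. Ck k \<phi>" "\<And>x. R < norm x \<Longrightarrow> \<phi> x = 0"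
  shows "test_function a b (\<lambda>z. \<eta> (fst z) * \<phi> (snd z))"
    "frechet_derivative (\<lambda>z. \<eta> (fst z) * \<phi> (snd z)) (at (t, x)) (h, w) = \<eta> t * frechet_derivative \<phi> (at x) w + frechet_derivative \<eta> (at t) h * \<phi> x"
proof -
  have 1: "Ck k (\<lambda>z. \<eta> (fst z))" for k using Ck_affine[OF bounded_linear_fst \<eta>(1), of k 0] by simp
  have 2: "Ck k (\<lambda>z. \<phi> (snd z))" for k using Ck_affine[OF bounded_linear_snd \<phi>(1), of k 0] by simp
  have K: "compact ({c..d} \<times> cball (0::'a) R)" by (intro compact_Times) auto
  have "\<eta> (fst z) * \<phi> (snd z) = 0" if "z \<notin> {c..d} \<times> cball 0 R" for z
    using \<eta>(2)[of "fst z"] \<phi>(2)[of "snd z"] that by (cases z) auto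
  then show "test_function a b (\<lambda>z. \<eta> (fst z) * \<phi> (snd z))"
    unfolding test_function_def using K \<eta>(3,4) 1 2
    by (intro conjI allI Ck_mult exI[of _ "{c..d} \<times> cball 0 R"]) auto
  have d1: "((\<lambda>z. \<eta> (fst z)) has_derivative (\<lambda>u. frechet_derivative \<eta> (at t) (fst u))) (at (t, x))"
    using has_derivative_compose[OF bounded_linear_imp_has_derivative[OF bounded_linear_fst] Ck_has_derivative[OF \<eta>(1)], of "(t,x)"] by simp
  have d2: "((\<lambda>z. \<phi> (snd z)) has_derivative (\<lambda>u. frechet_derivative \<phi> (at x) (snd u))) (at (t, x))"
    using has_derivative_compose[OF bounded_linear_imp_has_derivative[OF bounded_linear_snd] Ck_has_derivative[OF \<phi>(1)], of "(t,x)"] by simp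
  have "((\<lambda>z. \<eta> (fst z) * \<phi> (snd z)) has_derivative (\<lambda>u. \<eta> t * frechet_derivative \<phi> (at x) (snd u) + frechet_derivative \<eta> (at t) (fst u) * \<phi> x)) (at (t, x))"
    using has_derivative_mult[OF d1 d2] by simp
  from frechet_derivative_at[OF this, symmetric]
  show "frechet_derivative (\<lambda>z. \<eta> (fst z) * \<phi> (snd z)) (at (t, x)) (h, w) = \<eta> t * frechet_derivative \<phi> (at x) w + frechet_derivative \<eta> (at t) h * \<phi> x"
    by simp
qed

lemma Ck_derivative_apply_continuous:
  fixes \<phi> :: "'a::euclidean_space \<Rightarrow> real"
  assumes \<phi>: "\<And>k. Ck k \<phi>" and w: "continuous_on UNIV w"
  shows "continuous_on UNIV (\<lambda>x. frechet_derivative \<phi> (at x) (w x))"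
proof -
  have "continuous_on UNIV (\<lambda>x. frechet_derivative \<phi> (at x) i)" for i using \<phi>[of "Suc 0"] by simp
  then have "continuous_on UNIV (\<lambda>x. \<Sum>i\<in>Basis. (w x \<bullet> i) * frechet_derivative \<phi> (at x) i)"
    by (intro continuous_intros w)
  then show ?thesis by (simp only: derivative_basis_sum[OF \<phi>[of "Suc 0"], symmetric])
qed

text \<open>Test the equation with \<open>\<eta> r * \<phi> x\<close>, where \<open>\<eta>\<close> tends to the
  indicator of \<open>{s<..t}\<close>. The time derivative of \<open>\<eta>\<close> then concentrates at
  \<open>s\<close> and \<open>t\<close>, where \<open>\<integral> \<phi> d\<mu> r\<close> is continuous in
  \<open>r\<close> since \<open>\<mu>\<close> is continuous for the Wasserstein distance. Interior times are treated
  first; the end points follow by continuity. Measurability of \<open>H\<close> is not presupposed: it is read off from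
  the integrability contained in the weak formulation.\<close>
lemma integrated_continuity_equation:
  fixes \<mu> :: "real \<Rightarrow> 'a::euclidean_space measure" and \<phi> :: "'a \<Rightarrow> real"
  assumes ab: "a < b" and p: "1 \<le> p"
    and \<mu>: "\<And>t. t \<in> {a..b} \<Longrightarrow> \<mu> t \<in> prob_moment p"
    and g: "set_integrable lebesgue {a..b} g"
    and W: "\<And>s t. a \<le> s \<Longrightarrow> s \<le> t \<Longrightarrow> t \<le> b \<Longrightarrow> wasserstein p (\<mu> s) (\<mu> t) \<le> (LINT r:{s..t}|lebesgue. g r)"
    and v: "\<And>t. t \<in> {a..b} \<Longrightarrow> continuous_on UNIV (v t)"
    and m: "set_integrable lebesgue {a..b} m" "\<And>t. t \<in> {a..b} \<Longrightarrow> 0 \<le> m t"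
    and growth: "AE t\<in>{a..b} in lebesgue. \<forall>x. norm (v t x) \<le> m t * (1 + norm x)"
    and CE: "continuity_equation a b v \<mu>"
    and \<phi>: "\<And>k. Ck k \<phi>" "\<And>x. R < norm x \<Longrightarrow> \<phi> x = 0"
  defines "H \<equiv> \<lambda>r. \<integral>x. frechet_derivative \<phi> (at x) (v r x) \<partial>\<mu> r"
  shows "set_integrable lebesgue {a..b} H"
    and "\<And>s t. a \<le> s \<Longrightarrow> s \<le> t \<Longrightarrow> t \<le> b \<Longrightarrow> (\<integral>x. \<phi> x \<partial>\<mu> t) - (\<integral>x. \<phi> x \<partial>\<mu> s) = (LINT r:{s..t}|lebesgue. H r)"
proof -
  note mu = prob_momentD[OF \<mu>]
  obtain C where C: "0 \<le> C" "\<And>x u. \<bar>frechet_derivative \<phi> (at x) u\<bar> \<le> C * norm u"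
    using compact_support_derivative_bounded[OF \<phi>(1) \<phi>(2), of R] by auto
  have \<phi>L: "C-lipschitz_on UNIV \<phi>"
    using lipschitz_from_derivative[OF \<phi>(1) C] C by (intro lipschitz_onI) (auto simp: dist_norm)
  have \<phi>c: "continuous_on UNIV \<phi>" using Ck_continuous[OF \<phi>(1)[of 0]] .
  have bounded: "\<exists>B. \<forall>x. \<bar>h x\<bar> \<le> B" if h: "continuous_on UNIV h" "\<And>x. R < norm x \<Longrightarrow> h x = 0" for h :: "'a \<Rightarrow> real"
  proof -
    have "compact (h ` cball 0 R)" using h(1) by (intro compact_continuous_image) (auto intro: continuous_on_subset)
    then obtain B where B: "\<And>x. x \<in> cball 0 R \<Longrightarrow> \<bar>h x\<bar> \<le> B"
      by (fastforce dest: compact_imp_bounded simp: bounded_iff)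
    have "\<bar>h x\<bar> \<le> max 0 B" for x using B[of x] h(2)[of x] by (cases "norm x \<le> R") auto
    then show ?thesis by blast
  qed
  have int: "integrable (\<mu> r) h" if r: "r \<in> {a..b}" and hc: "continuous_on UNIV h" and hz: "\<And>x. R < norm x \<Longrightarrow> h x = 0" for r and h :: "'a \<Rightarrow> real"
  proof -
    interpret prob_space "\<mu> r" by (rule mu(1)[OF r])
    obtain B where "\<And>x. \<bar>h x\<bar> \<le> B" using bounded[OF hc hz] by auto
    then show ?thesis
      using borel_measurable_continuous_onI[OF hc]
      by (intro integrable_const_bound[where B=B]) (auto simp: measurable_cong_sets[OF mu(2)[OF r] refl])
  qed
  obtain B where B: "\<And>x. \<bar>\<phi> x\<bar> \<le> B" using bounded[OF \<phi>c \<phi>(2)] by auto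
  define G where "G r = (\<integral>x. \<phi> x \<partial>\<mu> r)" for r
  have GB: "\<bar>G r\<bar> \<le> B" if "r \<in> {a..b}" for r
  proof -
    interpret prob_space "\<mu> r" by (rule mu(1)[OF that])
    have "\<bar>G r\<bar> \<le> (\<integral>x. \<bar>\<phi> x\<bar> \<partial>\<mu> r)" unfolding G_def by (rule integral_abs_bound)
    also have "\<dots> \<le> (\<integral>x. B \<partial>\<mu> r)" using int[OF that \<phi>c \<phi>(2)] B by (intro integral_mono) auto
    finally show ?thesis by (simp add: prob_space)
  qed
  define \<Gamma> where "\<Gamma> t = (LINT r:{a..t}|lebesgue. g r)" for t
  have \<Gamma>c: "continuous_on {a..b} \<Gamma>" unfolding \<Gamma>_def by (rule continuous_on_set_integral_Icc[OF g])
  have Gd: "\<bar>G t - G s\<bar> \<le> 2 * C * \<bar>\<Gamma> t - \<Gamma> s\<bar>" if "a \<le> s" "s \<le> t" "t \<le> b" for s t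
  proof -
    have "\<bar>G s - G t\<bar> \<le> 2 * C * wasserstein p (\<mu> s) (\<mu> t)"
      unfolding G_def by (rule integral_diff_le_wasserstein[OF \<mu> \<mu> p \<phi>L B]) (use that in auto)
    also have "\<dots> \<le> 2 * C * (LINT r:{s..t}|lebesgue. g r)" using W[OF that] C by (intro mult_left_mono) auto
    also have "(LINT r:{s..t}|lebesgue. g r) = \<Gamma> t - \<Gamma> s"
      using set_integral_Icc_combine[OF g that] by (simp add: \<Gamma>_def)
    also have "2 * C * (\<Gamma> t - \<Gamma> s) \<le> 2 * C * \<bar>\<Gamma> t - \<Gamma> s\<bar>" using C by (intro mult_left_mono) auto
    finally show ?thesis by (simp add: abs_minus_commute)
  qed
  have Gc: "continuous_on {a..b} G"
    unfolding continuous_on_def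
  proof
    fix s assume s: "s \<in> {a..b}"
    have "((\<lambda>t. 2 * C * \<bar>\<Gamma> t - \<Gamma> s\<bar>) \<longlongrightarrow> 2 * C * \<bar>\<Gamma> s - \<Gamma> s\<bar>) (at s within {a..b})"
      using \<Gamma>c s by (intro tendsto_intros) (auto simp: continuous_on_def)
    then have "((\<lambda>t. 2 * C * \<bar>\<Gamma> t - \<Gamma> s\<bar>) \<longlongrightarrow> 0) (at s within {a..b})" by simp
    moreover have "eventually (\<lambda>t. norm (G t - G s) \<le> 2 * C * \<bar>\<Gamma> t - \<Gamma> s\<bar>) (at s within {a..b})"
      unfolding eventually_at_filter
    proof (intro always_eventually allI impI)
      fix t assume "t \<noteq> s" "t \<in> {a..b}"
      then show "norm (G t - G s) \<le> 2 * C * \<bar>\<Gamma> t - \<Gamma> s\<bar>"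
        using Gd[of s t] Gd[of t s] s by (cases "s \<le> t") (auto simp: abs_minus_commute)
    qed
    ultimately have "((\<lambda>t. G t - G s) \<longlongrightarrow> 0) (at s within {a..b})" by (rule Lim_null_comparison[rotated])
    then show "(G \<longlongrightarrow> G s) (at s within {a..b})" by (simp add: LIM_zero_iff)
  qed
  obtain S \<beta> :: "real \<Rightarrow> real" where S: "\<And>k. Ck k S" "\<And>s. (S has_real_derivative \<beta> s) (at s)" "\<And>s. 0 \<le> \<beta> s"
    "\<And>s. s \<le> 0 \<Longrightarrow> S s = 0" "\<And>s. 1 \<le> s \<Longrightarrow> S s = 1" "continuous_on UNIV \<beta>"
    "\<And>s. s \<le> 0 \<or> 1 \<le> s \<Longrightarrow> \<beta> s = 0"
    by (rule smooth_step) (rule that)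
  define G0 where "G0 r = indicator {a..b} r *\<^sub>R G r" for r
  have G0m [measurable]: "G0 \<in> borel_measurable borel"
    unfolding G0_def by (rule borel_measurable_continuous_on_indicator[OF _ Gc]) simp
  have B0: "0 \<le> B" using B[of 0] by simp
  have G0B: "\<bar>G0 r\<bar> \<le> B" for r using GB[of r] B0 by (auto simp: G0_def indicator_def)
  have G0c: "isCont G0 s" if "a < s" "s < b" for s
  proof -
    have "isCont G s" using continuous_on_interior[OF Gc, of s] that by simp
    then show ?thesis
      by (rule isCont_cong[THEN iffD1, rotated])
         (use that eventually_nhds_in_open[of "{a<..<b}" s] in \<open>auto simp: G0_def elim!: eventually_mono\<close>)
  qed
  define H1 where "H1 r = indicator {a<..<b} r *\<^sub>R H r" for r
  have Dz: "frechet_derivative \<phi> (at x) u = 0" if "R < norm x" for x u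
    by (rule Ck_derivative_vanishes[OF \<phi>(1), where R=R]) (use \<phi>(2) that in auto)
  \<comment> \<open>\<open>S ((r - s) / \<delta>) - S ((r - t) / \<delta>)\<close> is a smooth cut-off that equals one
    on \<open>{s + \<delta>..t}\<close> (for \<open>s + \<delta> \<le> t\<close>) and vanishes outside \<open>{s..t +
    \<delta>}\<close>.\<close>
  have step: "integrable lebesgue (\<lambda>r. (S (- s / \<delta> + r / \<delta>) - S (- t / \<delta> + r / \<delta>)) * H1 r) \<and>
      (\<integral>r. (S (- s / \<delta> + r / \<delta>) - S (- t / \<delta> + r / \<delta>)) * H1 r \<partial>lebesgue)
        = (\<integral>r. \<beta> (- t / \<delta> + r / \<delta>) / \<delta> * G0 r \<partial>lborel) - (\<integral>r. \<beta> (- s / \<delta> + r / \<delta>) / \<delta> * G0 r \<partial>lborel)"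
    if st: "a < s" "s < t" "t + \<delta> < b" "0 < \<delta>" for s t \<delta>
  proof -
    define \<eta> where "\<eta> r = S (- s / \<delta> + r / \<delta>) + (- 1) * S (- t / \<delta> + r / \<delta>)" for r
    define \<eta>' where "\<eta>' r = (\<beta> (- s / \<delta> + r / \<delta>) - \<beta> (- t / \<delta> + r / \<delta>)) / \<delta>" for r
    have \<eta>Ck: "Ck k \<eta>" for k
      unfolding \<eta>_def[abs_def] by (intro Ck_add Ck_mult Ck_const Ck_affine[where L="\<lambda>r. r / \<delta>"] bounded_linear_divide S(1))
    have \<eta>d: "(\<eta> has_real_derivative \<eta>' r) (at r)" for r
      unfolding \<eta>_def[abs_def] \<eta>'_def using st(4)
      by (auto intro!: derivative_eq_intros DERIV_chain2[OF S(2)] simp: field_simps)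
    have \<eta>f: "frechet_derivative \<eta> (at r) 1 = \<eta>' r" for r
      using frechet_derivative_at[OF \<eta>d[of r, unfolded has_field_derivative_def]] by (metis mult_1_right)
    have arg: "- c / \<delta> + r / \<delta> = (r - c) / \<delta>" for c r by (simp add: diff_divide_distrib)
    have \<eta>z: "\<eta> r = 0" if "r \<notin> {s..t+\<delta>}" for r
    proof (cases "r < s")
      case True
      then show ?thesis using st unfolding \<eta>_def arg by (simp add: S(4) divide_nonpos_pos)
    next
      case False
      then have "1 \<le> (r - s) / \<delta>" "1 \<le> (r - t) / \<delta>" using that st by (auto simp: le_divide_eq)
      then show ?thesis unfolding \<eta>_def arg by (simp add: S(5))
    qed
    have \<eta>'z: "\<eta>' r = 0" if "r \<notin> {s..t+\<delta>}" for r
    proof (cases "r < s")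
      case True
      then show ?thesis using st unfolding \<eta>'_def arg by (simp add: S(7) divide_nonpos_pos)
    next
      case False
      then have "1 \<le> (r - s) / \<delta>" "1 \<le> (r - t) / \<delta>" using that st by (auto simp: le_divide_eq)
      then show ?thesis unfolding \<eta>'_def arg by (simp add: S(7))
    qed
    have tf: "test_function a b (\<lambda>z. \<eta> (fst z) * \<phi> (snd z))"
      by (rule product_test_function(1)[of \<eta> s "t + \<delta>" a b \<phi> R]) (use \<eta>Ck \<eta>z st \<phi> in auto)
    have tfd: "frechet_derivative (\<lambda>z. \<eta> (fst z) * \<phi> (snd z)) (at (r, x)) (h, w)
        = \<eta> r * frechet_derivative \<phi> (at x) w + frechet_derivative \<eta> (at r) h * \<phi> x" for r x h w
      by (rule product_test_function(2)[of \<eta> s "t + \<delta>" a b \<phi> R]) (use \<eta>Ck \<eta>z st \<phi> in auto)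
    define I where "I = (\<lambda>t. \<integral>x. frechet_derivative (\<lambda>z. \<eta> (fst z) * \<phi> (snd z)) (at (t, x)) (1, 0) +
                          frechet_derivative (\<lambda>z. \<eta> (fst z) * \<phi> (snd z)) (at (t, x)) (0, v t x) \<partial>\<mu> t)"
    have I: "set_integrable lebesgue {a<..<b} I" "(LINT t:{a<..<b}|lebesgue. I t) = 0"
      using CE tf unfolding continuity_equation_def Let_def I_def by auto
    have z0: "frechet_derivative \<psi> (at x) 0 = 0" if "Ck (Suc 0) \<psi>" for \<psi> :: "'c::euclidean_space \<Rightarrow> real" and x
      using has_derivative_linear[OF Ck_has_derivative[OF that, of x]] by (rule linear_0)
    have Ieq: "I r = \<eta>' r * G r + \<eta> r * H r" if "r \<in> {a..b}" for r
    proof -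
      have "I r = (\<integral>x. \<eta>' r * \<phi> x + \<eta> r * frechet_derivative \<phi> (at x) (v r x) \<partial>\<mu> r)"
        unfolding I_def tfd by (simp add: z0[OF \<phi>(1)] z0[OF \<eta>Ck] \<eta>f)
      also have "\<dots> = \<eta>' r * G r + \<eta> r * H r"
        unfolding G_def H_def using int[OF that \<phi>c \<phi>(2)] int[OF that Ck_derivative_apply_continuous[OF \<phi>(1) v[OF that]] Dz] by simp
      finally show ?thesis .
    qed
    have eq: "indicator {a<..<b} r *\<^sub>R I r = \<eta>' r * G0 r + \<eta> r * H1 r" for r
      using Ieq[of r] \<eta>'z[of r] st by (cases "r \<in> {a<..<b}") (auto simp: G0_def H1_def)
    have \<beta>i: "integrable lborel (\<lambda>r. \<beta> (- c / \<delta> + r / \<delta>) / \<delta> * G0 r)" for c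
    proof -
      have bc: "continuous_on UNIV (\<lambda>r. \<beta> (- c / \<delta> + r / \<delta>) / \<delta>)"
        using st by (intro continuous_intros continuous_on_compose2[OF S(6)]) auto
      have "integrable lborel (\<lambda>r. \<beta> (- c / \<delta> + r / \<delta>) / \<delta>)"
      proof (rule integrable_lborel_compact_support[OF bc, where S="{c..c+\<delta>}"])
        fix r assume "r \<notin> {c..c+\<delta>}"
        then have "(r - c) / \<delta> \<le> 0 \<or> 1 \<le> (r - c) / \<delta>" using st by (auto simp: divide_nonpos_pos le_divide_eq)
        then show "\<beta> (- c / \<delta> + r / \<delta>) / \<delta> = 0" unfolding arg by (simp add: S(7))
      qed simp
      then have 1: "integrable lborel (\<lambda>r. B * (\<beta> (- c / \<delta> + r / \<delta>) / \<delta>))" by (rule integrable_mult_right)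
      have 2: "(\<lambda>r. \<beta> (- c / \<delta> + r / \<delta>) / \<delta> * G0 r) \<in> borel_measurable lborel"
        using borel_measurable_continuous_onI[OF bc] by measurable
      show ?thesis
      proof (rule Bochner_Integration.integrable_bound[OF 1 2], rule AE_I2)
        fix r
        show "norm (\<beta> (- c / \<delta> + r / \<delta>) / \<delta> * G0 r) \<le> norm (B * (\<beta> (- c / \<delta> + r / \<delta>) / \<delta>))"
          using mult_left_mono[OF G0B[of r], of "\<bar>\<beta> (- c / \<delta> + r / \<delta>) / \<delta>\<bar>"] B0 by (simp add: abs_mult mult.commute)
      qed
    qed
    have e1: "integrable lborel (\<lambda>r. \<eta>' r * G0 r)"
      "(\<integral>r. \<eta>' r * G0 r \<partial>lborel) = (\<integral>r. \<beta> (- s / \<delta> + r / \<delta>) / \<delta> * G0 r \<partial>lborel) - (\<integral>r. \<beta> (- t / \<delta> + r / \<delta>) / \<delta> * G0 r \<partial>lborel)"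
      using Bochner_Integration.integrable_diff[OF \<beta>i[of s] \<beta>i[of t]] Bochner_Integration.integral_diff[OF \<beta>i[of s] \<beta>i[of t]]
      by (auto simp: \<eta>'_def diff_divide_distrib left_diff_distrib)
    have e2: "integrable lebesgue (\<lambda>r. \<eta>' r * G0 r)" "(\<integral>r. \<eta>' r * G0 r \<partial>lebesgue) = (\<integral>r. \<eta>' r * G0 r \<partial>lborel)"
      using e1(1) borel_measurable_integrable[OF e1(1)] by (auto simp: integrable_completion integral_completion)
    have Ii: "integrable lebesgue (\<lambda>r. \<eta>' r * G0 r + \<eta> r * H1 r)" "(\<integral>r. \<eta>' r * G0 r + \<eta> r * H1 r \<partial>lebesgue) = 0"
      using I unfolding set_integrable_def set_lebesgue_integral_def eq by auto
    from Bochner_Integration.integrable_diff[OF Ii(1) e2(1)] have hi: "integrable lebesgue (\<lambda>r. \<eta> r * H1 r)" by simp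
    moreover have "(\<integral>r. \<eta> r * H1 r \<partial>lebesgue) = - (\<integral>r. \<eta>' r * G0 r \<partial>lebesgue)"
      using Ii(2) Bochner_Integration.integral_add[OF e2(1) hi] by simp
    ultimately show ?thesis using e1(2) e2(2) by (simp add: \<eta>_def)
  qed
  have lim: "(\<lambda>n. (S (- s / \<delta> n + r / \<delta> n) - S (- t / \<delta> n + r / \<delta> n)) * x) \<longlonglongrightarrow> indicator {s<..t} r * x"
    if st: "s < t" and d: "\<And>n. 0 < \<delta> n" "\<delta> \<longlonglongrightarrow> 0" for s t r x :: real and \<delta>
  proof -
    have arg: "- c / \<delta> n + r / \<delta> n = (r - c) / \<delta> n" for c n by (simp add: diff_divide_distrib)
    have "(\<lambda>n. S (- c / \<delta> n + r / \<delta> n)) \<longlonglongrightarrow> indicator {c<..} r" for c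
    proof (cases "c < r")
      case True
      have "eventually (\<lambda>n. \<delta> n < r - c) sequentially" using d(2) True by (intro order_tendstoD) auto
      then have "eventually (\<lambda>n. S (- c / \<delta> n + r / \<delta> n) = indicator {c<..} r) sequentially"
      proof eventually_elim
        case (elim n)
        then have "1 \<le> (r - c) / \<delta> n" using d(1)[of n] by (simp add: le_divide_eq)
        then show ?case using True unfolding arg by (simp add: S(5))
      qed
      then show ?thesis by (rule tendsto_eventually)
    next
      case False
      then have "S (- c / \<delta> n + r / \<delta> n) = 0" for n using d(1)[of n] unfolding arg by (simp add: S(4) divide_nonpos_pos)
      then show ?thesis using False by simp
    qed
    from tendsto_mult[OF tendsto_diff[OF this[of s] this[of t]] tendsto_const, of x]
    show ?thesis using st by (auto simp: indicator_def split: if_splits)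
  qed
  define \<delta> where "\<delta> t n = (b - t) / (n + 2)" for t :: real and n :: nat
  have \<delta>: "0 < \<delta> t n" "t + \<delta> t n < b" "\<delta> t \<longlonglongrightarrow> 0" if "t < b" for t n
  proof -
    show "0 < \<delta> t n" using that by (simp add: \<delta>_def)
    have "\<delta> t n < b - t" using that by (simp add: \<delta>_def divide_less_eq)
    then show "t + \<delta> t n < b" by simp
    have "(\<lambda>n. (b - t) / (real n + 2)) \<longlonglongrightarrow> 0" by real_asymp
    moreover have "\<delta> t = (\<lambda>n. (b - t) / (real n + 2))" by (rule ext) (simp add: \<delta>_def)
    ultimately show "\<delta> t \<longlonglongrightarrow> 0" by (simp only:)
  qed
  have H1m_st: "(\<lambda>r. indicator {s<..t} r * H1 r) \<in> borel_measurable lebesgue" if st: "a < s" "s < t" "t < b" for s t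
  proof (rule borel_measurable_LIMSEQ_real)
    show "(\<lambda>n. (S (- s / \<delta> t n + r / \<delta> t n) - S (- t / \<delta> t n + r / \<delta> t n)) * H1 r) \<longlonglongrightarrow> indicator {s<..t} r * H1 r" for r
      using \<delta>[OF st(3)] st(2) by (intro lim) auto
    show "(\<lambda>r. (S (- s / \<delta> t n + r / \<delta> t n) - S (- t / \<delta> t n + r / \<delta> t n)) * H1 r) \<in> borel_measurable lebesgue" for n
      using step[OF st(1,2) \<delta>(2,1)[OF st(3)], of n] by (auto dest: borel_measurable_integrable)
  qed
  have H1m: "H1 \<in> borel_measurable lebesgue"
  proof (rule borel_measurable_LIMSEQ_real)
    define \<sigma> where "\<sigma> n = (b - a) / (real n + 3)" for n :: nat
    have s0: "0 < \<sigma> n" "\<sigma> n \<le> (b - a) / 3" for n unfolding \<sigma>_def using ab by (simp, intro divide_left_mono) auto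
    have sl: "\<sigma> \<longlonglongrightarrow> 0" unfolding \<sigma>_def[abs_def] by real_asymp
    show "(\<lambda>r. indicator {a + \<sigma> n<..b - \<sigma> n} r * H1 r) \<in> borel_measurable lebesgue" for n
      using s0[of n] ab by (intro H1m_st) auto
    show "(\<lambda>n. indicator {a + \<sigma> n<..b - \<sigma> n} r * H1 r) \<longlonglongrightarrow> H1 r" for r
    proof (cases "r \<in> {a<..<b}")
      case True
      then have "eventually (\<lambda>n. \<sigma> n < min (r - a) (b - r)) sequentially" using sl by (intro order_tendstoD) auto
      then have "eventually (\<lambda>n. indicator {a + \<sigma> n<..b - \<sigma> n} r * H1 r = H1 r) sequentially"
        by eventually_elim auto
      then show ?thesis by (rule tendsto_eventually)
    qed (simp add: H1_def)
  qed
  have Hb: "AE r in lebesgue. \<bar>H1 r\<bar> \<le> C * (1 + \<bar>R\<bar>) * (indicator {a..b} r *\<^sub>R m r)"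
    using growth
  proof eventually_elim
    case (elim r)
    show ?case
    proof (cases "r \<in> {a<..<b}")
      case True
      then have r: "r \<in> {a..b}" by auto
      interpret prob_space "\<mu> r" by (rule mu(1)[OF r])
      have i: "integrable (\<mu> r) (\<lambda>x. frechet_derivative \<phi> (at x) (v r x))"
        by (rule int[OF r Ck_derivative_apply_continuous[OF \<phi>(1) v[OF r]] Dz])
      have "\<bar>H r\<bar> \<le> (\<integral>x. \<bar>frechet_derivative \<phi> (at x) (v r x)\<bar> \<partial>\<mu> r)" unfolding H_def by (rule integral_abs_bound)
      also have "\<dots> \<le> (\<integral>x. C * (1 + \<bar>R\<bar>) * m r \<partial>\<mu> r)"
      proof (rule integral_mono)
        fix x
        show "\<bar>frechet_derivative \<phi> (at x) (v r x)\<bar> \<le> C * (1 + \<bar>R\<bar>) * m r"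
        proof (cases "R < norm x")
          case True
          then show ?thesis using Dz C m(2)[OF r] by simp
        next
          case False
          have "\<bar>frechet_derivative \<phi> (at x) (v r x)\<bar> \<le> C * norm (v r x)" by (rule C)
          also have "\<dots> \<le> C * (m r * (1 + norm x))" using elim r C by (intro mult_left_mono) auto
          also have "\<dots> \<le> C * (m r * (1 + \<bar>R\<bar>))" using False C m(2)[OF r] by (intro mult_left_mono) auto
          finally show ?thesis by (simp add: mult_ac)
        qed
      qed (use i in auto)
      also have "\<dots> = C * (1 + \<bar>R\<bar>) * m r" by (simp add: prob_space)
      finally show ?thesis using True r by (simp add: H1_def)
    next
      case False
      then have "H1 r = 0" by (simp add: H1_def)
      moreover have "0 \<le> C * (1 + \<bar>R\<bar>) * (indicator {a..b} r *\<^sub>R m r)"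
        using C(1) m(2)[of r] by (intro mult_nonneg_nonneg) (auto simp: indicator_def)
      ultimately show ?thesis by simp
    qed
  qed
  have mi: "integrable lebesgue (\<lambda>r. C * (1 + \<bar>R\<bar>) * (indicator {a..b} r *\<^sub>R m r))"
    using m(1) by (simp add: set_integrable_def)
  have H1i: "integrable lebesgue H1"
    by (rule Bochner_Integration.integrable_bound[OF mi H1m]) (use Hb in \<open>auto elim!: eventually_mono\<close>)
  have ne: "AE r in lebesgue. r \<noteq> c" for c :: real by (rule AE_completion[OF AE_lborel_singleton])
  have HH1: "AE r in lebesgue. H1 r = indicator {a..b} r *\<^sub>R H r"
    using ne[of a] ne[of b] by eventually_elim (auto simp: H1_def indicator_def)
  have Hm: "(\<lambda>r. indicator {a..b} r *\<^sub>R H r) \<in> borel_measurable lebesgue"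
  proof -
    have "(\<lambda>r. indicator {a..b} r *\<^sub>R H r) = (\<lambda>r. H1 r + indicator {a} r * H a + indicator {b} r * H b)"
      using ab by (auto simp: H1_def indicator_def fun_eq_iff)
    moreover have "(\<lambda>r. H1 r + indicator {a} r * H a + indicator {b} r * H b) \<in> borel_measurable lebesgue"
      using H1m by (intro borel_measurable_add borel_measurable_times borel_measurable_indicator borel_measurable_const) auto
    ultimately show ?thesis by simp
  qed
  show Hint: "set_integrable lebesgue {a..b} H"
    unfolding set_integrable_def using H1i by (rule integrable_cong_AE[THEN iffD1, rotated 3]) (use HH1 Hm H1m in auto)
  have inner: "G t - G s = (LINT r:{s..t}|lebesgue. H r)" if st: "a < s" "s < t" "t < b" for s t
  proof -
    have l1: "(\<lambda>n. \<integral>r. (S (- s / \<delta> t n + r / \<delta> t n) - S (- t / \<delta> t n + r / \<delta> t n)) * H1 r \<partial>lebesgue) \<longlonglongrightarrow> G0 t - G0 s"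
    proof -
      have "(\<lambda>n. (\<integral>r. \<beta> (- t / \<delta> t n + r / \<delta> t n) / \<delta> t n * G0 r \<partial>lborel) - (\<integral>r. \<beta> (- s / \<delta> t n + r / \<delta> t n) / \<delta> t n * G0 r \<partial>lborel)) \<longlonglongrightarrow> G0 t - G0 s"
        using st by (intro tendsto_diff time_kernel_limit[OF S(2) S(4) S(5) S(6) S(7) G0m G0B G0c] \<delta>(1,3)) auto
      then show ?thesis using step[OF st(1,2) \<delta>(2,1)[OF st(3)]] by simp
    qed
    have l2: "(\<lambda>n. \<integral>r. (S (- s / \<delta> t n + r / \<delta> t n) - S (- t / \<delta> t n + r / \<delta> t n)) * H1 r \<partial>lebesgue) \<longlonglongrightarrow> (\<integral>r. indicator {s<..t} r * H1 r \<partial>lebesgue)"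
    proof (rule integral_dominated_convergence[where w="\<lambda>r. 2 * \<bar>H1 r\<bar>"])
      show "AE r in lebesgue. (\<lambda>n. (S (- s / \<delta> t n + r / \<delta> t n) - S (- t / \<delta> t n + r / \<delta> t n)) * H1 r) \<longlonglongrightarrow> indicator {s<..t} r * H1 r"
        using \<delta>[OF st(3)] st(2) by (intro AE_I2 lim) auto
      have Smono: "S x \<le> S y" if "x \<le> y" for x y using that S(2,3) by (meson DERIV_nonneg_imp_nondecreasing)
      have S01: "0 \<le> S x \<and> S x \<le> 1" for x
        using Smono[of "min x 0" x] Smono[of x "max x 1"] S(4)[of "min x 0"] S(5)[of "max x 1"] by simp
      show "AE r in lebesgue. norm ((S (- s / \<delta> t n + r / \<delta> t n) - S (- t / \<delta> t n + r / \<delta> t n)) * H1 r) \<le> 2 * \<bar>H1 r\<bar>" for n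
      proof (rule AE_I2)
        fix r
        have "\<bar>S (- s / \<delta> t n + r / \<delta> t n) - S (- t / \<delta> t n + r / \<delta> t n)\<bar> \<le> 2"
          using S01[of "- s / \<delta> t n + r / \<delta> t n"] S01[of "- t / \<delta> t n + r / \<delta> t n"] by linarith
        then show "norm ((S (- s / \<delta> t n + r / \<delta> t n) - S (- t / \<delta> t n + r / \<delta> t n)) * H1 r) \<le> 2 * \<bar>H1 r\<bar>"
          by (simp add: abs_mult mult_right_mono)
      qed
      show "(\<lambda>r. (S (- s / \<delta> t n + r / \<delta> t n) - S (- t / \<delta> t n + r / \<delta> t n)) * H1 r) \<in> borel_measurable lebesgue" for n
        using step[OF st(1,2) \<delta>(2,1)[OF st(3)], of n] by (auto dest: borel_measurable_integrable)
    qed (use H1i H1m_st[OF st] in auto)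
    have "G0 t - G0 s = (\<integral>r. indicator {s<..t} r * H1 r \<partial>lebesgue)" by (rule LIMSEQ_unique[OF l1 l2])
    also have "\<dots> = (LINT r:{s..t}|lebesgue. H r)"
      unfolding set_lebesgue_integral_def
    proof (rule integral_cong_AE)
      show "(\<lambda>r. indicator {s..t} r *\<^sub>R H r) \<in> borel_measurable lebesgue"
        using set_integrable_subset[OF Hint, of "{s..t}"] st by (auto simp: set_integrable_def dest: borel_measurable_integrable)
      show "AE r in lebesgue. indicator {s<..t} r * H1 r = indicator {s..t} r *\<^sub>R H r"
        using ne[of s] by eventually_elim (use st in \<open>auto simp: H1_def indicator_def\<close>)
    qed (rule H1m_st[OF st])
    finally show ?thesis using st by (simp add: G0_def)
  qed
  \<comment> \<open>\<open>P\<close> is constant on the open interval, hence on its closure by continuity.\<close>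
  define P where "P t = G t - (LINT r:{a..t}|lebesgue. H r)" for t
  have Pc: "continuous_on {a..b} P" unfolding P_def by (intro continuous_on_diff Gc continuous_on_set_integral_Icc Hint)
  have Pin: "P t = P ((a + b) / 2)" if "t \<in> {a<..<b}" for t
  proof -
    have *: "P s = P t" if "a < s" "s < t" "t < b" for s t
      using inner[OF that] set_integral_Icc_combine[OF Hint, of s t] that by (simp add: P_def)
    have mid: "a < (a + b) / 2" "(a + b) / 2 < b" using ab by auto
    consider "t < (a + b) / 2" | "t = (a + b) / 2" | "(a + b) / 2 < t" by linarith
    then show ?thesis
    proof cases
      case 1
      then show ?thesis using that mid by (intro *) auto
    next
      case 3
      then show ?thesis using that mid by (intro *[symmetric]) auto
    next
      case 2
      then show ?thesis by (simp only:)
    qed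
  qed
  have Pall: "P t = P ((a + b) / 2)" if "t \<in> {a..b}" for t
  proof (rule continuous_constant_on_closure[of "{a<..<b}" P])
    show "continuous_on (closure {a<..<b}) P" unfolding closure_greaterThanLessThan[OF ab] by (rule Pc)
    show "t \<in> closure {a<..<b}" unfolding closure_greaterThanLessThan[OF ab] by (rule that)
  qed (rule Pin)
  show "\<And>s t. a \<le> s \<Longrightarrow> s \<le> t \<Longrightarrow> t \<le> b \<Longrightarrow> (\<integral>x. \<phi> x \<partial>\<mu> t) - (\<integral>x. \<phi> x \<partial>\<mu> s) = (LINT r:{s..t}|lebesgue. H r)"
  proof -
    fix s t assume st: "a \<le> s" "s \<le> t" "t \<le> b"
    have "s \<in> {a..b}" "t \<in> {a..b}" using st by auto
    then have "P s = P t" by (rule trans[OF Pall Pall[symmetric]])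
    then show "(\<integral>x. \<phi> x \<partial>\<mu> t) - (\<integral>x. \<phi> x \<partial>\<mu> s) = (LINT r:{s..t}|lebesgue. H r)"
      using set_integral_Icc_combine[OF Hint st] by (simp add: P_def G_def)
  qed
qed


section \<open>Curves transported by a velocity field\<close>

text \<open>A diagonal argument on a countable dense set; the common Lipschitz constant turns convergence there into the
  Cauchy property at every point.\<close>
lemma equi_lipschitz_subsequence:
  fixes f :: "nat \<Rightarrow> 'a::euclidean_space \<Rightarrow> 'b::euclidean_space"
  assumes lip: "\<And>n. K-lipschitz_on UNIV (f n)" and bd: "\<And>n x. norm (f n x) \<le> c * (1 + norm x)"
  obtains r F where "strict_mono (r :: nat \<Rightarrow> nat)" "\<And>x. (\<lambda>n. f (r n) x) \<longlonglongrightarrow> F x" "K-lipschitz_on UNIV F"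
proof -
  have K: "0 \<le> K" using lipschitz_on_nonneg[OF lip[of 0]] .
  obtain S :: "'a set" where S: "countable S" "UNIV \<subseteq> closure S"
    by (rule separable[of "UNIV :: 'a set"])
  have pos: "0 < 1 + norm x" for x :: 'a by (simp add: add_pos_nonneg)
  define h where "h n x = f n x /\<^sub>R (1 + norm x)" for n x
  have "norm (h n x) \<le> c" for n x
    using bd[of n x] pos[of x] by (simp add: h_def divide_le_eq field_simps)
  then obtain r where r: "strict_mono (r :: nat \<Rightarrow> nat)" "\<And>x. x \<in> S \<Longrightarrow> \<exists>l. (\<lambda>n. h (r n) x) \<longlonglongrightarrow> l"
    using function_convergent_subsequence[OF S(1), of h c] by blast
  have convS: "convergent (\<lambda>n. f (r n) x)" if xS: "x \<in> S" for x
  proof -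
    obtain l where "(\<lambda>n. h (r n) x) \<longlonglongrightarrow> l" using r(2)[OF xS] by blast
    then have "(\<lambda>n. (1 + norm x) *\<^sub>R h (r n) x) \<longlonglongrightarrow> (1 + norm x) *\<^sub>R l" by (intro tendsto_intros)
    moreover have "(1 + norm x) *\<^sub>R h (r n) x = f (r n) x" for n using pos[of x] by (simp add: h_def)
    ultimately show ?thesis by (auto simp: convergent_def)
  qed
  have "Cauchy (\<lambda>n. f (r n) x)" for x
  proof (rule metric_CauchyI)
    fix e :: real assume e: "0 < e"
    define d where "d = e / (3 * (K + 1))"
    have d: "0 < d" "K * d \<le> e / 3" using e K by (auto simp: d_def field_simps)
    obtain y where y: "y \<in> S" "dist y x < d"
      using S(2) d(1) closure_approachable[of x S] by blast
    have "Cauchy (\<lambda>n. f (r n) y)" using convS[OF y(1)] by (rule convergent_Cauchy)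
    then obtain N where N: "\<And>m n. m \<ge> N \<Longrightarrow> n \<ge> N \<Longrightarrow> dist (f (r m) y) (f (r n) y) < e / 3"
      using e metric_CauchyD[of "\<lambda>n. f (r n) y" "e/3"] by auto
    have l: "dist (f (r n) x) (f (r n) y) \<le> e / 3" for n
    proof -
      have "dist (f (r n) x) (f (r n) y) \<le> K * dist x y" by (rule lipschitz_onD[OF lip]) auto
      also have "\<dots> \<le> K * d" using y(2) K by (intro mult_left_mono) (auto simp: dist_commute)
      finally show ?thesis using d(2) by simp
    qed
    have "dist (f (r m) x) (f (r n) x) < e" if "m \<ge> N" "n \<ge> N" for m n
    proof -
      have "dist (f (r m) x) (f (r n) x) \<le> dist (f (r m) x) (f (r m) y) + dist (f (r m) y) (f (r n) y) + dist (f (r n) y) (f (r n) x)"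
        by (meson add_mono dist_triangle order_refl order_trans)
      then show ?thesis using l[of m] l[of n] N[OF that] by (simp add: dist_commute)
    qed
    then show "\<exists>M. \<forall>m\<ge>M. \<forall>n\<ge>M. dist (f (r m) x) (f (r n) x) < e" by blast
  qed
  then have "\<exists>l. (\<lambda>n. f (r n) x) \<longlonglongrightarrow> l" for x using Cauchy_convergent convergent_def by blast
  then obtain F where F: "\<And>x. (\<lambda>n. f (r n) x) \<longlonglongrightarrow> F x" by metis
  have "K-lipschitz_on UNIV F"
  proof (rule lipschitz_onI[OF _ K])
    fix x y
    show "dist (F x) (F y) \<le> K * dist x y"
      by (rule tendsto_upperbound[OF tendsto_dist[OF F F]])
         (auto intro!: always_eventually lipschitz_onD[OF lip])
  qed
  then show ?thesis using that r(1) F by blast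
qed

text \<open>Open boxes generate the Borel sets and are stable under intersection, and the indicator of a box is an
  increasing limit of Lipschitz functions supported in the box.\<close>
lemma measure_eqI_lipschitz:
  fixes \<mu> \<nu> :: "'a::euclidean_space measure"
  assumes \<mu>: "prob_space \<mu>" "sets \<mu> = sets borel" and \<nu>: "prob_space \<nu>" "sets \<nu> = sets borel"
    and eq: "\<And>\<phi> K B R. K-lipschitz_on UNIV \<phi> \<Longrightarrow> (\<And>x. \<bar>\<phi> x\<bar> \<le> B) \<Longrightarrow> (\<And>x. R < norm x \<Longrightarrow> \<phi> x = 0)
       \<Longrightarrow> (\<integral>x. \<phi> x \<partial>\<mu>) = (\<integral>x. \<phi> x \<partial>\<nu> :: real)"
  shows "\<mu> = \<nu>"
proof -
  interpret M: prob_space \<mu> by fact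
  interpret N: prob_space \<nu> by fact
  have [measurable_cong]: "sets \<mu> = sets borel" "sets \<nu> = sets borel" by fact+
  have box: "measure \<mu> (box a b) = measure \<nu> (box a b)" for a b :: 'a
  proof -
    define \<phi> where "\<phi> n x = min 1 (real n * infdist x (- box a b))" for n x
    have Kl: "(real n)-lipschitz_on UNIV (\<phi> n)" for n
    proof (rule lipschitz_onI)
      fix x y
      have "\<bar>\<phi> n x - \<phi> n y\<bar> \<le> \<bar>real n * infdist x (- box a b) - real n * infdist y (- box a b)\<bar>"
        by (auto simp: \<phi>_def)
      also have "\<dots> = real n * \<bar>infdist x (- box a b) - infdist y (- box a b)\<bar>"
        by (simp add: abs_mult flip: right_diff_distrib)
      also have "\<dots> \<le> real n * dist x y" by (intro mult_left_mono infdist_triangle_abs) auto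
      finally show "dist (\<phi> n x) (\<phi> n y) \<le> real n * dist x y" by (simp add: dist_real_def)
    qed simp
    have \<phi>01: "0 \<le> \<phi> n x" "\<phi> n x \<le> 1" for n x by (auto simp: \<phi>_def infdist_nonneg)
    have \<phi>0: "\<phi> n x = 0" if "x \<notin> box a b" for n x using that by (simp add: \<phi>_def)
    obtain R where R: "\<And>x. x \<in> box a b \<Longrightarrow> norm x \<le> R" using bounded_box[of a b] by (auto simp: bounded_iff)
    have ne: "- box a b \<noteq> {}"
    proof
      assume "- box a b = {}"
      then have "bounded (UNIV :: 'a set)" using bounded_box[of a b] by (metis double_compl compl_bot_eq)
      then show False by simp
    qed
    have lim: "(\<lambda>n. \<phi> n x) \<longlonglongrightarrow> indicator (box a b) x" for x
    proof (cases "x \<in> box a b")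
      case True
      have d: "0 < infdist x (- box a b)"
        using infdist_pos_not_in_closed[of "- box a b" x] ne True by auto
      obtain N where N: "1 / infdist x (- box a b) \<le> real N" using real_arch_simple by blast
      have "eventually (\<lambda>n. \<phi> n x = indicator (box a b) x) sequentially"
        unfolding eventually_sequentially
      proof (intro exI[of _ N] allI impI)
        fix n assume "N \<le> n"
        then have "1 / infdist x (- box a b) \<le> real n" using N by linarith
        then show "\<phi> n x = indicator (box a b) x" using d True by (simp add: \<phi>_def divide_le_eq)
      qed
      then show ?thesis by (rule tendsto_eventually)
    qed (simp add: \<phi>0)
    have [measurable]: "\<phi> n \<in> borel_measurable borel" for n
      using lipschitz_on_continuous_on[OF Kl] by (rule borel_measurable_continuous_onI)
    have l1: "(\<lambda>n. \<integral>x. \<phi> n x \<partial>\<mu>) \<longlonglongrightarrow> (\<integral>x. indicator (box a b) x \<partial>\<mu>)"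
      by (rule integral_dominated_convergence[where w="\<lambda>_. 1"]) (use lim \<phi>01 in auto)
    have l2: "(\<lambda>n. \<integral>x. \<phi> n x \<partial>\<nu>) \<longlonglongrightarrow> (\<integral>x. indicator (box a b) x \<partial>\<nu>)"
      by (rule integral_dominated_convergence[where w="\<lambda>_. 1"]) (use lim \<phi>01 in auto)
    have "(\<integral>x. \<phi> n x \<partial>\<mu>) = (\<integral>x. \<phi> n x \<partial>\<nu>)" for n
    proof (rule eq[OF Kl, where B=1 and R=R])
      show "\<phi> n x = 0" if "R < norm x" for x using R[of x] that by (intro \<phi>0) auto
    qed (use \<phi>01 in auto)
    then have "(\<integral>x. indicator (box a b) x \<partial>\<mu>) = (\<integral>x. indicator (box a b) x \<partial>\<nu> :: real)"
      using LIMSEQ_unique[OF l1] l2 by simp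
    then show ?thesis by simp
  qed
  show ?thesis
  proof (rule measure_eqI_generator_eq[where \<Omega>=UNIV and E="range (\<lambda>(a, b). box a b :: 'a set)" and A="\<lambda>n. box (- (real n *\<^sub>R One)) (real n *\<^sub>R One)"])
    show "Int_stable (range (\<lambda>(a, b). box a b :: 'a set))"
      by (auto simp: Int_stable_def box_Int_box)
    show "sets \<mu> = sigma_sets UNIV (range (\<lambda>(a, b). box a b))" "sets \<nu> = sigma_sets UNIV (range (\<lambda>(a, b). box a b))"
      unfolding \<mu>(2) \<nu>(2) by (subst borel_eq_box, rule sets_measure_of, simp)+
    show "(\<Union>n. box (- (real n *\<^sub>R One)) (real n *\<^sub>R One)) = (UNIV :: 'a set)" by (rule UN_box_eq_UNIV)
  qed (auto simp: M.emeasure_eq_measure N.emeasure_eq_measure box)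
qed

lemma sigma_finite_lebesgue: "sigma_finite_measure (lebesgue :: 'a::euclidean_space measure)"
proof
  have "(\<Union>n. cball 0 (real n)) = (UNIV :: 'a set)"
  proof (intro equalityI subsetI)
    fix x :: 'a
    obtain n where "norm x \<le> real n" using real_arch_simple by blast
    then show "x \<in> (\<Union>n. cball 0 (real n))" by auto
  qed simp
  moreover have "emeasure lebesgue (cball (0::'a) (real n)) \<noteq> \<infinity>" for n
    using emeasure_lborel_cball_finite[of "0::'a" "real n"] by simp
  ultimately show "\<exists>A. countable A \<and> A \<subseteq> sets lebesgue \<and> \<Union>A = space (lebesgue :: 'a measure) \<and> (\<forall>a\<in>A. emeasure lebesgue a \<noteq> \<infinity>)"
    by (intro exI[of _ "range (\<lambda>n. cball (0::'a) (real n))"]) auto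
qed

text \<open>A curve of measures driven by a velocity field \<open>u\<close> in the form used by the duality argument:
  the bounds hold at every time (\<open>u\<close> may be set to zero on a null set of times), and the continuity
  equation is stated between two times against functions of space.\<close>
locale transport_curve =
  fixes p a b :: real and u :: "real \<Rightarrow> 'a::euclidean_space \<Rightarrow> 'a" and \<mu> :: "real \<Rightarrow> 'a measure" and m l g :: "real \<Rightarrow> real"
  assumes ab: "a < b" and p: "1 \<le> p"
    and mu: "\<And>t. t \<in> {a..b} \<Longrightarrow> \<mu> t \<in> prob_moment p"
    and m: "integrable lebesgue m" "\<And>t. 0 \<le> m t"
    and l: "integrable lebesgue l" "\<And>t. 0 \<le> l t"
    and g: "integrable lebesgue g" "\<And>t. 0 \<le> g t"
    and u_meas: "\<And>x. (\<lambda>t. u t x) \<in> borel_measurable lebesgue"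
    and growth: "\<And>t x. norm (u t x) \<le> m t * (1 + norm x)"
    and lip: "\<And>t. (l t)-lipschitz_on UNIV (u t)"
    and W: "\<And>s t. a \<le> s \<Longrightarrow> s \<le> t \<Longrightarrow> t \<le> b \<Longrightarrow> wasserstein p (\<mu> s) (\<mu> t) \<le> (LINT r:{s..t}|lebesgue. g r)"
    and ice_int: "\<And>\<phi> R. (\<And>k. Ck k \<phi>) \<Longrightarrow> (\<And>x. R < norm x \<Longrightarrow> \<phi> x = 0) \<Longrightarrow>
       set_integrable lebesgue {a..b} (\<lambda>r. \<integral>x. frechet_derivative \<phi> (at x) (u r x) \<partial>\<mu> r)"
    and ice: "\<And>\<phi> R s t. (\<And>k. Ck k \<phi>) \<Longrightarrow> (\<And>x. R < norm x \<Longrightarrow> \<phi> x = 0) \<Longrightarrow> a \<le> s \<Longrightarrow> s \<le> t \<Longrightarrow> t \<le> b \<Longrightarrow>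
       (\<integral>x. \<phi> x \<partial>\<mu> t) - (\<integral>x. \<phi> x \<partial>\<mu> s) = (LINT r:{s..t}|lebesgue. (\<integral>x. frechet_derivative \<phi> (at x) (u r x) \<partial>\<mu> r))"
begin

lemma set_int: "integrable lebesgue f \<Longrightarrow> set_integrable lebesgue {s..t::real} f"
  for f :: "real \<Rightarrow> 'b::{banach, second_countable_topology}"
  unfolding set_integrable_def by (intro integrable_mult_indicator) auto

text \<open>\<open>A\<close> bounds both the growth and the Lipschitz constant of the displacement \<open>drift\<close>,
  while \<open>E\<close> bounds the Wasserstein distance between the measures at two times.\<close>
definition A :: "real \<Rightarrow> real \<Rightarrow> real" where "A s t = (LINT r:{s..t}|lebesgue. m r + l r)"
definition E :: "real \<Rightarrow> real \<Rightarrow> real" where "E s t = (LINT r:{s..t}|lebesgue. g r)"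
definition drift :: "real \<Rightarrow> real \<Rightarrow> 'a \<Rightarrow> 'a" where "drift s t x = (LINT r:{s..t}|lebesgue. u r x)"

lemma set_int_nonneg: "(\<And>t. 0 \<le> f t) \<Longrightarrow> 0 \<le> (LINT r:{s..t::real}|lebesgue. f r :: real)"
  unfolding set_lebesgue_integral_def by (intro integral_nonneg_AE) auto

lemma A_nonneg: "0 \<le> A s t" unfolding A_def by (rule set_int_nonneg) (use m l in auto)
lemma E_nonneg: "0 \<le> E s t" unfolding E_def by (rule set_int_nonneg) (use g in auto)

lemma u_int: "set_integrable lebesgue {s..t} (\<lambda>r. u r x)"
  unfolding set_integrable_def
proof (rule Bochner_Integration.integrable_bound)
  show "integrable lebesgue (\<lambda>r. m r * (1 + norm x))" using m by simp
  show "(\<lambda>r. indicator {s..t} r *\<^sub>R u r x) \<in> borel_measurable lebesgue"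
    by (intro borel_measurable_scaleR borel_measurable_indicator u_meas) auto
  show "AE r in lebesgue. norm (indicator {s..t} r *\<^sub>R u r x) \<le> norm (m r * (1 + norm x))"
    using growth m by (intro AE_I2) (auto simp: indicator_def)
qed

lemma combine:
  assumes "s \<le> t" "t \<le> w"
  shows "A s t + A t w = A s w" "drift s t x + drift t w x = drift s w x"
proof -
  have "integrable lebesgue (\<lambda>r. m r + l r)" using m l by simp
  then show "A s t + A t w = A s w"
    unfolding A_def by (intro set_integral_Icc_combine[where b=w] set_int assms order_refl)
  show "drift s t x + drift t w x = drift s w x"
    unfolding drift_def by (intro set_integral_Icc_combine[where b=w] u_int assms order_refl)
qed

lemma A_mono: "s \<le> t \<Longrightarrow> t \<le> w \<Longrightarrow> A t w \<le> A s w" using combine(1)[of s t w] A_nonneg[of s t] by simp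

lemma drift_growth: "norm (drift s t x) \<le> A s t * (1 + norm x)"
proof -
  have "norm (drift s t x) \<le> (LINT r:{s..t}|lebesgue. norm (u r x))"
    unfolding drift_def by (rule set_integral_norm_bound[OF u_int])
  also have "\<dots> \<le> (LINT r:{s..t}|lebesgue. (m r + l r) * (1 + norm x))"
  proof (rule set_integral_mono)
    show "set_integrable lebesgue {s..t} (\<lambda>r. norm (u r x))" using set_integrable_norm[OF u_int] .
    show "set_integrable lebesgue {s..t} (\<lambda>r. (m r + l r) * (1 + norm x))" using m l by (intro set_int) auto
    show "norm (u r x) \<le> (m r + l r) * (1 + norm x)" for r
      using growth[of r x] l(2)[of r] by (simp add: distrib_right add_increasing2)
  qed
  also have "\<dots> = A s t * (1 + norm x)" by (simp add: A_def)
  finally show ?thesis .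
qed

lemma drift_lip: "(A s t)-lipschitz_on UNIV (drift s t)"
proof (rule lipschitz_onI[OF _ A_nonneg])
  fix x y
  have "drift s t x - drift s t y = (LINT r:{s..t}|lebesgue. u r x - u r y)"
    unfolding drift_def by (rule set_integral_diff(2)[OF u_int u_int, symmetric])
  then have "dist (drift s t x) (drift s t y) = norm (LINT r:{s..t}|lebesgue. u r x - u r y)" by (simp add: dist_norm)
  also have "\<dots> \<le> (LINT r:{s..t}|lebesgue. norm (u r x - u r y))"
    by (rule set_integral_norm_bound[OF set_integral_diff(1)[OF u_int u_int]])
  also have "\<dots> \<le> (LINT r:{s..t}|lebesgue. (m r + l r) * norm (x - y))"
  proof (rule set_integral_mono)
    show "set_integrable lebesgue {s..t} (\<lambda>r. norm (u r x - u r y))" using set_integrable_norm[OF set_integral_diff(1)[OF u_int u_int]] .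
    show "set_integrable lebesgue {s..t} (\<lambda>r. (m r + l r) * norm (x - y))" using m l by (intro set_int) auto
    show "norm (u r x - u r y) \<le> (m r + l r) * norm (x - y)" for r
      using lipschitz_onD[OF lip, of x y r] m(2)[of r] by (simp add: dist_norm distrib_right add_increasing)
  qed
  also have "\<dots> = A s t * dist x y" by (simp add: A_def dist_norm)
  finally show "dist (drift s t x) (drift s t y) \<le> A s t * dist x y" .
qed

text \<open>\<open>u\<close> is measurable in time and continuous in space, hence the limit of the jointly measurable
  maps obtained by composing with simple functions of the space variable.\<close>
lemma u_joint: "(\<lambda>z. u (fst z) (snd z)) \<in> borel_measurable (lebesgue \<Otimes>\<^sub>M (borel :: 'a measure))"
proof -
  obtain F :: "nat \<Rightarrow> 'a \<Rightarrow> 'a" where F: "\<And>i. simple_function borel (F i)" "\<And>x. (\<lambda>i. F i x) \<longlonglongrightarrow> x"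
    using borel_measurable_implies_sequence_metric[of "\<lambda>x::'a. x" borel 0] by auto
  show ?thesis
  proof (rule borel_measurable_LIMSEQ_metric)
    fix i
    have "(\<lambda>z. F i (snd z)) \<in> measurable (lebesgue \<Otimes>\<^sub>M borel) (count_space UNIV)"
      using measurable_simple_function[OF F(1)] by (rule measurable_compose[OF measurable_snd])
    then have "(\<lambda>z. F i (snd z)) \<in> measurable (lebesgue \<Otimes>\<^sub>M borel) (count_space (range (F i)))"
      using simple_functionD(1)[OF F(1)[of i]]
      by (subst measurable_count_space_eq2) (auto intro: measurable_sets)
    then show "(\<lambda>z. u (fst z) (F i (snd z))) \<in> borel_measurable (lebesgue \<Otimes>\<^sub>M borel)"
    proof (rule measurable_compose_countable'[rotated])
      show "(\<lambda>z. u (fst z) y) \<in> borel_measurable (lebesgue \<Otimes>\<^sub>M borel)" for y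
        using measurable_compose[OF measurable_fst u_meas] .
      show "countable (range (F i))" using simple_functionD(1)[OF F(1)[of i]] by (simp add: countable_finite)
    qed
  next
    fix z
    have "isCont (u (fst z)) (snd z)"
      using lipschitz_on_continuous_on[OF lip[of "fst z"]] by (simp add: continuous_on_eq_continuous_at)
    then show "(\<lambda>i. u (fst z) (F i (snd z))) \<longlonglongrightarrow> u (fst z) (snd z)" using F(2) by (rule isCont_tendsto_compose)
  qed
qed

lemma bounded_integrable:
  fixes h :: "'a \<Rightarrow> real"
  assumes r: "r \<in> {a..b}" and h: "continuous_on UNIV h" "\<And>x. \<bar>h x\<bar> \<le> B"
  shows "integrable (\<mu> r) h"
proof -
  note mr = prob_momentD[OF mu[OF r]]
  interpret prob_space "\<mu> r" by (rule mr(1))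
  show ?thesis
    using borel_measurable_continuous_onI[OF h(1)] h(2)
    by (intro integrable_const_bound[where B=B]) (auto simp: measurable_cong_sets[OF mr(2) refl])
qed

lemma integral_le_const:
  fixes h :: "'a \<Rightarrow> real"
  assumes r: "r \<in> {a..b}" and h: "continuous_on UNIV h" "\<And>x. \<bar>h x\<bar> \<le> B"
  shows "\<bar>\<integral>x. h x \<partial>\<mu> r\<bar> \<le> B"
proof -
  interpret prob_space "\<mu> r" by (rule prob_momentD(1)[OF mu[OF r]])
  have "\<bar>\<integral>x. h x \<partial>\<mu> r\<bar> \<le> (\<integral>x. \<bar>h x\<bar> \<partial>\<mu> r)" by (rule integral_abs_bound)
  also have "\<dots> \<le> (\<integral>x. B \<partial>\<mu> r)" using bounded_integrable[OF r h] h(2) by (intro integral_mono) auto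
  finally show ?thesis by (simp add: prob_space)
qed

text \<open>For a fixed measure \<open>\<mu> s\<close> the time integral can be moved inside; as the derivative of
  \<open>\<phi>\<close> is linear in the direction, it produces the displacement \<open>drift s t\<close>.\<close>
lemma fubini_step:
  fixes \<phi> :: "'a \<Rightarrow> real"
  assumes s: "s \<in> {a..b}" and \<phi>: "\<And>k. Ck k \<phi>" and c: "\<And>r x. \<bar>frechet_derivative \<phi> (at x) (u r x)\<bar> \<le> c * m r"
  shows "set_integrable lebesgue {s..t} (\<lambda>r. \<integral>x. frechet_derivative \<phi> (at x) (u r x) \<partial>\<mu> s)"
    "(LINT r:{s..t}|lebesgue. (\<integral>x. frechet_derivative \<phi> (at x) (u r x) \<partial>\<mu> s)) = (\<integral>x. frechet_derivative \<phi> (at x) (drift s t x) \<partial>\<mu> s)"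
proof -
  note ms = prob_momentD[OF mu[OF s]]
  interpret M: prob_space "\<mu> s" by (rule ms(1))
  interpret L: sigma_finite_measure "lebesgue :: real measure" by (rule sigma_finite_lebesgue)
  interpret P: pair_sigma_finite "lebesgue :: real measure" "\<mu> s" ..
  have ps: "sets (lebesgue \<Otimes>\<^sub>M \<mu> s) = sets (lebesgue \<Otimes>\<^sub>M (borel :: 'a measure))"
    using ms(2) by (intro sets_pair_measure_cong) auto
  define F where "F r x = indicator {s..t} r *\<^sub>R frechet_derivative \<phi> (at x) (u r x)" for r x
  have Dc: "continuous_on UNIV (\<lambda>x. frechet_derivative \<phi> (at x) i)" for i using \<phi>[of "Suc 0"] by simp
  have "(\<lambda>z. F (fst z) (snd z)) \<in> borel_measurable (lebesgue \<Otimes>\<^sub>M (borel :: 'a measure))"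
  proof -
    have 1: "(\<lambda>z. frechet_derivative \<phi> (at (snd z)) i) \<in> borel_measurable (lebesgue \<Otimes>\<^sub>M (borel :: 'a measure))" for i
      by (rule measurable_compose[OF measurable_snd borel_measurable_continuous_onI[OF Dc]])
    have 2: "(\<lambda>z. indicator {s..t} (fst z) :: real) \<in> borel_measurable (lebesgue \<Otimes>\<^sub>M (borel :: 'a measure))"
      by (rule measurable_compose[OF measurable_fst]) (intro borel_measurable_indicator, simp)
    have "(\<lambda>z. indicator {s..t} (fst z) *\<^sub>R (\<Sum>i\<in>Basis. (u (fst z) (snd z) \<bullet> i) * frechet_derivative \<phi> (at (snd z)) i)) \<in> borel_measurable (lebesgue \<Otimes>\<^sub>M (borel :: 'a measure))"
      by (intro borel_measurable_scaleR 2 borel_measurable_sum borel_measurable_times 1 borel_measurable_inner u_joint borel_measurable_const)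
    then show ?thesis unfolding F_def by (simp only: derivative_basis_sum[OF \<phi>[of "Suc 0"], symmetric])
  qed
  then have Fm: "case_prod F \<in> borel_measurable (lebesgue \<Otimes>\<^sub>M \<mu> s)"
    by (simp add: case_prod_unfold measurable_cong_sets[OF ps refl])
  have Fb: "norm (F r x) \<le> \<bar>c\<bar> * m r" for r x
    using c[where r=r and x=x] m(2)[of r] mult_right_mono[OF abs_ge_self[of c], of "m r"] by (auto simp: F_def indicator_def)
  have Fi: "integrable (lebesgue \<Otimes>\<^sub>M \<mu> s) (case_prod F)"
  proof (rule integrableI_bounded[OF Fm])
    have "(\<integral>\<^sup>+z. ennreal (norm (case_prod F z)) \<partial>(lebesgue \<Otimes>\<^sub>M \<mu> s)) = (\<integral>\<^sup>+r. (\<integral>\<^sup>+x. ennreal (norm (F r x)) \<partial>\<mu> s) \<partial>lebesgue)"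
      using Fm by (subst M.nn_integral_fst[symmetric]) auto
    also have "\<dots> \<le> (\<integral>\<^sup>+r. (\<integral>\<^sup>+x. ennreal (\<bar>c\<bar> * m r) \<partial>\<mu> s) \<partial>lebesgue)"
      by (intro nn_integral_mono ennreal_leI Fb)
    also have "\<dots> = (\<integral>\<^sup>+r. ennreal (\<bar>c\<bar> * m r) \<partial>lebesgue)" by (simp add: M.emeasure_space_1)
    also have "\<dots> = ennreal (\<integral>r. \<bar>c\<bar> * m r \<partial>lebesgue)" using m by (intro nn_integral_eq_integral) auto
    also have "\<dots> < \<infinity>" by simp
    finally show "(\<integral>\<^sup>+z. ennreal (norm (case_prod F z)) \<partial>(lebesgue \<Otimes>\<^sub>M \<mu> s)) < \<infinity>" .
  qed
  have "integrable lebesgue (\<lambda>r. \<integral>x. F r x \<partial>\<mu> s)" using P.integrable_fst[OF Fi] .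
  then show "set_integrable lebesgue {s..t} (\<lambda>r. \<integral>x. frechet_derivative \<phi> (at x) (u r x) \<partial>\<mu> s)"
    by (simp add: F_def set_integrable_def)
  have "(LINT r:{s..t}|lebesgue. (\<integral>x. frechet_derivative \<phi> (at x) (u r x) \<partial>\<mu> s)) = (\<integral>r. (\<integral>x. F r x \<partial>\<mu> s) \<partial>lebesgue)"
    by (simp add: F_def set_lebesgue_integral_def)
  also have "\<dots> = (\<integral>x. (\<integral>r. F r x \<partial>lebesgue) \<partial>\<mu> s)" by (rule P.Fubini_integral[OF Fi, symmetric])
  also have "(\<lambda>x. \<integral>r. F r x \<partial>lebesgue) = (\<lambda>x. frechet_derivative \<phi> (at x) (drift s t x))"
  proof
    fix x
    have bl: "bounded_linear (frechet_derivative \<phi> (at x))"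
      using Ck_has_derivative[OF \<phi>] has_derivative_bounded_linear by blast
    have "(\<integral>r. F r x \<partial>lebesgue) = (\<integral>r. frechet_derivative \<phi> (at x) (indicator {s..t} r *\<^sub>R u r x) \<partial>lebesgue)"
      by (simp add: F_def linear_cmul[OF bounded_linear.linear[OF bl]])
    also have "\<dots> = frechet_derivative \<phi> (at x) (\<integral>r. indicator {s..t} r *\<^sub>R u r x \<partial>lebesgue)"
      by (rule integral_bounded_linear[OF bl]) (use u_int in \<open>simp add: set_integrable_def\<close>)
    finally show "(\<integral>r. F r x \<partial>lebesgue) = frechet_derivative \<phi> (at x) (drift s t x)"
      by (simp add: drift_def set_lebesgue_integral_def)
  qed
  finally show "(LINT r:{s..t}|lebesgue. (\<integral>x. frechet_derivative \<phi> (at x) (u r x) \<partial>\<mu> s)) = (\<integral>x. frechet_derivative \<phi> (at x) (drift s t x) \<partial>\<mu> s)" .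
qed

end


section \<open>The error of one Euler step\<close>

context transport_curve
begin

lemma flux_lipschitz:
  fixes \<phi> :: "'a \<Rightarrow> real"
  assumes \<phi>: "\<And>k. Ck k \<phi>" "\<And>x. R < norm x \<Longrightarrow> \<phi> x = 0" and R: "0 \<le> R" and C: "0 \<le> C"
    "\<And>x u. \<bar>frechet_derivative \<phi> (at x) u\<bar> \<le> C * norm u"
    "\<And>x y u. \<bar>frechet_derivative \<phi> (at x) u - frechet_derivative \<phi> (at y) u\<bar> \<le> C * norm (x - y) * norm u"
  shows "\<bar>frechet_derivative \<phi> (at x) (u r x)\<bar> \<le> C * (1 + R) * m r"
    and "(C * (1 + R) * (m r + l r))-lipschitz_on UNIV (\<lambda>x. frechet_derivative \<phi> (at x) (u r x))"
proof -
  have Dz: "frechet_derivative \<phi> (at x) w = 0" if "R < norm x" for x w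
    by (rule Ck_derivative_vanishes[OF \<phi>(1), where R=R]) (use \<phi>(2) that in auto)
  have ub: "norm (u r x) \<le> (1 + R) * m r" if "norm x \<le> R" for x
    using growth[of r x] mult_left_mono[of "1 + norm x" "1 + R" "m r"] that m(2)[of r] by (simp add: mult.commute)
  show "\<bar>frechet_derivative \<phi> (at x) (u r x)\<bar> \<le> C * (1 + R) * m r"
  proof (cases "R < norm x")
    case True
    then show ?thesis using Dz C(1) R m(2)[of r] by simp
  next
    case False
    have "\<bar>frechet_derivative \<phi> (at x) (u r x)\<bar> \<le> C * norm (u r x)" by (rule C)
    also have "\<dots> \<le> C * ((1 + R) * m r)" using ub[of x] False C(1) by (intro mult_left_mono) auto
    finally show ?thesis by (simp add: mult.assoc)
  qed
  have near: "\<bar>frechet_derivative \<phi> (at x) (u r x) - frechet_derivative \<phi> (at y) (u r y)\<bar> \<le> C * (1 + R) * (m r + l r) * norm (x - y)"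
    if x: "norm x \<le> R" for x y
  proof -
    have lin: "linear (frechet_derivative \<phi> (at y))" using Ck_has_derivative[OF \<phi>(1)] has_derivative_linear by blast
    have "frechet_derivative \<phi> (at x) (u r x) - frechet_derivative \<phi> (at y) (u r y)
       = (frechet_derivative \<phi> (at x) (u r x) - frechet_derivative \<phi> (at y) (u r x)) + frechet_derivative \<phi> (at y) (u r x - u r y)"
      by (simp add: linear_diff[OF lin])
    also have "\<bar>\<dots>\<bar> \<le> C * norm (x - y) * norm (u r x) + C * norm (u r x - u r y)"
      using C(3)[of x "u r x" y] C(2)[of y "u r x - u r y"] by linarith
    also have "\<dots> \<le> C * norm (x - y) * ((1 + R) * m r) + C * (l r * norm (x - y))"
      using ub[OF x] lipschitz_onD[OF lip[of r], of x y] C(1) by (intro add_mono mult_left_mono) (auto simp: dist_norm)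
    also have "C * (l r * norm (x - y)) \<le> C * ((1 + R) * (l r * norm (x - y)))"
      using C(1) R l(2)[of r] by (intro mult_left_mono mult_right_mono[of 1 "1 + R" "l r * norm (x - y)", simplified]) (auto simp: mult_le_cancel_right1)
    finally show ?thesis by (simp add: algebra_simps)
  qed
  show "(C * (1 + R) * (m r + l r))-lipschitz_on UNIV (\<lambda>x. frechet_derivative \<phi> (at x) (u r x))"
  proof (rule lipschitz_onI)
    show "0 \<le> C * (1 + R) * (m r + l r)" using C(1) R m(2)[of r] l(2)[of r] by simp
    then have nn: "0 \<le> C * (1 + R) * (m r + l r) * norm (x - y)" for x y :: 'a by simp
    fix x y
    have "\<bar>frechet_derivative \<phi> (at x) (u r x) - frechet_derivative \<phi> (at y) (u r y)\<bar> \<le> C * (1 + R) * (m r + l r) * norm (x - y)"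
    proof -
      consider "norm x \<le> R" | "norm y \<le> R" | "R < norm x" "R < norm y" by linarith
      then show ?thesis
      proof cases
        case 1
        then show ?thesis by (rule near)
      next
        case 2
        then show ?thesis using near[of y x] by (simp add: abs_minus_commute norm_minus_commute)
      next
        case 3
        then show ?thesis using Dz nn by simp
      qed
    qed
    then show "dist (frechet_derivative \<phi> (at x) (u r x)) (frechet_derivative \<phi> (at y) (u r y)) \<le> C * (1 + R) * (m r + l r) * dist x y"
      by (simp add: dist_norm)
  qed
qed

text \<open>Replacing \<open>\<mu> r\<close> by \<open>\<mu> s\<close> costs the Lipschitz constant of the integrand
  times the Wasserstein distance \<open>E s t\<close>. The product \<open>A s t * E s t\<close> is of second order in
  the step.\<close>
lemma frozen_flux:
  fixes \<phi> :: "'a \<Rightarrow> real"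
  assumes \<phi>: "\<And>k. Ck k \<phi>" "\<And>x. R < norm x \<Longrightarrow> \<phi> x = 0" and R: "0 \<le> R" and C: "0 \<le> C"
    "\<And>x u. \<bar>frechet_derivative \<phi> (at x) u\<bar> \<le> C * norm u"
    "\<And>x y u. \<bar>frechet_derivative \<phi> (at x) u - frechet_derivative \<phi> (at y) u\<bar> \<le> C * norm (x - y) * norm u"
    and st: "a \<le> s" "s \<le> t" "t \<le> b"
  shows "\<bar>(\<integral>x. \<phi> x \<partial>\<mu> t) - (\<integral>x. \<phi> x \<partial>\<mu> s) - (\<integral>x. frechet_derivative \<phi> (at x) (drift s t x) \<partial>\<mu> s)\<bar> \<le> 2 * C * (1 + R) * A s t * E s t"
proof -
  define q where "q r x = frechet_derivative \<phi> (at x) (u r x)" for r x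
  have qb: "\<bar>q r x\<bar> \<le> C * (1 + R) * m r" for r x
    unfolding q_def by (rule flux_lipschitz(1)) (use \<phi> R C in auto)
  have ql: "(C * (1 + R) * (m r + l r))-lipschitz_on UNIV (q r)" for r
    unfolding q_def by (rule flux_lipschitz(2)) (use \<phi> R C in auto)
  have s: "s \<in> {a..b}" using st by auto
  have fub: "set_integrable lebesgue {s..t} (\<lambda>r. \<integral>x. q r x \<partial>\<mu> s)"
    "(LINT r:{s..t}|lebesgue. (\<integral>x. q r x \<partial>\<mu> s)) = (\<integral>x. frechet_derivative \<phi> (at x) (drift s t x) \<partial>\<mu> s)"
    unfolding q_def by (rule fubini_step[OF s \<phi>(1) qb[unfolded q_def]])+
  have hi: "set_integrable lebesgue {s..t} (\<lambda>r. \<integral>x. q r x \<partial>\<mu> r)"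
    unfolding q_def by (rule set_integrable_subset[OF ice_int[OF \<phi>(1), where R=R]]) (use \<phi>(2) st in auto)
  have "(\<integral>x. \<phi> x \<partial>\<mu> t) - (\<integral>x. \<phi> x \<partial>\<mu> s) = (LINT r:{s..t}|lebesgue. (\<integral>x. q r x \<partial>\<mu> r))"
    unfolding q_def by (rule ice[OF \<phi>(1), where R=R]) (use \<phi>(2) st in auto)
  then have "(\<integral>x. \<phi> x \<partial>\<mu> t) - (\<integral>x. \<phi> x \<partial>\<mu> s) - (\<integral>x. frechet_derivative \<phi> (at x) (drift s t x) \<partial>\<mu> s)
     = (LINT r:{s..t}|lebesgue. (\<integral>x. q r x \<partial>\<mu> r) - (\<integral>x. q r x \<partial>\<mu> s))"
    using set_integral_diff(2)[OF hi fub(1)] fub(2) by simp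
  also have "\<bar>\<dots>\<bar> \<le> (LINT r:{s..t}|lebesgue. \<bar>(\<integral>x. q r x \<partial>\<mu> r) - (\<integral>x. q r x \<partial>\<mu> s)\<bar>)"
    using set_integral_norm_bound[OF set_integral_diff(1)[OF hi fub(1)]] by simp
  also have "\<dots> \<le> (LINT r:{s..t}|lebesgue. (2 * C * (1 + R) * E s t) * (m r + l r))"
  proof (rule set_integral_mono)
    show "set_integrable lebesgue {s..t} (\<lambda>r. \<bar>(\<integral>x. q r x \<partial>\<mu> r) - (\<integral>x. q r x \<partial>\<mu> s)\<bar>)"
      using set_integrable_norm[OF set_integral_diff(1)[OF hi fub(1)]] by simp
    show "set_integrable lebesgue {s..t} (\<lambda>r. (2 * C * (1 + R) * E s t) * (m r + l r))" using m l by (intro set_int) auto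
    fix r assume r: "r \<in> {s..t}"
    have Er: "E s r \<le> E s t"
      unfolding E_def using set_integral_Icc_combine[OF set_int[OF g(1)], where a=s and s=r and t=t and b=t] r set_int_nonneg[of g r t] g(2) by auto
    have "\<bar>(\<integral>x. q r x \<partial>\<mu> s) - (\<integral>x. q r x \<partial>\<mu> r)\<bar> \<le> 2 * (C * (1 + R) * (m r + l r)) * wasserstein p (\<mu> s) (\<mu> r)"
      by (rule integral_diff_le_wasserstein[OF mu mu p ql qb]) (use st r in auto)
    also have "\<dots> \<le> 2 * (C * (1 + R) * (m r + l r)) * E s t"
      using W[of s r] Er st r C(1) R m(2)[of r] l(2)[of r] by (intro mult_left_mono) (auto simp: E_def)
    also have "\<dots> = (2 * C * (1 + R) * E s t) * (m r + l r)" by (simp only: mult_ac)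
    finally show "\<bar>(\<integral>x. q r x \<partial>\<mu> r) - (\<integral>x. q r x \<partial>\<mu> s)\<bar> \<le> (2 * C * (1 + R) * E s t) * (m r + l r)"
      by (simp only: abs_minus_commute)
  qed
  also have "\<dots> = 2 * C * (1 + R) * A s t * E s t" by (simp add: A_def mult_ac)
  finally show ?thesis .
qed

text \<open>A displacement of linear growth with factor at most one half cannot carry a distant point into the ball of
  radius \<open>R\<close>. Outside the ball of radius \<open>2 R + 1\<close> the Taylor remainder of a function
  supported in the former ball therefore vanishes.\<close>
lemma drift_escape:
  assumes "A s t \<le> 1/2" "2 * R + 1 < norm x"
  shows "R < norm (x + drift s t x)"
proof -
  have "norm (drift s t x) \<le> 1/2 * (1 + norm x)"
    using drift_growth[of s t x] mult_right_mono[OF assms(1), of "1 + norm x"] by simp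
  then show ?thesis using norm_triangle_ineq2[of x "- drift s t x"] assms(2) by simp
qed

text \<open>Three errors are added up: freezing the measure over the step, the second order Taylor remainder of the
  mollified function, and the commutator of mollification and displacement. The first two are of second order in the
  step with a constant that depends on \<open>\<epsilon>\<close>; the last one is of first order but carries the factor
  \<open>\<epsilon>\<close>.\<close>
lemma one_step_estimate:
  assumes e: "0 < \<epsilon>" and B: "0 \<le> B" and M: "0 \<le> M"
  shows "\<exists>C\<ge>0. \<forall>f K s t. K-lipschitz_on UNIV f \<longrightarrow> (\<forall>x. \<bar>f x\<bar> \<le> B) \<longrightarrow> (\<forall>x. M < norm x \<longrightarrow> f x = 0) \<longrightarrow>
     a \<le> s \<longrightarrow> s \<le> t \<longrightarrow> t \<le> b \<longrightarrow> A s t \<le> 1/2 \<longrightarrow>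
     \<bar>(\<integral>x. mollify \<epsilon> f x \<partial>\<mu> t) - (\<integral>x. mollify \<epsilon> (\<lambda>x. f (x + drift s t x)) x \<partial>\<mu> s)\<bar>
       \<le> K * \<epsilon> * A s t + C * A s t * (A s t + E s t)"
proof -
  obtain C where C: "0 \<le> C"
    "\<forall>f :: 'a \<Rightarrow> real. continuous_on UNIV f \<longrightarrow> (\<forall>x. \<bar>f x\<bar> \<le> B) \<longrightarrow> (\<forall>x. M < norm x \<longrightarrow> f x = 0) \<longrightarrow>
       (\<forall>k. Ck k (mollify \<epsilon> f)) \<and>
       (\<forall>x. M + \<epsilon> < norm x \<longrightarrow> mollify \<epsilon> f x = 0) \<and>
       (\<forall>x u. \<bar>frechet_derivative (mollify \<epsilon> f) (at x) u\<bar> \<le> C * norm u) \<and>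
       (\<forall>x y u. \<bar>frechet_derivative (mollify \<epsilon> f) (at x) u - frechet_derivative (mollify \<epsilon> f) (at y) u\<bar> \<le> C * norm (x - y) * norm u)"
    using mollify_smooth[OF e B, where 'a='a, of M] by (elim exE conjE) (rule that)
  define R where "R = M + \<epsilon>"
  have R: "0 \<le> R" using M e by (simp add: R_def)
  define C' where "C' = 2 * C * (1 + R) + C * (2 * R + 2)\<^sup>2"
  have C': "0 \<le> C'" using C(1) R by (simp add: C'_def)
  show ?thesis
  proof (intro exI[of _ C'] conjI C' allI impI)
    fix f :: "'a \<Rightarrow> real" and K s t
    assume f: "K-lipschitz_on UNIV f" "\<forall>x. \<bar>f x\<bar> \<le> B" "\<forall>x. M < norm x \<longrightarrow> f x = 0" and st: "a \<le> s" "s \<le> t" "t \<le> b" and A2: "A s t \<le> 1/2"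
    have fc: "continuous_on UNIV f" using lipschitz_on_continuous_on[OF f(1)] .
    have K: "0 \<le> K" using lipschitz_on_nonneg[OF f(1)] .
    define \<phi> where "\<phi> = mollify \<epsilon> f"
    have P: "(\<forall>k. Ck k \<phi>) \<and> (\<forall>x. M + \<epsilon> < norm x \<longrightarrow> \<phi> x = 0) \<and>
       (\<forall>x u. \<bar>frechet_derivative \<phi> (at x) u\<bar> \<le> C * norm u) \<and>
       (\<forall>x y u. \<bar>frechet_derivative \<phi> (at x) u - frechet_derivative \<phi> (at y) u\<bar> \<le> C * norm (x - y) * norm u)"
      unfolding \<phi>_def by (rule C(2)[rule_format]) (use fc f in auto)
    have \<phi>k: "Ck k \<phi>" for k using P by blast
    have \<phi>z: "\<phi> x = 0" if "R < norm x" for x using P that by (simp add: R_def)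
    have D1: "\<bar>frechet_derivative \<phi> (at x) u\<bar> \<le> C * norm u" for x u using P by blast
    have D2: "\<bar>frechet_derivative \<phi> (at x) u - frechet_derivative \<phi> (at y) u\<bar> \<le> C * norm (x - y) * norm u" for x y u using P by blast
    have Dz: "frechet_derivative \<phi> (at x) w = 0" if "R < norm x" for x w
      by (rule Ck_derivative_vanishes[OF \<phi>k, where R=R]) (use \<phi>z that in auto)
    have s: "s \<in> {a..b}" using st by auto
    have Vc: "continuous_on UNIV (drift s t)" using lipschitz_on_continuous_on[OF drift_lip] .
    have \<phi>c: "continuous_on UNIV \<phi>" using Ck_continuous[OF \<phi>k[of 0]] .
    have \<phi>b: "\<bar>\<phi> x\<bar> \<le> B" for x unfolding \<phi>_def by (rule mollify_bounded[OF e fc]) (use f in auto)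
    have shiftc: "continuous_on UNIV (\<lambda>x. \<phi> (x + drift s t x))"
      by (rule continuous_on_compose2[OF \<phi>c]) (auto intro!: continuous_intros Vc)
    have Dc: "continuous_on UNIV (\<lambda>x. frechet_derivative \<phi> (at x) (drift s t x))"
      by (rule Ck_derivative_apply_continuous[OF \<phi>k Vc])
    define f' where "f' = (\<lambda>x. f (x + drift s t x))"
    have f'l: "(K * (1 + A s t))-lipschitz_on UNIV f'"
    proof -
      have "(1 + A s t)-lipschitz_on UNIV (\<lambda>x. x + drift s t x)"
        by (intro lipschitz_on_add lipschitz_on_id drift_lip)
      from lipschitz_on_compose[OF this, of K f] f(1) show ?thesis
        by (auto simp: f'_def o_def intro: lipschitz_on_subset)
    qed
    have f'c: "continuous_on UNIV f'" using lipschitz_on_continuous_on[OF f'l] .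
    have mc: "continuous_on UNIV (mollify \<epsilon> f')" using lipschitz_on_continuous_on[OF mollify_lipschitz[OF e f'l]] .
    have mb: "\<bar>mollify \<epsilon> f' x\<bar> \<le> B" for x by (rule mollify_bounded[OF e f'c]) (use f in \<open>auto simp: f'_def\<close>)
    have A0: "0 \<le> A s t" by (rule A_nonneg)
    define rem where "rem x = \<phi> (x + drift s t x) - \<phi> x - frechet_derivative \<phi> (at x) (drift s t x)" for x
    have remb: "\<bar>rem x\<bar> \<le> C * (2 * R + 2)\<^sup>2 * (A s t)\<^sup>2" for x
    proof (cases "2 * R + 1 < norm x")
      case True
      then have "R < norm x" using R by linarith
      then show ?thesis using \<phi>z Dz drift_escape[OF A2 True] C(1) by (simp add: rem_def)
    next
      case False
      have "\<bar>rem x\<bar> \<le> C * (norm (drift s t x))\<^sup>2" unfolding rem_def by (rule taylor_remainder[OF \<phi>k C(1) D2])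
      also have "norm (drift s t x) \<le> A s t * (2 * R + 2)"
        using drift_growth[of s t x] mult_left_mono[of "1 + norm x" "2 * R + 2" "A s t"] False A0 by simp
      then have "C * (norm (drift s t x))\<^sup>2 \<le> C * (A s t * (2 * R + 2))\<^sup>2" using C(1) by (intro mult_left_mono power_mono) auto
      finally show ?thesis by (simp add: power_mult_distrib mult_ac)
    qed
    have remc: "continuous_on UNIV rem" unfolding rem_def by (intro continuous_on_diff shiftc \<phi>c Dc)
    define com where "com x = \<phi> (x + drift s t x) - mollify \<epsilon> f' x" for x
    have comb: "\<bar>com x\<bar> \<le> K * \<epsilon> * A s t" for x
      using mollify_commutator[OF e f(1) drift_lip, of s t x] by (simp add: com_def \<phi>_def f'_def abs_minus_commute mult_ac)
    have comc: "continuous_on UNIV com" unfolding com_def by (intro continuous_on_diff shiftc mc)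
    have i1: "integrable (\<mu> s) \<phi>" by (rule bounded_integrable[OF s \<phi>c \<phi>b])
    have i2: "integrable (\<mu> s) rem" by (rule bounded_integrable[OF s remc remb])
    have i3: "integrable (\<mu> s) com" by (rule bounded_integrable[OF s comc comb])
    have i4: "integrable (\<mu> s) (mollify \<epsilon> f')" by (rule bounded_integrable[OF s mc mb])
    have dec: "frechet_derivative \<phi> (at x) (drift s t x) = com x + mollify \<epsilon> f' x - \<phi> x - rem x" for x
      by (simp add: com_def rem_def)
    have "(\<integral>x. frechet_derivative \<phi> (at x) (drift s t x) \<partial>\<mu> s) = (\<integral>x. com x \<partial>\<mu> s) + (\<integral>x. mollify \<epsilon> f' x \<partial>\<mu> s) - (\<integral>x. \<phi> x \<partial>\<mu> s) - (\<integral>x. rem x \<partial>\<mu> s)"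
      unfolding dec using i1 i2 i3 i4 by simp
    then have split: "(\<integral>x. \<phi> x \<partial>\<mu> t) - (\<integral>x. mollify \<epsilon> f' x \<partial>\<mu> s)
       = ((\<integral>x. \<phi> x \<partial>\<mu> t) - (\<integral>x. \<phi> x \<partial>\<mu> s) - (\<integral>x. frechet_derivative \<phi> (at x) (drift s t x) \<partial>\<mu> s)) + (\<integral>x. com x \<partial>\<mu> s) - (\<integral>x. rem x \<partial>\<mu> s)"
      by simp
    have t1: "\<bar>(\<integral>x. \<phi> x \<partial>\<mu> t) - (\<integral>x. \<phi> x \<partial>\<mu> s) - (\<integral>x. frechet_derivative \<phi> (at x) (drift s t x) \<partial>\<mu> s)\<bar> \<le> 2 * C * (1 + R) * A s t * E s t"
      by (rule frozen_flux[OF \<phi>k \<phi>z R C(1) D1 D2 st])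
    have t2: "\<bar>\<integral>x. com x \<partial>\<mu> s\<bar> \<le> K * \<epsilon> * A s t" by (rule integral_le_const[OF s comc comb])
    have t3: "\<bar>\<integral>x. rem x \<partial>\<mu> s\<bar> \<le> C * (2 * R + 2)\<^sup>2 * (A s t)\<^sup>2" by (rule integral_le_const[OF s remc remb])
    have "\<bar>(\<integral>x. \<phi> x \<partial>\<mu> t) - (\<integral>x. mollify \<epsilon> f' x \<partial>\<mu> s)\<bar> \<le> 2 * C * (1 + R) * A s t * E s t + K * \<epsilon> * A s t + C * (2 * R + 2)\<^sup>2 * (A s t)\<^sup>2"
      unfolding split using t1 t2 t3 by linarith
    also have "\<dots> \<le> K * \<epsilon> * A s t + C' * A s t * (A s t + E s t)"
    proof -
      have "0 \<le> 2 * C * (1 + R) * A s t * A s t" "0 \<le> C * (2 * R + 2)\<^sup>2 * A s t * E s t"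
        using C(1) R A0 E_nonneg[of s t] by auto
      moreover have "C' * A s t * (A s t + E s t) = 2 * C * (1 + R) * A s t * E s t + C * (2 * R + 2)\<^sup>2 * (A s t)\<^sup>2
         + 2 * C * (1 + R) * A s t * A s t + C * (2 * R + 2)\<^sup>2 * A s t * E s t"
        by (simp add: C'_def algebra_simps power2_eq_square)
      ultimately show ?thesis by linarith
    qed
    finally show "\<bar>(\<integral>x. mollify \<epsilon> f x \<partial>\<mu> t) - (\<integral>x. mollify \<epsilon> (\<lambda>x. f (x + drift s t x)) x \<partial>\<mu> s)\<bar>
       \<le> K * \<epsilon> * A s t + C' * A s t * (A s t + E s t)" by (simp add: \<phi>_def f'_def)
  qed
qed

end


section \<open>Transport by limits of Euler polygons\<close>

context transport_curve
begin

definition grid :: "nat \<Rightarrow> nat \<Rightarrow> real" where "grid N k = a + real k * ((b - a) / real N)"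

text \<open>\<open>euler N n\<close> performs the last \<open>n\<close> of the \<open>N\<close> Euler steps, from
  \<open>grid N (N - n)\<close> to \<open>b\<close>; the recursion prepends steps because the duality argument runs
  backwards in time. Each step uses the exact time integral of the velocity at a fixed point.\<close>
primrec euler :: "nat \<Rightarrow> nat \<Rightarrow> 'a \<Rightarrow> 'a" where
  "euler N 0 = (\<lambda>x. x)"
| "euler N (Suc n) = (\<lambda>x. euler N n (x + drift (grid N (N - Suc n)) (grid N (N - n)) x))"

lemma grid_ends: "grid N 0 = a" "0 < N \<Longrightarrow> grid N N = b"
  by (auto simp: grid_def)

lemma grid_mono: "j \<le> k \<Longrightarrow> grid N j \<le> grid N k"
  unfolding grid_def using ab by (intro add_left_mono mult_right_mono) auto

lemma grid_range: "k \<le> N \<Longrightarrow> 0 < N \<Longrightarrow> a \<le> grid N k \<and> grid N k \<le> b"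
  using grid_mono[of 0 k N] grid_mono[of k N N] grid_ends by auto

text \<open>Discrete Gronwall estimates. Since the steps use the exact integrals of \<open>u\<close>, freezing the
  position at the starting point changes the total displacement only by the Lipschitz bound times the displacement
  itself, which gives the quadratic last estimate.\<close>
lemma euler_estimates:
  assumes N: "0 < N"
  shows "n \<le> N \<Longrightarrow> (exp (A (grid N (N - n)) b))-lipschitz_on UNIV (euler N n) \<and>
     (\<forall>x. norm (euler N n x - x) \<le> (exp (A (grid N (N - n)) b) - 1) * (1 + norm x)) \<and>
     (\<forall>x. norm (euler N n x - x - drift (grid N (N - n)) b x) \<le> A (grid N (N - n)) b * (exp (A (grid N (N - n)) b) - 1) * (1 + norm x))"
proof (induction n)
  case 0
  have "A b b = 0" "drift b b x = 0" for x using combine(1)[of b b b] combine(2)[of b b b x] by auto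
  then show ?case using N by (auto simp: grid_ends lipschitz_on_id)
next
  case (Suc n)
  define \<tau> where "\<tau> = grid N (N - n)"
  define \<tau>' where "\<tau>' = grid N (N - Suc n)"
  define \<alpha> where "\<alpha> = A \<tau>' \<tau>"
  define \<beta> where "\<beta> = A \<tau> b"
  have ord: "\<tau>' \<le> \<tau>" "\<tau> \<le> b" using grid_mono[of "N - Suc n" "N - n" N] grid_range[of "N - n" N] N by (auto simp: \<tau>_def \<tau>'_def)
  have ab': "A \<tau>' b = \<alpha> + \<beta>" using combine(1)[OF ord] by (simp add: \<alpha>_def \<beta>_def)
  have Vb: "drift \<tau>' b x = drift \<tau>' \<tau> x + drift \<tau> b x" for x using combine(2)[OF ord] by simp
  have pos: "0 \<le> \<alpha>" "0 \<le> \<beta>" by (auto simp: \<alpha>_def \<beta>_def A_nonneg)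
  have ea: "1 + \<alpha> \<le> exp \<alpha>" by (rule exp_ge_add_one_self)
  then have ea': "\<alpha> \<le> exp \<alpha> - 1" by linarith
  have eb: "1 \<le> exp \<beta>" using pos by simp
  have IH: "(exp \<beta>)-lipschitz_on UNIV (euler N n)" "\<And>x. norm (euler N n x - x) \<le> (exp \<beta> - 1) * (1 + norm x)"
    "\<And>x. norm (euler N n x - x - drift \<tau> b x) \<le> \<beta> * (exp \<beta> - 1) * (1 + norm x)"
    using Suc by (auto simp: \<tau>_def \<beta>_def)
  define y where "y x = x + drift \<tau>' \<tau> x" for x
  have Qs: "euler N (Suc n) x = euler N n (y x)" for x by (simp add: y_def \<tau>_def \<tau>'_def)
  have yb: "1 + norm (y x) \<le> exp \<alpha> * (1 + norm x)" for x
  proof -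
    have "1 + norm (y x) \<le> 1 + norm x + \<alpha> * (1 + norm x)"
      using drift_growth[of \<tau>' \<tau> x] norm_triangle_ineq[of x "drift \<tau>' \<tau> x"] by (simp add: y_def \<alpha>_def)
    also have "\<dots> = (1 + \<alpha>) * (1 + norm x)" by (simp add: algebra_simps)
    also have "\<dots> \<le> exp \<alpha> * (1 + norm x)" using ea by (intro mult_right_mono) auto
    finally show ?thesis .
  qed
  have lipQ: "(exp (\<alpha> + \<beta>))-lipschitz_on UNIV (euler N (Suc n))"
  proof (rule lipschitz_onI)
    fix x x'
    have "dist (euler N n (y x)) (euler N n (y x')) \<le> exp \<beta> * dist (y x) (y x')"
      by (rule lipschitz_onD[OF IH(1)]) auto
    also have "dist (y x) (y x') \<le> dist x x' + dist (drift \<tau>' \<tau> x) (drift \<tau>' \<tau> x')"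
      unfolding y_def by (rule dist_triangle_add)
    also have "\<dots> \<le> (1 + \<alpha>) * dist x x'"
      using lipschitz_onD[OF drift_lip, of x x' \<tau>' \<tau>] by (simp add: \<alpha>_def algebra_simps)
    also have "\<dots> \<le> exp \<alpha> * dist x x'" using ea by (intro mult_right_mono) auto
    finally have "dist (euler N n (y x)) (euler N n (y x')) \<le> exp \<beta> * (exp \<alpha> * dist x x')" by (simp add: mult_left_mono)
    then show "dist (euler N (Suc n) x) (euler N (Suc n) x') \<le> exp (\<alpha> + \<beta>) * dist x x'"
      unfolding Qs by (simp add: exp_add mult_ac)
  qed simp
  have b1: "norm (euler N (Suc n) x - x) \<le> (exp (\<alpha> + \<beta>) - 1) * (1 + norm x)" for x
  proof -
    have "norm (euler N (Suc n) x - x) \<le> norm (euler N n (y x) - y x) + norm (y x - x)"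
      unfolding Qs using norm_triangle_ineq[of "euler N n (y x) - y x" "y x - x"] by simp
    also have "\<dots> \<le> (exp \<beta> - 1) * (1 + norm (y x)) + \<alpha> * (1 + norm x)"
      using IH(2)[of "y x"] drift_growth[of \<tau>' \<tau> x] by (simp add: y_def \<alpha>_def)
    also have "\<dots> \<le> (exp \<beta> - 1) * (exp \<alpha> * (1 + norm x)) + (exp \<alpha> - 1) * (1 + norm x)"
      using eb yb by (intro add_mono mult_left_mono mult_right_mono ea') auto
    also have "\<dots> = (exp (\<alpha> + \<beta>) - 1) * (1 + norm x)" by (simp add: exp_add algebra_simps)
    finally show ?thesis .
  qed
  have b2: "norm (euler N (Suc n) x - x - drift \<tau>' b x) \<le> (\<alpha> + \<beta>) * (exp (\<alpha> + \<beta>) - 1) * (1 + norm x)" for x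
  proof -
    have "euler N (Suc n) x - x - drift \<tau>' b x = (euler N n (y x) - y x - drift \<tau> b (y x)) + (drift \<tau> b (y x) - drift \<tau> b x)"
      unfolding Qs Vb by (simp add: y_def)
    then have "norm (euler N (Suc n) x - x - drift \<tau>' b x) \<le> norm (euler N n (y x) - y x - drift \<tau> b (y x)) + norm (drift \<tau> b (y x) - drift \<tau> b x)"
      by (metis norm_triangle_ineq)
    also have "\<dots> \<le> \<beta> * (exp \<beta> - 1) * (1 + norm (y x)) + \<beta> * norm (y x - x)"
      using IH(3)[of "y x"] lipschitz_onD[OF drift_lip, of "y x" x \<tau> b] by (simp add: \<beta>_def dist_norm)
    also have "\<dots> \<le> \<beta> * (exp \<beta> - 1) * (exp \<alpha> * (1 + norm x)) + \<beta> * (\<alpha> * (1 + norm x))"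
      using yb[of x] drift_growth[of \<tau>' \<tau> x] pos eb by (intro add_mono mult_left_mono) (auto simp: y_def \<alpha>_def)
    also have "\<dots> \<le> \<beta> * (exp \<beta> - 1) * (exp \<alpha> * (1 + norm x)) + \<beta> * ((exp \<alpha> - 1) * (1 + norm x))"
      using pos by (intro add_left_mono mult_left_mono mult_right_mono ea') auto
    also have "\<dots> = \<beta> * (exp (\<alpha> + \<beta>) - 1) * (1 + norm x)" by (simp add: exp_add algebra_simps)
    also have "\<dots> \<le> (\<alpha> + \<beta>) * (exp (\<alpha> + \<beta>) - 1) * (1 + norm x)"
      using pos by (intro mult_right_mono) auto
    finally show ?thesis .
  qed
  show ?case
    using lipQ b1 b2 ab' by (simp only: \<tau>'_def[symmetric]) blast
qed

text \<open>Absolute continuity of the integral, as uniform continuity of its primitive.\<close>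
lemma mesh_small:
  assumes "0 < \<omega>"
  shows "\<exists>N0>0. \<forall>N\<ge>N0. \<forall>k<N. A (grid N k) (grid N (Suc k)) + E (grid N k) (grid N (Suc k)) \<le> \<omega>"
proof -
  define h where "h r = m r + l r + g r" for r
  have h: "integrable lebesgue h" unfolding h_def[abs_def] using m l g by simp
  define F where "F t = (LINT r:{a..t}|lebesgue. h r)" for t
  have AE: "A s t + E s t = F t - F s" if "a \<le> s" "s \<le> t" for s t
  proof -
    have "integrable lebesgue (\<lambda>r. m r + l r)" using m l by simp
    from set_integral_add(2)[OF set_int[OF this] set_int[OF g(1)]]
    have "A s t + E s t = (LINT r:{s..t}|lebesgue. h r)"
      unfolding A_def E_def h_def by simp
    then show ?thesis using set_integral_Icc_combine[OF set_int[OF h], where a=a and s=s and t=t and b=t] that by (simp add: F_def)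
  qed
  have "continuous_on {a..b} F" unfolding F_def by (rule continuous_on_set_integral_Icc[OF set_int[OF h]])
  then have "uniformly_continuous_on {a..b} F" by (rule compact_uniformly_continuous) simp
  then obtain d where d: "0 < d" "\<And>s t. s \<in> {a..b} \<Longrightarrow> t \<in> {a..b} \<Longrightarrow> dist t s < d \<Longrightarrow> dist (F t) (F s) < \<omega>"
    using assms unfolding uniformly_continuous_on_def by metis
  obtain N0 :: nat where N0: "(b - a) / d < real N0" using reals_Archimedean2 by blast
  have N0p: "0 < N0" using N0 ab d(1) by (metis divide_pos_pos diff_gt_0_iff_gt of_nat_0_less_iff order_less_trans)
  show ?thesis
  proof (intro exI[of _ N0] conjI N0p allI impI)
    fix N k assume N: "N0 \<le> N" and k: "k < N"
    then have Np: "0 < N" using N0p by simp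
    have "(b - a) / d < real N" using N0 N by simp
    then have "(b - a) / real N < d" using d(1) Np by (simp add: field_simps)
    moreover have "grid N (Suc k) - grid N k = (b - a) / real N"
    proof -
      have "(a + real (Suc k) * c) - (a + real k * c) = c" for c :: real by (simp add: algebra_simps)
      then show ?thesis unfolding grid_def .
    qed
    ultimately have "dist (grid N (Suc k)) (grid N k) < d" using ab Np by (simp add: dist_real_def)
    then have "dist (F (grid N (Suc k))) (F (grid N k)) < \<omega>"
      using grid_range[of k N] grid_range[of "Suc k" N] k Np by (intro d) auto
    then show "A (grid N k) (grid N (Suc k)) + E (grid N k) (grid N (Suc k)) \<le> \<omega>"
      using AE[of "grid N k" "grid N (Suc k)"] grid_range[of k N] grid_mono[of k "Suc k" N] k Np by (simp add: dist_real_def)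
  qed
qed

text \<open>Backwards in time, \<open>f = \<phi> \<circ> euler N n\<close> replaces the solution of the dual transport
  equation. Each \<open>f\<close> has Lipschitz constant at most \<open>K * exp (A a b)\<close> and support in the ball
  of radius \<open>2 R + 1\<close>, so that the one step estimate applies with one constant for all steps. The bound
  \<open>3/2\<close> on \<open>exp (A a b)\<close> keeps the Euler maps within \<open>(1 + \<bar>x\<bar>) / 2\<close> of
  the identity, which controls the supports.\<close>
lemma telescope:
  fixes \<phi> :: "'a \<Rightarrow> real"
  assumes A: "exp (A a b) \<le> 3/2" and \<phi>: "K-lipschitz_on UNIV \<phi>" "\<And>x. \<bar>\<phi> x\<bar> \<le> B" "\<And>x. R < norm x \<Longrightarrow> \<phi> x = 0"
    and R: "0 \<le> R" and e: "0 < \<epsilon>"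
  shows "\<exists>C\<ge>0. \<forall>N>0. \<forall>\<omega>. (\<forall>k<N. A (grid N k) (grid N (Suc k)) + E (grid N k) (grid N (Suc k)) \<le> \<omega>) \<longrightarrow>
    \<bar>(\<integral>x. mollify \<epsilon> \<phi> x \<partial>\<mu> b) - (\<integral>x. mollify \<epsilon> (\<lambda>x. \<phi> (euler N N x)) x \<partial>\<mu> a)\<bar> \<le> A a b * (K * exp (A a b) * \<epsilon> + C * \<omega>)"
proof -
  have B: "0 \<le> B" using \<phi>(2)[of 0] by simp
  have K: "0 \<le> K" using lipschitz_on_nonneg[OF \<phi>(1)] .
  have R1: "0 \<le> 2 * R + 1" using R by simp
  obtain C where C: "0 \<le> C" "\<forall>f K s t. K-lipschitz_on UNIV f \<longrightarrow> (\<forall>x. \<bar>f x\<bar> \<le> B) \<longrightarrow> (\<forall>x. 2 * R + 1 < norm x \<longrightarrow> f x = 0) \<longrightarrow>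
     a \<le> s \<longrightarrow> s \<le> t \<longrightarrow> t \<le> b \<longrightarrow> A s t \<le> 1/2 \<longrightarrow>
     \<bar>(\<integral>x. mollify \<epsilon> f x \<partial>\<mu> t) - (\<integral>x. mollify \<epsilon> (\<lambda>x. f (x + drift s t x)) x \<partial>\<mu> s)\<bar>
       \<le> K * \<epsilon> * A s t + C * A s t * (A s t + E s t)"
    using one_step_estimate[OF e B R1] by (elim exE conjE) (rule that)
  show ?thesis
  proof (intro exI[of _ C] conjI C(1) allI impI)
    fix N :: nat and \<omega> assume N: "0 < N" and \<omega>: "\<forall>k<N. A (grid N k) (grid N (Suc k)) + E (grid N k) (grid N (Suc k)) \<le> \<omega>"
    have "n \<le> N \<Longrightarrow> \<bar>(\<integral>x. mollify \<epsilon> \<phi> x \<partial>\<mu> b) - (\<integral>x. mollify \<epsilon> (\<lambda>x. \<phi> (euler N n x)) x \<partial>\<mu> (grid N (N - n)))\<bar>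
        \<le> A (grid N (N - n)) b * (K * exp (A a b) * \<epsilon> + C * \<omega>)" for n
    proof (induction n)
      case 0
      have "A b b = 0" using combine(1)[of b b b] by simp
      then show ?case using N by (simp add: grid_ends)
    next
      case (Suc n)
      define \<tau> where "\<tau> = grid N (N - n)"
      define \<tau>' where "\<tau>' = grid N (N - Suc n)"
      define k where "k = N - Suc n"
      have k: "k < N" "Suc k = N - n" using Suc.prems by (auto simp: k_def)
      have ord: "a \<le> \<tau>'" "\<tau>' \<le> \<tau>" "\<tau> \<le> b"
        using grid_mono[of "N - Suc n" "N - n" N] grid_range[of "N - n" N] grid_range[of "N - Suc n" N] N by (auto simp: \<tau>_def \<tau>'_def)
      have Aab: "A a b = A a \<tau> + A \<tau> b" using combine(1)[of a \<tau> b] ord by simp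
      have A\<tau>b: "A \<tau> b \<le> A a b" using Aab A_nonneg[of a \<tau>] by simp
      have A\<tau>'\<tau>: "A \<tau>' b = A \<tau>' \<tau> + A \<tau> b" using combine(1)[of \<tau>' \<tau> b] ord by simp
      have "A \<tau>' \<tau> \<le> A a b" using A\<tau>'\<tau> A_mono[of a \<tau>' b] ord A_nonneg[of \<tau> b] by simp
      moreover have "A a b \<le> 1/2" using exp_ge_add_one_self[of "A a b"] A by linarith
      ultimately have small: "A \<tau>' \<tau> \<le> 1/2" by simp
      have Qe: "(exp (A \<tau> b))-lipschitz_on UNIV (euler N n)" "\<And>x. norm (euler N n x - x) \<le> (exp (A \<tau> b) - 1) * (1 + norm x)"
        using euler_estimates[OF N, of n] Suc.prems by (auto simp: \<tau>_def)
      define f where "f = (\<lambda>x. \<phi> (euler N n x))"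
      have eA: "exp (A \<tau> b) \<le> exp (A a b)" using A\<tau>b by simp
      have fl: "(K * exp (A a b))-lipschitz_on UNIV f"
      proof (rule lipschitz_onI)
        fix x y
        have "dist (f x) (f y) \<le> K * dist (euler N n x) (euler N n y)" unfolding f_def by (rule lipschitz_onD[OF \<phi>(1)]) auto
        also have "\<dots> \<le> K * (exp (A \<tau> b) * dist x y)" using lipschitz_onD[OF Qe(1)] K by (intro mult_left_mono) auto
        also have "\<dots> \<le> K * (exp (A a b) * dist x y)" using eA K by (intro mult_left_mono mult_right_mono) auto
        finally show "dist (f x) (f y) \<le> K * exp (A a b) * dist x y" by (simp add: mult.assoc)
      qed (use K in simp)
      have fz: "f x = 0" if "2 * R + 1 < norm x" for x
      proof -
        have "norm (euler N n x - x) \<le> 1/2 * (1 + norm x)"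
          using Qe(2)[of x] mult_right_mono[of "exp (A \<tau> b) - 1" "1/2" "1 + norm x"] eA A by simp
        then have "R < norm (euler N n x)" using that norm_triangle_sub[of x "euler N n x"] by (simp add: norm_minus_commute)
        then show ?thesis by (simp add: f_def \<phi>(3))
      qed
      have one: "\<bar>(\<integral>x. mollify \<epsilon> f x \<partial>\<mu> \<tau>) - (\<integral>x. mollify \<epsilon> (\<lambda>x. f (x + drift \<tau>' \<tau> x)) x \<partial>\<mu> \<tau>')\<bar>
         \<le> K * exp (A a b) * \<epsilon> * A \<tau>' \<tau> + C * A \<tau>' \<tau> * (A \<tau>' \<tau> + E \<tau>' \<tau>)"
        using fl \<phi>(2) fz ord small by (intro C(2)[rule_format]) (auto simp: f_def)
      have "A \<tau>' \<tau> + E \<tau>' \<tau> \<le> \<omega>" using \<omega>[rule_format, OF k(1)] k(2) by (simp add: \<tau>_def \<tau>'_def k_def)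
      then have "C * A \<tau>' \<tau> * (A \<tau>' \<tau> + E \<tau>' \<tau>) \<le> C * A \<tau>' \<tau> * \<omega>"
        using C(1) A_nonneg[of \<tau>' \<tau>] by (intro mult_left_mono) auto
      with one have one': "\<bar>(\<integral>x. mollify \<epsilon> f x \<partial>\<mu> \<tau>) - (\<integral>x. mollify \<epsilon> (\<lambda>x. f (x + drift \<tau>' \<tau> x)) x \<partial>\<mu> \<tau>')\<bar>
         \<le> A \<tau>' \<tau> * (K * exp (A a b) * \<epsilon> + C * \<omega>)" by (simp add: algebra_simps)
      have IH: "\<bar>(\<integral>x. mollify \<epsilon> \<phi> x \<partial>\<mu> b) - (\<integral>x. mollify \<epsilon> f x \<partial>\<mu> \<tau>)\<bar> \<le> A \<tau> b * (K * exp (A a b) * \<epsilon> + C * \<omega>)"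
        using Suc by (simp add: f_def \<tau>_def)
      have fs: "(\<lambda>x. \<phi> (euler N (Suc n) x)) = (\<lambda>x. f (x + drift \<tau>' \<tau> x))" by (simp add: f_def \<tau>_def \<tau>'_def)
      have "\<bar>(\<integral>x. mollify \<epsilon> \<phi> x \<partial>\<mu> b) - (\<integral>x. mollify \<epsilon> (\<lambda>x. f (x + drift \<tau>' \<tau> x)) x \<partial>\<mu> \<tau>')\<bar>
         \<le> A \<tau>' b * (K * exp (A a b) * \<epsilon> + C * \<omega>)"
        using IH one' unfolding A\<tau>'\<tau> distrib_right by linarith
      then show ?case unfolding fs \<tau>'_def .
    qed
    from this[of N] show "\<bar>(\<integral>x. mollify \<epsilon> \<phi> x \<partial>\<mu> b) - (\<integral>x. mollify \<epsilon> (\<lambda>x. \<phi> (euler N N x)) x \<partial>\<mu> a)\<bar> \<le> A a b * (K * exp (A a b) * \<epsilon> + C * \<omega>)"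
      by (simp add: grid_ends)
  qed
qed

text \<open>The Euler maps are equi-Lipschitz, so a subsequence converges to a map \<open>\<Phi>\<close>, which inherits
  their estimates. Test functions are compared in the order: first the mesh tends to zero for fixed
  \<open>\<epsilon>\<close>, then \<open>\<epsilon>\<close>.\<close>
lemma flow_map:
  assumes A: "exp (A a b) \<le> 3/2"
  obtains \<Phi> where "\<Phi> \<in> borel_measurable borel" "\<mu> b = distr (\<mu> a) borel \<Phi>"
    "\<And>x. norm (\<Phi> x - x - drift a b x) \<le> A a b * (exp (A a b) - 1) * (1 + norm x)"
proof -
  define L where "L = exp (A a b)"
  have est: "L-lipschitz_on UNIV (euler N N)" "norm (euler N N x - x) \<le> (L - 1) * (1 + norm x)"
     "norm (euler N N x - x - drift a b x) \<le> A a b * (L - 1) * (1 + norm x)" if "0 < N" for N x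
    using euler_estimates[OF that, of N] by (auto simp: L_def grid_ends)
  have qb: "norm (euler N N x) \<le> 2 * (1 + norm x)" if N: "0 < N" for N x
  proof -
    have "norm (euler N N x - x) \<le> 1/2 * (1 + norm x)"
      using est(2)[OF N, of x] mult_right_mono[of "L - 1" "1/2" "1 + norm x"] A by (simp add: L_def)
    with norm_triangle_sub[of "euler N N x" x] norm_ge_zero[of x] show ?thesis by argo
  qed
  obtain r \<Phi> where r: "strict_mono (r :: nat \<Rightarrow> nat)" "\<And>x. (\<lambda>n. euler (Suc (r n)) (Suc (r n)) x) \<longlonglongrightarrow> \<Phi> x" "L-lipschitz_on UNIV \<Phi>"
    by (rule equi_lipschitz_subsequence[of L "\<lambda>n. euler (Suc n) (Suc n)" 2, OF est(1) qb]) (auto intro: that)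
  have \<Phi>c: "continuous_on UNIV \<Phi>" using lipschitz_on_continuous_on[OF r(3)] .
  have \<Phi>m: "\<Phi> \<in> borel_measurable borel" by (rule borel_measurable_continuous_onI[OF \<Phi>c])
  have a: "a \<in> {a..b}" and b: "b \<in> {a..b}" using ab by auto
  note ma = prob_momentD[OF mu[OF a]] and mb = prob_momentD[OF mu[OF b]]
  interpret Ma: prob_space "\<mu> a" by (rule ma(1))
  have \<Phi>ma: "\<Phi> \<in> borel_measurable (\<mu> a)" using \<Phi>m by (simp add: measurable_cong_sets[OF ma(2) refl])
  have "\<mu> b = distr (\<mu> a) borel \<Phi>"
  proof (rule measure_eqI_lipschitz[OF mb(1,2)])
    show "prob_space (distr (\<mu> a) borel \<Phi>)" by (rule Ma.prob_space_distr[OF \<Phi>ma])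
    show "sets (distr (\<mu> a) borel \<Phi>) = sets borel" by simp
    fix \<phi> :: "'a \<Rightarrow> real" and K B R0
    assume \<phi>: "K-lipschitz_on UNIV \<phi>" "\<And>x. \<bar>\<phi> x\<bar> \<le> B" "\<And>x. R0 < norm x \<Longrightarrow> \<phi> x = 0"
    have K: "0 \<le> K" using lipschitz_on_nonneg[OF \<phi>(1)] .
    have \<phi>c: "continuous_on UNIV \<phi>" using lipschitz_on_continuous_on[OF \<phi>(1)] .
    have L1: "0 \<le> L" by (simp add: L_def)
    define R where "R = max R0 0"
    have R: "0 \<le> R" "\<And>x. R < norm x \<Longrightarrow> \<phi> x = 0" using \<phi>(3) by (auto simp: R_def)
    have Qc: "continuous_on UNIV (\<lambda>x. \<phi> (euler N N x))" if "0 < N" for N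
      using lipschitz_on_continuous_on[OF est(1)[OF that]] by (rule continuous_on_compose2[OF \<phi>c]) auto
    have Ql: "(K * L)-lipschitz_on UNIV (\<lambda>x. \<phi> (euler N N x))" if "0 < N" for N
      using lipschitz_on_compose2[OF est(1)[OF that], of K \<phi>] \<phi>(1) by (auto intro: lipschitz_on_subset)
    have main: "\<bar>(\<integral>x. \<phi> x \<partial>\<mu> b) - (\<integral>x. \<phi> (\<Phi> x) \<partial>\<mu> a)\<bar> \<le> \<eta>" if \<eta>: "0 < \<eta>" for \<eta>
    proof -
      \<comment> \<open>\<open>D * \<epsilon>\<close> collects the two mollification errors at the ends and the
        commutators of all steps.\<close>
      define D where "D = K + K * L + A a b * (K * L) + 1"
      have D: "0 < D" using K L1 A_nonneg[of a b] by (simp add: D_def add_nonneg_pos)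
      define \<epsilon> where "\<epsilon> = \<eta> / (2 * D)"
      have e: "0 < \<epsilon>" using \<eta> D by (simp add: \<epsilon>_def)
      have ex: "\<exists>C\<ge>0. \<forall>N>0. \<forall>\<omega>. (\<forall>k<N. A (grid N k) (grid N (Suc k)) + E (grid N k) (grid N (Suc k)) \<le> \<omega>) \<longrightarrow>
        \<bar>(\<integral>x. mollify \<epsilon> \<phi> x \<partial>\<mu> b) - (\<integral>x. mollify \<epsilon> (\<lambda>x. \<phi> (euler N N x)) x \<partial>\<mu> a)\<bar> \<le> A a b * (K * exp (A a b) * \<epsilon> + C * \<omega>)"
        by (rule telescope[OF A \<phi>(1,2) R(2,1) e])
      obtain C where C: "0 \<le> C" "\<forall>N>0. \<forall>\<omega>. (\<forall>k<N. A (grid N k) (grid N (Suc k)) + E (grid N k) (grid N (Suc k)) \<le> \<omega>) \<longrightarrow>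
        \<bar>(\<integral>x. mollify \<epsilon> \<phi> x \<partial>\<mu> b) - (\<integral>x. mollify \<epsilon> (\<lambda>x. \<phi> (euler N N x)) x \<partial>\<mu> a)\<bar> \<le> A a b * (K * exp (A a b) * \<epsilon> + C * \<omega>)"
        using ex by (elim exE conjE) (rule that)
      define \<omega> where "\<omega> = \<eta> / (2 * (A a b * C + 1))"
      have AC: "0 \<le> A a b * C" using C(1) A_nonneg[of a b] by simp
      have \<omega>: "0 < \<omega>" "A a b * C * \<omega> \<le> \<eta> / 2"
      proof -
        show "0 < \<omega>" using \<eta> AC by (simp add: \<omega>_def)
        have "A a b * C * \<omega> \<le> (A a b * C + 1) * \<omega>" using \<open>0 < \<omega>\<close> by (intro mult_right_mono) auto
        also have "\<dots> = \<eta> / 2" using AC by (simp add: \<omega>_def field_simps)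
        finally show "A a b * C * \<omega> \<le> \<eta> / 2" .
      qed
      obtain N0 where N0: "0 < N0" "\<forall>N\<ge>N0. \<forall>k<N. A (grid N k) (grid N (Suc k)) + E (grid N k) (grid N (Suc k)) \<le> \<omega>"
        using mesh_small[OF \<omega>(1)] by (elim exE conjE) (rule that)
      have fin: "\<bar>(\<integral>x. \<phi> x \<partial>\<mu> b) - (\<integral>x. \<phi> (euler N N x) \<partial>\<mu> a)\<bar> \<le> \<eta>" if N: "N0 \<le> N" for N
      proof -
        have Np: "0 < N" using N N0(1) by simp
        have t1: "\<bar>(\<integral>x. mollify \<epsilon> \<phi> x \<partial>\<mu> b) - (\<integral>x. mollify \<epsilon> (\<lambda>x. \<phi> (euler N N x)) x \<partial>\<mu> a)\<bar> \<le> A a b * (K * L * \<epsilon> + C * \<omega>)"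
          unfolding L_def using C(2) N0(2) N Np by blast
        have cmp: "\<bar>(\<integral>x. f x \<partial>\<mu> t) - (\<integral>x. mollify \<epsilon> f x \<partial>\<mu> t)\<bar> \<le> k * \<epsilon>"
          if t: "t \<in> {a..b}" and f: "k-lipschitz_on UNIV f" and fb: "\<And>x. \<bar>f x\<bar> \<le> B" for f :: "'a \<Rightarrow> real" and k t
        proof -
          have fc: "continuous_on UNIV f" using lipschitz_on_continuous_on[OF f] .
          have mc: "continuous_on UNIV (mollify \<epsilon> f)" using lipschitz_on_continuous_on[OF mollify_lipschitz[OF e f]] .
          have "(\<integral>x. f x \<partial>\<mu> t) - (\<integral>x. mollify \<epsilon> f x \<partial>\<mu> t) = (\<integral>x. f x - mollify \<epsilon> f x \<partial>\<mu> t)"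
            using bounded_integrable[OF t fc fb] bounded_integrable[OF t mc mollify_bounded[OF e fc fb]] by simp
          also have "\<bar>\<dots>\<bar> \<le> k * \<epsilon>"
            by (rule integral_le_const[OF t continuous_on_diff[OF fc mc]]) (use mollify_close[OF e f] in \<open>simp add: abs_minus_commute\<close>)
          finally show ?thesis .
        qed
        have t2: "\<bar>(\<integral>x. \<phi> x \<partial>\<mu> b) - (\<integral>x. mollify \<epsilon> \<phi> x \<partial>\<mu> b)\<bar> \<le> K * \<epsilon>" by (rule cmp[OF b \<phi>(1,2)])
        have t3: "\<bar>(\<integral>x. \<phi> (euler N N x) \<partial>\<mu> a) - (\<integral>x. mollify \<epsilon> (\<lambda>x. \<phi> (euler N N x)) x \<partial>\<mu> a)\<bar> \<le> K * L * \<epsilon>"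
          by (rule cmp[OF a Ql[OF Np] \<phi>(2)])
        have "\<bar>(\<integral>x. \<phi> x \<partial>\<mu> b) - (\<integral>x. \<phi> (euler N N x) \<partial>\<mu> a)\<bar> \<le> K * \<epsilon> + K * L * \<epsilon> + A a b * (K * L * \<epsilon> + C * \<omega>)"
          using t1 t2 t3 by linarith
        also have "\<dots> \<le> D * \<epsilon> + A a b * C * \<omega>" using e by (simp add: D_def algebra_simps)
        also have "D * \<epsilon> = \<eta> / 2" using D by (simp add: \<epsilon>_def)
        finally show ?thesis using \<omega>(2) by linarith
      qed
      have "(\<lambda>n. \<integral>x. \<phi> (euler (Suc (r n)) (Suc (r n)) x) \<partial>\<mu> a) \<longlonglongrightarrow> (\<integral>x. \<phi> (\<Phi> x) \<partial>\<mu> a)"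
      proof (rule integral_dominated_convergence[where w="\<lambda>_. B"])
        have m1: "h \<in> borel_measurable (\<mu> a)" if "continuous_on UNIV h" for h :: "'a \<Rightarrow> real"
          using borel_measurable_continuous_onI[OF that] by (simp add: measurable_cong_sets[OF ma(2) refl])
        show "(\<lambda>x. \<phi> (\<Phi> x)) \<in> borel_measurable (\<mu> a)"
          by (rule m1, rule continuous_on_compose2[OF \<phi>c \<Phi>c]) auto
        show "(\<lambda>x. \<phi> (euler (Suc (r n)) (Suc (r n)) x)) \<in> borel_measurable (\<mu> a)" for n by (rule m1, rule Qc) simp
        show "AE x in \<mu> a. (\<lambda>n. \<phi> (euler (Suc (r n)) (Suc (r n)) x)) \<longlonglongrightarrow> \<phi> (\<Phi> x)"
        proof (rule AE_I2)
          fix x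
          have "isCont \<phi> (\<Phi> x)" using \<phi>c by (simp add: continuous_on_eq_continuous_at)
          then show "(\<lambda>n. \<phi> (euler (Suc (r n)) (Suc (r n)) x)) \<longlonglongrightarrow> \<phi> (\<Phi> x)" by (rule isCont_tendsto_compose[OF _ r(2)])
        qed
      qed (use \<phi>(2) in auto)
      then have "(\<lambda>n. \<bar>(\<integral>x. \<phi> x \<partial>\<mu> b) - (\<integral>x. \<phi> (euler (Suc (r n)) (Suc (r n)) x) \<partial>\<mu> a)\<bar>) \<longlonglongrightarrow> \<bar>(\<integral>x. \<phi> x \<partial>\<mu> b) - (\<integral>x. \<phi> (\<Phi> x) \<partial>\<mu> a)\<bar>"
        by (intro tendsto_intros)
      then show ?thesis
      proof (rule Lim_bounded[where M=N0], intro allI impI)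
        fix n assume "N0 \<le> n"
        then have "N0 \<le> Suc (r n)" using seq_suble[OF r(1), of n] by simp
        then show "\<bar>(\<integral>x. \<phi> x \<partial>\<mu> b) - (\<integral>x. \<phi> (euler (Suc (r n)) (Suc (r n)) x) \<partial>\<mu> a)\<bar> \<le> \<eta>" by (rule fin)
      qed
    qed
    have "\<bar>(\<integral>x. \<phi> x \<partial>\<mu> b) - (\<integral>x. \<phi> (\<Phi> x) \<partial>\<mu> a)\<bar> \<le> 0"
      by (rule field_le_epsilon) (use main in simp)
    moreover have "(\<integral>x. \<phi> x \<partial>distr (\<mu> a) borel \<Phi>) = (\<integral>x. \<phi> (\<Phi> x) \<partial>\<mu> a)"
      by (rule integral_distr[OF \<Phi>ma borel_measurable_continuous_onI[OF \<phi>c]])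
    ultimately show "(\<integral>x. \<phi> x \<partial>\<mu> b) = (\<integral>x. \<phi> x \<partial>distr (\<mu> a) borel \<Phi>)" by simp
  qed
  moreover have "norm (\<Phi> x - x - drift a b x) \<le> A a b * (exp (A a b) - 1) * (1 + norm x)" for x
  proof (rule Lim_bounded)
    show "(\<lambda>n. norm (euler (Suc (r n)) (Suc (r n)) x - x - drift a b x)) \<longlonglongrightarrow> norm (\<Phi> x - x - drift a b x)"
      by (intro tendsto_intros r)
    show "\<forall>n\<ge>0. norm (euler (Suc (r n)) (Suc (r n)) x - x - drift a b x) \<le> A a b * (exp (A a b) - 1) * (1 + norm x)"
      using est(3)[of "Suc _"] by (auto simp: L_def)
  qed
  ultimately show ?thesis using that \<Phi>m by blast
qed

end


section \<open>Support functions of sets of maps\<close>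

interpretation C0: Metric_space "C0 :: ('a::euclidean_space \<Rightarrow> 'a) set" d_cc
  by (rule Metric_space_C0)

lemma norm_le_sup_on: "x \<in> S \<Longrightarrow> ennreal (norm (v x - w x)) \<le> sup_on S v w"
  unfolding sup_on_def by (rule SUP_upper)

text \<open>The term of index \<open>k\<close> of the series defining \<open>d_cc\<close> already controls the values on
  the ball of radius \<open>k + 1\<close>; the bound \<open>e \<le> 1\<close> makes the truncation by one
  harmless.\<close>
lemma d_cc_eval_less:
  fixes v w :: "'a::euclidean_space \<Rightarrow> 'a"
  assumes x: "norm x \<le> real (Suc k)" and d: "d_cc v w < (1/2) ^ Suc k * e" and e: "e \<le> 1"
  shows "norm (v x - w x) < e"
proof -
  define s where "s = sup_on (cball 0 (real (Suc k))) v w"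
  have "(1/2) ^ Suc k * enn2real (min 1 s) \<le> d_cc v w"
    unfolding d_cc_def s_def
    using sum_le_suminf[OF d_cc_summable[of v w], of "{k}"] by simp
  then have "(1/2) ^ Suc k * enn2real (min 1 s) < (1/2) ^ Suc k * e" using d by (rule le_less_trans)
  then have es: "enn2real (min 1 s) < e" by (rule mult_left_less_imp_less) simp
  have "min 1 s < top" by (auto simp: min_less_iff_disj)
  then have "min 1 s = ennreal (enn2real (min 1 s))" by simp
  then have "min 1 s < ennreal e" using es by (metis ennreal_lessI enn2real_nonneg le_less_trans)
  also have "\<dots> \<le> 1" using e by simp
  finally have "min 1 s = s" by (auto simp: min_def split: if_splits)
  with \<open>min 1 s < ennreal e\<close> have "s < ennreal e" by simp
  then have "ennreal (norm (v x - w x)) < ennreal e"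
    using norm_le_sup_on[of x "cball 0 (real (Suc k))" v w] x by (simp add: s_def le_less_trans)
  then show ?thesis by (simp add: ennreal_less_iff)
qed

lemma continuous_map_eval:
  fixes x :: "'a::euclidean_space"
  shows "continuous_map C0_topology euclidean (\<lambda>w. w x)"
  unfolding continuous_map_def
proof (intro conjI allI impI)
  fix U :: "'a set" assume U: "openin euclidean U"
  show "openin C0_topology {w \<in> topspace C0_topology. w x \<in> U}"
    unfolding C0.openin_mtopology C0.topspace_mtopology
  proof (intro conjI allI impI)
    fix w :: "'a \<Rightarrow> 'a" assume w: "w \<in> {w \<in> C0. w x \<in> U}"
    then obtain e where e: "0 < e" "ball (w x) e \<subseteq> U" using U by (auto simp: open_contains_ball)
    obtain k :: nat where k: "norm x \<le> real k" using real_arch_simple by blast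
    then have k': "norm x \<le> real (Suc k)" by simp
    show "\<exists>r>0. C0.mball w r \<subseteq> {w \<in> C0. w x \<in> U}"
    proof (intro exI[of _ "(1/2) ^ Suc k * min e 1"] conjI subsetI)
      show "0 < (1/2) ^ Suc k * min e 1" using e(1) by simp
      fix v assume v: "v \<in> C0.mball w ((1/2) ^ Suc k * min e 1)"
      then have "norm (w x - v x) < min e 1" by (intro d_cc_eval_less[OF k']) auto
      then have "v x \<in> ball (w x) e" by (simp add: dist_norm)
      then show "v \<in> {w \<in> C0. w x \<in> U}" using v e(2) by auto
    qed
  qed auto
qed simp

text \<open>The list form \<open>ps\<close> of finitely many coefficients and points keeps the family of functionals
  countable once coefficients and points are taken from a countable set.\<close>
definition functional :: "('a \<times> 'a::euclidean_space) list \<Rightarrow> ('a \<Rightarrow> 'a) \<Rightarrow> real" where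
  "functional ps w = (\<Sum>(c, x)\<leftarrow>ps. c \<bullet> w x)"

lemma continuous_map_functional: "continuous_map C0_topology euclideanreal (functional ps)"
proof (induction ps)
  case Nil
  then show ?case by (simp add: functional_def[abs_def])
next
  case (Cons q ps)
  have "continuous_map C0_topology euclideanreal (\<lambda>w. fst q \<bullet> w (snd q))"
    using continuous_map_compose[OF continuous_map_eval[of "snd q"], of euclideanreal "\<lambda>y. fst q \<bullet> y"]
    by (simp add: o_def continuous_intros)
  then have "continuous_map C0_topology euclideanreal (\<lambda>w. fst q \<bullet> w (snd q) + functional ps w)"
    using Cons by (rule continuous_map_add)
  then show ?case by (simp add: functional_def[abs_def] case_prod_unfold)
qed

lemma open_functional_superlevel: "openin C0_topology {w \<in> C0. \<kappa> < functional ps w}"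
  using openin_continuous_map_preimage[OF continuous_map_functional, of "{\<kappa><..}"] by simp

definition weight :: "('a \<times> 'a::euclidean_space) list \<Rightarrow> real" where
  "weight ps = (\<Sum>(c, x)\<leftarrow>ps. norm c)"

lemma weight_nonneg: "0 \<le> weight ps"
  unfolding weight_def by (intro sum_list_nonneg) auto

lemma functional_diff_le:
  assumes "\<And>x. norm (v x - w x) \<le> d"
  shows "\<bar>functional ps v - functional ps w\<bar> \<le> weight ps * d"
proof (induction ps)
  case (Cons q ps)
  have "\<bar>fst q \<bullet> (v (snd q) - w (snd q))\<bar> \<le> norm (fst q) * d"
    using Cauchy_Schwarz_ineq2[of "fst q" "v (snd q) - w (snd q)"] mult_left_mono[OF assms[of "snd q"], of "norm (fst q)"] by simp
  then show ?case using Cons by (simp add: functional_def weight_def case_prod_unfold algebra_simps)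
qed (simp add: functional_def weight_def)

definition growth_weight :: "real \<Rightarrow> ('a \<times> 'a::euclidean_space) list \<Rightarrow> real" where
  "growth_weight c ps = (\<Sum>(a, x)\<leftarrow>ps. norm a * (1 + norm x + c))"

lemma functional_growth:
  assumes "\<And>x. norm (v x) \<le> k * (1 + norm x + c)"
  shows "\<bar>functional ps v\<bar> \<le> k * growth_weight c ps"
proof (induction ps)
  case (Cons q ps)
  have "\<bar>fst q \<bullet> v (snd q)\<bar> \<le> norm (fst q) * (k * (1 + norm (snd q) + c))"
    using Cauchy_Schwarz_ineq2[of "fst q" "v (snd q)"] mult_left_mono[OF assms[of "snd q"], of "norm (fst q)"] by simp
  then show ?case using Cons by (simp add: functional_def growth_weight_def case_prod_unfold algebra_simps)
qed (simp add: functional_def growth_weight_def)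

text \<open>The superlevel sets of the supremum are exactly the times at which \<open>F t\<close> meets an open
  superlevel set of the functional, so measurability of the multimap gives measurability of the support
  function.\<close>
lemma support_function_integrable:
  fixes F :: "real \<Rightarrow> ('a::euclidean_space \<Rightarrow> 'a) set"
  assumes F: "measurable_multimap {0..T} F" and ne: "\<And>t. t \<in> {0..T} \<Longrightarrow> F t \<noteq> {}" and sub: "\<And>t. t \<in> {0..T} \<Longrightarrow> F t \<subseteq> C0"
    and N: "N \<in> null_sets lebesgue"
    and m: "set_integrable lebesgue {0..T} m"
    and growth: "\<And>t v x. t \<in> {0..T} - N \<Longrightarrow> v \<in> F t \<Longrightarrow> norm (v x) \<le> m t * (1 + norm x + c)"
  shows "integrable lebesgue (\<lambda>t. if t \<in> {0..T} - N then SUP v\<in>F t. functional ps v else 0)"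
proof -
  define s where "s t = (if t \<in> {0..T} - N then SUP v\<in>F t. functional ps v else 0)" for t
  have Nm: "N \<in> sets lebesgue" using N by blast
  have b: "\<bar>functional ps v\<bar> \<le> m t * growth_weight c ps" if "t \<in> {0..T} - N" "v \<in> F t" for t v
    by (rule functional_growth) (rule growth[OF that])
  have bdd: "bdd_above (functional ps ` F t)" if "t \<in> {0..T} - N" for t
    using b[OF that] by (intro bdd_aboveI[where M="m t * growth_weight c ps"]) fastforce
  have less_iff: "\<kappa> < (SUP v\<in>F t. functional ps v) \<longleftrightarrow> (\<exists>v\<in>F t. \<kappa> < functional ps v)" if "t \<in> {0..T} - N" for t \<kappa>
    by (rule less_cSUP_iff[OF ne bdd]) (use that in auto)
  have sm: "s \<in> borel_measurable lebesgue"
  proof (subst borel_measurable_iff_greater, intro allI)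
    fix \<kappa> :: real
    define U where "U = {t \<in> {0..T}. F t \<inter> {w \<in> C0. \<kappa> < functional ps w} \<noteq> {}}"
    have Um: "U \<in> sets lebesgue"
      using F open_functional_superlevel[of \<kappa> ps] unfolding measurable_multimap_def U_def by blast
    have "{t \<in> space lebesgue. \<kappa> < s t} = (U - N) \<union> (if \<kappa> < 0 then - ({0..T} - N) else {})"
    proof (intro equalityI subsetI)
      fix t assume t: "t \<in> {t \<in> space lebesgue. \<kappa> < s t}"
      show "t \<in> (U - N) \<union> (if \<kappa> < 0 then - ({0..T} - N) else {})"
      proof (cases "t \<in> {0..T} - N")
        case True
        then have "\<kappa> < (SUP v\<in>F t. functional ps v)" using t by (simp add: s_def)
        then obtain v where "v \<in> F t" "\<kappa> < functional ps v"
          using less_iff[OF True] by auto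
        then show ?thesis using sub[of t] True by (auto simp: U_def)
      qed (use t in \<open>auto simp: s_def\<close>)
    next
      fix t assume t: "t \<in> (U - N) \<union> (if \<kappa> < 0 then - ({0..T} - N) else {})"
      show "t \<in> {t \<in> space lebesgue. \<kappa> < s t}"
      proof (cases "t \<in> {0..T} - N")
        case True
        then have "t \<in> U" using t by (auto split: if_splits)
        then obtain v where "v \<in> F t" "\<kappa> < functional ps v" by (auto simp: U_def)
        then have "\<kappa> < (SUP v\<in>F t. functional ps v)" using less_iff[OF True] by auto
        then show ?thesis using True by (simp add: s_def)
      qed (use t in \<open>auto simp: s_def U_def split: if_splits\<close>)
    qed
    moreover have "(U - N) \<union> (if \<kappa> < 0 then - ({0..T} - N) else {}) \<in> sets lebesgue"
    proof -
      have "{0..T} - N \<in> sets lebesgue" using Nm by (intro sets.Diff) simp_all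
      from sets.compl_sets[OF this] have "- ({0..T} - N) \<in> sets lebesgue" by (simp add: Compl_eq_Diff_UNIV)
      then show ?thesis using Um Nm by auto
    qed
    ultimately show "{t \<in> space lebesgue. \<kappa> < s t} \<in> sets lebesgue" by simp
  qed
  have "integrable lebesgue (\<lambda>t. growth_weight c ps * (indicator {0..T} t *\<^sub>R m t))"
    using m by (simp add: set_integrable_def)
  then have "integrable lebesgue s"
  proof (rule Bochner_Integration.integrable_bound[OF _ sm])
    show "AE t in lebesgue. norm (s t) \<le> norm (growth_weight c ps * (indicator {0..T} t *\<^sub>R m t))"
    proof (rule AE_I2)
      fix t
      show "norm (s t) \<le> norm (growth_weight c ps * (indicator {0..T} t *\<^sub>R m t))"
      proof (cases "t \<in> {0..T} - N")
        case True
        have "\<bar>SUP v\<in>F t. functional ps v\<bar> \<le> m t * growth_weight c ps"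
        proof (rule abs_leI)
          show "(SUP v\<in>F t. functional ps v) \<le> m t * growth_weight c ps"
            by (rule cSUP_least) (use ne[of t] True b[OF True] in \<open>auto simp: abs_le_iff\<close>)
          obtain v where v: "v \<in> F t" using ne[of t] True by auto
          have "functional ps v \<le> (SUP v\<in>F t. functional ps v)" by (rule cSUP_upper[OF v bdd[OF True]])
          then show "- (SUP v\<in>F t. functional ps v) \<le> m t * growth_weight c ps" using b[OF True v] by simp
        qed
        then show ?thesis using True by (simp add: s_def mult.commute)
      next
        case False
        then have "s t = 0" unfolding s_def by (rule if_not_P)
        then show ?thesis by simp
      qed
    qed
  qed
  then show ?thesis by (simp add: s_def[abs_def])
qed

text \<open>Projection onto a convex set, on finitely many points: near-minimality of \<open>w\<close> for the distance
  to \<open>\<xi>\<close> implies an approximate variational inequality, and the assumption for the coefficients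
  \<open>\<xi> x - w x\<close> then shows that the distance is small. No minimiser needs to exist, so the set of
  restrictions may fail to be closed.\<close>
lemma approximate_separation:
  fixes \<xi> :: "'a::euclidean_space \<Rightarrow> 'a"
  assumes S: "convex_maps S" "S \<noteq> {}" and X: "finite X"
    and bd: "\<And>w x. w \<in> S \<Longrightarrow> x \<in> X \<Longrightarrow> norm (w x) \<le> R"
    and sep: "\<And>a \<eta>. 0 < \<eta> \<Longrightarrow> \<exists>z\<in>S. (\<Sum>x\<in>X. a x \<bullet> \<xi> x) \<le> (\<Sum>x\<in>X. a x \<bullet> z x) + \<eta>"
    and e: "0 < \<epsilon>"
  shows "\<exists>w\<in>S. (\<Sum>x\<in>X. (norm (\<xi> x - w x))\<^sup>2) \<le> \<epsilon>"
proof -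
  define D where "D w = (\<Sum>x\<in>X. (norm (\<xi> x - w x))\<^sup>2)" for w
  have D0: "0 \<le> D w" for w by (simp add: D_def sum_nonneg)
  define I where "I = (INF w\<in>S. D w)"
  have bb: "bdd_below (D ` S)" using D0 by (intro bdd_belowI[where m=0]) auto
  define B where "B = real (card X) * (2 * R)\<^sup>2"
  have B0: "0 \<le> B" by (simp add: B_def)
  define c where "c = min 1 (\<epsilon> / (2 * (B + 2)))"
  have c: "0 < c" "c \<le> 1" "c * (B + 2) \<le> \<epsilon> / 2"
  proof -
    show "0 < c" "c \<le> 1" using e B0 by (auto simp: c_def)
    have "c * (B + 2) \<le> \<epsilon> / (2 * (B + 2)) * (B + 2)" using B0 by (intro mult_right_mono) (auto simp: c_def)
    also have "\<dots> = \<epsilon> / 2" using B0 by (simp add: field_simps)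
    finally show "c * (B + 2) \<le> \<epsilon> / 2" .
  qed
  \<comment> \<open>The slack \<open>c\<^sup>2\<close> is of second order for the step of length \<open>c\<close> taken
    from \<open>w\<close> towards \<open>z\<close> below.\<close>
  obtain w where w: "w \<in> S" "D w < I + c\<^sup>2"
    using cINF_less_iff[OF S(2) bb, of "I + c\<^sup>2"] c(1) by (auto simp: I_def)
  obtain z where z: "z \<in> S" "(\<Sum>x\<in>X. (\<xi> x - w x) \<bullet> \<xi> x) \<le> (\<Sum>x\<in>X. (\<xi> x - w x) \<bullet> z x) + c"
    using sep[OF c(1), of "\<lambda>x. \<xi> x - w x"] by blast
  define y where "y = (\<lambda>x. (1 - c) *\<^sub>R w x + c *\<^sub>R z x)"
  have y: "y \<in> S" using S(1) w(1) z(1) c by (auto simp: convex_maps_def y_def)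
  have "I \<le> D y" unfolding I_def by (rule cINF_lower[OF bb y])
  have "D y = D w - 2 * c * (\<Sum>x\<in>X. (\<xi> x - w x) \<bullet> (z x - w x)) + c\<^sup>2 * (\<Sum>x\<in>X. (norm (z x - w x))\<^sup>2)"
  proof -
    have "(norm (\<xi> x - y x))\<^sup>2 = (norm (\<xi> x - w x))\<^sup>2 - 2 * c * ((\<xi> x - w x) \<bullet> (z x - w x)) + c\<^sup>2 * (norm (z x - w x))\<^sup>2" for x
    proof -
      have sq: "(norm (g - c *\<^sub>R h))\<^sup>2 = (norm g)\<^sup>2 - 2 * c * (g \<bullet> h) + c\<^sup>2 * (norm h)\<^sup>2" for g h :: 'a
        unfolding power2_norm_eq_inner by (simp add: inner_diff_left inner_diff_right inner_commute power2_eq_square)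
      have "\<xi> x - y x = (\<xi> x - w x) - c *\<^sub>R (z x - w x)" by (simp add: y_def algebra_simps)
      then show ?thesis by (simp only: sq)
    qed
    then show ?thesis by (simp add: D_def sum.distrib sum_subtractf sum_distrib_left)
  qed
  also have "(\<Sum>x\<in>X. (norm (z x - w x))\<^sup>2) \<le> (\<Sum>x\<in>X. (2 * R)\<^sup>2)"
  proof (intro sum_mono power_mono)
    fix x assume "x \<in> X"
    then show "norm (z x - w x) \<le> 2 * R" using bd[OF w(1)] bd[OF z(1)] norm_triangle_ineq4[of "z x" "w x"] by fastforce
  qed simp
  then have "c\<^sup>2 * (\<Sum>x\<in>X. (norm (z x - w x))\<^sup>2) \<le> c\<^sup>2 * B" unfolding B_def by (intro mult_left_mono) auto
  finally have "D y \<le> D w - 2 * c * (\<Sum>x\<in>X. (\<xi> x - w x) \<bullet> (z x - w x)) + c\<^sup>2 * B" by simp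
  then have "2 * c * (\<Sum>x\<in>X. (\<xi> x - w x) \<bullet> (z x - w x)) \<le> c * (c * (B + 1))"
    using \<open>I \<le> D y\<close> w(2) by (simp add: algebra_simps power2_eq_square)
  then have "2 * (\<Sum>x\<in>X. (\<xi> x - w x) \<bullet> (z x - w x)) \<le> c * (B + 1)" using c(1) by (simp add: mult.assoc mult.left_commute[of 2 c])
  then have i: "(\<Sum>x\<in>X. (\<xi> x - w x) \<bullet> (z x - w x)) \<le> c * (B + 1)" 
    using mult_nonneg_nonneg[of c "B + 1"] c(1) B0 by linarith
  have "D w = (\<Sum>x\<in>X. (\<xi> x - w x) \<bullet> \<xi> x) - (\<Sum>x\<in>X. (\<xi> x - w x) \<bullet> w x)"
    by (simp add: D_def power2_norm_eq_inner inner_diff_right sum_subtractf)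
  also have "\<dots> \<le> (\<Sum>x\<in>X. (\<xi> x - w x) \<bullet> z x) + c - (\<Sum>x\<in>X. (\<xi> x - w x) \<bullet> w x)" using z(2) by simp
  also have "\<dots> = (\<Sum>x\<in>X. (\<xi> x - w x) \<bullet> (z x - w x)) + c" by (simp add: inner_diff_right sum_subtractf)
  also have "\<dots> \<le> c * (B + 2)" using i by (simp add: algebra_simps)
  finally have "D w \<le> \<epsilon>" using c(3) e by linarith
  then show ?thesis using w(1) by (auto simp: D_def)
qed

text \<open>Both sides depend continuously on the coefficients, uniformly for maps bounded on \<open>X\<close>.\<close>
lemma dense_coefficients:
  fixes \<xi> :: "'a::euclidean_space \<Rightarrow> 'a"
  assumes C: "closure C = UNIV" and X: "finite X" and bd: "\<And>w x. w \<in> S \<Longrightarrow> x \<in> X \<Longrightarrow> norm (w x) \<le> R" "\<And>x. x \<in> X \<Longrightarrow> norm (\<xi> x) \<le> R"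
    and sep: "\<And>a \<eta>. (\<And>x. a x \<in> C) \<Longrightarrow> 0 < \<eta> \<Longrightarrow> \<exists>z\<in>S. (\<Sum>x\<in>X. a x \<bullet> \<xi> x) \<le> (\<Sum>x\<in>X. a x \<bullet> z x) + \<eta>" and \<eta>: "0 < \<eta>"
  shows "\<exists>z\<in>S. (\<Sum>x\<in>X. a x \<bullet> \<xi> x) \<le> (\<Sum>x\<in>X. a x \<bullet> z x) + \<eta>"
proof -
  define R' where "R' = max R 0"
  define P where "P = real (card X) * (2 * R')"
  have P: "0 \<le> P" by (simp add: P_def R'_def)
  define d where "d = \<eta> / 2 / (P + 1)"
  have d: "0 < d" "real (card X) * (d * (2 * R')) \<le> \<eta> / 2"
  proof -
    show "0 < d" using P \<eta> by (simp add: d_def)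
    then have "d * P \<le> d * (P + 1)" by (intro mult_left_mono) auto
    also have "\<dots> = \<eta> / 2"
    proof -
      have "y / (P + 1) * (P + 1) = y" for y using P by simp
      then show ?thesis unfolding d_def .
    qed
    finally show "real (card X) * (d * (2 * R')) \<le> \<eta> / 2" by (simp add: mult_ac P_def)
  qed
  have "\<exists>c\<in>C. dist c (a x) < d" for x using C d(1) closure_approachable[of "a x" C] by auto
  then obtain a' where a': "\<And>x. a' x \<in> C" "\<And>x. dist (a' x) (a x) < d" by metis
  obtain z where z: "z \<in> S" "(\<Sum>x\<in>X. a' x \<bullet> \<xi> x) \<le> (\<Sum>x\<in>X. a' x \<bullet> z x) + \<eta> / 2"
    using sep[of a' "\<eta>/2", OF a'(1)] \<eta> by auto
  have "(\<Sum>x\<in>X. a x \<bullet> \<xi> x) - (\<Sum>x\<in>X. a x \<bullet> z x) = (\<Sum>x\<in>X. a' x \<bullet> \<xi> x) - (\<Sum>x\<in>X. a' x \<bullet> z x) + (\<Sum>x\<in>X. (a x - a' x) \<bullet> (\<xi> x - z x))"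
    by (simp add: inner_diff_left inner_diff_right sum_subtractf)
  also have "(\<Sum>x\<in>X. (a x - a' x) \<bullet> (\<xi> x - z x)) \<le> (\<Sum>x\<in>X. d * (2 * R'))"
  proof (rule sum_mono)
    fix x assume x: "x \<in> X"
    have "(a x - a' x) \<bullet> (\<xi> x - z x) \<le> norm (a x - a' x) * norm (\<xi> x - z x)" by (rule norm_cauchy_schwarz)
    also have "\<dots> \<le> d * (2 * R')"
    proof (intro mult_mono)
      show "norm (a x - a' x) \<le> d" using a'(2)[of x] by (simp add: dist_norm norm_minus_commute)
      show "norm (\<xi> x - z x) \<le> 2 * R'"
        using bd(1)[OF z(1) x] bd(2)[OF x] norm_triangle_ineq4[of "\<xi> x" "z x"] by (simp add: R'_def)
    qed (use d in auto)
    finally show "(a x - a' x) \<bullet> (\<xi> x - z x) \<le> d * (2 * R')" .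
  qed
  also have "(\<Sum>x\<in>X. d * (2 * R')) \<le> \<eta> / 2" using d(2) by simp
  finally show ?thesis using z by (intro bexI[of _ z]) auto
qed

text \<open>Equi-Lipschitz maps that converge on a dense set converge locally uniformly, and therefore for
  \<open>d_cc\<close>.\<close>
lemma closed_limit:
  fixes w :: "nat \<Rightarrow> 'a::euclidean_space \<Rightarrow> 'a"
  assumes S: "closedin C0_topology S" and w: "\<And>n. w n \<in> S" and wl: "\<And>n. K-lipschitz_on UNIV (w n)"
    and \<xi>: "K-lipschitz_on UNIV \<xi>" and D: "closure D = UNIV" and lim: "\<And>x. x \<in> D \<Longrightarrow> (\<lambda>n. w n x) \<longlonglongrightarrow> \<xi> x"
  shows "\<xi> \<in> S"
proof -
  have K: "0 \<le> K" using lipschitz_on_nonneg[OF \<xi>] .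
  have \<xi>C: "\<xi> \<in> C0" using lipschitz_on_continuous_on[OF \<xi>] by (simp add: C0_def)
  have SC: "S \<subseteq> C0" using closedin_subset[OF S] by simp
  have unif: "eventually (\<lambda>n. \<forall>x\<in>cball 0 \<rho>. norm (w n x - \<xi> x) \<le> e) sequentially" if e: "0 < e" for e \<rho> :: real
  proof -
    define d where "d = e / (3 * (K + 1))"
    have d: "0 < d" "K * d \<le> e / 3" using e K by (auto simp: d_def field_simps)
    have "cball (0::'a) \<rho> \<subseteq> (\<Union>c\<in>D. ball c d)"
    proof
      fix x :: 'a
      obtain y where "y \<in> D" "dist y x < d" using D d(1) closure_approachable[of x D] by auto
      then show "x \<in> (\<Union>c\<in>D. ball c d)" by auto
    qed
    then obtain D' where D': "D' \<subseteq> D" "finite D'" "cball (0::'a) \<rho> \<subseteq> (\<Union>c\<in>D'. ball c d)"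
      using compactE_image[OF compact_cball, of D "\<lambda>c. ball c d" 0 \<rho>] by (metis open_ball)
    have "eventually (\<lambda>n. \<forall>c\<in>D'. dist (w n c) (\<xi> c) < e / 3) sequentially"
    proof (rule eventually_ball_finite[OF D'(2)], rule ballI)
      fix c assume "c \<in> D'"
      then show "eventually (\<lambda>n. dist (w n c) (\<xi> c) < e / 3) sequentially"
        using lim[of c] D'(1) e by (intro tendstoD) auto
    qed
    then show ?thesis
    proof eventually_elim
      case (elim n)
      show ?case
      proof
        fix x :: 'a assume "x \<in> cball 0 \<rho>"
        then obtain c where c: "c \<in> D'" "dist c x < d" using D'(3) by auto
        have 1: "dist (w n x) (w n c) \<le> K * d" "dist (\<xi> c) (\<xi> x) \<le> K * d"
          using lipschitz_onD[OF wl, of x c n] lipschitz_onD[OF \<xi>, of c x] c(2) K mult_left_mono[of "dist c x" d K]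
          by (auto simp: dist_commute)
        have "dist (w n x) (\<xi> x) \<le> dist (w n x) (w n c) + (dist (w n c) (\<xi> c) + dist (\<xi> c) (\<xi> x))"
          by (meson add_left_mono dist_triangle order_trans)
        also have "\<dots> \<le> e" using 1 d(2) elim c(1) by (auto dest!: bspec)
        finally show "norm (w n x - \<xi> x) \<le> e" by (simp add: dist_norm)
      qed
    qed
  qed
  have "(\<lambda>n. d_cc (w n) \<xi>) \<longlonglongrightarrow> (\<Sum>k. 0)"
    unfolding d_cc_def
  proof (rule tannerys_theorem[where M="\<lambda>k. (1/2) ^ Suc k", THEN conjunct2, THEN conjunct2])
    show "eventually (\<lambda>(k, n). norm ((1/2) ^ Suc k * enn2real (min 1 (sup_on (cball 0 (real (Suc k))) (w n) \<xi>))) \<le> (1/2) ^ Suc k) (at_top \<times>\<^sub>F sequentially)"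
      by (rule always_eventually) (auto simp: abs_mult intro!: mult_left_le d_cc_term_le_1)
    fix k
    show "(\<lambda>n. (1/2) ^ Suc k * enn2real (min 1 (sup_on (cball 0 (real (Suc k))) (w n) \<xi>))) \<longlonglongrightarrow> 0"
    proof (rule tendsto_mult_right_zero, rule tendstoI)
      fix e :: real assume e: "0 < e"
      show "eventually (\<lambda>n. dist (enn2real (min 1 (sup_on (cball 0 (real (Suc k))) (w n) \<xi>))) 0 < e) sequentially"
      proof (rule eventually_mono)
        show "eventually (\<lambda>n. \<forall>x\<in>cball 0 (real (Suc k)). norm (w n x - \<xi> x) \<le> e / 2) sequentially"
          using e by (intro unif) simp
        fix n assume "\<forall>x\<in>cball 0 (real (Suc k)). norm (w n x - \<xi> x) \<le> e / 2"
        then have "sup_on (cball 0 (real (Suc k))) (w n) \<xi> \<le> ennreal (e / 2)"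
          unfolding sup_on_def by (intro SUP_least ennreal_leI) auto
        then have "min 1 (sup_on (cball 0 (real (Suc k))) (w n) \<xi>) \<le> ennreal (e / 2)" by (simp add: min.coboundedI2)
        then have "enn2real (min 1 (sup_on (cball 0 (real (Suc k))) (w n) \<xi>)) \<le> e / 2"
          using enn2real_mono[of _ "ennreal (e/2)"] e by simp
        then show "dist (enn2real (min 1 (sup_on (cball 0 (real (Suc k))) (w n) \<xi>))) 0 < e" using e by simp
      qed
    qed
  qed (auto simp: summable_geometric)
  then have d: "(\<lambda>n. d_cc (w n) \<xi>) \<longlonglongrightarrow> 0" by simp
  show ?thesis
  proof (rule ccontr)
    assume "\<xi> \<notin> S"
    then have x: "\<xi> \<in> C0 - S" using \<xi>C by simp
    have "openin C0_topology (C0 - S)" using S by (simp add: closedin_def)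
    then obtain r where r: "0 < r" "C0.mball \<xi> r \<subseteq> C0 - S" using x unfolding C0.openin_mtopology by blast
    have "eventually (\<lambda>n. d_cc (w n) \<xi> < r) sequentially" using d r(1) by (intro order_tendstoD) auto
    then obtain n where "d_cc (w n) \<xi> < r" by (auto simp: eventually_sequentially)
    then have "w n \<in> C0.mball \<xi> r" using \<xi>C w[of n] SC by (auto simp: C0.commute)
    then show False using r(2) w[of n] by auto
  qed
qed


section \<open>Solutions as transported curves, and tangency along a sequence\<close>

lemma transport_curve_restrict:
  assumes tc: "transport_curve p a b u \<mu> m l g" and c: "a < c" "c \<le> b"
  shows "transport_curve p a c u \<mu> m l g"
proof -
  interpret transport_curve p a b u \<mu> m l g by (rule tc)
  show ?thesis
  proof
    fix \<phi> :: "'a \<Rightarrow> real" and R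
    assume "\<And>k. Ck k \<phi>" "\<And>x. R < norm x \<Longrightarrow> \<phi> x = 0"
    then have "set_integrable lebesgue {a..b} (\<lambda>r. \<integral>x. frechet_derivative \<phi> (at x) (u r x) \<partial>\<mu> r)" by (rule ice_int)
    then show "set_integrable lebesgue {a..c} (\<lambda>r. \<integral>x. frechet_derivative \<phi> (at x) (u r x) \<partial>\<mu> r)"
      by (rule set_integrable_subset) (use c in auto)
  next
    fix \<phi> :: "'a \<Rightarrow> real" and R s t
    assume "\<And>k. Ck k \<phi>" "\<And>x. R < norm x \<Longrightarrow> \<phi> x = 0" "a \<le> s" "s \<le> t" "t \<le> c"
    then show "(\<integral>x. \<phi> x \<partial>\<mu> t) - (\<integral>x. \<phi> x \<partial>\<mu> s) = (LINT r:{s..t}|lebesgue. (\<integral>x. frechet_derivative \<phi> (at x) (u r x) \<partial>\<mu> r))"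
      using c by (intro ice[where R=R]) auto
  next
    fix t assume "t \<in> {a..c}" then show "\<mu> t \<in> prob_moment p" using c by (intro mu) auto
  next
    fix s t assume "a \<le> s" "s \<le> t" "t \<le> c"
    then show "wasserstein p (\<mu> s) (\<mu> t) \<le> (LINT r:{s..t}|lebesgue. g r)" using c by (intro W) auto
  qed (use c p m l g u_meas growth lip in auto)
qed

lemma measurable_map_eval:
  fixes v :: "real \<Rightarrow> 'a::euclidean_space \<Rightarrow> 'a"
  assumes v: "measurable_map I v" and I: "I \<in> sets lebesgue" and N: "N \<in> sets lebesgue"
  shows "(\<lambda>r. if r \<in> I - N then v r x else 0) \<in> borel_measurable lebesgue"
proof (rule borel_measurableI)
  fix U :: "'a set" assume U: "open U"
  have "openin C0_topology {w \<in> topspace C0_topology. w x \<in> U}"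
    by (rule openin_continuous_map_preimage[OF continuous_map_eval]) (use U in simp)
  then have "{r \<in> I. v r \<in> {w \<in> C0. w x \<in> U}} \<in> sets lebesgue" using v by (auto simp: measurable_map_def)
  moreover have "{r \<in> I. v r \<in> {w \<in> C0. w x \<in> U}} = {r \<in> I. v r x \<in> U}" using v by (auto simp: measurable_map_def)
  ultimately have 1: "{r \<in> I. v r x \<in> U} - N \<in> sets lebesgue" using N by (auto intro: sets.Diff)
  have "I - N \<in> sets lebesgue" using I N by (rule sets.Diff)
  from sets.compl_sets[OF this] have 2: "- (I - N) \<in> sets lebesgue" by (simp add: Compl_eq_Diff_UNIV)
  have "(\<lambda>r. if r \<in> I - N then v r x else 0) -` U \<inter> space lebesgue = ({r \<in> I. v r x \<in> U} - N) \<union> (if 0 \<in> U then - (I - N) else {})"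
    by (auto split: if_splits)
  then show "(\<lambda>r. if r \<in> I - N then v r x else 0) -` U \<inter> space lebesgue \<in> sets lebesgue" using 1 2 by auto
qed

text \<open>Along an absolutely continuous curve the moments are bounded, so the growth bound involving \<open>moment p
  (\<mu> r)\<close> becomes a bound by a multiple of \<open>m r * (1 + \<bar>x\<bar>)\<close>.\<close>
lemma transport_curve_of_solution:
  fixes \<mu> :: "real \<Rightarrow> 'a::euclidean_space measure"
  assumes \<tau>: "\<tau> < T" and p: "1 \<le> p" and ac: "abs_cont_curve p \<tau> T \<mu>" and v: "measurable_map {\<tau>..T} v"
    and CE: "continuity_equation \<tau> T v \<mu>" and N: "N \<in> null_sets lebesgue"
    and m: "set_integrable lebesgue {\<tau>..T} m" "\<And>r. r \<in> {\<tau>..T} \<Longrightarrow> 0 \<le> m r"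
    and l: "set_integrable lebesgue {\<tau>..T} l" "\<And>r. r \<in> {\<tau>..T} \<Longrightarrow> 0 \<le> l r"
    and growth: "\<And>r x. r \<in> {\<tau>..T} - N \<Longrightarrow> norm (v r x) \<le> m r * (1 + norm x + moment p (\<mu> r))"
    and lip: "\<And>r. r \<in> {\<tau>..T} - N \<Longrightarrow> (l r)-lipschitz_on UNIV (v r)"
  shows "\<exists>k g. 0 \<le> k \<and> transport_curve p \<tau> T (\<lambda>r x. if r \<in> {\<tau>..T} - N then v r x else 0) \<mu>
     (\<lambda>r. indicator {\<tau>..T} r *\<^sub>R (m r * k)) (\<lambda>r. indicator {\<tau>..T} r *\<^sub>R l r) g"
proof -
  have mu: "\<mu> t \<in> prob_moment p" if "t \<in> {\<tau>..T}" for t using ac that by (auto simp: abs_cont_curve_def)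
  obtain g where g: "set_integrable lebesgue {\<tau>..T} g" "\<And>t. t \<in> {\<tau>..T} \<Longrightarrow> 0 \<le> g t"
    "\<And>s t. \<tau> \<le> s \<Longrightarrow> s \<le> t \<Longrightarrow> t \<le> T \<Longrightarrow> wasserstein p (\<mu> s) (\<mu> t) \<le> (LINT r:{s..t}|lebesgue. g r)"
    using ac unfolding abs_cont_curve_def by auto
  define c where "c = (LINT r:{\<tau>..T}|lebesgue. g r) + 1"
  have Wc: "wasserstein p (\<mu> \<tau>) (\<mu> t) < c" if t: "t \<in> {\<tau>..T}" for t
  proof -
    have "wasserstein p (\<mu> \<tau>) (\<mu> t) \<le> (LINT r:{\<tau>..t}|lebesgue. g r)" using g(3)[of \<tau> t] t by auto
    moreover have "(LINT r:{\<tau>..t}|lebesgue. g r) + (LINT r:{t..T}|lebesgue. g r) = (LINT r:{\<tau>..T}|lebesgue. g r)"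
      using t by (intro set_integral_Icc_combine[OF g(1)]) auto
    moreover have "0 \<le> (LINT r:{t..T}|lebesgue. g r)"
      unfolding set_lebesgue_integral_def using g(2) t by (intro integral_nonneg_AE AE_I2) (auto simp: indicator_def)
    ultimately show ?thesis by (simp add: c_def)
  qed
  define Mx where "Mx = (2 powr p * ((\<integral>x. norm x powr p \<partial>\<mu> \<tau>) + c powr p)) powr (1 / p)"
  have mom: "moment p (\<mu> t) \<le> Mx" if t: "t \<in> {\<tau>..T}" for t
  proof -
    have "(\<integral>x. norm x powr p \<partial>\<mu> t) \<le> 2 powr p * ((\<integral>x. norm x powr p \<partial>\<mu> \<tau>) + c powr p)"
      by (rule moment_le_wasserstein[OF mu mu _ Wc]) (use t \<tau> p in auto)
    then show ?thesis unfolding moment_def Mx_def using p by (intro powr_mono2) auto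
  qed
  have Mx0: "0 \<le> Mx" by (simp add: Mx_def)
  define k where "k = 1 + Mx"
  have k: "0 \<le> k" using Mx0 by (simp add: k_def)
  define u where "u = (\<lambda>r x. if r \<in> {\<tau>..T} - N then v r x else 0)"
  have gr: "norm (v r x) \<le> (m r * k) * (1 + norm x)" if r: "r \<in> {\<tau>..T} - N" for r x
  proof -
    have "norm (v r x) \<le> m r * (1 + norm x + moment p (\<mu> r))" by (rule growth[OF r])
    also have "\<dots> \<le> m r * (k * (1 + norm x))"
    proof (rule mult_left_mono)
      have "k * (1 + norm x) = 1 + norm x + Mx + Mx * norm x" by (simp add: k_def algebra_simps)
      then show "1 + norm x + moment p (\<mu> r) \<le> k * (1 + norm x)"
        using mom[of r] r mult_nonneg_nonneg[OF Mx0 norm_ge_zero[of x]] by simp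
    qed (use m(2) r in simp)
    finally show ?thesis by (simp add: mult.assoc)
  qed
  have AEN: "AE r in lebesgue. r \<notin> N" using N by (rule AE_not_in)
  have mk: "set_integrable lebesgue {\<tau>..T} (\<lambda>r. m r * k)" using m(1) by simp
  have vc: "continuous_on UNIV (v t)" if "t \<in> {\<tau>..T}" for t using v that by (auto simp: measurable_map_def C0_def)
  note ICE = integrated_continuity_equation[OF \<tau> p mu g(1) g(3) vc mk]
  have AEg: "AE t\<in>{\<tau>..T} in lebesgue. \<forall>x. norm (v t x) \<le> m t * k * (1 + norm x)"
    using AEN by eventually_elim (use gr in auto)
  have Hu: "AE r in lebesgue. indicator {\<tau>..T} r *\<^sub>R (\<integral>x. frechet_derivative \<phi> (at x) (v r x) \<partial>\<mu> r)
      = indicator {\<tau>..T} r *\<^sub>R (\<integral>x. frechet_derivative \<phi> (at x) (u r x) \<partial>\<mu> r)" for \<phi> :: "'a \<Rightarrow> real"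
    using AEN by eventually_elim (auto simp: u_def indicator_def)
  have Hm: "(\<lambda>r. indicator S r *\<^sub>R (\<integral>x. frechet_derivative \<phi> (at x) (u r x) \<partial>\<mu> r)) \<in> borel_measurable lebesgue"
    if "set_integrable lebesgue {\<tau>..T} (\<lambda>r. \<integral>x. frechet_derivative \<phi> (at x) (v r x) \<partial>\<mu> r)" "S \<subseteq> {\<tau>..T}" "S \<in> sets lebesgue"
    for S and \<phi> :: "'a \<Rightarrow> real"
  proof -
    have "(\<lambda>r. indicator S r *\<^sub>R (\<integral>x. frechet_derivative \<phi> (at x) (v r x) \<partial>\<mu> r)) \<in> borel_measurable lebesgue"
      using set_integrable_subset[OF that(1,3,2)] by (auto simp: set_integrable_def)
    moreover have "AE r in lebesgue. indicator S r *\<^sub>R (\<integral>x. frechet_derivative \<phi> (at x) (v r x) \<partial>\<mu> r)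
      = indicator S r *\<^sub>R (\<integral>x. frechet_derivative \<phi> (at x) (u r x) \<partial>\<mu> r)"
      using AEN by eventually_elim (use that(2) in \<open>auto simp: u_def indicator_def\<close>)
    ultimately show ?thesis by (rule borel_measurable_AE)
  qed
  have "transport_curve p \<tau> T u \<mu> (\<lambda>r. indicator {\<tau>..T} r *\<^sub>R (m r * k)) (\<lambda>r. indicator {\<tau>..T} r *\<^sub>R l r) (\<lambda>r. indicator {\<tau>..T} r *\<^sub>R g r)"
  proof
    show "\<tau> < T" "1 \<le> p" by fact+
    show "\<mu> t \<in> prob_moment p" if "t \<in> {\<tau>..T}" for t using mu that .
    show "integrable lebesgue (\<lambda>r. indicator {\<tau>..T} r *\<^sub>R (m r * k))" using mk by (simp add: set_integrable_def)
    show "integrable lebesgue (\<lambda>r. indicator {\<tau>..T} r *\<^sub>R l r)" using l(1) by (simp add: set_integrable_def)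
    show "integrable lebesgue (\<lambda>r. indicator {\<tau>..T} r *\<^sub>R g r)" using g(1) by (simp add: set_integrable_def)
    show "0 \<le> indicator {\<tau>..T} t *\<^sub>R (m t * k)" for t using m(2)[of t] k by (auto simp: indicator_def)
    show "0 \<le> indicator {\<tau>..T} t *\<^sub>R l t" for t using l(2)[of t] by (auto simp: indicator_def)
    show "0 \<le> indicator {\<tau>..T} t *\<^sub>R g t" for t using g(2)[of t] by (auto simp: indicator_def)
    show "(\<lambda>t. u t x) \<in> borel_measurable lebesgue" for x
      unfolding u_def using N by (intro measurable_map_eval[OF v]) auto
    show "norm (u t x) \<le> indicator {\<tau>..T} t *\<^sub>R (m t * k) * (1 + norm x)" for t x
      using gr[of t x] m(2)[of t] k by (auto simp: u_def indicator_def)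
    show "(indicator {\<tau>..T} t *\<^sub>R l t)-lipschitz_on UNIV (u t)" for t
    proof (cases "t \<in> {\<tau>..T} - N")
      case True
      then have "u t = v t" by (simp add: u_def)
      then show ?thesis using lip[OF True] True by simp
    next
      case False
      then have "u t = (\<lambda>_. 0)" unfolding u_def by (simp only: if_False)
      then show ?thesis using l(2)[of t] by (auto simp: lipschitz_on_def indicator_def)
    qed
    show "wasserstein p (\<mu> s) (\<mu> t) \<le> (LINT r:{s..t}|lebesgue. indicator {\<tau>..T} r *\<^sub>R g r)" if "\<tau> \<le> s" "s \<le> t" "t \<le> T" for s t
    proof -
      have "(LINT r:{s..t}|lebesgue. g r) = (LINT r:{s..t}|lebesgue. indicator {\<tau>..T} r *\<^sub>R g r)"
        using that by (intro set_lebesgue_integral_cong) auto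
      then show ?thesis using g(3)[OF that] by simp
    qed
  next
    fix \<phi> :: "'a \<Rightarrow> real" and R
    assume \<phi>: "\<And>k. Ck k \<phi>" "\<And>x. R < norm x \<Longrightarrow> \<phi> x = 0"
    have i: "set_integrable lebesgue {\<tau>..T} (\<lambda>r. \<integral>x. frechet_derivative \<phi> (at x) (v r x) \<partial>\<mu> r)"
      by (rule ICE(1)[where R=R]) (use m(2) k AEg CE \<phi> in auto)
    have "integrable lebesgue (\<lambda>r. indicator {\<tau>..T} r *\<^sub>R (\<integral>x. frechet_derivative \<phi> (at x) (u r x) \<partial>\<mu> r))"
      by (rule integrable_cong_AE[THEN iffD1, OF _ _ Hu])
         (use i Hm[OF i] in \<open>auto simp: set_integrable_def\<close>)
    then show "set_integrable lebesgue {\<tau>..T} (\<lambda>r. \<integral>x. frechet_derivative \<phi> (at x) (u r x) \<partial>\<mu> r)"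
      by (simp add: set_integrable_def)
  next
    fix \<phi> :: "'a \<Rightarrow> real" and R s t
    assume \<phi>: "\<And>k. Ck k \<phi>" "\<And>x. R < norm x \<Longrightarrow> \<phi> x = 0" and st: "\<tau> \<le> s" "s \<le> t" "t \<le> T"
    have i: "set_integrable lebesgue {\<tau>..T} (\<lambda>r. \<integral>x. frechet_derivative \<phi> (at x) (v r x) \<partial>\<mu> r)"
      by (rule ICE(1)[where R=R]) (use m(2) k AEg CE \<phi> in auto)
    have "(\<integral>x. \<phi> x \<partial>\<mu> t) - (\<integral>x. \<phi> x \<partial>\<mu> s) = (LINT r:{s..t}|lebesgue. (\<integral>x. frechet_derivative \<phi> (at x) (v r x) \<partial>\<mu> r))"
      by (rule ICE(2)[where R=R]) (use m(2) k AEg CE \<phi> st in auto)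
    also have "\<dots> = (LINT r:{s..t}|lebesgue. (\<integral>x. frechet_derivative \<phi> (at x) (u r x) \<partial>\<mu> r))"
      unfolding set_lebesgue_integral_def
    proof (rule integral_cong_AE)
      show "(\<lambda>r. indicator {s..t} r *\<^sub>R (\<integral>x. frechet_derivative \<phi> (at x) (v r x) \<partial>\<mu> r)) \<in> borel_measurable lebesgue"
        using set_integrable_subset[OF i, of "{s..t}"] st by (auto simp: set_integrable_def dest: borel_measurable_integrable)
      show "(\<lambda>r. indicator {s..t} r *\<^sub>R (\<integral>x. frechet_derivative \<phi> (at x) (u r x) \<partial>\<mu> r)) \<in> borel_measurable lebesgue"
        by (rule Hm[OF i]) (use st in auto)
      show "AE r in lebesgue. indicator {s..t} r *\<^sub>R (\<integral>x. frechet_derivative \<phi> (at x) (v r x) \<partial>\<mu> r)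
        = indicator {s..t} r *\<^sub>R (\<integral>x. frechet_derivative \<phi> (at x) (u r x) \<partial>\<mu> r)"
        using AEN by eventually_elim (use st in \<open>auto simp: u_def indicator_def\<close>)
    qed
    finally show "(\<integral>x. \<phi> x \<partial>\<mu> t) - (\<integral>x. \<phi> x \<partial>\<mu> s) = (LINT r:{s..t}|lebesgue. (\<integral>x. frechet_derivative \<phi> (at x) (u r x) \<partial>\<mu> r))" .
  qed
  then show ?thesis unfolding u_def using k by blast
qed

text \<open>The lower limit vanishes as soon as the quotients tend to zero along one sequence of steps.\<close>
lemma contingent_cone_sequentialI:
  assumes \<xi>: "\<xi> \<in> borel_measurable borel" "integrable \<nu> (\<lambda>x. norm (\<xi> x) powr p)" and Q: "Q \<noteq> {}"
    and h: "\<And>n. 0 < h n" "h \<longlonglongrightarrow> 0" and e: "e \<longlonglongrightarrow> 0"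
    and \<sigma>: "\<And>n. \<sigma> n \<in> Q" "\<And>n. 1 / h n * wasserstein p (distr \<nu> borel (\<lambda>x. x + h n *\<^sub>R \<xi> x)) (\<sigma> n) \<le> e n"
  shows "\<xi> \<in> contingent_cone p Q \<nu>"
proof -
  define f where "f h = 1 / h * wasserstein_dist_to p (distr \<nu> borel (\<lambda>x. x + h *\<^sub>R \<xi> x)) Q" for h
  have f0: "0 \<le> f h" if "0 < h" for h
  proof -
    have "0 \<le> wasserstein_dist_to p (distr \<nu> borel (\<lambda>x. x + h *\<^sub>R \<xi> x)) Q"
      unfolding wasserstein_dist_to_def using Q wasserstein_nonneg by (intro cINF_greatest) auto
    then show ?thesis using that by (simp add: f_def)
  qed
  have fe: "f (h n) \<le> e n" for n
  proof -
    have "wasserstein_dist_to p (distr \<nu> borel (\<lambda>x. x + h n *\<^sub>R \<xi> x)) Q \<le> wasserstein p (distr \<nu> borel (\<lambda>x. x + h n *\<^sub>R \<xi> x)) (\<sigma> n)"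
      unfolding wasserstein_dist_to_def using \<sigma>(1) wasserstein_nonneg by (intro cINF_lower bdd_belowI[where m=0]) auto
    then have "f (h n) \<le> 1 / h n * wasserstein p (distr \<nu> borel (\<lambda>x. x + h n *\<^sub>R \<xi> x)) (\<sigma> n)"
      unfolding f_def using h(1)[of n] by (intro mult_left_mono) auto
    then show ?thesis using \<sigma>(2)[of n] by simp
  qed
  have "Liminf (at_right 0) (\<lambda>h. ereal (f h)) = 0"
  proof (rule antisym)
    show "0 \<le> Liminf (at_right 0) (\<lambda>h. ereal (f h))"
      by (rule Liminf_bounded) (auto simp: eventually_at_right_less eventually_at_filter intro!: always_eventually f0)
    show "Liminf (at_right 0) (\<lambda>h. ereal (f h)) \<le> 0"
    proof (rule ccontr)
      assume "\<not> Liminf (at_right 0) (\<lambda>h. ereal (f h)) \<le> 0"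
      then have "0 < Liminf (at_right 0) (\<lambda>h. ereal (f h))" by simp
      from dense[OF this] obtain y where y: "0 < y" "y < Liminf (at_right 0) (\<lambda>h. ereal (f h))" by auto
      have "eventually (\<lambda>h. y < ereal (f h)) (at_right 0)"
        using iffD1[OF le_Liminf_iff, OF order_refl] y(2) by blast
      moreover have "filterlim h (at_right 0) sequentially"
        using h by (intro tendsto_imp_filterlim_at_right always_eventually) auto
      ultimately have ev: "eventually (\<lambda>n. y < ereal (f (h n))) sequentially" by (rule eventually_compose_filterlim)
      have "(\<lambda>n. ereal (e n)) \<longlonglongrightarrow> 0" using e by (simp add: zero_ereal_def)
      then have "eventually (\<lambda>n. ereal (e n) < y) sequentially" using y(1) by (rule order_tendstoD)
      with ev have "eventually (\<lambda>n. False) sequentially"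
      proof eventually_elim
        case (elim n)
        have "ereal (e n) < ereal (f (h n))" using elim(2,1) by (rule less_trans)
        with fe[of n] show ?case by simp
      qed
      then show False by simp
    qed
  qed
  then show ?thesis using \<xi> by (simp add: contingent_cone_def f_def)
qed

lemma d_supD:
  assumes "d_sup v w \<le> ennreal c" "0 \<le> c"
  shows "norm (v x - w x) \<le> c"
proof -
  have "ennreal (norm (v x - w x)) \<le> ennreal c"
    using order_trans[OF norm_le_sup_on[of x UNIV v w] assms(1)] by simp
  then show ?thesis using assms(2) by (simp add: ennreal_le_iff)
qed

lemma functional_integral:
  fixes u :: "real \<Rightarrow> 'a::euclidean_space \<Rightarrow> 'a"
  assumes u: "\<And>x. set_integrable lebesgue S (\<lambda>r. u r x)"
  shows "set_integrable lebesgue S (\<lambda>r. functional ps (u r)) \<and>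
    functional ps (\<lambda>x. LINT r:S|lebesgue. u r x) = (LINT r:S|lebesgue. functional ps (u r))"
proof (induction ps)
  case Nil
  then show ?case by (simp add: functional_def set_integrable_def set_lebesgue_integral_def)
next
  case (Cons q ps)
  have i: "integrable lebesgue (\<lambda>r. indicator S r *\<^sub>R u r (snd q))" using u by (simp add: set_integrable_def)
  have 1: "set_integrable lebesgue S (\<lambda>r. fst q \<bullet> u r (snd q))"
    using integrable_inner_right[OF i, of "fst q"] by (simp add: set_integrable_def)
  have 2: "fst q \<bullet> (LINT r:S|lebesgue. u r (snd q)) = (LINT r:S|lebesgue. fst q \<bullet> u r (snd q))"
    using integral_inner_right[OF i, of "fst q"] by (simp add: set_lebesgue_integral_def)
  have eq: "functional (q # ps) w = fst q \<bullet> w (snd q) + functional ps w" for w :: "'a \<Rightarrow> 'a"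
    by (simp add: functional_def case_prod_unfold)
  show ?case unfolding eq using 1 2 Cons set_integral_add[OF 1, of "\<lambda>r. functional ps (u r)"] by simp
qed

lemma tendsto_functional:
  assumes "\<And>x. (\<lambda>n. f n x) \<longlonglongrightarrow> F x"
  shows "(\<lambda>n. functional ps (f n)) \<longlonglongrightarrow> functional ps F"
proof (induction ps)
  case (Cons q ps)
  have "(\<lambda>n. fst q \<bullet> f n (snd q) + functional ps (f n)) \<longlonglongrightarrow> fst q \<bullet> F (snd q) + functional ps F"
    by (intro tendsto_intros assms Cons)
  then show ?case by (simp add: functional_def case_prod_unfold)
qed (simp add: functional_def)

lemma functional_scale: "functional ps (\<lambda>x. c *\<^sub>R w x) = c * functional ps w"
  by (induction ps) (auto simp: functional_def algebra_simps)


section \<open>A tangent velocity at almost every time\<close>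

text \<open>On finitely many points of \<open>C\<close> the convex set \<open>S\<close> comes arbitrarily close to
  \<open>\<xi>\<close>. Enumerating \<open>C\<close> yields a sequence in \<open>S\<close> that converges to
  \<open>\<xi>\<close> on the dense set \<open>C\<close>.\<close>
lemma closed_convex_mem_of_support:
  fixes \<xi> :: "'a::euclidean_space \<Rightarrow> 'a" and B :: "'a \<Rightarrow> real"
  assumes S: "closedin C0_topology S" "S \<noteq> {}" "convex_maps S"
    and lip: "\<And>w. w \<in> S \<Longrightarrow> K-lipschitz_on UNIV w" and bd: "\<And>w x. w \<in> S \<Longrightarrow> norm (w x) \<le> B x"
    and \<xi>: "K-lipschitz_on UNIV \<xi>" and C: "countable C" "closure C = UNIV"
    and separated: "\<And>X a \<eta>. finite X \<Longrightarrow> X \<subseteq> C \<Longrightarrow> (\<And>x. a x \<in> C) \<Longrightarrow> 0 < \<eta> \<Longrightarrow>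
      \<exists>z\<in>S. (\<Sum>x\<in>X. a x \<bullet> \<xi> x) \<le> (\<Sum>x\<in>X. a x \<bullet> z x) + \<eta>"
  shows "\<xi> \<in> S"
proof -
  have Cne: "C \<noteq> {}" using C(2) by auto
  define en where "en = from_nat_into C"
  have en: "range en = C" unfolding en_def by (rule range_from_nat_into[OF Cne C(1)])
  have "\<exists>w\<in>S. (\<Sum>x\<in>en ` {..n}. (norm (\<xi> x - w x))\<^sup>2) \<le> (inverse (real (Suc n)))\<^sup>2" for n
  proof -
    define X where "X = en ` {..n}"
    have X: "finite X" "X \<subseteq> C" using en by (auto simp: X_def)
    define R where "R = (\<Sum>x\<in>X. \<bar>B x\<bar> + norm (\<xi> x))"
    have R: "\<bar>B x\<bar> + norm (\<xi> x) \<le> R" if "x \<in> X" for x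
      unfolding R_def using X(1) that by (intro member_le_sum) auto
    have b1: "norm (w x) \<le> R" if "w \<in> S" "x \<in> X" for w x
      using bd[OF that(1), of x] R[OF that(2)] norm_ge_zero[of "\<xi> x"] by linarith
    have b2: "norm (\<xi> x) \<le> R" if "x \<in> X" for x
      using R[OF that] abs_ge_zero[of "B x"] by linarith
    have "\<exists>w\<in>S. (\<Sum>x\<in>X. (norm (\<xi> x - w x))\<^sup>2) \<le> (inverse (real (Suc n)))\<^sup>2"
    proof (rule approximate_separation[where R=R])
      show "\<exists>z\<in>S. (\<Sum>x\<in>X. a x \<bullet> \<xi> x) \<le> (\<Sum>x\<in>X. a x \<bullet> z x) + \<eta>" if \<eta>: "0 < \<eta>" for a \<eta>
      proof (rule dense_coefficients[where R=R and C=C])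
        show "\<exists>z\<in>S. (\<Sum>x\<in>X. a x \<bullet> \<xi> x) \<le> (\<Sum>x\<in>X. a x \<bullet> z x) + \<eta>" if "\<And>x. a x \<in> C" "0 < \<eta>" for a \<eta>
          by (rule separated[OF X that])
        show "norm (w x) \<le> R" if "w \<in> S" "x \<in> X" for w x by (rule b1[OF that])
        show "norm (\<xi> x) \<le> R" if "x \<in> X" for x by (rule b2[OF that])
      qed (fact C(2) X(1) \<eta>)+
      show "norm (w x) \<le> R" if "w \<in> S" "x \<in> X" for w x by (rule b1[OF that])
    qed (use S X in auto)
    then show ?thesis by (simp add: X_def)
  qed
  then obtain w where w: "\<And>n. w n \<in> S" "\<And>n. (\<Sum>x\<in>en ` {..n}. (norm (\<xi> x - w n x))\<^sup>2) \<le> (inverse (real (Suc n)))\<^sup>2"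
    by metis
  show ?thesis
  proof (rule closed_limit[OF S(1) w(1) lip[OF w(1)] \<xi> C(2)])
    fix x assume "x \<in> C"
    then obtain j where j: "x = en j" using en by auto
    have "eventually (\<lambda>n. norm (w n x - \<xi> x) \<le> inverse (real (Suc n))) sequentially"
      unfolding eventually_sequentially
    proof (intro exI[of _ j] allI impI)
      fix n assume n: "j \<le> n"
      have "(norm (\<xi> x - w n x))\<^sup>2 \<le> (\<Sum>x\<in>en ` {..n}. (norm (\<xi> x - w n x))\<^sup>2)"
        using n j by (intro member_le_sum) auto
      also have "\<dots> \<le> (inverse (real (Suc n)))\<^sup>2" by (rule w(2))
      finally have "norm (\<xi> x - w n x) \<le> inverse (real (Suc n))" by (rule power2_le_imp_le) simp
      then show "norm (w n x - \<xi> x) \<le> inverse (real (Suc n))" by (simp add: norm_minus_commute)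
    qed
    then have "(\<lambda>n. w n x - \<xi> x) \<longlonglongrightarrow> 0" by (rule Lim_null_comparison[OF _ LIMSEQ_inverse_real_of_nat])
    then show "(\<lambda>n. w n x) \<longlonglongrightarrow> \<xi> x" by (simp add: LIM_zero_iff)
  qed
qed

text \<open>Coupling \<open>x + h n * \<xi> x\<close> with \<open>\<Phi> n x\<close> bounds the Wasserstein distance by
  \<open>h n\<close> times the \<open>L\<^sup>p(\<nu>)\<close> norm of \<open>b n\<close>, which tends to zero by
  dominated convergence; a multiple of \<open>(1 + \<bar>x\<bar>)\<^sup>p\<close> is an integrable majorant.\<close>
lemma contingent_cone_of_transport:
  fixes \<xi> :: "'a::euclidean_space \<Rightarrow> 'a" and \<Phi> :: "nat \<Rightarrow> 'a \<Rightarrow> 'a" and b :: "nat \<Rightarrow> 'a \<Rightarrow> real"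
  assumes \<nu>: "\<nu> \<in> prob_moment p" and p0: "0 < p"
    and \<xi>m [measurable]: "\<xi> \<in> borel_measurable borel" and \<xi>g: "\<And>x. norm (\<xi> x) \<le> Cb * (1 + norm x)"
    and h: "\<And>n. 0 < h n" "h \<longlonglongrightarrow> 0"
    and \<Phi>: "\<And>n. \<Phi> n \<in> borel_measurable borel" and \<sigma>: "\<And>n. \<sigma> n \<in> Q" "\<And>n. \<sigma> n = distr \<nu> borel (\<Phi> n)"
    and close: "\<And>n x. norm (x + h n *\<^sub>R \<xi> x - \<Phi> n x) \<le> h n * b n x"
    and bm: "\<And>n. b n \<in> borel_measurable borel" and b0: "\<And>n x. 0 \<le> b n x"
    and bb: "\<And>n x. b n x \<le> Cb * (1 + norm x)" and b_lim: "\<And>x. (\<lambda>n. b n x) \<longlonglongrightarrow> 0"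
  shows "\<xi> \<in> contingent_cone p Q \<nu>"
proof -
  note nu = prob_momentD[OF \<nu>]
  interpret nu: prob_space \<nu> by (rule nu(1))
  have [measurable_cong]: "sets \<nu> = sets borel" by (rule nu(2))
  have Cb0: "0 \<le> Cb" using order_trans[OF norm_ge_zero \<xi>g[of 0]] by simp
  define wd where "wd x = (Cb * (1 + norm x)) powr p" for x :: 'a
  have wdm: "wd \<in> borel_measurable \<nu>" unfolding wd_def[abs_def] by measurable
  have wdi: "integrable \<nu> wd"
  proof (rule Bochner_Integration.integrable_bound[OF _ wdm])
    show "integrable \<nu> (\<lambda>x. Cb powr p * (2 powr p * (1 + norm x powr p)))" using nu(4) by simp
    show "AE x in \<nu>. norm (wd x) \<le> norm (Cb powr p * (2 powr p * (1 + norm x powr p)))"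
    proof (rule AE_I2)
      fix x :: 'a
      have "wd x = Cb powr p * (1 + norm x) powr p" using Cb0 by (simp add: wd_def powr_mult)
      also have "\<dots> \<le> Cb powr p * (2 powr p * (1 powr p + norm x powr p))"
        by (intro mult_left_mono powr_sum_le) (use p0 in auto)
      finally show "norm (wd x) \<le> norm (Cb powr p * (2 powr p * (1 + norm x powr p)))" by (simp add: wd_def)
    qed
  qed
  have bw: "b n x powr p \<le> wd x" for n x
    unfolding wd_def using p0 b0 bb by (intro powr_mono2) auto
  have bi: "integrable \<nu> (\<lambda>x. b n x powr p)" for n
  proof (rule Bochner_Integration.integrable_bound[OF wdi])
    show "(\<lambda>x. b n x powr p) \<in> borel_measurable \<nu>" using bm[of n] by measurable
    show "AE x in \<nu>. norm (b n x powr p) \<le> norm (wd x)" using bw by (intro AE_I2) (simp add: wd_def)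
  qed
  define J where "J n = (\<integral>x. b n x powr p \<partial>\<nu>)" for n
  have J0: "0 \<le> J n" for n by (simp add: J_def)
  have J_lim: "J \<longlonglongrightarrow> 0"
  proof -
    have "(\<lambda>n. \<integral>x. b n x powr p \<partial>\<nu>) \<longlonglongrightarrow> (\<integral>x. 0 \<partial>\<nu>)"
    proof (rule integral_dominated_convergence[where w=wd])
      show "AE x in \<nu>. (\<lambda>n. b n x powr p) \<longlonglongrightarrow> 0"
      proof (rule AE_I2)
        fix x
        show "(\<lambda>n. b n x powr p) \<longlonglongrightarrow> 0"
          using tendsto_powr'[OF b_lim tendsto_const, of p x] b0 p0 by simp
      qed
      show "(\<lambda>x. b n x powr p) \<in> borel_measurable \<nu>" for n using bi by (rule borel_measurable_integrable)
    qed (use wdi bw in auto)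
    then show ?thesis by (simp add: J_def[abs_def])
  qed
  have Jr_lim: "(\<lambda>n. J n powr (1 / p)) \<longlonglongrightarrow> 0"
    using tendsto_powr'[OF J_lim tendsto_const, of "1/p"] J0 p0 by simp
  have dist: "1 / h n * wasserstein p (distr \<nu> borel (\<lambda>x. x + h n *\<^sub>R \<xi> x)) (\<sigma> n) \<le> J n powr (1 / p)" for n
  proof -
    define c where "c = h n"
    have c: "0 < c" using h(1) by (simp add: c_def)
    have pt: "norm (x + c *\<^sub>R \<xi> x - \<Phi> n x) \<le> c * b n x" for x using close[of x n] by (simp add: c_def)
    have "(\<integral>\<^sup>+x. ennreal (norm (x + c *\<^sub>R \<xi> x - \<Phi> n x) powr p) \<partial>\<nu>) \<le> (\<integral>\<^sup>+x. ennreal (c powr p * b n x powr p) \<partial>\<nu>)"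
    proof (intro nn_integral_mono ennreal_leI)
      fix x
      have "norm (x + c *\<^sub>R \<xi> x - \<Phi> n x) powr p \<le> (c * b n x) powr p" using pt p0 by (intro powr_mono2) auto
      then show "norm (x + c *\<^sub>R \<xi> x - \<Phi> n x) powr p \<le> c powr p * b n x powr p" using c b0 by (simp add: powr_mult)
    qed
    also have "\<dots> = ennreal (\<integral>x. c powr p * b n x powr p \<partial>\<nu>)" using bi by (intro nn_integral_eq_integral) auto
    also have "\<dots> = ennreal ((c * J n powr (1 / p)) powr p)" using c J0[of n] p0 by (simp add: J_def[symmetric] powr_mult powr_powr)
    finally have "wasserstein p (distr \<nu> borel (\<lambda>x. x + c *\<^sub>R \<xi> x)) (distr \<nu> borel (\<Phi> n)) \<le> c * J n powr (1 / p)"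
      using c p0 \<Phi> by (intro wasserstein_distr_le nu(2)) auto
    then have "1 / c * wasserstein p (distr \<nu> borel (\<lambda>x. x + c *\<^sub>R \<xi> x)) (\<sigma> n) \<le> 1 / c * (c * J n powr (1 / p))"
      unfolding \<sigma>(2) using c by (intro mult_left_mono) auto
    also have "\<dots> = J n powr (1 / p)" using c by simp
    finally show ?thesis by (simp only: c_def)
  qed
  show ?thesis
  proof (rule contingent_cone_sequentialI[OF \<xi>m, where e="\<lambda>n. J n powr (1 / p)"])
    show "integrable \<nu> (\<lambda>x. norm (\<xi> x) powr p)"
    proof (rule Bochner_Integration.integrable_bound[OF wdi])
      show "(\<lambda>x. norm (\<xi> x) powr p) \<in> borel_measurable \<nu>" by measurable
      show "AE x in \<nu>. norm (norm (\<xi> x) powr p) \<le> norm (wd x)"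
        using p0 \<xi>g by (auto simp: wd_def intro!: AE_I2 powr_mono2)
    qed
  qed (use \<sigma>(1) h Jr_lim dist in auto)
qed

text \<open>The hypotheses describe a time \<open>\<tau>\<close> at which all bounds hold and all averages converge. The
  tangent velocity is a limit of averages of the velocity of a viable curve.\<close>
lemma tangent_velocity:
  fixes V :: "real \<Rightarrow> 'a::euclidean_space measure \<Rightarrow> ('a \<Rightarrow> 'a) set" and T p \<tau> :: real
  assumes p: "1 < p" and N: "N \<in> null_sets lebesgue" and \<tau>: "\<tau> \<in> {0..T} - N" "\<tau> < T"
    and m: "set_integrable lebesgue {0..T} m" "\<And>t. t \<in> {0..T} \<Longrightarrow> 0 \<le> m t"
    and l: "set_integrable lebesgue {0..T} l" "\<And>t. t \<in> {0..T} \<Longrightarrow> 0 \<le> l t"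
    and L: "set_integrable lebesgue {0..T} L" "\<And>t. t \<in> {0..T} \<Longrightarrow> 0 \<le> L t"
    and growth: "\<And>t \<mu> v x. t \<in> {0..T} - N \<Longrightarrow> \<mu> \<in> prob_moment p \<Longrightarrow> v \<in> V t \<mu> \<Longrightarrow> norm (v x) \<le> m t * (1 + norm x + moment p \<mu>)"
    and lip: "\<And>t \<mu> v. t \<in> {0..T} - N \<Longrightarrow> \<mu> \<in> prob_moment p \<Longrightarrow> v \<in> V t \<mu> \<Longrightarrow> (l t)-lipschitz_on UNIV v"
    and cont: "\<And>t \<mu> \<nu> v. t \<in> {0..T} - N \<Longrightarrow> \<mu> \<in> prob_moment p \<Longrightarrow> \<nu> \<in> prob_moment p \<Longrightarrow> v \<in> V t \<mu> \<Longrightarrow>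
        \<exists>w\<in>V t \<nu>. d_sup v w \<le> ennreal (L t * wasserstein p \<mu> \<nu>)"
    and V: "\<And>t \<mu>. t \<in> {0..T} \<Longrightarrow> \<mu> \<in> prob_moment p \<Longrightarrow> closedin C0_topology (V t \<mu>) \<and> V t \<mu> \<noteq> {} \<and> convex_maps (V t \<mu>)"
    and D: "D \<subseteq> prob_moment p" "\<And>\<nu> e. \<nu> \<in> prob_moment p \<Longrightarrow> 0 < e \<Longrightarrow> \<exists>\<nu>'\<in>D. wasserstein p \<nu> \<nu>' < e"
    and C: "countable C" "closure C = (UNIV :: 'a set)"
    and h: "\<And>n. 0 < h n" "h \<longlonglongrightarrow> 0"
    and avg: "\<And>f. f \<in> {m, l, L} \<Longrightarrow> (\<lambda>n. (1 / h n) * (LINT r:{\<tau>..\<tau>+h n}|lebesgue. indicator {0..T} r *\<^sub>R f r)) \<longlonglongrightarrow> f \<tau>"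
    and sint: "\<And>\<nu>' ps. \<nu>' \<in> D \<Longrightarrow> ps \<in> lists (C \<times> C) \<Longrightarrow> integrable lebesgue (\<lambda>t. if t \<in> {0..T} - N then SUP v\<in>V t \<nu>'. functional ps v else 0)"
    and avgs: "\<And>\<nu>' ps. \<nu>' \<in> D \<Longrightarrow> ps \<in> lists (C \<times> C) \<Longrightarrow>
       (\<lambda>n. (1 / h n) * (LINT r:{\<tau>..\<tau>+h n}|lebesgue. if r \<in> {0..T} - N then SUP v\<in>V r \<nu>'. functional ps v else 0))
         \<longlonglongrightarrow> (SUP v\<in>V \<tau> \<nu>'. functional ps v)"
    and viable: "viable p T V Q" and \<nu>: "\<nu> \<in> Q"
  shows "V \<tau> \<nu> \<inter> contingent_cone p Q \<nu> \<noteq> {}"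
proof -
  have p1: "1 \<le> p" "0 < p" using p by auto
  have \<tau>T: "\<tau> \<in> {0..T}" "0 \<le> \<tau>" "{\<tau>..T} \<subseteq> {0..T}" using \<tau> by auto
  obtain \<mu> v where sol: "abs_cont_curve p \<tau> T \<mu>" "\<mu> \<tau> = \<nu>" "\<And>t. t \<in> {\<tau>..T} \<Longrightarrow> \<mu> t \<in> Q"
    "measurable_map {\<tau>..T} v" "\<And>t. t \<in> {\<tau>..T} \<Longrightarrow> v t \<in> V t (\<mu> t)" "continuity_equation \<tau> T v \<mu>"
    using viable \<tau>T(1) \<nu> unfolding viable_def solutions_def by blast
  have mu: "\<mu> t \<in> prob_moment p" if "t \<in> {\<tau>..T}" for t using sol(1) that by (auto simp: abs_cont_curve_def)
  have \<nu>P: "\<nu> \<in> prob_moment p" using mu[of \<tau>] sol(2) \<tau> by auto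
  define u where "u = (\<lambda>r x. if r \<in> {\<tau>..T} - N then v r x else 0)"
  have good: "r \<in> {0..T} - N" if "r \<in> {\<tau>..T} - N" for r using that \<tau>T by auto
  have ex: "\<exists>k g. 0 \<le> k \<and> transport_curve p \<tau> T u \<mu> (\<lambda>r. indicator {\<tau>..T} r *\<^sub>R (m r * k)) (\<lambda>r. indicator {\<tau>..T} r *\<^sub>R l r) g"
    unfolding u_def
  proof (rule transport_curve_of_solution[OF \<tau>(2) p1(1) sol(1) sol(4) sol(6) N])
    show "set_integrable lebesgue {\<tau>..T} m" "set_integrable lebesgue {\<tau>..T} l"
      using \<tau>T by (auto intro: set_integrable_subset[OF m(1)] set_integrable_subset[OF l(1)])
    show "0 \<le> m r" "0 \<le> l r" if "r \<in> {\<tau>..T}" for r using m(2) l(2) that \<tau>T by auto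
    show "norm (v r x) \<le> m r * (1 + norm x + moment p (\<mu> r))" if "r \<in> {\<tau>..T} - N" for r x
      using growth[OF good[OF that] mu sol(5)] that by auto
    show "(l r)-lipschitz_on UNIV (v r)" if "r \<in> {\<tau>..T} - N" for r
      using lip[OF good[OF that] mu sol(5)] that by auto
  qed
  obtain k g where k: "0 \<le> k" and tc0: "transport_curve p \<tau> T u \<mu> (\<lambda>r. indicator {\<tau>..T} r *\<^sub>R (m r * k)) (\<lambda>r. indicator {\<tau>..T} r *\<^sub>R l r) g"
    using ex by (elim exE conjE) (rule that)
  define mm where "mm = (\<lambda>r. indicator {\<tau>..T} r *\<^sub>R (m r * k))"
  define ll where "ll = (\<lambda>r. indicator {\<tau>..T} r *\<^sub>R l r)"
  have tc: "transport_curve p \<tau> T u \<mu> mm ll g" using tc0 by (simp add: mm_def ll_def)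
  interpret tc: transport_curve p \<tau> T u \<mu> mm ll g by (rule tc)

  define a where "a n = tc.A \<tau> (\<tau> + h n)" for n
  define E where "E n = tc.E \<tau> (\<tau> + h n)" for n
  have ev_T: "eventually (\<lambda>n. \<tau> + h n \<le> T) sequentially"
  proof -
    have "eventually (\<lambda>n. h n < T - \<tau>) sequentially" using h(2) \<tau>(2) by (intro order_tendstoD) auto
    then show ?thesis by eventually_elim simp
  qed
  define \<Lambda> where "\<Lambda> = k * m \<tau> + l \<tau>"
  have \<Lambda>0: "0 \<le> \<Lambda>" using k m(2)[OF \<tau>T(1)] l(2)[OF \<tau>T(1)] by (simp add: \<Lambda>_def)
  have ind_int: "set_integrable lebesgue {s..t} (\<lambda>r. indicator {0..T} r *\<^sub>R f r)" if "set_integrable lebesgue {0..T} f" for f :: "real \<Rightarrow> real" and s t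
    using that by (intro tc.set_int) (simp add: set_integrable_def)
  have a_lim: "(\<lambda>n. (1 / h n) * a n) \<longlonglongrightarrow> \<Lambda>"
  proof (rule Lim_transform_eventually)
    show "(\<lambda>n. k * ((1 / h n) * (LINT r:{\<tau>..\<tau>+h n}|lebesgue. indicator {0..T} r *\<^sub>R m r))
        + (1 / h n) * (LINT r:{\<tau>..\<tau>+h n}|lebesgue. indicator {0..T} r *\<^sub>R l r)) \<longlonglongrightarrow> \<Lambda>"
      unfolding \<Lambda>_def by (intro tendsto_intros avg) auto
    show "eventually (\<lambda>n. k * ((1 / h n) * (LINT r:{\<tau>..\<tau>+h n}|lebesgue. indicator {0..T} r *\<^sub>R m r))
        + (1 / h n) * (LINT r:{\<tau>..\<tau>+h n}|lebesgue. indicator {0..T} r *\<^sub>R l r) = (1 / h n) * a n) sequentially"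
      using ev_T
    proof eventually_elim
      case (elim n)
      have "a n = (LINT r:{\<tau>..\<tau>+h n}|lebesgue. k * (indicator {0..T} r *\<^sub>R m r) + indicator {0..T} r *\<^sub>R l r)"
        unfolding a_def tc.A_def using elim \<tau>T by (intro set_lebesgue_integral_cong) (auto simp: mm_def ll_def)
      also have "\<dots> = k * (LINT r:{\<tau>..\<tau>+h n}|lebesgue. indicator {0..T} r *\<^sub>R m r) + (LINT r:{\<tau>..\<tau>+h n}|lebesgue. indicator {0..T} r *\<^sub>R l r)"
        using set_integral_add(2)[OF set_integrable_mult_right[OF ind_int[OF m(1)]] ind_int[OF l(1)]] by simp
      finally show ?case by (simp add: algebra_simps)
    qed
  qed
  have a0: "0 \<le> a n" for n by (simp add: a_def tc.A_nonneg)
  have a_lim0: "a \<longlonglongrightarrow> 0"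
  proof -
    have "(\<lambda>n. h n * ((1 / h n) * a n)) \<longlonglongrightarrow> 0 * \<Lambda>" by (intro tendsto_mult h a_lim)
    moreover have "h n * ((1 / h n) * a n) = a n" for n using h(1)[of n] by simp
    ultimately show ?thesis by simp
  qed
  have E_lim: "E \<longlonglongrightarrow> 0"
  proof -
    define F where "F t = (LINT r:{\<tau>..t}|lebesgue. g r)" for t
    have "continuous_on {\<tau>..\<tau>+1} F" unfolding F_def by (rule continuous_on_set_integral_Icc[OF tc.set_int[OF tc.g(1)]])
    moreover have "(\<lambda>n. \<tau> + h n) \<longlonglongrightarrow> \<tau> + 0" by (intro tendsto_intros h)
    moreover have "eventually (\<lambda>n. \<tau> + h n \<in> {\<tau>..\<tau>+1}) sequentially"
    proof -
      have "eventually (\<lambda>n. h n < 1) sequentially" using h(2) by (intro order_tendstoD) auto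
      then show ?thesis by eventually_elim (use h(1) less_imp_le in auto)
    qed
    ultimately have "(\<lambda>n. F (\<tau> + h n)) \<longlonglongrightarrow> F \<tau>" by (intro continuous_on_tendsto_compose[of "{\<tau>..\<tau>+1}" F]) auto
    moreover have "F \<tau> = 0"
      using set_integral_Icc_combine[OF tc.set_int[OF tc.g(1)], of \<tau> \<tau> \<tau> \<tau>] by (simp add: F_def)
    ultimately show ?thesis by (simp add: E_def[abs_def] tc.E_def F_def)
  qed
  define xi where "xi n x = (1 / h n) *\<^sub>R tc.drift \<tau> (\<tau> + h n) x" for n x
  have xi_growth: "norm (xi n x) \<le> (1 / h n) * a n * (1 + norm x)" for n x
    using mult_left_mono[OF tc.drift_growth[of \<tau> "\<tau> + h n" x], of "1 / h n"] h(1)[of n] by (simp add: xi_def a_def)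
  have xi_lip: "((1 / h n) * a n)-lipschitz_on UNIV (xi n)" for n
  proof (rule lipschitz_onI)
    fix x y
    have "dist (xi n x) (xi n y) = (1 / h n) * dist (tc.drift \<tau> (\<tau> + h n) x) (tc.drift \<tau> (\<tau> + h n) y)"
      using h(1)[of n] by (simp add: xi_def dist_norm flip: scaleR_diff_right)
    also have "\<dots> \<le> (1 / h n) * (a n * dist x y)"
      using lipschitz_onD[OF tc.drift_lip, of x y \<tau> "\<tau> + h n"] h(1)[of n] by (intro mult_left_mono) (auto simp: a_def)
    finally show "dist (xi n x) (xi n y) \<le> (1 / h n) * a n * dist x y" by (simp add: mult.assoc)
  qed (use a0 h(1)[of n] in simp)
  have "eventually (\<lambda>n. \<tau> + h n \<le> T \<and> (1 / h n) * a n < \<Lambda> + 1 \<and> a n < ln (3/2)) sequentially"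
    using a_lim a_lim0 by (intro eventually_conj ev_T order_tendstoD) auto
  then obtain n0 where n0: "\<And>n. n0 \<le> n \<Longrightarrow> \<tau> + h n \<le> T \<and> (1 / h n) * a n < \<Lambda> + 1 \<and> a n < ln (3/2)"
    by (auto simp: eventually_sequentially)
  have fl: "(\<Lambda> + 1)-lipschitz_on UNIV (xi (n + n0))" for n
    by (rule lipschitz_on_le[OF xi_lip]) (use n0[of "n + n0"] in simp)
  have fg: "norm (xi (n + n0) x) \<le> (\<Lambda> + 1) * (1 + norm x)" for n x
    by (rule order_trans[OF xi_growth mult_right_mono]) (use n0[of "n + n0"] in auto)
  obtain r \<xi> where r: "strict_mono (r :: nat \<Rightarrow> nat)" "\<And>x. (\<lambda>n. xi (r n + n0) x) \<longlonglongrightarrow> \<xi> x" "(\<Lambda> + 1)-lipschitz_on UNIV \<xi>"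
    by (rule equi_lipschitz_subsequence[of "\<Lambda> + 1" "\<lambda>n. xi (n + n0)" "\<Lambda> + 1", OF fl fg]) (rule that)
  define \<kappa> where "\<kappa> n = r n + n0" for n
  have \<kappa>: "n0 \<le> \<kappa> n" for n by (simp add: \<kappa>_def)
  have \<kappa>lim: "filterlim \<kappa> at_top sequentially"
    by (rule filterlim_at_top_mono[OF filterlim_subseq[OF r(1)]]) (simp add: \<kappa>_def)
  have xi_lim: "(\<lambda>n. xi (\<kappa> n) x) \<longlonglongrightarrow> \<xi> x" for x using r(2) by (simp add: \<kappa>_def)
  have \<xi>g: "norm (\<xi> x) \<le> (\<Lambda> + 1) * (1 + norm x)" for x
    by (rule Lim_bounded[OF tendsto_norm[OF r(2)], where M=0]) (use fg in auto)

  have bdd: "bdd_above (functional ps ` V t \<nu>')" if "t \<in> {0..T} - N" "\<nu>' \<in> prob_moment p" for t \<nu>' ps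
  proof (rule bdd_aboveI[where M="m t * growth_weight (moment p \<nu>') ps"])
    fix y assume "y \<in> functional ps ` V t \<nu>'"
    then obtain w where w: "w \<in> V t \<nu>'" "y = functional ps w" by auto
    then show "y \<le> m t * growth_weight (moment p \<nu>') ps"
      using functional_growth[OF growth[OF that w(1)], of ps] by simp
  qed
  \<comment> \<open>\<open>\<nu>'\<close> ranges over a countable set only: the convergence of averages is available for
    countably many support functions.\<close>
  have support: "functional ps \<xi> \<le> (SUP w\<in>V \<tau> \<nu>'. functional ps w) + weight ps * wasserstein p \<nu> \<nu>' * L \<tau>"
    if \<nu>': "\<nu>' \<in> D" and ps: "ps \<in> lists (C \<times> C)" for \<nu>' ps
  proof -
    define s where "s t = (if t \<in> {0..T} - N then SUP w\<in>V t \<nu>'. functional ps w else 0)" for t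
    have \<nu>'P: "\<nu>' \<in> prob_moment p" using \<nu>' D(1) by auto
    have step: "functional ps (xi n) \<le> (1 / h n) * (LINT t:{\<tau>..\<tau>+h n}|lebesgue. s t)
        + weight ps * (E n + wasserstein p \<nu> \<nu>') * ((1 / h n) * (LINT t:{\<tau>..\<tau>+h n}|lebesgue. indicator {0..T} t *\<^sub>R L t))"
      if n: "n0 \<le> n" for n
    proof -
      have T: "\<tau> + h n \<le> T" using n0[OF n] by simp
      define c where "c = weight ps * (E n + wasserstein p \<nu> \<nu>')"
      have si: "set_integrable lebesgue {\<tau>..\<tau>+h n} s" unfolding s_def by (rule tc.set_int[OF sint[OF \<nu>' ps]])
      have Li: "set_integrable lebesgue {\<tau>..\<tau>+h n} (\<lambda>t. c * (indicator {0..T} t *\<^sub>R L t))"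
        by (rule set_integrable_mult_right[OF ind_int[OF L(1)]])
      note fi = functional_integral[where S="{\<tau>..\<tau> + h n}" and u=u and ps=ps, OF tc.u_int]
      have "AE t in lebesgue. t \<notin> N" using N by (rule AE_not_in)
      then have le: "AE t \<in> {\<tau>..\<tau>+h n} in lebesgue. functional ps (u t) \<le> s t + c * (indicator {0..T} t *\<^sub>R L t)"
      proof eventually_elim
        case (elim t)
        show ?case
        proof
          assume t: "t \<in> {\<tau>..\<tau>+h n}"
          have tT: "t \<in> {\<tau>..T}" using t T by auto
          then have tg: "t \<in> {0..T} - N" using elim \<tau>T by auto
          have ut: "u t = v t" using tT elim by (simp add: u_def)
          \<comment> \<open>Pass from \<open>V t (\<mu> t)\<close> to \<open>V t \<nu>'\<close> through \<open>V t
            \<nu>\<close>: the two Wasserstein distances are then available separately.\<close>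
          obtain w where w: "w \<in> V t \<nu>" "d_sup (v t) w \<le> ennreal (L t * wasserstein p (\<mu> t) \<nu>)"
            using cont[OF tg mu[OF tT] \<nu>P sol(5)[OF tT]] by blast
          obtain w' where w': "w' \<in> V t \<nu>'" "d_sup w w' \<le> ennreal (L t * wasserstein p \<nu> \<nu>')"
            using cont[OF tg \<nu>P \<nu>'P w(1)] by blast
          have Lt: "0 \<le> L t" using L(2) tg by auto
          have WE: "wasserstein p (\<mu> t) \<nu> \<le> E n"
          proof -
            have "wasserstein p (\<mu> t) \<nu> = wasserstein p (\<mu> \<tau>) (\<mu> t)" using sol(2) wasserstein_commute by simp
            also have "\<dots> \<le> tc.E \<tau> t" unfolding tc.E_def using tT by (intro tc.W) auto
            also have "\<dots> \<le> E n"
              unfolding E_def tc.E_def using set_integral_Icc_combine[OF tc.set_int[OF tc.g(1)], of \<tau> t "\<tau> + h n" "\<tau> + h n"]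
                tc.set_int_nonneg[of g t "\<tau> + h n"] tc.g(2) t by auto
            finally show ?thesis .
          qed
          have d1: "norm (v t x - w x) \<le> L t * wasserstein p (\<mu> t) \<nu>" for x
            by (rule d_supD[OF w(2)]) (intro mult_nonneg_nonneg Lt wasserstein_nonneg)
          have d2: "norm (w x - w' x) \<le> L t * wasserstein p \<nu> \<nu>'" for x
            by (rule d_supD[OF w'(2)]) (intro mult_nonneg_nonneg Lt wasserstein_nonneg)
          have f1: "functional ps (v t) - functional ps w \<le> weight ps * (L t * wasserstein p (\<mu> t) \<nu>)"
            using functional_diff_le[where v="v t" and w=w and ps=ps, OF d1] by linarith
          have f2: "functional ps w - functional ps w' \<le> weight ps * (L t * wasserstein p \<nu> \<nu>')"
            using functional_diff_le[where v=w and w=w' and ps=ps, OF d2] by linarith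
          have "functional ps w' \<le> s t" unfolding s_def using tg cSUP_upper[OF w'(1) bdd[OF tg \<nu>'P]] by simp
          moreover have "weight ps * (L t * wasserstein p (\<mu> t) \<nu>) \<le> weight ps * (L t * E n)"
            using WE Lt weight_nonneg by (intro mult_left_mono) auto
          ultimately have "functional ps (v t) \<le> s t + (weight ps * (L t * E n) + weight ps * (L t * wasserstein p \<nu> \<nu>'))"
            using f1 f2 by linarith
          also have "weight ps * (L t * E n) + weight ps * (L t * wasserstein p \<nu> \<nu>') = c * L t" by (simp add: c_def algebra_simps)
          finally show "functional ps (u t) \<le> s t + c * (indicator {0..T} t *\<^sub>R L t)" using ut tg by simp
        qed
      qed
      have "functional ps (tc.drift \<tau> (\<tau> + h n)) = (LINT t:{\<tau>..\<tau>+h n}|lebesgue. functional ps (u t))"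
        using fi by (simp add: tc.drift_def[abs_def])
      also have "\<dots> \<le> (LINT t:{\<tau>..\<tau>+h n}|lebesgue. s t + c * (indicator {0..T} t *\<^sub>R L t))"
        using fi set_integral_add(1)[OF si Li] le by (intro set_integral_mono_AE) auto
      also have "\<dots> = (LINT t:{\<tau>..\<tau>+h n}|lebesgue. s t) + c * (LINT t:{\<tau>..\<tau>+h n}|lebesgue. indicator {0..T} t *\<^sub>R L t)"
        using set_integral_add(2)[OF si Li] by simp
      finally have "(1 / h n) * functional ps (tc.drift \<tau> (\<tau> + h n)) \<le> (1 / h n) * ((LINT t:{\<tau>..\<tau>+h n}|lebesgue. s t) + c * (LINT t:{\<tau>..\<tau>+h n}|lebesgue. indicator {0..T} t *\<^sub>R L t))"
        using h(1)[of n] by (intro mult_left_mono) auto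
      moreover have "functional ps (xi n) = (1 / h n) * functional ps (tc.drift \<tau> (\<tau> + h n))"
        unfolding xi_def by (rule functional_scale)
      ultimately have "functional ps (xi n) \<le> (1 / h n) * ((LINT t:{\<tau>..\<tau>+h n}|lebesgue. s t) + c * (LINT t:{\<tau>..\<tau>+h n}|lebesgue. indicator {0..T} t *\<^sub>R L t))"
        by (simp only:)
      also have "\<dots> = (1 / h n) * (LINT t:{\<tau>..\<tau>+h n}|lebesgue. s t) + c * ((1 / h n) * (LINT t:{\<tau>..\<tau>+h n}|lebesgue. indicator {0..T} t *\<^sub>R L t))"
        by (simp only: distrib_left mult.left_commute)
      finally show ?thesis unfolding c_def .
    qed
    have lim: "(\<lambda>n. (1 / h n) * (LINT t:{\<tau>..\<tau>+h n}|lebesgue. s t)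
        + weight ps * (E n + wasserstein p \<nu> \<nu>') * ((1 / h n) * (LINT t:{\<tau>..\<tau>+h n}|lebesgue. indicator {0..T} t *\<^sub>R L t)))
      \<longlonglongrightarrow> (SUP w\<in>V \<tau> \<nu>'. functional ps w) + weight ps * (0 + wasserstein p \<nu> \<nu>') * L \<tau>"
      unfolding s_def by (intro tendsto_add tendsto_mult tendsto_const E_lim avgs[OF \<nu>' ps] avg) auto
    have "functional ps \<xi> \<le> (SUP w\<in>V \<tau> \<nu>'. functional ps w) + weight ps * (0 + wasserstein p \<nu> \<nu>') * L \<tau>"
      by (rule LIMSEQ_le[OF tendsto_functional[OF xi_lim] filterlim_compose[OF lim \<kappa>lim]]) (use step \<kappa> in auto)
    then show ?thesis by simp
  qed
  have closed: "closedin C0_topology (V \<tau> \<nu>)" "V \<tau> \<nu> \<noteq> {}" "convex_maps (V \<tau> \<nu>)" using V[OF \<tau>T(1) \<nu>P] by auto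
  have L\<tau>: "0 \<le> L \<tau>" using L(2)[OF \<tau>T(1)] .
  \<comment> \<open>Return from \<open>\<nu>'\<close> to \<open>\<nu>\<close>: the supremum for \<open>\<nu>'\<close> is
    nearly attained, and its near-maximiser is close to an element of \<open>V \<tau> \<nu>\<close>.\<close>
  have separated: "\<exists>z\<in>V \<tau> \<nu>. (\<Sum>x\<in>X. a x \<bullet> \<xi> x) \<le> (\<Sum>x\<in>X. a x \<bullet> z x) + \<eta>"
    if X: "finite X" "X \<subseteq> C" and a: "\<And>x. a x \<in> C" and \<eta>: "0 < \<eta>" for X a \<eta>
  proof -
    obtain xs where xs: "set xs = X" "distinct xs" using finite_distinct_list[OF X(1)] by auto
    define ps where "ps = map (\<lambda>x. (a x, x)) xs"
    have ps: "ps \<in> lists (C \<times> C)" using xs X a by (auto simp: ps_def)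
    have fs: "functional ps w = (\<Sum>x\<in>X. a x \<bullet> w x)" for w
      using xs by (simp add: functional_def ps_def o_def case_prod_unfold sum_list_distinct_conv_sum_set)
    define \<delta> where "\<delta> = \<eta> / 4 / (weight ps * L \<tau> + 1)"
    have w0: "0 \<le> weight ps * L \<tau>" using weight_nonneg[of ps] L\<tau> by simp
    have \<delta>: "0 < \<delta>" using \<eta> w0 by (simp add: \<delta>_def)
    have w\<delta>: "weight ps * L \<tau> * \<delta> \<le> \<eta> / 4"
    proof -
      have "weight ps * L \<tau> * \<delta> \<le> (weight ps * L \<tau> + 1) * \<delta>" using \<delta> by (intro mult_right_mono) auto
      also have "\<dots> = \<eta> / 4"
      proof -
        have "(P + 1) * (y / (P + 1)) = y" if "0 \<le> P" for P y :: real using that by simp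
        from this[OF w0] show ?thesis unfolding \<delta>_def .
      qed
      finally show ?thesis .
    qed
    obtain \<nu>' where \<nu>': "\<nu>' \<in> D" "wasserstein p \<nu> \<nu>' < \<delta>" using D(2)[OF \<nu>P \<delta>] by blast
    have \<nu>'P: "\<nu>' \<in> prob_moment p" using \<nu>'(1) D(1) by auto
    have wW: "weight ps * wasserstein p \<nu> \<nu>' * L \<tau> \<le> \<eta> / 4"
    proof -
      have "weight ps * L \<tau> * wasserstein p \<nu> \<nu>' \<le> weight ps * L \<tau> * \<delta>" using \<nu>'(2) w0 by (intro mult_left_mono) auto
      then show ?thesis using w\<delta> by (simp add: mult_ac)
    qed
    have ne': "V \<tau> \<nu>' \<noteq> {}" using V[OF \<tau>T(1) \<nu>'P] by auto
    define Sp where "Sp = (SUP w\<in>V \<tau> \<nu>'. functional ps w)"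
    have "Sp - \<eta> / 2 < (SUP w\<in>V \<tau> \<nu>'. functional ps w) \<longleftrightarrow> (\<exists>w'\<in>V \<tau> \<nu>'. Sp - \<eta> / 2 < functional ps w')"
      by (rule less_cSUP_iff[OF ne' bdd[OF \<tau>(1) \<nu>'P]])
    then have "\<exists>w'\<in>V \<tau> \<nu>'. Sp - \<eta> / 2 < functional ps w'" using \<eta> by (simp add: Sp_def)
    then obtain w' where w': "w' \<in> V \<tau> \<nu>'" "Sp - \<eta> / 2 < functional ps w'" by blast
    obtain z where z: "z \<in> V \<tau> \<nu>" "d_sup w' z \<le> ennreal (L \<tau> * wasserstein p \<nu>' \<nu>)"
      using cont[OF \<tau>(1) \<nu>'P \<nu>P w'(1)] by blast
    have d: "norm (w' x - z x) \<le> L \<tau> * wasserstein p \<nu>' \<nu>" for x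
      by (rule d_supD[OF z(2)]) (intro mult_nonneg_nonneg L\<tau> wasserstein_nonneg)
    have "functional ps w' - functional ps z \<le> weight ps * (L \<tau> * wasserstein p \<nu>' \<nu>)"
      using functional_diff_le[where v=w' and w=z and ps=ps, OF d] by linarith
    also have "\<dots> = weight ps * wasserstein p \<nu> \<nu>' * L \<tau>" by (simp add: wasserstein_commute[of p \<nu>'])
    finally have "functional ps \<xi> \<le> functional ps z + \<eta>"
      using support[OF \<nu>'(1) ps] wW w'(2) unfolding Sp_def[symmetric] by linarith
    then show ?thesis using z(1) by (auto simp: fs)
  qed
  have mem: "\<xi> \<in> V \<tau> \<nu>"
  proof (rule closed_convex_mem_of_support[OF closed, where K="max (\<Lambda> + 1) (l \<tau>)" and C=C and B="\<lambda>x. m \<tau> * (1 + norm x + moment p \<nu>)"])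
    show "(max (\<Lambda> + 1) (l \<tau>))-lipschitz_on UNIV w" if "w \<in> V \<tau> \<nu>" for w
      using lip[OF \<tau>(1) \<nu>P that] by (rule lipschitz_on_le) simp
    show "norm (w x) \<le> m \<tau> * (1 + norm x + moment p \<nu>)" if "w \<in> V \<tau> \<nu>" for w x
      by (rule growth[OF \<tau>(1) \<nu>P that])
    show "(max (\<Lambda> + 1) (l \<tau>))-lipschitz_on UNIV \<xi>" using r(3) by (rule lipschitz_on_le) simp
  qed (fact C separated)+
  have cone: "\<xi> \<in> contingent_cone p Q \<nu>"
  proof -
    have flow: "\<exists>\<Phi>. \<Phi> \<in> borel_measurable borel \<and> \<mu> (\<tau> + h n) = distr \<nu> borel \<Phi> \<and>
        (\<forall>x. norm (\<Phi> x - x - tc.drift \<tau> (\<tau> + h n) x) \<le> a n * (exp (a n) - 1) * (1 + norm x))" if n: "n0 \<le> n" for n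
    proof -
      have hT: "\<tau> < \<tau> + h n" "\<tau> + h n \<le> T" using n0[OF n] h(1)[of n] by auto
      interpret c: transport_curve p \<tau> "\<tau> + h n" u \<mu> mm ll g by (rule transport_curve_restrict[OF tc hT])
      have "exp (a n) < exp (ln (3/2))" unfolding exp_less_cancel_iff using n0[OF n] by blast
      then have "exp (tc.A \<tau> (\<tau> + h n)) \<le> 3/2" by (simp add: a_def)
      from c.flow_map[OF this] obtain \<Phi> where "\<Phi> \<in> borel_measurable borel" "\<mu> (\<tau> + h n) = distr (\<mu> \<tau>) borel \<Phi>"
         "\<forall>x. norm (\<Phi> x - x - tc.drift \<tau> (\<tau> + h n) x) \<le> tc.A \<tau> (\<tau> + h n) * (exp (tc.A \<tau> (\<tau> + h n)) - 1) * (1 + norm x)"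
        by metis
      then show ?thesis using sol(2) by (auto simp: a_def)
    qed
    \<comment> \<open>\<open>h n * b n x\<close> bounds the distance from \<open>x + h n * \<xi> x\<close> to the
      transported point: the error of the averaged velocity plus that of \<open>flow_map\<close>.\<close>
    define b where "b n x = norm (\<xi> x - xi n x) + (1 / h n) * a n * (exp (a n) - 1) * (1 + norm x)" for n x
    have b0: "0 \<le> b n x" for n x using a0[of n] h(1)[of n] by (simp add: b_def)
    have \<xi>c: "continuous_on UNIV \<xi>" using lipschitz_on_continuous_on[OF r(3)] .
    have \<xi>m: "\<xi> \<in> borel_measurable borel" by (rule borel_measurable_continuous_onI[OF \<xi>c])
    have bc: "continuous_on UNIV (b n)" for n
      unfolding b_def[abs_def] using lipschitz_on_continuous_on[OF xi_lip[of n]] by (intro continuous_intros \<xi>c) auto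
    have bm: "b n \<in> borel_measurable borel" for n by (rule borel_measurable_continuous_onI[OF bc])
    define Cb where "Cb = 2 * (\<Lambda> + 1) + (\<Lambda> + 1) * (1/2)"
    have Cb0: "0 \<le> Cb" "\<Lambda> + 1 \<le> Cb" using \<Lambda>0 by (auto simp: Cb_def)
    have bb: "b (\<kappa> n) x \<le> Cb * (1 + norm x)" for n x
    proof -
      have "exp (a (\<kappa> n)) < exp (ln (3/2))" unfolding exp_less_cancel_iff using n0[OF \<kappa>[of n]] by blast
      then have e: "exp (a (\<kappa> n)) - 1 \<le> 1/2" by simp
      have "norm (\<xi> x - xi (\<kappa> n) x) \<le> norm (\<xi> x) + norm (xi (\<kappa> n) x)" by (rule norm_triangle_ineq4)
      also have "\<dots> \<le> (\<Lambda> + 1) * (1 + norm x) + (\<Lambda> + 1) * (1 + norm x)"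
        unfolding \<kappa>_def by (intro add_mono \<xi>g fg)
      also have "\<dots> = 2 * (\<Lambda> + 1) * (1 + norm x)" by (simp add: algebra_simps)
      finally have 1: "norm (\<xi> x - xi (\<kappa> n) x) \<le> 2 * (\<Lambda> + 1) * (1 + norm x)" .
      have "(1 / h (\<kappa> n)) * a (\<kappa> n) * (exp (a (\<kappa> n)) - 1) \<le> (\<Lambda> + 1) * (1/2)"
        using n0[OF \<kappa>[of n]] e a0[of "\<kappa> n"] \<Lambda>0 h(1)[of "\<kappa> n"] by (intro mult_mono) auto
      then have "(1 / h (\<kappa> n)) * a (\<kappa> n) * (exp (a (\<kappa> n)) - 1) * (1 + norm x) \<le> (\<Lambda> + 1) * (1/2) * (1 + norm x)"
        by (rule mult_right_mono) simp
      with 1 show ?thesis unfolding b_def Cb_def distrib_right[of "2 * (\<Lambda> + 1)"] by linarith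
    qed
    have \<beta>lim: "(\<lambda>n. (1 / h n) * a n * (exp (a n) - 1)) \<longlonglongrightarrow> \<Lambda> * (exp 0 - 1)"
      by (intro tendsto_intros a_lim a_lim0)
    have b_lim: "(\<lambda>n. b (\<kappa> n) x) \<longlonglongrightarrow> 0" for x
    proof -
      have "(\<lambda>n. norm (\<xi> x - xi (\<kappa> n) x) + (1 / h (\<kappa> n)) * a (\<kappa> n) * (exp (a (\<kappa> n)) - 1) * (1 + norm x))
         \<longlonglongrightarrow> norm (\<xi> x - \<xi> x) + \<Lambda> * (exp 0 - 1) * (1 + norm x)"
        by (intro tendsto_add tendsto_norm tendsto_diff tendsto_const xi_lim tendsto_mult[OF filterlim_compose[OF \<beta>lim \<kappa>lim] tendsto_const])
      then show ?thesis by (simp add: b_def)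
    qed
    have "\<exists>\<Phi>. \<Phi> \<in> borel_measurable borel \<and> \<mu> (\<tau> + h (\<kappa> n)) = distr \<nu> borel \<Phi> \<and>
        (\<forall>x. norm (x + h (\<kappa> n) *\<^sub>R \<xi> x - \<Phi> x) \<le> h (\<kappa> n) * b (\<kappa> n) x)" for n
    proof -
      define c where "c = h (\<kappa> n)"
      have c: "0 < c" using h(1) by (simp add: c_def)
      obtain \<Phi> where \<Phi>: "\<Phi> \<in> borel_measurable borel" "\<mu> (\<tau> + c) = distr \<nu> borel \<Phi>"
        "\<And>x. norm (\<Phi> x - x - tc.drift \<tau> (\<tau> + c) x) \<le> a (\<kappa> n) * (exp (a (\<kappa> n)) - 1) * (1 + norm x)"
        using flow[OF \<kappa>[of n]] by (auto simp: c_def)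
      have pt: "norm (x + c *\<^sub>R \<xi> x - \<Phi> x) \<le> c * b (\<kappa> n) x" for x
      proof -
        have Vx: "tc.drift \<tau> (\<tau> + c) x = c *\<^sub>R xi (\<kappa> n) x" using c by (simp add: xi_def c_def)
        have "x + c *\<^sub>R \<xi> x - \<Phi> x = c *\<^sub>R (\<xi> x - xi (\<kappa> n) x) - (\<Phi> x - x - tc.drift \<tau> (\<tau> + c) x)"
          by (simp add: Vx scaleR_diff_right)
        then have "norm (x + c *\<^sub>R \<xi> x - \<Phi> x) \<le> norm (c *\<^sub>R (\<xi> x - xi (\<kappa> n) x)) + norm (\<Phi> x - x - tc.drift \<tau> (\<tau> + c) x)"
          by (metis norm_triangle_ineq4)
        also have "\<dots> \<le> c * norm (\<xi> x - xi (\<kappa> n) x) + a (\<kappa> n) * (exp (a (\<kappa> n)) - 1) * (1 + norm x)"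
          using \<Phi>(3)[of x] c by simp
        also have "\<dots> = c * b (\<kappa> n) x" using c by (simp add: b_def c_def[symmetric] distrib_left)
        finally show ?thesis .
      qed
      then show ?thesis using \<Phi>(1,2) by (auto simp: c_def)
    qed
    then obtain \<Phi> where \<Phi>: "\<And>n. \<Phi> n \<in> borel_measurable borel" "\<And>n. \<mu> (\<tau> + h (\<kappa> n)) = distr \<nu> borel (\<Phi> n)"
      "\<And>n x. norm (x + h (\<kappa> n) *\<^sub>R \<xi> x - \<Phi> n x) \<le> h (\<kappa> n) * b (\<kappa> n) x"
      by metis
    show ?thesis
    proof (rule contingent_cone_of_transport[OF \<nu>P p1(2) \<xi>m _ h(1) _ \<Phi>(1) _ \<Phi>(2,3) bm b0 bb b_lim])
      show "norm (\<xi> x) \<le> Cb * (1 + norm x)" for x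
        using \<xi>g[of x] mult_right_mono[OF Cb0(2), of "1 + norm x"] by simp
      show "(\<lambda>n. h (\<kappa> n)) \<longlonglongrightarrow> 0" by (rule filterlim_compose[OF h(2) \<kappa>lim])
      show "\<mu> (\<tau> + h (\<kappa> n)) \<in> Q" for n using n0[OF \<kappa>[of n]] h(1)[of "\<kappa> n"] by (intro sol(3)) auto
    qed
  qed
  show ?thesis using mem cone by blast
qed

theorem theorem4p6:
  fixes p T :: real
    and V :: "real \<Rightarrow> 'a::euclidean_space measure \<Rightarrow> ('a \<Rightarrow> 'a) set"
    and Q :: "'a measure set"
  assumes "T > 0"
    and "1 < p"
    and "\<And>t \<mu>. t \<in> {0..T} \<Longrightarrow> \<mu> \<in> prob_moment p \<Longrightarrow> convex_maps (V t \<mu>)"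
    and "hypotheses_CI p T V"
    and "proper_set p Q"
    and "viable p T V Q"
  shows "AE t\<in>{0..T} in lebesgue. \<forall>\<nu>\<in>Q. V t \<nu> \<inter> contingent_cone p Q \<nu> \<noteq> {}"
proof -
  note hyp = assms(4)[unfolded hypotheses_CI_def]
  have mult: "measurable_multimap {0..T} (\<lambda>t. V t \<mu>)" if "\<mu> \<in> prob_moment p" for \<mu> using hyp that by blast
  have V: "closedin C0_topology (V t \<mu>) \<and> V t \<mu> \<noteq> {} \<and> convex_maps (V t \<mu>)" if "t \<in> {0..T}" "\<mu> \<in> prob_moment p" for t \<mu>
    using hyp assms(3) that by blast
  obtain m where m: "set_integrable lebesgue {0..T} m" "\<forall>t\<in>{0..T}. 0 \<le> m t"
    "AE t\<in>{0..T} in lebesgue. \<forall>\<mu>\<in>prob_moment p. \<forall>v\<in>V t \<mu>. \<forall>x. norm (v x) \<le> m t * (1 + norm x + moment p \<mu>)"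
    using hyp by (elim exE conjE) (rule that)
  obtain l where l: "set_integrable lebesgue {0..T} l" "\<forall>t\<in>{0..T}. 0 \<le> l t"
    "AE t\<in>{0..T} in lebesgue. \<forall>\<mu>\<in>prob_moment p. \<forall>v\<in>V t \<mu>. (l t)-lipschitz_on UNIV v"
    using hyp by (elim exE conjE) (rule that)
  obtain L where L: "set_integrable lebesgue {0..T} L" "\<forall>t\<in>{0..T}. 0 \<le> L t"
    "AE t\<in>{0..T} in lebesgue. \<forall>\<mu>\<in>prob_moment p. \<forall>\<nu>\<in>prob_moment p. \<forall>v\<in>V t \<mu>.
           \<exists>w\<in>V t \<nu>. d_sup v w \<le> ennreal (L t * wasserstein p \<mu> \<nu>)"
    using hyp by (elim exE conjE) (rule that)
  have "AE t in lebesgue. t \<in> {0..T} \<longrightarrow>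
      (\<forall>\<mu>\<in>prob_moment p. \<forall>v\<in>V t \<mu>. \<forall>x. norm (v x) \<le> m t * (1 + norm x + moment p \<mu>)) \<and>
      (\<forall>\<mu>\<in>prob_moment p. \<forall>v\<in>V t \<mu>. (l t)-lipschitz_on UNIV v) \<and>
      (\<forall>\<mu>\<in>prob_moment p. \<forall>\<nu>\<in>prob_moment p. \<forall>v\<in>V t \<mu>. \<exists>w\<in>V t \<nu>. d_sup v w \<le> ennreal (L t * wasserstein p \<mu> \<nu>))"
    using m(3) l(3) L(3) by eventually_elim blast
  then obtain N where N: "N \<in> null_sets lebesgue" and good: "{t \<in> space lebesgue. \<not> (t \<in> {0..T} \<longrightarrow>
      (\<forall>\<mu>\<in>prob_moment p. \<forall>v\<in>V t \<mu>. \<forall>x. norm (v x) \<le> m t * (1 + norm x + moment p \<mu>)) \<and>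
      (\<forall>\<mu>\<in>prob_moment p. \<forall>v\<in>V t \<mu>. (l t)-lipschitz_on UNIV v) \<and>
      (\<forall>\<mu>\<in>prob_moment p. \<forall>\<nu>\<in>prob_moment p. \<forall>v\<in>V t \<mu>. \<exists>w\<in>V t \<nu>. d_sup v w \<le> ennreal (L t * wasserstein p \<mu> \<nu>)))} \<subseteq> N"
    by (auto simp: eventually_ae_filter)
  have good': "(\<forall>\<mu>\<in>prob_moment p. \<forall>v\<in>V t \<mu>. \<forall>x. norm (v x) \<le> m t * (1 + norm x + moment p \<mu>)) \<and>
      (\<forall>\<mu>\<in>prob_moment p. \<forall>v\<in>V t \<mu>. (l t)-lipschitz_on UNIV v) \<and>
      (\<forall>\<mu>\<in>prob_moment p. \<forall>\<nu>\<in>prob_moment p. \<forall>v\<in>V t \<mu>. \<exists>w\<in>V t \<nu>. d_sup v w \<le> ennreal (L t * wasserstein p \<mu> \<nu>))"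
    if t: "t \<in> {0..T} - N" for t
  proof (rule ccontr)
    assume "\<not> ?thesis"
    then have "t \<in> N" using t by (intro subsetD[OF good]) simp
    then show False using t by simp
  qed
  have growth: "norm (v x) \<le> m t * (1 + norm x + moment p \<mu>)" if "t \<in> {0..T} - N" "\<mu> \<in> prob_moment p" "v \<in> V t \<mu>" for t \<mu> v x
    using good'[OF that(1)] that(2,3) by blast
  have lip: "(l t)-lipschitz_on UNIV v" if "t \<in> {0..T} - N" "\<mu> \<in> prob_moment p" "v \<in> V t \<mu>" for t \<mu> v
    using good'[OF that(1)] that(2,3) by blast
  have cont: "\<exists>w\<in>V t \<nu>. d_sup v w \<le> ennreal (L t * wasserstein p \<mu> \<nu>)"
    if "t \<in> {0..T} - N" "\<mu> \<in> prob_moment p" "\<nu> \<in> prob_moment p" "v \<in> V t \<mu>" for t \<mu> \<nu> v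
    using good'[OF that(1)] that(2-) by blast
  obtain D :: "'a measure set" where D: "countable D" "D \<subseteq> prob_moment p" "\<And>\<nu> e. \<nu> \<in> prob_moment p \<Longrightarrow> 0 < e \<Longrightarrow> \<exists>\<nu>'\<in>D. wasserstein p \<nu> \<nu>' < e"
    by (rule countable_dense_measures[of p]) (use assms(2) in simp, rule that)
  obtain C :: "'a set" where C: "countable C" "UNIV \<subseteq> closure C"
    by (rule separable[of "UNIV :: 'a set"])
  have Ccl: "closure C = UNIV" using C(2) by auto
  define s where "s q t = (if t \<in> {0..T} - N then SUP v\<in>V t (fst q). functional (snd q) v else 0)" for q :: "'a measure \<times> ('a \<times> 'a) list" and t
  define J where "J = D \<times> lists (C \<times> C)"
  have J: "countable J" unfolding J_def using D(1) C(1) by auto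
  have sint: "integrable lebesgue (s q)" if "q \<in> J" for q
  proof -
    have P: "fst q \<in> prob_moment p" using that D(2) by (auto simp: J_def)
    show ?thesis
      unfolding s_def[abs_def]
    proof (rule support_function_integrable[OF mult[OF P] _ _ N m(1)])
      show "V t (fst q) \<noteq> {}" if "t \<in> {0..T}" for t using V[OF that P] by auto
      show "V t (fst q) \<subseteq> C0" if "t \<in> {0..T}" for t using closedin_subset V[OF that P] by fastforce
      show "norm (v x) \<le> m t * (1 + norm x + moment p (fst q))" if "t \<in> {0..T} - N" "v \<in> V t (fst q)" for t v x
        by (rule growth[OF that(1) P that(2)])
    qed
  qed
  \<comment> \<open>One sequence of integrable functions collects the three bounds and the countably many support
    functions.\<close>
  define f where "f i = (case i of 0 \<Rightarrow> (\<lambda>t. indicator {0..T} t *\<^sub>R m t) | Suc 0 \<Rightarrow> (\<lambda>t. indicator {0..T} t *\<^sub>R l t)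
      | Suc (Suc 0) \<Rightarrow> (\<lambda>t. indicator {0..T} t *\<^sub>R L t) | Suc (Suc (Suc j)) \<Rightarrow> (if J = {} then (\<lambda>_. 0) else s (from_nat_into J j)))" for i :: nat
  have fint: "integrable lebesgue (f i)" for i
    using m(1) l(1) L(1) sint from_nat_into[of J] by (auto simp: f_def set_integrable_def split: nat.splits)
  obtain h where h: "\<And>n. 0 < h n" "h \<longlonglongrightarrow> 0"
    "AE t in lebesgue. \<forall>i. (\<lambda>n. (1 / h n) * (LINT r:{t..t+h n}|lebesgue. f i r)) \<longlonglongrightarrow> f i t"
    by (rule common_averaging_sequence[of f, OF fint]) (rule that)
  have "AE t in lebesgue. t \<noteq> T" by (rule AE_completion[OF AE_lborel_singleton])
  moreover have "AE t in lebesgue. t \<notin> N" using N by (rule AE_not_in)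
  ultimately show ?thesis using h(3)
  proof eventually_elim
    case (elim \<tau>)
    show ?case
    proof (intro impI ballI)
      fix \<nu> assume \<tau>: "\<tau> \<in> {0..T}" and \<nu>: "\<nu> \<in> Q"
      have \<tau>N: "\<tau> \<in> {0..T} - N" "\<tau> < T" using \<tau> elim by auto
      have lim: "(\<lambda>n. (1 / h n) * (LINT r:{\<tau>..\<tau>+h n}|lebesgue. f i r)) \<longlonglongrightarrow> f i \<tau>" for i using elim(3) by blast
      show "V \<tau> \<nu> \<inter> contingent_cone p Q \<nu> \<noteq> {}"
      proof (rule tangent_velocity[where N=N and T=T and m=m and l=l and L=L and D=D and C=C and h=h])
        show "1 < p" "N \<in> null_sets lebesgue" "\<tau> \<in> {0..T} - N" "\<tau> < T" "viable p T V Q" "\<nu> \<in> Q"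
          "set_integrable lebesgue {0..T} m" "set_integrable lebesgue {0..T} l" "set_integrable lebesgue {0..T} L"
          "D \<subseteq> prob_moment p" "countable C" "closure C = UNIV" "h \<longlonglongrightarrow> 0"
          by fact+
        show "norm (v x) \<le> m t * (1 + norm x + moment p \<mu>)" if "t \<in> {0..T} - N" "\<mu> \<in> prob_moment p" "v \<in> V t \<mu>" for t \<mu> v x
          by (rule growth[OF that])
        show "(l t)-lipschitz_on UNIV v" if "t \<in> {0..T} - N" "\<mu> \<in> prob_moment p" "v \<in> V t \<mu>" for t \<mu> v
          by (rule lip[OF that])
        show "\<exists>w\<in>V t \<nu>. d_sup v w \<le> ennreal (L t * wasserstein p \<mu> \<nu>)"
          if "t \<in> {0..T} - N" "\<mu> \<in> prob_moment p" "\<nu> \<in> prob_moment p" "v \<in> V t \<mu>" for t \<mu> \<nu> v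
          by (rule cont[OF that])
        show "closedin C0_topology (V t \<mu>) \<and> V t \<mu> \<noteq> {} \<and> convex_maps (V t \<mu>)" if "t \<in> {0..T}" "\<mu> \<in> prob_moment p" for t \<mu>
          by (rule V[OF that])
        show "\<exists>\<nu>'\<in>D. wasserstein p \<nu> \<nu>' < e" if "\<nu> \<in> prob_moment p" "0 < e" for \<nu> e
          by (rule D(3)[OF that])
        show "0 < h n" for n by (rule h(1))
        show "0 \<le> m t" "0 \<le> l t" "0 \<le> L t" if "t \<in> {0..T}" for t using m(2) l(2) L(2) that by auto
        show "(\<lambda>n. (1 / h n) * (LINT r:{\<tau>..\<tau>+h n}|lebesgue. indicator {0..T} r *\<^sub>R k r)) \<longlonglongrightarrow> k \<tau>" if "k \<in> {m, l, L}" for k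
          using that lim[of 0] lim[of "Suc 0"] lim[of "Suc (Suc 0)"] \<tau> by (auto simp: f_def)
      next
        fix \<nu>' ps assume q: "\<nu>' \<in> D" "ps \<in> lists (C \<times> C)"
        have qJ: "(\<nu>', ps) \<in> J" using q by (simp add: J_def)
        show "integrable lebesgue (\<lambda>t. if t \<in> {0..T} - N then SUP v\<in>V t \<nu>'. functional ps v else 0)"
          using sint[OF qJ] by (simp only: s_def[abs_def] fst_conv snd_conv)
        obtain j where j: "from_nat_into J j = (\<nu>', ps)" using from_nat_into_surj[OF J qJ] by blast
        have fj: "f (Suc (Suc (Suc j))) = s (\<nu>', ps)" using j qJ by (auto simp: f_def)
        show "(\<lambda>n. (1 / h n) * (LINT r:{\<tau>..\<tau>+h n}|lebesgue. if r \<in> {0..T} - N then SUP v\<in>V r \<nu>'. functional ps v else 0))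
           \<longlonglongrightarrow> (SUP v\<in>V \<tau> \<nu>'. functional ps v)"
          using lim[of "Suc (Suc (Suc j))"] \<tau>N(1) unfolding fj s_def fst_conv snd_conv by (simp only: if_True)
      qed
    qed
  qed
qed

end
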